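(* Let $B$ be a pointed Poisson Hopf algebra over $k$ with group of group-like elements $G$, such that $\{g,t\}=0$ for all $g,t\in G$. Then: (1) $C=\mathrm{gr}\,B$ (the associated graded with respect to the coradical filtration) is a graded Poisson Hopf algebra. (2) $R^e\#(kG)^e\cong C^e$ as algebras, where $C\cong R\#kG$ is the biproduct decomposition of $C$. The isomorphism is given by the algebra map $\Phi:R^e\#(kG)^e\to C^e$, $\Phi(a\#b)=\Psi(a)\,\iota^e(b)$ for $a\in R^e$, $b\in(kG)^e$.
   Context: $k$ is a field; Sweedler notation is used. A Poisson algebra is a commutative $k$-algebra with a Lie bracket $\{\cdot,\cdot\}$ such that $\{a,bc\}=\{a,b\}c+b\{a,c\}$; $A\otimes A$ is Poisson with $\{a\otimes b,c\otimes d\}=ac\otimes\{b,d\}+\{a,c\}\otimes bd$. A Poisson Hopf algebra is a commutative Hopf algebra with a Poisson bracket such that $\Delta(\{a,b\})=\{\Delta(a),\Delta(b)\}$; pointed means pointed as a coalgebra. Graded object: let $\{B_n\}$ be the coradical filtration of $B$ and $C=\bigoplus_nC(n)$, $C(n)=B_n/B_{n-1}$. Under the hypothesis, $\{B_i,B_j\}\subset B_{i+j}$, and the bracket on $C$ is $\{\overline x,\overline y\}=\overline{\{x,y\}}\in C(i+j)$ for $x\in B_i$, $y\in B_j$. A graded Poisson Hopf algebra is a Poisson Hopf algebra which is a graded Hopf algebra with $\{C(i),C(j)\}\subset C(i+j)$. Biproduct: $C(0)=kG$; let $\iota:kG\to C$ be the inclusion and $\pi:C\to kG$ the projection with kernel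 $\bigoplus_{i\ge1}C(i)$ (both are Poisson Hopf algebra maps, $kG$ having zero bracket). Let $R=\{x\in C:(\mathrm{id}\otimes\pi)\Delta(x)=x\otimes1\}$, a Poisson subalgebra of $C$; every element of $C$ is a linear combination of products $xg$ ($x\in R,g\in G$), and $C\cong R\#kG$ (Radford biproduct) via $xg\mapsto x\#g$. For $g\in G$, $y\in R$ one has $g^{-1}\{g,y\}\in R$ and $\{g,\{y,g^{-1}\}\}\in R$. Universal enveloping algebra: for a Poisson algebra $A$, $A^e$ is the associative unital $k$-algebra generated by two copies $\{m_a\}$, $\{h_a\}$ of the vector space $A$ (linear in $a$) subject to $m_{xy}=m_xm_y$, $h_{\{x,y\}}=h_xh_y-h_yh_x$, $h_{xy}=m_yh_x+m_xh_y$, $m_{\{x,y\}}=h_xm_y-m_yh_x$, $m_1=1$. The map $a\mapsto m_a$ is injective and $a$ is identified with $m_a$. The generators $h_y$ of $R^e$ are written $\beta_y$. If $A$ is a Poisson Hopf algebra, $A^e$ is a Hopf algebra with $\Delta(a)=a_1\otimes a_2$ for $a \in A$, $\Delta(h_a)=a_1\otimes h_{a_2}+h_{a_1}\otimes a_2$, $\epsilon(h_a)=0$. A Poisson algebra map $A\to A'$ induces an algebra map $A^e\to A'^e$; $\iota^e:(kG)^e\to C^e$ is induced by $\iota$, and $\Psi:R^e\to C^e$ by the inclusion $R\subset C$ (so $\Psi(y)=y$, $\Psi(\beta_y)=h_y$). $R^e$ is a $(kG)^e$-module algebra via $g\cdot y=y$, $g\cdot\beta_y=\beta_y+g^{-1}\{g,y\}$,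 $h_g\cdot y=g^{-1}\{g,y\}$, $h_g\cdot\beta_y=\beta_{g^{-1}\{g,y\}}+\{g,\{y,g^{-1}\}\}$ for $g\in G,y\in R$, and $R^e\#(kG)^e$ is the smash product: $R^e\otimes(kG)^e$ with $(a\#b)(a'\#b')=a(b_1\cdot a')\#b_2b'$. *)

theory Defs
  imports "HOL-Algebra.Module" "HOL-Algebra.QuotRing"
begin

section \<open>Vector spaces, spans and quotients\<close>

text \<open>
  Everything is relative to a field \<open>K\<close>, given as a HOL-Algebra ring record. Vector spaces and
  algebras are HOL-Algebra \<open>module\<close> records over \<open>K\<close>; for objects that are only vector spaces the
  multiplicative fields of the record are irrelevant. Maps are only meaningful on carriers.
\<close>

definition k_linear ::
  "('k, 'r) ring_scheme \<Rightarrow> ('k, 'a, 'm) module_scheme \<Rightarrow> ('k, 'b, 'n) module_scheme \<Rightarrow> ('a \<Rightarrow> 'b) \<Rightarrow> bool"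
  where "k_linear K M N f \<longleftrightarrow>
    f \<in> carrier M \<rightarrow> carrier N \<and>
    (\<forall>x\<in>carrier M. \<forall>y\<in>carrier M. f (x \<oplus>\<^bsub>M\<^esub> y) = f x \<oplus>\<^bsub>N\<^esub> f y) \<and>
    (\<forall>k\<in>carrier K. \<forall>x\<in>carrier M. f (k \<odot>\<^bsub>M\<^esub> x) = k \<odot>\<^bsub>N\<^esub> f x)"

definition k_bilinear ::
  "('k, 'r) ring_scheme \<Rightarrow> ('k, 'a, 'm) module_scheme \<Rightarrow> ('k, 'b, 'n) module_scheme \<Rightarrow>
    ('k, 'c, 'p) module_scheme \<Rightarrow> ('a \<Rightarrow> 'b \<Rightarrow> 'c) \<Rightarrow> bool"
  where "k_bilinear K M N P f \<longleftrightarrow>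
    (\<forall>x\<in>carrier M. k_linear K N P (f x)) \<and>
    (\<forall>y\<in>carrier N. k_linear K M P (\<lambda>x. f x y))"

definition k_span :: "('k, 'r) ring_scheme \<Rightarrow> ('k, 'a, 'm) module_scheme \<Rightarrow> 'a set \<Rightarrow> 'a set"
  where "k_span K M S = \<Inter>{N. submodule N K M \<and> S \<subseteq> N}"

text \<open>\<open>M Quot N\<close> together with the induced scalar multiplication. It is used both for quotients by
  subspaces (then the ring multiplication is irrelevant) and for quotients by two-sided ideals.\<close>

definition quot :: "('k, 'a, 'm) module_scheme \<Rightarrow> 'a set \<Rightarrow> ('k, 'a set) module"
  where "quot M N =
    \<lparr>carrier = a_rcosets\<^bsub>M\<^esub> N,
     mult = rcoset_mult M N,
     one = N +>\<^bsub>M\<^esub> \<one>\<^bsub>M\<^esub>,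
     zero = N,
     add = set_add M,
     smult = (\<lambda>k S. \<Union>x\<in>S. N +>\<^bsub>M\<^esub> (k \<odot>\<^bsub>M\<^esub> x))\<rparr>"

text \<open>The free vector space on a set \<open>S\<close>: finitely supported functions \<open>S \<rightarrow> K\<close>, extended by zero.\<close>

definition support :: "('k, 'r) ring_scheme \<Rightarrow> ('x \<Rightarrow> 'k) \<Rightarrow> 'x set"
  where "support K F = {x. F x \<noteq> \<zero>\<^bsub>K\<^esub>}"

definition delta :: "('k, 'r) ring_scheme \<Rightarrow> 'x \<Rightarrow> 'x \<Rightarrow> 'k"
  where "delta K x = (\<lambda>y. if y = x then \<one>\<^bsub>K\<^esub> else \<zero>\<^bsub>K\<^esub>)"

definition free_space :: "('k, 'r) ring_scheme \<Rightarrow> 'x set \<Rightarrow> ('k, 'x \<Rightarrow> 'k) module"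
  where "free_space K S =
    \<lparr>carrier = {F. range F \<subseteq> carrier K \<and> finite (support K F) \<and> support K F \<subseteq> S},
     mult = undefined,
     one = undefined,
     zero = (\<lambda>_. \<zero>\<^bsub>K\<^esub>),
     add = (\<lambda>F G x. F x \<oplus>\<^bsub>K\<^esub> G x),
     smult = (\<lambda>k F x. k \<otimes>\<^bsub>K\<^esub> F x)\<rparr>"


section \<open>Associative algebras\<close>

locale k_algebra = K?: field K + module K A + A?: ring A
  for K (structure) and A (structure) +
  assumes smult_mult_left:
      "\<lbrakk>k \<in> carrier K; x \<in> carrier A; y \<in> carrier A\<rbrakk>
        \<Longrightarrow> (k \<odot>\<^bsub>A\<^esub> x) \<otimes>\<^bsub>A\<^esub> y = k \<odot>\<^bsub>A\<^esub> (x \<otimes>\<^bsub>A\<^esub> y)"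
    and smult_mult_right:
      "\<lbrakk>k \<in> carrier K; x \<in> carrier A; y \<in> carrier A\<rbrakk>
        \<Longrightarrow> x \<otimes>\<^bsub>A\<^esub> (k \<odot>\<^bsub>A\<^esub> y) = k \<odot>\<^bsub>A\<^esub> (x \<otimes>\<^bsub>A\<^esub> y)"

definition k_algebra_iso ::
  "('k, 'r) ring_scheme \<Rightarrow> ('k, 'a, 'm) module_scheme \<Rightarrow> ('k, 'b, 'n) module_scheme \<Rightarrow> ('a \<Rightarrow> 'b) \<Rightarrow> bool"
  where "k_algebra_iso K A A' f \<longleftrightarrow>
    k_algebra K A \<and> k_algebra K A' \<and>
    k_linear K A A' f \<and> f \<in> ring_hom A A' \<and> bij_betw f (carrier A) (carrier A')"

definition base_algebra :: "('k, 'r) ring_scheme \<Rightarrow> ('k, 'k) module"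
  where "base_algebra K =
    \<lparr>carrier = carrier K, mult = mult K, one = \<one>\<^bsub>K\<^esub>, zero = \<zero>\<^bsub>K\<^esub>, add = add K, smult = mult K\<rparr>"


section \<open>Tensor products\<close>

definition tensor_relations ::
  "('k, 'r) ring_scheme \<Rightarrow> ('k, 'a, 'm) module_scheme \<Rightarrow> ('k, 'b, 'n) module_scheme \<Rightarrow> ('a \<times> 'b \<Rightarrow> 'k) set"
  where "tensor_relations K M N =
    (let F = free_space K (carrier M \<times> carrier N) in
     k_span K F
      ({delta K (x \<oplus>\<^bsub>M\<^esub> x', y) \<ominus>\<^bsub>F\<^esub> (delta K (x, y) \<oplus>\<^bsub>F\<^esub> delta K (x', y)) | x x' y.
          x \<in> carrier M \<and> x' \<in> carrier M \<and> y \<in> carrier N} \<union>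
       {delta K (x, y \<oplus>\<^bsub>N\<^esub> y') \<ominus>\<^bsub>F\<^esub> (delta K (x, y) \<oplus>\<^bsub>F\<^esub> delta K (x, y')) | x y y'.
          x \<in> carrier M \<and> y \<in> carrier N \<and> y' \<in> carrier N} \<union>
       {delta K (k \<odot>\<^bsub>M\<^esub> x, y) \<ominus>\<^bsub>F\<^esub> k \<odot>\<^bsub>F\<^esub> delta K (x, y) | k x y.
          k \<in> carrier K \<and> x \<in> carrier M \<and> y \<in> carrier N} \<union>
       {delta K (x, k \<odot>\<^bsub>N\<^esub> y) \<ominus>\<^bsub>F\<^esub> k \<odot>\<^bsub>F\<^esub> delta K (x, y) | k x y.
          k \<in> carrier K \<and> x \<in> carrier M \<and> y \<in> carrier N}))"

definition tensor_space ::
  "('k, 'r) ring_scheme \<Rightarrow> ('k, 'a, 'm) module_scheme \<Rightarrow> ('k, 'b, 'n) module_scheme \<Rightarrow>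
    ('k, ('a \<times> 'b \<Rightarrow> 'k) set) module"
  where "tensor_space K M N =
    quot (free_space K (carrier M \<times> carrier N)) (tensor_relations K M N)"

definition tens ::
  "('k, 'r) ring_scheme \<Rightarrow> ('k, 'a, 'm) module_scheme \<Rightarrow> ('k, 'b, 'n) module_scheme \<Rightarrow>
    'a \<Rightarrow> 'b \<Rightarrow> ('a \<times> 'b \<Rightarrow> 'k) set"
  where "tens K M N x y =
    tensor_relations K M N +>\<^bsub>free_space K (carrier M \<times> carrier N)\<^esub> delta K (x, y)"

text \<open>The linear map out of a tensor product, with values in \<open>P\<close>, induced by a bilinear map \<open>f\<close>:
  every representative \<open>\<Sum> k\<^sub>i (x\<^sub>i, y\<^sub>i)\<close> of the argument must give the same value
  \<open>\<Sum> k\<^sub>i f x\<^sub>i y\<^sub>i\<close>. In Sweedler notation, \<open>\<Sum> f x\<^sub>1 x\<^sub>2\<close> is \<open>tensor_lift K P f (\<Delta> x)\<close>.\<close>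

definition tensor_lift ::
  "('k, 'r) ring_scheme \<Rightarrow> ('k, 'c, 'p) module_scheme \<Rightarrow> ('a \<Rightarrow> 'b \<Rightarrow> 'c) \<Rightarrow> ('a \<times> 'b \<Rightarrow> 'k) set \<Rightarrow> 'c"
  where "tensor_lift K P f u =
    the_elem ((\<lambda>F. \<Oplus>\<^bsub>P\<^esub>p\<in>support K F. F p \<odot>\<^bsub>P\<^esub> f (fst p) (snd p)) ` u)"

text \<open>\<open>f \<otimes> g\<close> with values in \<open>M \<otimes> N\<close>.\<close>

definition tensor_map ::
  "('k, 'r) ring_scheme \<Rightarrow> ('k, 'c, 'm) module_scheme \<Rightarrow> ('k, 'd, 'n) module_scheme \<Rightarrow>
    ('a \<Rightarrow> 'c) \<Rightarrow> ('b \<Rightarrow> 'd) \<Rightarrow> ('a \<times> 'b \<Rightarrow> 'k) set \<Rightarrow> ('c \<times> 'd \<Rightarrow> 'k) set"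
  where "tensor_map K M N f g = tensor_lift K (tensor_space K M N) (\<lambda>x y. tens K M N (f x) (g y))"

text \<open>The canonical isomorphism \<open>(M \<otimes> M) \<otimes> M \<rightarrow> M \<otimes> (M \<otimes> M)\<close>.\<close>

definition tensor_assoc ::
  "('k, 'r) ring_scheme \<Rightarrow> ('k, 'a, 'm) module_scheme \<Rightarrow>
    (('a \<times> 'a \<Rightarrow> 'k) set \<times> 'a \<Rightarrow> 'k) set \<Rightarrow> ('a \<times> ('a \<times> 'a \<Rightarrow> 'k) set \<Rightarrow> 'k) set"
  where "tensor_assoc K M =
    (let MM = tensor_space K M M; T = tensor_space K M MM in
     tensor_lift K T (\<lambda>u z. tensor_lift K T (\<lambda>x y. tens K M MM x (tens K M M y z)) u))"

text \<open>The image of \<open>U \<otimes> V\<close> in \<open>M \<otimes> N\<close>.\<close>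

definition tensor_sub ::
  "('k, 'r) ring_scheme \<Rightarrow> ('k, 'a, 'm) module_scheme \<Rightarrow> ('k, 'b, 'n) module_scheme \<Rightarrow>
    'a set \<Rightarrow> 'b set \<Rightarrow> ('a \<times> 'b \<Rightarrow> 'k) set set"
  where "tensor_sub K M N U V =
    k_span K (tensor_space K M N) {tens K M N x y | x y. x \<in> U \<and> y \<in> V}"

text \<open>The tensor product of algebras.\<close>

definition tensor_alg ::
  "('k, 'r) ring_scheme \<Rightarrow> ('k, 'a, 'm) module_scheme \<Rightarrow> ('k, 'b, 'n) module_scheme \<Rightarrow>
    ('k, ('a \<times> 'b \<Rightarrow> 'k) set) module"
  where "tensor_alg K A B =
    (let T = tensor_space K A B in
     T\<lparr>mult := \<lambda>u v. tensor_lift K T (\<lambda>a b. tensor_lift K T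
                 (\<lambda>c d. tens K A B (a \<otimes>\<^bsub>A\<^esub> c) (b \<otimes>\<^bsub>B\<^esub> d)) v) u,
       one := tens K A B \<one>\<^bsub>A\<^esub> \<one>\<^bsub>B\<^esub>\<rparr>)"


section \<open>Coalgebras, pointedness and the coradical filtration\<close>

locale coalgebra = K?: field K + module K C
  for K (structure) and C (structure) and \<Delta> and \<epsilon> +
  assumes comult_linear: "k_linear K C (tensor_space K C C) \<Delta>"
    and counit_linear: "k_linear K C (base_algebra K) \<epsilon>"
    and coassoc: "x \<in> carrier C \<Longrightarrow>
      tensor_map K C (tensor_space K C C) (\<lambda>a. a) \<Delta> (\<Delta> x) =
      tensor_assoc K C (tensor_map K (tensor_space K C C) C \<Delta> (\<lambda>b. b) (\<Delta> x))"
    and counit_left: "x \<in> carrier C \<Longrightarrow> tensor_lift K C (\<lambda>a b. \<epsilon> a \<odot>\<^bsub>C\<^esub> b) (\<Delta> x) = x"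
    and counit_right: "x \<in> carrier C \<Longrightarrow> tensor_lift K C (\<lambda>a b. \<epsilon> b \<odot>\<^bsub>C\<^esub> a) (\<Delta> x) = x"

definition grouplikes ::
  "('k, 'r) ring_scheme \<Rightarrow> ('k, 'a, 'm) module_scheme \<Rightarrow> ('a \<Rightarrow> ('a \<times> 'a \<Rightarrow> 'k) set) \<Rightarrow> ('a \<Rightarrow> 'k) \<Rightarrow> 'a set"
  where "grouplikes K C \<Delta> \<epsilon> = {g \<in> carrier C. \<Delta> g = tens K C C g g \<and> \<epsilon> g = \<one>\<^bsub>K\<^esub>}"

definition subcoalgebra ::
  "('k, 'r) ring_scheme \<Rightarrow> ('k, 'a, 'm) module_scheme \<Rightarrow> ('a \<Rightarrow> ('a \<times> 'a \<Rightarrow> 'k) set) \<Rightarrow> 'a set \<Rightarrow> bool"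
  where "subcoalgebra K C \<Delta> D \<longleftrightarrow> submodule D K C \<and> \<Delta> ` D \<subseteq> tensor_sub K C C D D"

definition simple_subcoalgebra ::
  "('k, 'r) ring_scheme \<Rightarrow> ('k, 'a, 'm) module_scheme \<Rightarrow> ('a \<Rightarrow> ('a \<times> 'a \<Rightarrow> 'k) set) \<Rightarrow> 'a set \<Rightarrow> bool"
  where "simple_subcoalgebra K C \<Delta> D \<longleftrightarrow>
    subcoalgebra K C \<Delta> D \<and> D \<noteq> {\<zero>\<^bsub>C\<^esub>} \<and>
    (\<forall>D'. subcoalgebra K C \<Delta> D' \<and> D' \<subseteq> D \<longrightarrow> D' = {\<zero>\<^bsub>C\<^esub>} \<or> D' = D)"

text \<open>Pointed: every simple subcoalgebra is one-dimensional.\<close>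

definition pointed ::
  "('k, 'r) ring_scheme \<Rightarrow> ('k, 'a, 'm) module_scheme \<Rightarrow> ('a \<Rightarrow> ('a \<times> 'a \<Rightarrow> 'k) set) \<Rightarrow> bool"
  where "pointed K C \<Delta> \<longleftrightarrow>
    (\<forall>D. simple_subcoalgebra K C \<Delta> D \<longrightarrow>
      (\<exists>x\<in>carrier C. x \<noteq> \<zero>\<^bsub>C\<^esub> \<and> D = {k \<odot>\<^bsub>C\<^esub> x | k. k \<in> carrier K}))"

fun corad_filt ::
  "('k, 'r) ring_scheme \<Rightarrow> ('k, 'a, 'm) module_scheme \<Rightarrow> ('a \<Rightarrow> ('a \<times> 'a \<Rightarrow> 'k) set) \<Rightarrow> nat \<Rightarrow> 'a set"
  where
    "corad_filt K C \<Delta> 0 = k_span K C (\<Union>{D. simple_subcoalgebra K C \<Delta> D})"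
  | "corad_filt K C \<Delta> (Suc n) =
      {x \<in> carrier C. \<Delta> x \<in>
        tensor_sub K C C (carrier C) (corad_filt K C \<Delta> n)
        <+>\<^bsub>tensor_space K C C\<^esub>
        tensor_sub K C C (corad_filt K C \<Delta> 0) (carrier C)}"


section \<open>Poisson algebras and Poisson Hopf algebras\<close>

record ('k, 'a) poisson = "('k, 'a) module" +
  bracket :: "'a \<Rightarrow> 'a \<Rightarrow> 'a" (\<open>\<lbrace>_,/ _\<rbrace>\<index>\<close>)

record ('k, 'a) poisson_hopf = "('k, 'a) poisson" +
  comult :: "'a \<Rightarrow> ('a \<times> 'a \<Rightarrow> 'k) set"
  counit :: "'a \<Rightarrow> 'k"
  antipode :: "'a \<Rightarrow> 'a"

locale poisson_algebra = K?: field K + algebra K A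
  for K (structure) and A (structure) +
  assumes bracket_bilinear: "k_bilinear K A A A (bracket A)"
    and bracket_self: "a \<in> carrier A \<Longrightarrow> \<lbrace>a, a\<rbrace>\<^bsub>A\<^esub> = \<zero>\<^bsub>A\<^esub>"
    and jacobi: "\<lbrakk>a \<in> carrier A; b \<in> carrier A; c \<in> carrier A\<rbrakk> \<Longrightarrow>
      \<lbrace>a, \<lbrace>b, c\<rbrace>\<^bsub>A\<^esub>\<rbrace>\<^bsub>A\<^esub> \<oplus>\<^bsub>A\<^esub> \<lbrace>b, \<lbrace>c, a\<rbrace>\<^bsub>A\<^esub>\<rbrace>\<^bsub>A\<^esub> \<oplus>\<^bsub>A\<^esub> \<lbrace>c, \<lbrace>a, b\<rbrace>\<^bsub>A\<^esub>\<rbrace>\<^bsub>A\<^esub> = \<zero>\<^bsub>A\<^esub>"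
    and leibniz: "\<lbrakk>a \<in> carrier A; b \<in> carrier A; c \<in> carrier A\<rbrakk> \<Longrightarrow>
      \<lbrace>a, b \<otimes>\<^bsub>A\<^esub> c\<rbrace>\<^bsub>A\<^esub> = \<lbrace>a, b\<rbrace>\<^bsub>A\<^esub> \<otimes>\<^bsub>A\<^esub> c \<oplus>\<^bsub>A\<^esub> b \<otimes>\<^bsub>A\<^esub> \<lbrace>a, c\<rbrace>\<^bsub>A\<^esub>"

definition tensor_bracket ::
  "('k, 'r) ring_scheme \<Rightarrow> ('k, 'a, 'm) poisson_scheme \<Rightarrow>
    ('a \<times> 'a \<Rightarrow> 'k) set \<Rightarrow> ('a \<times> 'a \<Rightarrow> 'k) set \<Rightarrow> ('a \<times> 'a \<Rightarrow> 'k) set"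
  where "tensor_bracket K A u v =
    (let T = tensor_space K A A in
     tensor_lift K T (\<lambda>a b. tensor_lift K T
       (\<lambda>c d. tens K A A (a \<otimes>\<^bsub>A\<^esub> c) \<lbrace>b, d\<rbrace>\<^bsub>A\<^esub> \<oplus>\<^bsub>T\<^esub> tens K A A \<lbrace>a, c\<rbrace>\<^bsub>A\<^esub> (b \<otimes>\<^bsub>A\<^esub> d)) v) u)"

locale poisson_hopf_algebra = poisson_algebra K A + coalgebra K A "comult A" "counit A"
  for K (structure) and A (structure) +
  assumes comult_hom: "comult A \<in> ring_hom A (tensor_alg K A A)"
    and counit_hom: "counit A \<in> ring_hom A K"
    and antipode_linear: "k_linear K A A (antipode A)"
    and antipode_left: "x \<in> carrier A \<Longrightarrow>
      tensor_lift K A (\<lambda>a b. antipode A a \<otimes>\<^bsub>A\<^esub> b) (comult A x) = counit A x \<odot>\<^bsub>A\<^esub> \<one>\<^bsub>A\<^esub>"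
    and antipode_right: "x \<in> carrier A \<Longrightarrow>
      tensor_lift K A (\<lambda>a b. a \<otimes>\<^bsub>A\<^esub> antipode A b) (comult A x) = counit A x \<odot>\<^bsub>A\<^esub> \<one>\<^bsub>A\<^esub>"
    and comult_bracket: "\<lbrakk>x \<in> carrier A; y \<in> carrier A\<rbrakk> \<Longrightarrow>
      comult A \<lbrace>x, y\<rbrace>\<^bsub>A\<^esub> = tensor_bracket K A (comult A x) (comult A y)"

text \<open>\<open>A = \<Oplus>\<^sub>n D n\<close> is a grading of the Poisson Hopf algebra \<open>A\<close>.\<close>

locale graded_poisson_hopf_algebra = poisson_hopf_algebra K A
  for K (structure) and A (structure) and D :: "nat \<Rightarrow> _ set" +
  assumes part_submodule: "submodule (D n) K A"
    and direct_sum: "x \<in> carrier A \<Longrightarrow>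
      \<exists>!f. (\<forall>n. f n \<in> D n) \<and> finite {n. f n \<noteq> \<zero>\<^bsub>A\<^esub>} \<and> x = (\<Oplus>\<^bsub>A\<^esub>n\<in>{n. f n \<noteq> \<zero>\<^bsub>A\<^esub>}. f n)"
    and one_graded: "\<one>\<^bsub>A\<^esub> \<in> D 0"
    and mult_graded: "\<lbrakk>x \<in> D i; y \<in> D j\<rbrakk> \<Longrightarrow> x \<otimes>\<^bsub>A\<^esub> y \<in> D (i + j)"
    and comult_graded: "x \<in> D n \<Longrightarrow>
      comult A x \<in> k_span K (tensor_space K A A) (\<Union>i\<le>n. tensor_sub K A A (D i) (D (n - i)))"
    and counit_graded: "\<lbrakk>x \<in> D n; n \<noteq> 0\<rbrakk> \<Longrightarrow> counit A x = \<zero>\<^bsub>K\<^esub>"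
    and antipode_graded: "x \<in> D n \<Longrightarrow> antipode A x \<in> D n"
    and bracket_graded: "\<lbrakk>x \<in> D i; y \<in> D j\<rbrakk> \<Longrightarrow> \<lbrace>x, y\<rbrace>\<^bsub>A\<^esub> \<in> D (i + j)"


section \<open>The associated graded object of the coradical filtration\<close>

text \<open>
  An element of \<open>gr B = \<Oplus>\<^sub>n B\<^sub>n / B\<^bsub>n-1\<^esub>\<close> is a function sending \<open>n\<close> to a coset in \<open>B\<^sub>n / B\<^bsub>n-1\<^esub>\<close>,
  almost everywhere the zero coset \<open>B\<^bsub>n-1\<^esub>\<close>. The operations below are induced from all
  representatives at once, so they produce elements of \<open>gr B\<close> only when they are well defined.
\<close>

abbreviation Bfilt :: "('k, 'r) ring_scheme \<Rightarrow> ('k, 'b, 'm) poisson_hopf_scheme \<Rightarrow> nat \<Rightarrow> 'b set"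
  where "Bfilt K B \<equiv> corad_filt K B (comult B)"

text \<open>\<open>B\<^bsub>n-1\<^esub>\<close>, where \<open>B\<^bsub>-1\<^esub> = 0\<close>.\<close>

definition Bprev :: "('k, 'r) ring_scheme \<Rightarrow> ('k, 'b, 'm) poisson_hopf_scheme \<Rightarrow> nat \<Rightarrow> 'b set"
  where "Bprev K B n = (case n of 0 \<Rightarrow> {\<zero>\<^bsub>B\<^esub>} | Suc m \<Rightarrow> Bfilt K B m)"

definition gr_quot ::
  "('k, 'r) ring_scheme \<Rightarrow> ('k, 'b, 'm) poisson_hopf_scheme \<Rightarrow> nat \<Rightarrow> ('k, 'b set) module"
  where "gr_quot K B n = quot (B\<lparr>carrier := Bfilt K B n\<rparr>) (Bprev K B n)"

text \<open>The class in \<open>B\<^sub>n / B\<^bsub>n-1\<^esub>\<close> of \<open>x \<in> B\<^sub>n\<close>, as a homogeneous element of \<open>gr B\<close>.\<close>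

definition gr_class ::
  "('k, 'r) ring_scheme \<Rightarrow> ('k, 'b, 'm) poisson_hopf_scheme \<Rightarrow> nat \<Rightarrow> 'b \<Rightarrow> (nat \<Rightarrow> 'b set)"
  where "gr_class K B n x = (\<lambda>m. if m = n then Bprev K B n +>\<^bsub>B\<^esub> x else Bprev K B m)"

text \<open>For an operation \<open>f\<close> with \<open>f B\<^sub>i B\<^sub>j \<subseteq> B\<^bsub>i+j\<^esub>\<close>, the induced bilinear operation on \<open>gr B\<close>.\<close>

definition gr_op ::
  "('k, 'r) ring_scheme \<Rightarrow> ('k, 'b, 'm) poisson_hopf_scheme \<Rightarrow> ('b \<Rightarrow> 'b \<Rightarrow> 'b) \<Rightarrow>
    (nat \<Rightarrow> 'b set) \<Rightarrow> (nat \<Rightarrow> 'b set) \<Rightarrow> (nat \<Rightarrow> 'b set)"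
  where "gr_op K B f u v =
    (\<lambda>n. \<Oplus>\<^bsub>gr_quot K B n\<^esub>i\<in>{..n}. \<Union>x\<in>u i. \<Union>y\<in>v (n - i). Bprev K B n +>\<^bsub>B\<^esub> f x y)"

definition gr_alg ::
  "('k, 'r) ring_scheme \<Rightarrow> ('k, 'b, 'm) poisson_hopf_scheme \<Rightarrow> ('k, nat \<Rightarrow> 'b set) module"
  where "gr_alg K B =
    \<lparr>carrier = {u. (\<forall>n. u n \<in> carrier (gr_quot K B n)) \<and> finite {n. u n \<noteq> Bprev K B n}},
     mult = gr_op K B (mult B),
     one = gr_class K B 0 \<one>\<^bsub>B\<^esub>,
     zero = (\<lambda>n. Bprev K B n),
     add = (\<lambda>u v n. u n \<oplus>\<^bsub>gr_quot K B n\<^esub> v n),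
     smult = (\<lambda>k u n. k \<odot>\<^bsub>gr_quot K B n\<^esub> u n)\<rparr>"

text \<open>\<open>gr_tensor_class K B n t s\<close>: \<open>t \<in> \<Sum>\<^sub>i B\<^sub>i \<otimes> B\<^bsub>n-i\<^esub>\<close>, and \<open>s\<close> is its class in
  \<open>\<Oplus>\<^sub>i B\<^sub>i/B\<^bsub>i-1\<^esub> \<otimes> B\<^bsub>n-i\<^esub>/B\<^bsub>n-i-1\<^esub> \<subseteq> gr B \<otimes> gr B\<close>.\<close>

definition gr_tensor_class ::
  "('k, 'r) ring_scheme \<Rightarrow> ('k, 'b, 'm) poisson_hopf_scheme \<Rightarrow> nat \<Rightarrow>
    ('b \<times> 'b \<Rightarrow> 'k) set \<Rightarrow> ((nat \<Rightarrow> 'b set) \<times> (nat \<Rightarrow> 'b set) \<Rightarrow> 'k) set \<Rightarrow> bool"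
  where "gr_tensor_class K B n t s \<longleftrightarrow>
    (\<exists>(N::nat) d a b.
      (\<forall>j<N. d j \<le> n \<and> a j \<in> Bfilt K B (d j) \<and> b j \<in> Bfilt K B (n - d j)) \<and>
      t = (\<Oplus>\<^bsub>tensor_space K B B\<^esub>j\<in>{..<N}. tens K B B (a j) (b j)) \<and>
      s = (\<Oplus>\<^bsub>tensor_space K (gr_alg K B) (gr_alg K B)\<^esub>j\<in>{..<N}.
            tens K (gr_alg K B) (gr_alg K B)
              (gr_class K B (d j) (a j)) (gr_class K B (n - d j) (b j))))"

definition gr ::
  "('k, 'r) ring_scheme \<Rightarrow> ('k, 'b, 'm) poisson_hopf_scheme \<Rightarrow> ('k, nat \<Rightarrow> 'b set) poisson_hopf"
  where "gr K B = module.extend (gr_alg K B)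
    \<lparr>bracket = gr_op K B (bracket B),
     comult = (\<lambda>u. \<Oplus>\<^bsub>tensor_space K (gr_alg K B) (gr_alg K B)\<^esub>n\<in>{n. u n \<noteq> Bprev K B n}.
                THE s. \<exists>x\<in>u n. gr_tensor_class K B n (comult B x) s),
     counit = (\<lambda>u. the_elem (counit B ` u 0)),
     antipode = (\<lambda>u n. \<Union>x\<in>u n. Bprev K B n +>\<^bsub>B\<^esub> antipode B x)\<rparr>"

definition gr_part ::
  "('k, 'r) ring_scheme \<Rightarrow> ('k, 'b, 'm) poisson_hopf_scheme \<Rightarrow> nat \<Rightarrow> (nat \<Rightarrow> 'b set) set"
  where "gr_part K B n = {u \<in> carrier (gr K B). \<forall>m. m \<noteq> n \<longrightarrow> u m = Bprev K B m}"


section \<open>The pieces \<open>kG\<close> and \<open>R\<close> of \<open>gr B\<close>\<close>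

text \<open>\<open>D\<close> as a Hopf subalgebra of \<open>A\<close>; its comultiplication is the one of \<open>A\<close>, corestricted along
  \<open>D \<otimes> D \<rightarrow> A \<otimes> A\<close>.\<close>

definition hopf_restrict ::
  "('k, 'r) ring_scheme \<Rightarrow> ('k, 'a, 'm) poisson_hopf_scheme \<Rightarrow> 'a set \<Rightarrow> ('k, 'a, 'm) poisson_hopf_scheme"
  where "hopf_restrict K A D =
    (let E = A\<lparr>carrier := D\<rparr> in
     E\<lparr>comult := \<lambda>x. THE u. u \<in> carrier (tensor_space K E E) \<and>
                          tensor_map K A A (\<lambda>a. a) (\<lambda>b. b) u = comult A x\<rparr>)"

text \<open>The group-likes of \<open>B\<close>, regarded as elements of degree \<open>0\<close> of \<open>gr B\<close>.\<close>

definition gr_group ::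
  "('k, 'r) ring_scheme \<Rightarrow> ('k, 'b, 'm) poisson_hopf_scheme \<Rightarrow> (nat \<Rightarrow> 'b set) set"
  where "gr_group K B = gr_class K B 0 ` grouplikes K B (comult B) (counit B)"

definition gr_kG ::
  "('k, 'r) ring_scheme \<Rightarrow> ('k, 'b, 'm) poisson_hopf_scheme \<Rightarrow> ('k, nat \<Rightarrow> 'b set) poisson_hopf"
  where "gr_kG K B = hopf_restrict K (gr K B) (k_span K (gr K B) (gr_group K B))"

text \<open>The projection \<open>\<pi> : gr B \<rightarrow> (gr B)(0) = kG\<close>.\<close>

definition gr_proj ::
  "('k, 'r) ring_scheme \<Rightarrow> ('k, 'b, 'm) poisson_hopf_scheme \<Rightarrow> (nat \<Rightarrow> 'b set) \<Rightarrow> (nat \<Rightarrow> 'b set)"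
  where "gr_proj K B u = (\<lambda>n. if n = 0 then u 0 else Bprev K B n)"

definition gr_R ::
  "('k, 'r) ring_scheme \<Rightarrow> ('k, 'b, 'm) poisson_hopf_scheme \<Rightarrow> ('k, nat \<Rightarrow> 'b set) poisson"
  where "gr_R K B =
    (let C = gr K B in
     poisson.truncate (C\<lparr>carrier := {x \<in> carrier C.
       tensor_map K C (gr_kG K B) (\<lambda>a. a) (gr_proj K B) (comult C x) =
       tens K C (gr_kG K B) x \<one>\<^bsub>gr_kG K B\<^esub>}\<rparr>))"


section \<open>The universal enveloping algebra of a Poisson algebra\<close>

text \<open>The free associative algebra on \<open>S\<close>: words over \<open>S\<close> with the concatenation product.\<close>

definition free_algebra :: "('k, 'r) ring_scheme \<Rightarrow> 'x set \<Rightarrow> ('k, 'x list \<Rightarrow> 'k) module"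
  where "free_algebra K S = (free_space K (lists S))
    \<lparr>mult := \<lambda>F G w. \<Oplus>\<^bsub>K\<^esub>i\<in>{..length w}. F (take i w) \<otimes>\<^bsub>K\<^esub> G (drop i w),
     one := delta K []\<rparr>"

text \<open>The two copies of \<open>A\<close> are indexed by \<open>Inl\<close> (for \<open>m\<close>) and \<open>Inr\<close> (for \<open>h\<close>).\<close>

definition env_free ::
  "('k, 'r) ring_scheme \<Rightarrow> ('k, 'a, 'm) poisson_scheme \<Rightarrow> ('k, ('a + 'a) list \<Rightarrow> 'k) module"
  where "env_free K A = free_algebra K (Inl ` carrier A \<union> Inr ` carrier A)"

definition env_relations ::
  "('k, 'r) ring_scheme \<Rightarrow> ('k, 'a, 'm) poisson_scheme \<Rightarrow> (('a + 'a) list \<Rightarrow> 'k) set"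
  where "env_relations K A =
    (let F = env_free K A;
         m = (\<lambda>a. delta K [Inl a]);
         h = (\<lambda>a. delta K [Inr a])
     in {m (x \<oplus>\<^bsub>A\<^esub> y) \<ominus>\<^bsub>F\<^esub> (m x \<oplus>\<^bsub>F\<^esub> m y) | x y. x \<in> carrier A \<and> y \<in> carrier A}
      \<union> {m (k \<odot>\<^bsub>A\<^esub> x) \<ominus>\<^bsub>F\<^esub> k \<odot>\<^bsub>F\<^esub> m x | k x. k \<in> carrier K \<and> x \<in> carrier A}
      \<union> {h (x \<oplus>\<^bsub>A\<^esub> y) \<ominus>\<^bsub>F\<^esub> (h x \<oplus>\<^bsub>F\<^esub> h y) | x y. x \<in> carrier A \<and> y \<in> carrier A}
      \<union> {h (k \<odot>\<^bsub>A\<^esub> x) \<ominus>\<^bsub>F\<^esub> k \<odot>\<^bsub>F\<^esub> h x | k x. k \<in> carrier K \<and> x \<in> carrier A}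
      \<union> {m (x \<otimes>\<^bsub>A\<^esub> y) \<ominus>\<^bsub>F\<^esub> m x \<otimes>\<^bsub>F\<^esub> m y | x y. x \<in> carrier A \<and> y \<in> carrier A}
      \<union> {h \<lbrace>x, y\<rbrace>\<^bsub>A\<^esub> \<ominus>\<^bsub>F\<^esub> (h x \<otimes>\<^bsub>F\<^esub> h y \<ominus>\<^bsub>F\<^esub> h y \<otimes>\<^bsub>F\<^esub> h x) | x y. x \<in> carrier A \<and> y \<in> carrier A}
      \<union> {h (x \<otimes>\<^bsub>A\<^esub> y) \<ominus>\<^bsub>F\<^esub> (m y \<otimes>\<^bsub>F\<^esub> h x \<oplus>\<^bsub>F\<^esub> m x \<otimes>\<^bsub>F\<^esub> h y) | x y. x \<in> carrier A \<and> y \<in> carrier A}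
      \<union> {m \<lbrace>x, y\<rbrace>\<^bsub>A\<^esub> \<ominus>\<^bsub>F\<^esub> (h x \<otimes>\<^bsub>F\<^esub> m y \<ominus>\<^bsub>F\<^esub> m y \<otimes>\<^bsub>F\<^esub> h x) | x y. x \<in> carrier A \<and> y \<in> carrier A}
      \<union> {m \<one>\<^bsub>A\<^esub> \<ominus>\<^bsub>F\<^esub> \<one>\<^bsub>F\<^esub>})"

definition env_ideal ::
  "('k, 'r) ring_scheme \<Rightarrow> ('k, 'a, 'm) poisson_scheme \<Rightarrow> (('a + 'a) list \<Rightarrow> 'k) set"
  where "env_ideal K A = Idl\<^bsub>env_free K A\<^esub> (env_relations K A)"

definition env ::
  "('k, 'r) ring_scheme \<Rightarrow> ('k, 'a, 'm) poisson_scheme \<Rightarrow> ('k, (('a + 'a) list \<Rightarrow> 'k) set) module"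
  where "env K A = quot (env_free K A) (env_ideal K A)"

definition env_m ::
  "('k, 'r) ring_scheme \<Rightarrow> ('k, 'a, 'm) poisson_scheme \<Rightarrow> 'a \<Rightarrow> (('a + 'a) list \<Rightarrow> 'k) set"
  where "env_m K A a = env_ideal K A +>\<^bsub>env_free K A\<^esub> delta K [Inl a]"

definition env_h ::
  "('k, 'r) ring_scheme \<Rightarrow> ('k, 'a, 'm) poisson_scheme \<Rightarrow> 'a \<Rightarrow> (('a + 'a) list \<Rightarrow> 'k) set"
  where "env_h K A a = env_ideal K A +>\<^bsub>env_free K A\<^esub> delta K [Inr a]"

text \<open>The algebra map from an enveloping algebra to \<open>T\<close> with \<open>m\<^sub>a \<mapsto> \<mu> a\<close> and \<open>h\<^sub>a \<mapsto> \<eta> a\<close>; as in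
  \<open>tensor_lift\<close>, all representatives must give the same value.\<close>

definition env_lift ::
  "('k, 'r) ring_scheme \<Rightarrow> ('k, 't, 'p) module_scheme \<Rightarrow> ('a \<Rightarrow> 't) \<Rightarrow> ('a \<Rightarrow> 't) \<Rightarrow>
    (('a + 'a) list \<Rightarrow> 'k) set \<Rightarrow> 't"
  where "env_lift K T \<mu> \<eta> S =
    the_elem ((\<lambda>F. \<Oplus>\<^bsub>T\<^esub>w\<in>support K F.
      F w \<odot>\<^bsub>T\<^esub> foldr (\<lambda>s t. case_sum \<mu> \<eta> s \<otimes>\<^bsub>T\<^esub> t) w \<one>\<^bsub>T\<^esub>) ` S)"

text \<open>The map \<open>f\<^sup>e\<close> induced by a Poisson algebra map \<open>f\<close> with values in \<open>A'\<close>.\<close>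

definition env_map ::
  "('k, 'r) ring_scheme \<Rightarrow> ('k, 'b, 'n) poisson_scheme \<Rightarrow> ('a \<Rightarrow> 'b) \<Rightarrow>
    (('a + 'a) list \<Rightarrow> 'k) set \<Rightarrow> (('b + 'b) list \<Rightarrow> 'k) set"
  where "env_map K A' f =
    env_lift K (env K A') (\<lambda>a. env_m K A' (f a)) (\<lambda>a. env_h K A' (f a))"

definition env_comult ::
  "('k, 'r) ring_scheme \<Rightarrow> ('k, 'a, 'm) poisson_hopf_scheme \<Rightarrow> (('a + 'a) list \<Rightarrow> 'k) set \<Rightarrow>
    ((('a + 'a) list \<Rightarrow> 'k) set \<times> (('a + 'a) list \<Rightarrow> 'k) set \<Rightarrow> 'k) set"
  where "env_comult K A =
    (let E = env K A; EE = tensor_alg K E E; m = env_m K A; h = env_h K A in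
     env_lift K EE
      (\<lambda>a. tensor_lift K EE (\<lambda>a1 a2. tens K E E (m a1) (m a2)) (comult A a))
      (\<lambda>a. tensor_lift K EE (\<lambda>a1 a2. tens K E E (m a1) (h a2) \<oplus>\<^bsub>EE\<^esub> tens K E E (h a1) (m a2))
              (comult A a)))"

definition env_counit ::
  "('k, 'r) ring_scheme \<Rightarrow> ('k, 'a, 'm) poisson_hopf_scheme \<Rightarrow> (('a + 'a) list \<Rightarrow> 'k) set \<Rightarrow> 'k"
  where "env_counit K A = env_lift K (base_algebra K) (counit A) (\<lambda>_. \<zero>\<^bsub>K\<^esub>)"


section \<open>Module algebras and smash products\<close>

text \<open>\<open>A\<close> is a module algebra, via \<open>act\<close>, over the bialgebra \<open>H\<close> with structure maps \<open>\<Delta>\<close>, \<open>\<epsilon>\<close>.\<close>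

definition module_algebra ::
  "('k, 'r) ring_scheme \<Rightarrow> ('k, 'h, 'm) module_scheme \<Rightarrow> ('h \<Rightarrow> ('h \<times> 'h \<Rightarrow> 'k) set) \<Rightarrow> ('h \<Rightarrow> 'k) \<Rightarrow>
    ('k, 'a, 'n) module_scheme \<Rightarrow> ('h \<Rightarrow> 'a \<Rightarrow> 'a) \<Rightarrow> bool"
  where "module_algebra K H \<Delta> \<epsilon> A act \<longleftrightarrow>
    k_bilinear K H A A act \<and>
    (\<forall>a\<in>carrier A. act \<one>\<^bsub>H\<^esub> a = a) \<and>
    (\<forall>x\<in>carrier H. \<forall>y\<in>carrier H. \<forall>a\<in>carrier A. act (x \<otimes>\<^bsub>H\<^esub> y) a = act x (act y a)) \<and>
    (\<forall>x\<in>carrier H. act x \<one>\<^bsub>A\<^esub> = \<epsilon> x \<odot>\<^bsub>A\<^esub> \<one>\<^bsub>A\<^esub>) \<and>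
    (\<forall>x\<in>carrier H. \<forall>a\<in>carrier A. \<forall>b\<in>carrier A.
      act x (a \<otimes>\<^bsub>A\<^esub> b) = tensor_lift K A (\<lambda>x1 x2. act x1 a \<otimes>\<^bsub>A\<^esub> act x2 b) (\<Delta> x))"

definition smash ::
  "('k, 'r) ring_scheme \<Rightarrow> ('k, 'a, 'n) module_scheme \<Rightarrow> ('k, 'h, 'm) module_scheme \<Rightarrow>
    ('h \<Rightarrow> ('h \<times> 'h \<Rightarrow> 'k) set) \<Rightarrow> ('h \<Rightarrow> 'a \<Rightarrow> 'a) \<Rightarrow> ('k, ('a \<times> 'h \<Rightarrow> 'k) set) module"
  where "smash K A H \<Delta> act =
    (let T = tensor_space K A H in
     T\<lparr>mult := \<lambda>u v. tensor_lift K T (\<lambda>a b. tensor_lift K T (\<lambda>a' b'.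
                 tensor_lift K T (\<lambda>b1 b2. tens K A H (a \<otimes>\<^bsub>A\<^esub> act b1 a') (b2 \<otimes>\<^bsub>H\<^esub> b')) (\<Delta> b)) v) u,
       one := tens K A H \<one>\<^bsub>A\<^esub> \<one>\<^bsub>H\<^esub>\<rparr>)"

text \<open>\<open>act\<close> makes \<open>R\<^sup>e\<close> a \<open>(kG)\<^sup>e\<close>-module algebra with the prescribed values on generators, where
  \<open>R\<close> and \<open>kG\<close> are the pieces of \<open>C = gr B\<close>.\<close>

definition gr_env_action ::
  "('k, 'r) ring_scheme \<Rightarrow> ('k, 'b, 'm) poisson_hopf_scheme \<Rightarrow>
    ((((nat \<Rightarrow> 'b set) + (nat \<Rightarrow> 'b set)) list \<Rightarrow> 'k) set \<Rightarrow>
     (((nat \<Rightarrow> 'b set) + (nat \<Rightarrow> 'b set)) list \<Rightarrow> 'k) set \<Rightarrow>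
     (((nat \<Rightarrow> 'b set) + (nat \<Rightarrow> 'b set)) list \<Rightarrow> 'k) set) \<Rightarrow> bool"
  where "gr_env_action K B act \<longleftrightarrow>
    (let C = gr K B; kG = gr_kG K B; R = gr_R K B; Re = env K R;
         m = env_m K R; \<beta> = env_h K R;
         ad = (\<lambda>g y. inv\<^bsub>C\<^esub> g \<otimes>\<^bsub>C\<^esub> \<lbrace>g, y\<rbrace>\<^bsub>C\<^esub>)
     in module_algebra K (env K kG) (env_comult K kG) (env_counit K kG) Re act \<and>
        (\<forall>g\<in>gr_group K B. \<forall>y\<in>carrier R.
          act (env_m K kG g) (m y) = m y \<and>
          act (env_m K kG g) (\<beta> y) = \<beta> y \<oplus>\<^bsub>Re\<^esub> m (ad g y) \<and>
          act (env_h K kG g) (m y) = m (ad g y) \<and>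
          act (env_h K kG g) (\<beta> y) = \<beta> (ad g y) \<oplus>\<^bsub>Re\<^esub> m \<lbrace>g, \<lbrace>y, inv\<^bsub>C\<^esub> g\<rbrace>\<^bsub>C\<^esub>\<rbrace>\<^bsub>C\<^esub>))"

end

theory Submission
  imports Defs
begin

text \<open>
  Part (1). An element of \<open>B\<close> lies in \<open>B\<^bsub>n+1\<^esub>\<close> iff all slices of its coproduct by functionals vanishing on
  \<open>B\<^sub>0\<close> lie in \<open>B\<^sub>n\<close>. Since \<open>B\<^sub>0 = kG\<close> has zero bracket and \<open>\<Delta>(B\<^sub>n) \<subseteq> \<Sum>\<^sub>i B\<^sub>i \<otimes> B\<^bsub>n-i\<^esub>\<close>, slicing
  \<open>\<Delta>{x, y} = {\<Delta>x, \<Delta>y}\<close> gives \<open>{B\<^sub>i, B\<^sub>j} \<subseteq> B\<^bsub>i+j\<^esub>\<close> by induction, and likewise for products. Hence all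
  structure maps descend to \<open>C\<close>; the Hopf and Poisson identities are checked on homogeneous classes.

  Part (2). \<open>C = \<Oplus>\<^sub>g R g\<close> is graded by \<open>G\<close>, so \<open>C\<^sup>e\<close> is generated by the \<open>m\<close> and \<open>h\<close> of \<open>R \<union> G\<close>, and
  moving \<open>m\<^sub>g\<close>, \<open>h\<^sub>g\<close> past \<open>R\<^sup>e\<close> is exactly the smash product action; this makes \<open>\<Phi>\<close> a surjective algebra
  map. The universal property of \<open>C\<^sup>e\<close> yields an algebra map \<open>C\<^sup>e \<rightarrow> End(R\<^sup>e) \<otimes> (kG)\<^sup>e\<close>, in which \<open>R\<^sup>e\<close> acts by
  multiplication and \<open>(kG)\<^sup>e\<close> by its action; evaluating the endomorphism at \<open>1\<close> gives a left inverse of \<open>\<Phi>\<close>.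
\<close>

text \<open>Tensors here are cosets in a free space, so two expressions for one tensor are hard to
  compare directly. Over a field the functionals \<phi> \<otimes> \<psi> separate points, and
  contracting one leg turns a claim about tensors into one about vectors; hence complements come
  early, and the behaviour of the filtration under \<Delta> and the coassociativity of C are argued
  by slices. In part (2) the action is prescribed on generators only, its existence has to be
  proved, and associativity of the smash product is not at hand. The key element is m_{g^-1} h_g,
  which is additive in g: inside C^e conjugation by m_g gives an automorphism of R^e and the
  commutator with m_{g^-1} h_g a derivation, both governed by the single operator y |-> g^-1 {g, y}.
  One universal statement about such data gives first a representation of C^e on R^e, from which the
  action is read off, and then the map to End(R^e) \<otimes> (kG)^e. The left inverse of \<Phi> is
  only linear; it proves injectivity, and the algebra axioms of the smash product are then pulled
  back along \<Phi>.\<close>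

notation (input) carrier ("|_|")

syntax (input)
  "_index" :: "logic => index"  ("\<^sub>_" [1000])
  "_mult_of" :: "[logic, logic, logic] => logic"  ("_ *\<^sub>_ _" [70, 1000, 71] 70)
  "_add_of" :: "[logic, logic, logic] => logic"  ("_ +\<^sub>_ _" [65, 1000, 66] 65)
  "_minus_of" :: "[logic, logic, logic] => logic"  ("_ -\<^sub>_ _" [65, 1000, 66] 65)
  "_zero_of" :: "logic => logic"  ("0\<^sub>_" [1000] 1000)
  "_one_of" :: "logic => logic"  ("1\<^sub>_" [1000] 1000)
  "_bracket_of" :: "[logic, logic, logic] => logic"  ("{_, _}\<^sub>_" [0, 0, 1000] 1000)
translations
  "x *\<^sub>M y" => "CONST monoid.mult M x y"
  "x +\<^sub>M y" => "CONST ring.add M x y"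
  "x -\<^sub>M y" => "CONST a_minus M x y"
  "0\<^sub>M" => "CONST ring.zero M"
  "1\<^sub>M" => "CONST monoid.one M"
  "{x, y}\<^sub>M" => "CONST bracket M x y"

section \<open>Vector spaces over K: arithmetic and subspaces\<close>

locale base = K?: field K for K :: "('k, 'r) ring_scheme" (structure)
begin

lemma cring_K [simp, intro]: "cring K"
 by unfold_locales

abbreviation (input) "vs == module K"
abbreviation (input) "sub H M == submodule H K M"
abbreviation (input) "lin == k_linear K"
abbreviation (input) "bil == k_bilinear K"
abbreviation (input) "span == k_span K"
abbreviation (input) "free == free_space K"
abbreviation (input) "TS == tensor_space K"
abbreviation (input) "ts == tens K"
abbreviation (input) "tsub == tensor_sub K"
abbreviation (input) "tlift == tensor_lift K"
abbreviation (input) "tmap == tensor_map K"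

lemma mod_agrp: "module K M ==> abelian_group M"
 by (simp add: module_def)

context
 fixes M :: "('k, 'm, 'z) module_scheme"
 assumes M: "module K M"
begin

interpretation M: module K M by (rule M)

lemma v_add_closed [simp, intro]: "x\<in>|M| ==> y\<in>|M| ==> x +\<^sub>M y\<in>|M|"
 by simp
lemma v_zero_closed [simp, intro]: "0\<^sub>M\<in>|M|"
 by simp
lemma v_neg_closed [simp, intro]: "x\<in>|M| ==> \<ominus>\<^sub>M x\<in>|M|"
 by simp
lemma v_minus_closed [simp, intro]: "x\<in>|M| ==> y\<in>|M| ==> x -\<^sub>M y\<in>|M|"
 by simp
lemma v_smult_closed [simp, intro]: "k\<in>|K| ==> x\<in>|M| ==> k \<odot>\<^sub>M x\<in>|M|"
 by simp
lemma v_assoc: "x\<in>|M| ==> y\<in>|M| ==> z\<in>|M| ==>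
  (x +\<^sub>M y) +\<^sub>M z = x +\<^sub>M (y +\<^sub>M z)"
 by (rule M.M.a_assoc)
lemma v_comm: "x\<in>|M| ==> y\<in>|M| ==> x +\<^sub>M y = y +\<^sub>M x"
 by (rule M.M.a_comm)
lemma v_lcomm: "x\<in>|M| ==> y\<in>|M| ==> z\<in>|M| ==>
  x +\<^sub>M (y +\<^sub>M z) = y +\<^sub>M (x +\<^sub>M z)"
 by (rule M.M.a_lcomm)
lemma v_zero [simp]:
 assumes "x\<in>|M|"
 shows "0\<^sub>M +\<^sub>M x = x" "x +\<^sub>M 0\<^sub>M = x" "x -\<^sub>M 0\<^sub>M = x"
 using assms by (auto simp: a_minus_def)
lemma v_neg [simp]:
 assumes "x\<in>|M|"
 shows "\<ominus>\<^sub>M x +\<^sub>M x = 0\<^sub>M" "x +\<^sub>M \<ominus>\<^sub>M x = 0\<^sub>M" "x -\<^sub>M x = 0\<^sub>M" "\<ominus>\<^sub>M (\<ominus>\<^sub>M x) = x"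
 using assms by (auto simp: M.l_neg M.r_neg a_minus_def)
lemma v_neg2 [simp]:
 assumes "x\<in>|M|" "y\<in>|M|"
 shows "\<ominus>\<^sub>M x +\<^sub>M (x +\<^sub>M y) = y" "x +\<^sub>M (\<ominus>\<^sub>M x +\<^sub>M y) = y"
 using assms by (auto simp: M.M.r_neg1 M.M.r_neg2)
lemma v_neg_zero [simp]: "\<ominus>\<^sub>M 0\<^sub>M = 0\<^sub>M"
 using M.M.r_neg[of "0\<^sub>M"] M.M.l_zero[of "\<ominus>\<^sub>M 0\<^sub>M"] by simp
lemma v_neg_add: "x\<in>|M| ==> y\<in>|M| ==> \<ominus>\<^sub>M (x +\<^sub>M y) = \<ominus>\<^sub>M x +\<^sub>M \<ominus>\<^sub>M y"
 by (rule M.M.minus_add)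
lemma v_cancel_l: "x\<in>|M| ==> y\<in>|M| ==> z\<in>|M| ==>
  x +\<^sub>M y = x +\<^sub>M z \<longleftrightarrow> y = z"
 by simp
lemma v_eq_diff: "x\<in>|M| ==> y\<in>|M| ==> x -\<^sub>M y = 0\<^sub>M \<longleftrightarrow> x = y"
proof
 assume xy: "x\<in>|M|" "y\<in>|M|" and "x -\<^sub>M y = 0\<^sub>M"
 hence "(x -\<^sub>M y) +\<^sub>M y = y" by simp
 thus "x = y" using xy by (simp add: a_minus_def M.M.a_assoc M.l_neg)
qed simp
lemma v_diff_add [simp]: "x\<in>|M| ==> y\<in>|M| ==> (x -\<^sub>M y) +\<^sub>M y = x"
 by (simp add: a_minus_def M.M.a_assoc M.l_neg)
lemma v_add_diff [simp]: "x\<in>|M| ==> y\<in>|M| ==> (x +\<^sub>M y) -\<^sub>M y = x"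
 by (simp add: a_minus_def M.M.a_assoc M.r_neg)
lemma v_smult_zero [simp]: "x\<in>|M| ==> \<zero> \<odot>\<^sub>M x = 0\<^sub>M"
 "k\<in>|K| ==> k \<odot>\<^sub>M 0\<^sub>M = 0\<^sub>M"
 by simp_all
lemma v_smult_one [simp]: "x\<in>|M| ==> \<one> \<odot>\<^sub>M x = x"
 by simp
lemma v_smult_ldistr: "k\<in>|K| ==> l\<in>|K| ==> x\<in>|M| ==>
  (k \<oplus> l) \<odot>\<^sub>M x = k \<odot>\<^sub>M x +\<^sub>M l \<odot>\<^sub>M x"
 by (rule M.smult_l_distr)
lemma v_smult_rdistr: "k\<in>|K| ==> x\<in>|M| ==> y\<in>|M| ==>
  k \<odot>\<^sub>M (x +\<^sub>M y) = k \<odot>\<^sub>M x +\<^sub>M k \<odot>\<^sub>M y"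
 by (rule M.smult_r_distr)
lemma v_smult_assoc: "k\<in>|K| ==> l\<in>|K| ==> x\<in>|M| ==>
  (k \<otimes> l) \<odot>\<^sub>M x = k \<odot>\<^sub>M (l \<odot>\<^sub>M x)"
 by (rule M.smult_assoc1)
lemma v_smult_neg_one: "x\<in>|M| ==> (\<ominus> \<one>) \<odot>\<^sub>M x = \<ominus>\<^sub>M x"
 by (simp add: M.smult_l_minus)
lemma v_smult_neg: "k\<in>|K| ==> x\<in>|M| ==> (\<ominus> k) \<odot>\<^sub>M x = \<ominus>\<^sub>M (k \<odot>\<^sub>M x)"
 "k\<in>|K| ==> x\<in>|M| ==> k \<odot>\<^sub>M (\<ominus>\<^sub>M x) = \<ominus>\<^sub>M (k \<odot>\<^sub>M x)"
 by (simp_all add: M.smult_l_minus M.smult_r_minus)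
lemma v_smult_minus: "k\<in>|K| ==> x\<in>|M| ==> y\<in>|M| ==>
  k \<odot>\<^sub>M (x -\<^sub>M y) = k \<odot>\<^sub>M x -\<^sub>M k \<odot>\<^sub>M y"
 by (simp add: a_minus_def M.smult_r_distr M.smult_r_minus)

lemma v_finsum_closed [simp, intro]: "(!!i. i\<in>I ==> f i\<in>carrier M) ==> (\<Oplus>\<^sub>M i\<in>I. f i)\<in>|M|"
 by (rule M.M.finsum_closed) auto
lemma v_finsum_empty [simp]: "(\<Oplus>\<^sub>M i\<in>{}. f i) = 0\<^sub>M"
 by simp
lemma v_finsum_insert: "finite I ==> i \<notin> I ==> (!!j. j\<in>insert i I ==> f j\<in>carrier M) ==>
  (\<Oplus>\<^sub>M i\<in>insert i I. f i) = f i +\<^sub>M (\<Oplus>\<^sub>M i\<in>I. f i)"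
 by (rule M.M.finsum_insert) auto
lemma v_finsum_add: "(!!i. i\<in>I ==> f i\<in>carrier M) ==> (!!i. i\<in>I ==> g i\<in>carrier M) ==>
  (\<Oplus>\<^sub>M i\<in>I. f i +\<^sub>M g i) = (\<Oplus>\<^sub>M i\<in>I. f i) +\<^sub>M (\<Oplus>\<^sub>M i\<in>I. g i)"
 by (rule M.M.finsum_addf) auto
lemma v_finsum_zero: "(!!i. i\<in>I ==> f i = 0\<^sub>M) ==> (\<Oplus>\<^sub>M i\<in>I. f i) = 0\<^sub>M"
 using M.M.add.finprod_one_eqI by auto
lemma v_finsum_cong: "(!!i. i\<in>I ==> g i\<in>carrier M) ==> (!!i. i\<in>I ==> f i = g i) ==>
  (\<Oplus>\<^sub>M i\<in>I. f i) = (\<Oplus>\<^sub>M i\<in>I. g i)"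
 by (rule M.M.finsum_cong') auto
lemma v_finsum_mono: "finite J ==> I\<subseteq>J ==> (!!i. i\<in>J - I ==> f i = 0\<^sub>M) ==>
  (!!i. i\<in>I ==> f i\<in>carrier M) ==> (\<Oplus>\<^sub>M i\<in>J. f i) = (\<Oplus>\<^sub>M i\<in>I. f i)"
proof -
 assume a: "finite J" "I\<subseteq>J" "!!i. i\<in>J - I ==> f i = 0\<^sub>M" "!!i. i\<in>I ==> f i\<in>|M|"
 have "f i\<in>|M|" if "i\<in>J" for i
  using that a(3)[of i] a(4)[of i] by (cases "i\<in>I") auto
 thus ?thesis using a by (intro M.M.add.finprod_mono_neutral_cong_right) auto
qed
lemma v_finsum_single: "finite I ==> i\<in>I ==> (!!j. j\<in>I ==> j ~= i ==> f j = 0\<^sub>M) ==> f i\<in>|M| ==>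
  (\<Oplus>\<^sub>M i\<in>I. f i) = f i"
proof -
 assume a: "finite I" "i\<in>I" "!!j. j\<in>I ==> j ~= i ==> f j = 0\<^sub>M" "f i\<in>|M|"
 hence "(\<Oplus>\<^sub>M i\<in>I. f i) = (\<Oplus>\<^sub>M i\<in>{i}. f i)"
  by (intro v_finsum_mono) auto
 also have "... = f i" using a by (subst v_finsum_insert) auto
 finally show ?thesis .
qed
lemma v_finsum_smult: "finite I ==> k\<in>|K| ==> (!!i. i\<in>I ==> f i\<in>carrier M) ==>
  k \<odot>\<^sub>M (\<Oplus>\<^sub>M i\<in>I. f i) = (\<Oplus>\<^sub>M i\<in>I. k \<odot>\<^sub>M f i)"
 by (rule M.finsum_smult_ldistr) auto
lemma v_finsum_swap: "finite I ==> finite J ==> (!!i j. i\<in>I ==> j\<in>J ==> f i j\<in>carrier M) ==>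
  (\<Oplus>\<^sub>M i\<in>I. \<Oplus>\<^sub>M j\<in>J. f i j) = (\<Oplus>\<^sub>M j\<in>J. \<Oplus>\<^sub>M i\<in>I. f i j)"
proof (induction I rule: finite_induct)
 case empty
 thus ?case by (simp add: v_finsum_zero)
next
 case (insert i I)
 hence "(\<Oplus>\<^sub>M i\<in>insert i I. \<Oplus>\<^sub>M j\<in>J. f i j) = (\<Oplus>\<^sub>M j\<in>J. f i j) +\<^sub>M (\<Oplus>\<^sub>M j\<in>J. \<Oplus>\<^sub>M i\<in>I. f i j)"
  by (subst v_finsum_insert) auto
 also have "... = (\<Oplus>\<^sub>M j\<in>J. f i j +\<^sub>M (\<Oplus>\<^sub>M i\<in>I. f i j))"
  using insert by (intro v_finsum_add[symmetric]) auto
 also have "... = (\<Oplus>\<^sub>M j\<in>J. \<Oplus>\<^sub>M i\<in>insert i I. f i j)"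
  using insert by (intro v_finsum_cong v_finsum_insert[symmetric]) auto
 finally show ?case .
qed

lemma submodule_crit:
 assumes "H\<subseteq>|M|" "0\<^sub>M\<in>H"
  "!!x y. x\<in>H ==> y\<in>H ==> x +\<^sub>M y\<in>H"
  "!!k x. k\<in>|K| ==> x\<in>H ==> k \<odot>\<^sub>M x\<in>H"
 shows "submodule H K M"
proof (rule M.submoduleI)
 fix a assume "a\<in>H"
 thus "\<ominus>\<^sub>M a\<in>H"
  using assms(4)[of "\<ominus> \<one>" a] v_smult_neg_one[of a] assms(1) by auto
qed (use assms in auto)

lemma sub_subset: "submodule H K M ==> H\<subseteq>|M|"
 by (rule M.submoduleE(1))
lemma sub_carrier: "submodule H K M ==> x\<in>H ==> x\<in>|M|"
 using M.submoduleE(1) by blast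
lemma sub_add: "submodule H K M ==> x\<in>H ==> y\<in>H ==> x +\<^sub>M y\<in>H"
 by (rule M.submoduleE(5))
lemma sub_neg: "submodule H K M ==> x\<in>H ==> \<ominus>\<^sub>M x\<in>H"
 by (rule M.submoduleE(3))
lemma sub_minus: "submodule H K M ==> x\<in>H ==> y\<in>H ==> x -\<^sub>M y\<in>H"
 unfolding a_minus_def by (intro sub_add sub_neg)
lemma sub_smult: "submodule H K M ==> k\<in>|K| ==> x\<in>H ==> k \<odot>\<^sub>M x\<in>H"
 by (rule M.submoduleE(4))
lemma sub_zero: "submodule H K M ==> 0\<^sub>M\<in>H"
 using M.submoduleE(2)[of H] sub_smult[of H "\<zero>"] v_smult_zero(1) sub_carrier[of H]
 by (metis K.zero_closed all_not_in_conv)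
lemma sub_finsum:
 assumes "submodule H K M" "!!i. i\<in>I ==> f i\<in>H"
 shows "(\<Oplus>\<^sub>M i\<in>I. f i)\<in>H"
proof (cases "finite I")
 case True
 thus ?thesis using assms(2)
 proof (induction I rule: finite_induct)
  case empty
  thus ?case by (simp add: sub_zero[OF assms(1)])
 next
  case (insert i I)
  thus ?case
   by (subst v_finsum_insert) (auto intro: sub_add[OF assms(1)] sub_carrier[OF assms(1)])
 qed
next
 case False
 thus ?thesis using M.M.finsum_infinite sub_zero[OF assms(1)] by simp
qed
lemma sub_cancel:
 assumes "submodule H K M" "x +\<^sub>M y\<in>H" "y\<in>H" "x\<in>|M|"
 shows "x\<in>H"
 using sub_minus[OF assms(1,2,3)] v_add_diff[of x y] assms(4) sub_carrier[OF assms(1,3)] by simp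
lemma sub_full: "submodule (carrier M) K M"
 by (rule M.carrier_is_submodule)
lemma sub_null: "submodule {0\<^sub>M} K M"
 by (rule submodule_crit) auto
lemma sub_module: "submodule H K M ==> module K (M\<lparr>carrier := H\<rparr>)"
 by (rule submodule.submodule_is_module) (auto simp: M)
lemma sub_Int: "(!!H. H\<in>\<H> ==> submodule H K M) ==> submodule (carrier M \<inter> \<Inter>\<H>) K M"
 by (rule submodule_crit) (auto intro: sub_add sub_smult sub_zero)
end

lemma sub_restrict:
 assumes "module K M" "submodule H K M" "submodule X K M" "X\<subseteq>H"
 shows "submodule X K (M\<lparr>carrier := H\<rparr>)"
 by (rule submodule_crit[OF sub_module[OF assms(1,2)]])
  (use assms in "auto intro: sub_add sub_smult sub_zero")

end

section \<open>Linear and bilinear maps\<close>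

lemma k_linearI:
 assumes "!!x. x\<in>|M| ==> f x\<in>|N|"
  "!!x y. x\<in>|M| ==> y\<in>|M| ==> f (x +\<^sub>M y) = f x +\<^sub>N f y"
  "!!k x. k\<in>|K| ==> x\<in>|M| ==> f (k \<odot>\<^sub>M x) = k \<odot>\<^sub>N f x"
 shows "k_linear K M N f"
 using assms unfolding k_linear_def by auto

lemma lin_closed: "k_linear K M N f ==> x\<in>|M| ==> f x\<in>|N|"
 and lin_add: "k_linear K M N f ==> x\<in>|M| ==> y\<in>|M| ==> f (x +\<^sub>M y) = f x +\<^sub>N f y"
 and lin_smult: "k_linear K M N f ==> k\<in>|K| ==> x\<in>|M| ==> f (k \<odot>\<^sub>M x) = k \<odot>\<^sub>N f x"
 unfolding k_linear_def by auto

lemma lin_id: "|M|\<subseteq>|N| ==> add M = add N ==> smult M = smult N ==> k_linear K M N (%x. x)"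
 by (auto intro!: k_linearI)

lemma lin_cong: "k_linear K M N f ==> module K M ==> (!!x. x\<in>|M| ==> g x = f x) ==> k_linear K M N g"
 by (rule k_linearI) (auto simp: lin_closed lin_add lin_smult module.smult_closed abelian_group.axioms(1)
   abelian_monoid.a_closed module_def)

lemma lin_comp: "k_linear K M N f ==> k_linear K N P g ==> k_linear K M P (%x. g (f x))"
 by (rule k_linearI) (auto simp: lin_closed lin_add lin_smult)

lemma lin_restrict: "k_linear K M N f ==> H\<subseteq>|M| ==> k_linear K (M\<lparr>carrier := H\<rparr>) N f"
 by (rule k_linearI) (auto simp: lin_closed lin_add lin_smult subset_iff)

lemma lin_corestrict: "k_linear K M N f ==> (!!x. x\<in>|M| ==> f x\<in>H) ==> k_linear K M (N\<lparr>carrier := H\<rparr>) f"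
 by (rule k_linearI) (auto simp: lin_closed lin_add lin_smult)

lemma k_bilinearI:
 assumes "!!x y. x\<in>|M| ==> y\<in>|N| ==> f x y\<in>|P|"
  "!!x x' y. x\<in>|M| ==> x'\<in>|M| ==> y\<in>|N| ==> f (x +\<^sub>M x') y = f x y +\<^sub>P f x' y"
  "!!x y y'. x\<in>|M| ==> y\<in>|N| ==> y'\<in>|N| ==> f x (y +\<^sub>N y') = f x y +\<^sub>P f x y'"
  "!!k x y. k\<in>|K| ==> x\<in>|M| ==> y\<in>|N| ==> f (k \<odot>\<^sub>M x) y = k \<odot>\<^sub>P f x y"
  "!!k x y. k\<in>|K| ==> x\<in>|M| ==> y\<in>|N| ==> f x (k \<odot>\<^sub>N y) = k \<odot>\<^sub>P f x y"
 shows "k_bilinear K M N P f"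
 unfolding k_bilinear_def by (auto intro!: k_linearI assms)

lemma bil_left: "k_bilinear K M N P f ==> y\<in>|N| ==> k_linear K M P (%x. f x y)"
 and bil_right: "k_bilinear K M N P f ==> x\<in>|M| ==> k_linear K N P (f x)"
 unfolding k_bilinear_def by auto

lemma bil_closed: "k_bilinear K M N P f ==> x\<in>|M| ==> y\<in>|N| ==> f x y\<in>|P|"
 and bil_add_l: "k_bilinear K M N P f ==> x\<in>|M| ==> x'\<in>|M| ==> y\<in>|N| ==>
  f (x +\<^sub>M x') y = f x y +\<^sub>P f x' y"
 and bil_add_r: "k_bilinear K M N P f ==> x\<in>|M| ==> y\<in>|N| ==> y'\<in>|N| ==>
  f x (y +\<^sub>N y') = f x y +\<^sub>P f x y'"
 and bil_smult_l: "k_bilinear K M N P f ==> k\<in>|K| ==> x\<in>|M| ==> y\<in>|N| ==>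
  f (k \<odot>\<^sub>M x) y = k \<odot>\<^sub>P f x y"
 and bil_smult_r: "k_bilinear K M N P f ==> k\<in>|K| ==> x\<in>|M| ==> y\<in>|N| ==>
  f x (k \<odot>\<^sub>N y) = k \<odot>\<^sub>P f x y"
 unfolding k_bilinear_def k_linear_def by auto

lemma bil_comp: "k_bilinear K M N P f ==> k_linear K M' M g ==> k_linear K N' N h ==>
  k_bilinear K M' N' P (%x y. f (g x) (h y))"
 by (rule k_bilinearI) (auto simp: lin_closed lin_add lin_smult bil_closed bil_add_l bil_add_r bil_smult_l bil_smult_r)

lemma bil_post: "k_bilinear K M N P f ==> k_linear K P Q g ==> k_bilinear K M N Q (%x y. g (f x y))"
 by (rule k_bilinearI) (auto simp: lin_closed lin_add lin_smult bil_closed bil_add_l bil_add_r bil_smult_l bil_smult_r)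

context base
begin

lemma lin_zero:
 assumes "lin M N f" "vs M" "vs N"
 shows "f 0\<^sub>M = 0\<^sub>N"
proof -
 have "f (\<zero> \<odot>\<^sub>M 0\<^sub>M) = \<zero> \<odot>\<^sub>N f 0\<^sub>M"
  using assms by (intro lin_smult[OF assms(1)]) auto
 thus ?thesis using assms lin_closed[OF assms(1), of "0\<^sub>M"] by simp
qed

lemma lin_neg:
 assumes "lin M N f" "vs M" "vs N" "x\<in>|M|"
 shows "f (\<ominus>\<^sub>M x) = \<ominus>\<^sub>N f x"
 using lin_smult[OF assms(1), of "\<ominus> \<one>" x] assms lin_closed[OF assms(1,4)]
 by (simp add: v_smult_neg_one)

lemma lin_minus:
 assumes "lin M N f" "vs M" "vs N" "x\<in>|M|" "y\<in>|M|"
 shows "f (x -\<^sub>M y) = f x -\<^sub>N f y"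
 using assms by (simp add: a_minus_def lin_add[OF assms(1)] lin_neg)

lemma lin_finsum:
 assumes "lin M N f" "vs M" "vs N" "finite I" "!!i. i\<in>I ==> g i\<in>|M|"
 shows "f (\<Oplus>\<^sub>M i\<in>I. g i) = (\<Oplus>\<^sub>N i\<in>I. f (g i))"
 using assms(4,5)
proof (induction I rule: finite_induct)
 case empty
 thus ?case using assms by (simp add: lin_zero)
next
 case (insert i I)
 hence "f (\<Oplus>\<^sub>M i\<in>insert i I. g i) = f (g i +\<^sub>M (\<Oplus>\<^sub>M i\<in>I. g i))"
  using assms(2) by (subst v_finsum_insert) auto
 also have "... = f (g i) +\<^sub>N f (\<Oplus>\<^sub>M i\<in>I. g i)"
  using assms(2) insert by (intro lin_add[OF assms(1)]) auto
 also have "... = (\<Oplus>\<^sub>N i\<in>insert i I. f (g i))"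
  using assms insert by (subst v_finsum_insert) (auto intro: lin_closed[OF assms(1)])
 finally show ?case .
qed

lemma lin_null: "vs N ==> lin M N (%x. 0\<^sub>N)"
 by (auto intro!: k_linearI)

lemma lin_plus:
 assumes N: "vs N" and f: "lin M N f" and g: "lin M N g"
 shows "lin M N (%x. f x +\<^sub>N g x)"
 by (rule k_linearI) (simp_all add: N lin_closed[OF f] lin_closed[OF g] lin_add[OF f] lin_add[OF g]
   lin_smult[OF f] lin_smult[OF g] v_assoc v_lcomm v_smult_rdistr)

lemma lin_scale:
 assumes N: "vs N" and f: "lin M N f" and k: "k\<in>|K|"
 shows "lin M N (%x. k \<odot>\<^sub>N f x)"
 by (rule k_linearI) (simp_all add: N k lin_closed[OF f] lin_add[OF f] lin_smult[OF f] v_smult_rdistr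
   v_smult_assoc[symmetric] K.m_comm)

lemma lin_uminus:
 assumes N: "vs N" and f: "lin M N f"
 shows "lin M N (%x. \<ominus>\<^sub>N f x)"
 by (rule k_linearI) (simp_all add: N lin_closed[OF f] lin_add[OF f] lin_smult[OF f] v_neg_add v_smult_neg)

lemma lin_diff: "vs N ==> lin M N f ==> lin M N g ==> lin M N (%x. f x -\<^sub>N g x)"
 unfolding a_minus_def by (intro lin_plus lin_uminus)

lemma lin_sum:
 assumes "vs N" "vs M" "finite I" "!!i. i\<in>I ==> lin M N (f i)"
 shows "lin M N (%x. \<Oplus>\<^sub>N i\<in>I. f i x)"
proof (rule k_linearI)
 fix x y assume xy: "x\<in>|M|" "y\<in>|M|"
 have "(\<Oplus>\<^sub>N i\<in>I. f i (x +\<^sub>M y)) = (\<Oplus>\<^sub>N i\<in>I. f i x +\<^sub>N f i y)"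
  using assms xy by (intro v_finsum_cong v_add_closed lin_add[OF assms(4)] lin_closed[OF assms(4)]) auto
 thus "(\<Oplus>\<^sub>N i\<in>I. f i (x +\<^sub>M y)) = (\<Oplus>\<^sub>N i\<in>I. f i x) +\<^sub>N (\<Oplus>\<^sub>N i\<in>I. f i y)"
  using assms(1) xy by (simp add: v_finsum_add lin_closed[OF assms(4)])
next
 fix k x assume xy: "k\<in>|K|" "x\<in>|M|"
 have "(\<Oplus>\<^sub>N i\<in>I. f i (k \<odot>\<^sub>M x)) = (\<Oplus>\<^sub>N i\<in>I. k \<odot>\<^sub>N f i x)"
  using assms xy by (intro v_finsum_cong v_smult_closed lin_smult[OF assms(4)] lin_closed[OF assms(4)]) auto
 thus "(\<Oplus>\<^sub>N i\<in>I. f i (k \<odot>\<^sub>M x)) = k \<odot>\<^sub>N (\<Oplus>\<^sub>N i\<in>I. f i x)"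
  using assms(1,3) xy by (simp add: v_finsum_smult lin_closed[OF assms(4)])
qed (use assms in "auto intro!: v_finsum_closed lin_closed[OF assms(4)]")

lemma sub_preimage:
 assumes "lin M N f" "vs M" "vs N" "sub H N"
 shows "sub {x\<in>carrier M. f x\<in>H} M"
 by (rule submodule_crit[OF assms(2)])
  (use assms in "auto simp: lin_add[OF assms(1)] lin_smult[OF assms(1)] lin_zero intro: sub_add sub_smult sub_zero")

lemma sub_image:
 assumes "lin M N f" "vs M" "vs N" "sub H M"
 shows "sub (f ` H) N"
proof (rule submodule_crit[OF assms(3)])
 show "f ` H\<subseteq>|N|" using assms by (auto intro: lin_closed sub_carrier)
 show "0\<^sub>N\<in>f ` H" using lin_zero[OF assms(1-3)] sub_zero[OF assms(2,4)] by (metis image_eqI)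
 fix x y assume "x\<in>f ` H" "y\<in>f ` H"
 then obtain a b where "a\<in>H" "b\<in>H" "x = f a" "y = f b" by auto
 thus "x +\<^sub>N y\<in>f ` H"
  using assms by (intro image_eqI[of _ _ "a +\<^sub>M b"]) (auto simp: lin_add[OF assms(1)] sub_carrier sub_add)
next
 fix k x assume "k\<in>|K|" "x\<in>f ` H"
 then obtain a where "a\<in>H" "x = f a" by auto
 thus "k \<odot>\<^sub>N x\<in>f ` H" using \<open>k\<in>|K|\<close>
  using assms by (intro image_eqI[of _ _ "k \<odot>\<^sub>M a"]) (auto simp: lin_smult[OF assms(1)] sub_carrier sub_smult)
qed

lemma sub_eq:
 assumes "lin M N f" "lin M N g" "vs M" "vs N"
 shows "sub {x\<in>carrier M. f x = g x} M"
 by (rule submodule_crit[OF assms(3)])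
  (use assms in "auto simp: lin_add[OF assms(1)] lin_smult[OF assms(1)] lin_add[OF assms(2)] lin_smult[OF assms(2)] lin_zero")

section \<open>Sums and spans of subspaces\<close>

lemma set_add_iff: "x\<in>H <+>\<^sub>M H' \<longleftrightarrow> (\<exists>h\<in>H. \<exists>h'\<in>H'. x = h +\<^sub>M h')"
 by (auto simp: set_add_def')

lemma sub_sum:
 assumes "vs M" "sub H M" "submodule H' K M"
 shows "sub (H <+>\<^sub>M H') M"
proof (rule submodule_crit[OF assms(1)])
 show "H <+>\<^sub>M H'\<subseteq>|M|" using assms by (auto simp: set_add_iff sub_carrier)
 show "0\<^sub>M\<in>H <+>\<^sub>M H'" using assms unfolding set_add_iff
  by (intro bexI[of _ "0\<^sub>M"]) (auto intro: sub_zero)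
 fix x y assume "x\<in>H <+>\<^sub>M H'" "y\<in>H <+>\<^sub>M H'"
 then obtain a a' b b' where h: "a\<in>H" "b\<in>H" "a'\<in>H'" "b'\<in>H'" "x = a +\<^sub>M a'" "y = b +\<^sub>M b'"
  by (auto simp: set_add_iff)
 hence "x +\<^sub>M y = (a +\<^sub>M b) +\<^sub>M (a' +\<^sub>M b')"
  using assms by (simp add: v_assoc v_lcomm sub_carrier[of M H] sub_carrier[of M H'])
 thus "x +\<^sub>M y\<in>H <+>\<^sub>M H'" unfolding set_add_iff
  using h assms by (blast intro: sub_add)
next
 fix k x assume k: "k\<in>|K|" and "x\<in>H <+>\<^sub>M H'"
 then obtain a a' where h: "a\<in>H" "a'\<in>H'" "x = a +\<^sub>M a'" by (auto simp: set_add_iff)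
 hence "k \<odot>\<^sub>M x = k \<odot>\<^sub>M a +\<^sub>M k \<odot>\<^sub>M a'"
  using assms k by (simp add: v_smult_rdistr sub_carrier[of M H] sub_carrier[of M H'])
 thus "k \<odot>\<^sub>M x\<in>H <+>\<^sub>M H'" unfolding set_add_iff
  using h assms k by (blast intro: sub_smult)
qed

lemma set_add_left: "vs M ==> sub H M ==> submodule H' K M ==> x\<in>H ==> x\<in>H <+>\<^sub>M H'"
 unfolding set_add_iff by (rule bexI[of _ x], rule bexI[of _ "0\<^sub>M"]) (auto simp: sub_carrier sub_zero)

lemma set_add_right: "vs M ==> sub H M ==> submodule H' K M ==> x\<in>H' ==> x\<in>H <+>\<^sub>M H'"
 unfolding set_add_iff by (rule bexI[of _ "0\<^sub>M"], rule bexI[of _ x]) (auto simp: sub_carrier sub_zero)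

lemma span_sub:
 assumes "vs M" "S\<subseteq>|M|"
 shows "sub (span M S) M"
proof -
 have "span M S = |M| \<inter> \<Inter>{N. sub N M & S\<subseteq>N}"
  using sub_full[OF assms(1)] assms(2) by (auto simp: k_span_def)
 thus ?thesis using sub_Int[OF assms(1), of "{N. sub N M & S\<subseteq>N}"] by auto
qed

lemma span_incl: "x\<in>S ==> x\<in>span M S"
 by (auto simp: k_span_def)

lemma span_least: "sub N M ==> S\<subseteq>N ==> span M S\<subseteq>N"
 by (auto simp: k_span_def)

lemma span_mono: "S\<subseteq>T ==> span M S\<subseteq>span M T"
 by (auto simp: k_span_def)

lemma span_induct [consumes 3, case_names zero base add smult]:
 assumes "x\<in>span M S" "vs M" "S\<subseteq>|M|"
  "P 0\<^sub>M" "!!s. s\<in>S ==> P s"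
  "!!x y. x\<in>span M S ==> y\<in>span M S ==> P x ==> P y ==> P (x +\<^sub>M y)"
  "!!k x. k\<in>|K| ==> x\<in>span M S ==> P x ==> P (k \<odot>\<^sub>M x)"
 shows "P x"
proof -
 note s = span_sub[OF assms(2,3)]
 have "sub {x\<in>span M S. P x} M"
  by (rule submodule_crit[OF assms(2)])
   (use assms s in "auto simp: sub_carrier[OF assms(2) s] intro: sub_add sub_smult sub_zero")
 hence "span M S\<subseteq>{x\<in>span M S. P x}"
  by (rule span_least) (use assms in "auto intro: span_incl")
 thus ?thesis using assms(1) by blast
qed

lemma lin_eq_span:
 assumes "lin M N f" "lin M N g" "vs M" "vs N" "S\<subseteq>|M|"
  "!!s. s\<in>S ==> f s = g s" "x\<in>span M S"
 shows "f x = g x"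
 using span_least[OF sub_eq[OF assms(1-4)], of S] assms(5,6,7) by auto

subsection \<open>Complements and functionals\<close>

lemma smult_cancel:
 assumes "vs M" "k\<in>|K|" "x\<in>|M|" "k ~= \<zero>" "k \<odot>\<^sub>M x\<in>H" "sub H M"
 shows "x\<in>H"
proof -
 have u: "k\<in>Units K" using assms field_Units by auto
 hence i: "inv k\<in>|K|" "inv k \<otimes> k = \<one>" by auto
 have "inv k \<odot>\<^sub>M (k \<odot>\<^sub>M x)\<in>H" by (rule sub_smult) (use assms i in auto)
 moreover have "inv k \<odot>\<^sub>M (k \<odot>\<^sub>M x) = x"
  using assms i v_smult_assoc[OF assms(1) i(1) assms(2,3)] by simp
 ultimately show ?thesis by simp
qed

definition line :: "('k, 'm, 'z) module_scheme => 'm => 'm set"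
 where "line M v = {k \<odot>\<^sub>M v | k. k\<in>|K|}"

lemma sub_line: "vs M ==> v\<in>|M| ==> sub (line M v) M"
 by (rule submodule_crit) (auto simp: line_def v_smult_ldistr[symmetric] v_smult_assoc[symmetric] intro: exI[of _ \<zero>])

lemma line_incl: "vs M ==> v\<in>|M| ==> v\<in>line M v"
 unfolding line_def using v_smult_one by (metis (mono_tags, lifting) K.one_closed mem_Collect_eq)

text \<open>By Zorn, take H maximal among the subspaces that contain X and meet U trivially. A
  vector w outside H + U could be adjoined to H: if h + k w lies in U with k nonzero, then k w, and
  hence w, lies in H + U.\<close>

lemma complement_exists:
 assumes M: "vs M" and X: "sub X M" and U: "sub U M" and XU: "X \<inter> U\<subseteq>{0\<^sub>M}"
 obtains H where "sub H M" "X\<subseteq>H" "H \<inter> U\<subseteq>{0\<^sub>M}" "|M|\<subseteq>H <+>\<^sub>M U"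
proof -
 define \<A> where "\<A> = {H. sub H M & X\<subseteq>H & H \<inter> U\<subseteq>{0\<^sub>M}}"
 have ne: "X\<in>\<A>" using X XU by (auto simp: \<A>_def)
 have ch: "\<Union>\<C>\<in>\<A>" if C: "\<C> ~= {}" "subset.chain \<A> \<C>" for \<C>
 proof -
  have CA: "\<C>\<subseteq>\<A>" and lin: "!!A B. A\<in>\<C> ==> B\<in>\<C> ==> A\<subseteq>B \<or> B\<subseteq>A"
   using C(2) by (auto simp: subset.chain_def)
  have "sub (\<Union>\<C>) M"
  proof (rule submodule_crit[OF M])
   show "\<Union>\<C>\<subseteq>|M|" using CA by (auto simp: \<A>_def sub_carrier[OF M])
   show "0\<^sub>M\<in>\<Union>\<C>" using CA C(1) sub_zero[OF M] by (fastforce simp: \<A>_def)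
   fix x y assume "x\<in>\<Union>\<C>" "y\<in>\<Union>\<C>"
   then obtain A B where AB: "A\<in>\<C>" "B\<in>\<C>" "x\<in>A" "y\<in>B" by auto
   then obtain D where "D\<in>\<C>" "x\<in>D" "y\<in>D" using lin[of A B] by auto
   thus "x +\<^sub>M y\<in>\<Union>\<C>" using CA by (auto simp: \<A>_def intro!: bexI[of _ D] sub_add[OF M])
  next
   fix k x assume "k\<in>|K|" "x\<in>\<Union>\<C>"
   thus "k \<odot>\<^sub>M x\<in>\<Union>\<C>" using CA by (auto simp: \<A>_def intro!: bexI sub_smult[OF M])
  qed
  thus ?thesis using C(1) CA by (fastforce simp: \<A>_def)
 qed
 obtain H where H: "H\<in>\<A>" and max: "!!Y. Y\<in>\<A> ==> H\<subseteq>Y ==> Y = H"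
  using subset_Zorn_nonempty[of \<A>] ne ch by blast
 have Hs: "sub H M" "X\<subseteq>H" "H \<inter> U\<subseteq>{0\<^sub>M}" using H by (auto simp: \<A>_def)
 have "w\<in>H <+>\<^sub>M U" if w: "w\<in>|M|" for w
 proof (rule ccontr)
  assume nw: "w \<notin> H <+>\<^sub>M U"
  note L = sub_line[OF M w]
  let ?Y = "H <+>\<^sub>M line M w"
  have Y: "submodule ?Y K M" by (rule sub_sum[OF M Hs(1) L])
  have HY: "H\<subseteq>?Y" using set_add_left[OF M Hs(1) L] by auto
  have "u = 0\<^sub>M" if uY: "u\<in>?Y" and uU: "u\<in>U" for u
  proof -
   obtain h k where hk: "h\<in>H" "k\<in>|K|" "u = h +\<^sub>M k \<odot>\<^sub>M w"
    using uY unfolding set_add_iff line_def by blast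
   have hc: "h\<in>|M|" using sub_carrier[OF M Hs(1) hk(1)] .
   show ?thesis
   proof (cases "k = \<zero>")
    case True
    thus ?thesis using hk hc M w Hs(3) uU by auto
   next
    case False
    have "k \<odot>\<^sub>M w = \<ominus>\<^sub>M h +\<^sub>M u" using hk hc M w by simp
    also have "...\<in>H <+>\<^sub>M U" unfolding set_add_iff using hk(1) uU sub_neg[OF M Hs(1)] by blast
    finally have "w\<in>H <+>\<^sub>M U"
     using smult_cancel[OF M hk(2) w False _ sub_sum[OF M Hs(1) U]] by blast
    thus ?thesis using nw by contradiction
   qed
  qed
  hence "?Y\<in>\<A>" using Y HY Hs by (auto simp: \<A>_def)
  hence "?Y = H" using max HY by blast
  moreover have "w\<in>?Y" using set_add_right[OF M Hs(1) L] line_incl[OF M w] by blast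
  ultimately have "w\<in>H" by simp
  thus False using nw set_add_left[OF M Hs(1) U] by blast
 qed
 thus ?thesis using that[OF Hs] by blast
qed

text \<open>Projection onto U along a complement H that contains X. Having X inside H is what later
  yields functionals vanishing on a prescribed subspace.\<close>

lemma projection_exists:
 assumes M: "vs M" and X: "sub X M" and U: "sub U M" and XU: "X \<inter> U\<subseteq>{0\<^sub>M}"
 obtains p where "lin M M p" "!!x. x\<in>|M| ==> p x\<in>U" "!!u. u\<in>U ==> p u = u"
  "!!x. x\<in>X ==> p x = 0\<^sub>M"
proof -
 obtain H where H: "sub H M" "X\<subseteq>H" "H \<inter> U\<subseteq>{0\<^sub>M}" "|M|\<subseteq>H <+>\<^sub>M U"
  using complement_exists[OF assms] .
 define p where "p x = (THE u. u\<in>U & x -\<^sub>M u\<in>H)" for x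
 have p1: "p x = u" if "u\<in>U" "x -\<^sub>M u\<in>H" "x\<in>|M|" for x u
  unfolding p_def
 proof (rule the_equality)
  fix u' assume u': "u'\<in>U & x -\<^sub>M u'\<in>H"
  have c: "u\<in>|M|" "u'\<in>|M|" using u' that by (auto intro: sub_carrier[OF M U])
  have "(x -\<^sub>M u) -\<^sub>M (x -\<^sub>M u') = u' -\<^sub>M u"
   using c M that(3) by (simp add: a_minus_def v_neg_add v_assoc v_lcomm[of M _ "\<ominus>\<^sub>M x"] v_comm)
  hence "u' -\<^sub>M u\<in>H \<inter> U"
   using sub_minus[OF M H(1) that(2), of "x -\<^sub>M u'"] u' sub_minus[OF M U, of u' u] that(1) by simp
  hence "u' -\<^sub>M u = 0\<^sub>M" using H(3) by blast
  thus "u' = u" using c M by (simp add: v_eq_diff)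
 qed (use that in auto)
 have ex: "\<exists>u. u\<in>U & x -\<^sub>M u\<in>H" if x: "x\<in>|M|" for x
 proof -
  obtain h u where hu: "h\<in>H" "u\<in>U" "x = h +\<^sub>M u" using H(4) x unfolding set_add_iff subset_iff by blast
  hence "x -\<^sub>M u = h" using M sub_carrier[OF M H(1)] sub_carrier[OF M U] by simp
  thus ?thesis using hu by blast
 qed
 have p2: "p x\<in>U & x -\<^sub>M p x\<in>H" if x: "x\<in>|M|" for x
  using ex[OF x] p1 x by auto
 have pc: "p x\<in>|M|" if "x\<in>|M|" for x using p2[OF that] sub_carrier[OF M U] by blast
 have "lin M M p"
 proof (rule k_linearI)
  fix x y assume xy: "x\<in>|M|" "y\<in>|M|"
  have "(x +\<^sub>M y) -\<^sub>M (p x +\<^sub>M p y) = (x -\<^sub>M p x) +\<^sub>M (y -\<^sub>M p y)"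
   using xy pc M by (simp add: a_minus_def v_neg_add v_assoc v_lcomm)
  thus "p (x +\<^sub>M y) = p x +\<^sub>M p y"
   using xy p2 M by (intro p1) (auto intro: sub_add[OF M U] sub_add[OF M H(1)])
 next
  fix k x assume kx: "k\<in>|K|" "x\<in>|M|"
  show "p (k \<odot>\<^sub>M x) = k \<odot>\<^sub>M p x"
   using kx p2 M pc by (intro p1) (auto intro: sub_smult[OF M U] sub_smult[OF M H(1)] simp: v_smult_minus[symmetric])
 qed (rule pc)
 moreover have "p u = u" if "u\<in>U" for u
  using that M sub_carrier[OF M U that] sub_zero[OF M H(1)] by (intro p1) auto
 moreover have "p x = 0\<^sub>M" if "x\<in>X" for x
  using that M H(2) sub_carrier[OF M X that] sub_zero[OF M U] by (intro p1) auto
 ultimately show ?thesis using that p2 by blast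
qed

text \<open>Precompose f with a projection onto X. This is the source of the lifted functionals on B
  and of the injectivity of U \<otimes> V \<rightarrow> M \<otimes> N.\<close>

lemma lin_extension:
 assumes M: "vs M" and N: "vs N" and X: "sub X M" and f: "lin (M\<lparr>carrier := X\<rparr>) N f"
 obtains g where "lin M N g" "!!x. x\<in>X ==> g x = f x"
proof -
 obtain p where p: "lin M M p" "!!x. x\<in>|M| ==> p x\<in>X" "!!u. u\<in>X ==> p u = u"
  using projection_exists[OF M sub_null[OF M] X] by (metis inf_le1)
 have "lin M N (%x. f (p x))"
  using lin_comp[OF lin_corestrict[OF p(1,2)] f] by simp
 thus ?thesis using that p(3) by simp
qed

lemma base_algebra_simps [simp]:
 "|base_algebra K| = |K|" "mult (base_algebra K) = mult K" "one (base_algebra K) = one K"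
 "zero (base_algebra K) = zero K" "add (base_algebra K) = add K" "smult (base_algebra K) = mult K"
 by (simp_all add: base_algebra_def)

lemma base_module [simp]: "vs (base_algebra K)"
proof (rule moduleI)
 show "abelian_group (base_algebra K)"
  by (rule abelian_groupI) (auto simp: K.a_ac intro: K.l_neg)
qed (auto simp: K.l_distr K.r_distr K.m_assoc)

abbreviation fnl :: "('k, 'm, 'z) module_scheme => ('m => 'k) => bool"
 where "fnl M \<phi> \<equiv> lin M (base_algebra K) \<phi>"

lemma fnl_closed: "fnl M \<phi> ==> x\<in>|M| ==> \<phi> x\<in>|K|"
 using lin_closed by fastforce
lemma fnl_add: "fnl M \<phi> ==> x\<in>|M| ==> y\<in>|M| ==> \<phi> (x +\<^sub>M y) = \<phi> x \<oplus> \<phi> y"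
 using lin_add by fastforce
lemma fnl_smult: "fnl M \<phi> ==> k\<in>|K| ==> x\<in>|M| ==> \<phi> (k \<odot>\<^sub>M x) = k \<otimes> \<phi> x"
 using lin_smult by fastforce
lemma fnl_zero: "fnl M \<phi> ==> vs M ==> \<phi> 0\<^sub>M = \<zero>"
 using lin_zero[of M "base_algebra K"] by simp

text \<open>Project onto the line through v along a complement containing X and read off the
  coordinate; v outside X makes this line meet X trivially.\<close>

lemma separation:
 assumes M: "vs M" and X: "sub X M" and v: "v\<in>|M|" "v \<notin> X"
 obtains \<phi> where "fnl M \<phi>" "!!x. x\<in>X ==> \<phi> x = \<zero>" "\<phi> v = \<one>"
proof -
 have vz: "k = \<zero>" if "k\<in>|K|" "k \<odot>\<^sub>M v\<in>X" for k
  using smult_cancel[OF M that(1) v(1) _ that(2) X] v(2) by blast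
 have XL: "X \<inter> line M v\<subseteq>{0\<^sub>M}"
 proof
  fix x assume "x\<in>X \<inter> line M v"
  then obtain k where k: "k\<in>|K|" "k \<odot>\<^sub>M v\<in>X" "x = k \<odot>\<^sub>M v" by (auto simp: line_def)
  show "x\<in>{0\<^sub>M}" using vz[OF k(1,2)] k(3) v(1) M by simp
 qed
 obtain p where p: "lin M M p" "!!x. x\<in>|M| ==> p x\<in>line M v" "!!u. u\<in>line M v ==> p u = u"
  "!!x. x\<in>X ==> p x = 0\<^sub>M"
  using projection_exists[OF M X sub_line[OF M v(1)] XL] by blast
 define \<phi> where "\<phi> x = (THE k. k\<in>|K| & p x = k \<odot>\<^sub>M v)" for x
 have uniq: "k = l" if "k\<in>|K|" "l\<in>|K|" "k \<odot>\<^sub>M v = l \<odot>\<^sub>M v" for k l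
 proof -
  have "(k \<ominus> l) \<odot>\<^sub>M v = 0\<^sub>M"
   using that v M by (simp add: a_minus_def[of K] v_smult_ldistr v_smult_neg)
  hence "k \<ominus> l = \<zero>" using vz[of "k \<ominus> l"] that X M by (simp add: sub_zero)
  moreover have "k = (k \<ominus> l) \<oplus> l" using that by (simp add: a_minus_def K.a_assoc K.l_neg)
  ultimately show ?thesis using that by simp
 qed
 have f1: "\<phi> x = k" if "k\<in>|K|" "p x = k \<odot>\<^sub>M v" for x k
  unfolding \<phi>_def using that uniq by (intro the_equality) auto
 have f2: "\<phi> x\<in>|K| & p x = \<phi> x \<odot>\<^sub>M v" if x: "x\<in>|M|" for x
  using p(2)[OF x] f1 by (auto simp: line_def)
 have "fnl M \<phi>"
 proof (rule k_linearI)
  fix x y assume xy: "x\<in>|M|" "y\<in>|M|"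
  have "p (x +\<^sub>M y) = (\<phi> x \<oplus> \<phi> y) \<odot>\<^sub>M v"
   using f2[OF xy(1)] f2[OF xy(2)] v(1) M lin_add[OF p(1) xy] v_smult_ldistr[OF M _ _ v(1)] by simp
  thus "\<phi> (x +\<^sub>M y) = \<phi> x +\<^sub>(base_algebra K) \<phi> y"
   using f2[OF xy(1)] f2[OF xy(2)] f1 by simp
 next
  fix k x assume xy: "k\<in>|K|" "x\<in>|M|"
  have "p (k \<odot>\<^sub>M x) = (k \<otimes> \<phi> x) \<odot>\<^sub>M v"
   using f2[OF xy(2)] xy(1) v(1) M lin_smult[OF p(1) xy] v_smult_assoc[OF M xy(1) _ v(1)] by simp
  thus "\<phi> (k \<odot>\<^sub>M x) = k \<odot>\<^sub>(base_algebra K) \<phi> x"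
   using f2[OF xy(2)] xy(1) f1 by simp
 qed (use f2 in simp)
 moreover have "\<phi> x = \<zero>" if "x\<in>X" for x using that p(4) v M by (intro f1) auto
 moreover have "\<phi> v = \<one>" using p(3) line_incl[OF M v(1)] v M by (intro f1) auto
 ultimately show ?thesis using that by blast
qed

lemma fnl_zeroI:
 assumes "vs M" "v\<in>|M|" "!!\<phi>. fnl M \<phi> ==> \<phi> v = \<zero>"
 shows "v = 0\<^sub>M"
 using separation[OF assms(1) sub_null[OF assms(1)] assms(2)] assms(3)
 by (metis K.zero_not_one empty_iff insert_iff)

lemma fnl_memI:
 assumes "vs M" "sub X M" "v\<in>|M|" "!!\<phi>. fnl M \<phi> ==> (!!x. x\<in>X ==> \<phi> x = \<zero>) ==> \<phi> v = \<zero>"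
 shows "v\<in>X"
 using separation[OF assms(1,2,3)] assms(4) by (metis K.zero_not_one)

end

text \<open>The constructions on cosets run over all representatives, through
  \<open>the_elem\<close> of an image or a union. Once the value is seen to be constant on the
  coset, this fact and the next extract it.\<close>

lemma image_const: "(!!y. y\<in>S ==> f y = c) ==> x\<in>S ==> f ` S = {c}"
 by auto

lemma UN_const: "(!!y. y\<in>S ==> f y = c) ==> x\<in>S ==> (\<Union>y\<in>S. f y) = c"
 by auto

context base
begin

subsection \<open>Quotients\<close>

lemma sub_asub: "vs M ==> sub H M ==> abelian_subgroup H M"
 by (intro abelian_subgroupI3 additive_subgroup.intro submodule.axioms(1) mod_agrp)

lemma coset_mem:
 assumes "vs M" "sub H M" "x\<in>|M|"
 shows "y\<in>H +>\<^sub>M x \<longleftrightarrow> y\<in>|M| & y -\<^sub>M x\<in>H"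
proof -
 interpret abelian_subgroup H M by (rule sub_asub[OF assms(1,2)])
 show ?thesis using assms(3) a_rcos_module[of x y] a_elemrcos_carrier[of x y] by (auto simp: a_minus_def)
qed

lemma coset_self: "vs M ==> sub H M ==> x\<in>|M| ==> x\<in>H +>\<^sub>M x"
 by (simp add: coset_mem sub_zero)

lemma coset_eq:
 assumes "vs M" "sub H M" "x\<in>|M|" "y\<in>|M|"
 shows "H +>\<^sub>M x = H +>\<^sub>M y \<longleftrightarrow> x -\<^sub>M y\<in>H"
proof -
 interpret abelian_subgroup H M by (rule sub_asub[OF assms(1,2)])
 show ?thesis
  using assms coset_mem[OF assms(1,2,4), of x] a_repr_independence'[of x y] coset_self[OF assms(1,2,3)]
  by (auto)
qed

lemma coset_eq_sub:
 assumes "vs M" "sub H M" "x\<in>|M|"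
 shows "H +>\<^sub>M x = H \<longleftrightarrow> x\<in>H"
proof -
 have "H +>\<^sub>M 0\<^sub>M = H"
  using coset_mem[OF assms(1,2), of "0\<^sub>M"] sub_carrier[OF assms(1,2)] assms(1) by auto
 thus ?thesis using coset_eq[OF assms, of "0\<^sub>M"] assms by simp
qed

lemma coset_zero: "vs M ==> sub H M ==> H +>\<^sub>M 0\<^sub>M = H"
 by (simp add: coset_eq_sub sub_zero)

lemma quot_simps: "|quot M H| = a_rcosets\<^bsub>M\<^esub> H" "zero (quot M H) = H" "add (quot M H) = set_add M"
 "mult (quot M H) = rcoset_mult M H" "one (quot M H) = H +>\<^sub>M 1\<^sub>M"
 by (simp_all add: quot_def)

lemma quot_carrier: "|quot M H| = (%x. H +>\<^sub>M x) ` |M|"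
 by (auto simp: quot_def A_RCOSETS_def')

context
 fixes M :: "('k, 'm, 'z) module_scheme" and H
 assumes M: "vs M" and H: "sub H M"
begin

interpretation H: abelian_subgroup H M by (rule sub_asub[OF M H])

lemma quot_add: "x\<in>|M| ==> y\<in>|M| ==>
  (H +>\<^sub>M x) +\<^sub>(quot M H) (H +>\<^sub>M y) = H +>\<^sub>M (x +\<^sub>M y)"
 by (simp add: quot_simps H.a_rcos_sum)

lemma quot_smult:
 assumes k: "k\<in>|K|" and x: "x\<in>|M|"
 shows "k \<odot>\<^sub>(quot M H) (H +>\<^sub>M x) = H +>\<^sub>M (k \<odot>\<^sub>M x)"
proof -
 have "H +>\<^sub>M (k \<odot>\<^sub>M y) = H +>\<^sub>M (k \<odot>\<^sub>M x)" if "y\<in>H +>\<^sub>M x" for y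
 proof -
  have y: "y\<in>|M|" "y -\<^sub>M x\<in>H" using that coset_mem[OF M H x] by auto
  have "k \<odot>\<^sub>M y -\<^sub>M k \<odot>\<^sub>M x\<in>H"
   using sub_smult[OF M H k y(2)] v_smult_minus[OF M k y(1) x] by simp
  thus ?thesis using coset_eq[OF M H v_smult_closed[OF M k y(1)] v_smult_closed[OF M k x]] by simp
 qed
 hence "(\<Union>y\<in>H +>\<^sub>M x. H +>\<^sub>M (k \<odot>\<^sub>M y)) = H +>\<^sub>M (k \<odot>\<^sub>M x)"
  by (rule UN_const[OF _ coset_self[OF M H x]])
 thus ?thesis by (simp add: quot_def)
qed

lemma quot_cls_lin_aux: "0\<^sub>(quot M H) = H +>\<^sub>M 0\<^sub>M"
 by (simp add: quot_simps coset_zero[OF M H])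

lemma quot_module [simp]: "vs (quot M H)"
proof (rule moduleI)
 show "abelian_group (quot M H)"
 proof (rule abelian_groupI)
  fix X assume "X\<in>|quot M H|"
  then obtain x where x: "X = H +>\<^sub>M x" "x\<in>|M|" by (auto simp: quot_carrier)
  show "\<exists>Y\<in>|quot M H|. Y +\<^sub>(quot M H) X = 0\<^sub>(quot M H)"
   by (rule bexI[of _ "H +>\<^sub>M (\<ominus>\<^sub>M x)"]) (use x M in "auto simp: quot_add quot_carrier quot_cls_lin_aux")
  fix Y assume "Y\<in>|quot M H|"
  then obtain y where y: "Y = H +>\<^sub>M y" "y\<in>|M|" by (auto simp: quot_carrier)
  show "X +\<^sub>(quot M H) Y = Y +\<^sub>(quot M H) X" using x y v_comm[OF M x(2) y(2)] by (simp add: quot_add)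
 qed (auto simp: quot_carrier quot_add quot_cls_lin_aux M v_assoc)
qed (auto simp: quot_carrier quot_add quot_smult M v_smult_ldistr v_smult_rdistr v_smult_assoc)

lemma quot_cls_lin: "lin M (quot M H) (%x. H +>\<^sub>M x)"
 by (rule k_linearI) (auto simp: quot_carrier quot_add quot_smult)

lemma quot_lift_cls:
 assumes f: "lin M P f" and P: "vs P" and z: "!!x. x\<in>H ==> f x = 0\<^sub>P" and x: "x\<in>|M|"
 shows "the_elem (f ` (H +>\<^sub>M x)) = f x"
proof -
 have "f y = f x" if "y\<in>H +>\<^sub>M x" for y
 proof -
  have y: "y\<in>|M|" "y -\<^sub>M x\<in>H" using that coset_mem[OF M H x] by auto
  have "f y -\<^sub>P f x = 0\<^sub>P" using lin_minus[OF f M P y(1) x] z[OF y(2)] by simp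
  thus ?thesis using v_eq_diff[OF P lin_closed[OF f y(1)] lin_closed[OF f x]] by simp
 qed
 hence "f ` (H +>\<^sub>M x) = {f x}" by (rule image_const[OF _ coset_self[OF M H x]])
 thus ?thesis by simp
qed

lemma quot_lift_lin:
 assumes f: "lin M P f" and P: "vs P" and z: "!!x. x\<in>H ==> f x = 0\<^sub>P"
 shows "lin (quot M H) P (%S. the_elem (f ` S))"
 by (rule k_linearI)
  (auto simp: quot_carrier quot_add quot_smult M quot_lift_cls[OF f P z] lin_closed[OF f] lin_add[OF f] lin_smult[OF f])

end

subsection \<open>Free spaces\<close>

lemma free_carrier: "F\<in>|free S| \<longleftrightarrow>
  range F\<subseteq>|K| & finite (support K F) & support K F\<subseteq>S"
 by (simp add: free_space_def)

lemma free_simps: "zero (free S) = (%_. \<zero>)" "F +\<^sub>(free S) G = (%x. F x \<oplus> G x)"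
 "k \<odot>\<^sub>(free S) F = (%x. k \<otimes> F x)"
 by (simp_all add: free_space_def)

lemma free_carrierD: "F\<in>|free S| ==> F x\<in>|K|"
 by (auto simp: free_carrier)

lemma free_add_closed: "F\<in>|free S| ==> G\<in>|free S| ==>
  (%x. F x \<oplus> G x)\<in>|free S|"
proof -
 assume a: "F\<in>|free S|" "G\<in>|free S|"
 have "support K (%x. F x \<oplus> G x)\<subseteq>support K F \<union> support K G"
  by (auto simp: support_def)
 thus ?thesis using a unfolding free_carrier
  by (auto intro: finite_subset[of _ "support K F \<union> support K G"] intro!: K.a_closed)
qed

lemma free_smult_closed: "F\<in>|free S| ==> k\<in>|K| ==>
  (%x. k \<otimes> F x)\<in>|free S|"
proof -
 assume a: "F\<in>|free S|" "k\<in>|K|"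
 have "support K (%x. k \<otimes> F x)\<subseteq>support K F"
  using a by (auto simp: support_def)
 thus ?thesis using a unfolding free_carrier by (auto intro: finite_subset[of _ "support K F"] intro!: K.m_closed)
qed

lemma free_module [simp]: "vs (free S)"
proof (rule moduleI)
 show "abelian_group (free S)"
 proof (rule abelian_groupI)
  fix F assume F: "F\<in>|free S|"
  show "\<exists>G\<in>|free S|. G +\<^sub>(free S) F = 0\<^sub>(free S)"
   by (rule bexI[of _ "%x. (\<ominus> \<one>) \<otimes> F x"])
    (use free_smult_closed[OF F, of "\<ominus> \<one>"] free_carrierD[OF F] in "auto simp: free_simps K.l_minus K.l_neg")
 qed (auto simp: free_simps free_add_closed free_carrierD K.a_ac,
    auto simp: free_carrier support_def)
qed (auto simp: free_simps free_smult_closed free_carrierD K.l_distr K.r_distr K.m_assoc)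

lemma delta_carrier [simp]: "x\<in>S ==> delta K x\<in>|free S|"
 by (auto simp: free_carrier delta_def support_def split: if_splits)

text \<open>Induction on a finite set containing the support, removing one point at a time.\<close>

lemma free_span:
 assumes "F\<in>|free S|"
 shows "F\<in>span (free S) (delta K ` S)"
proof -
 let ?M = "free S"
 have sp: "sub (span ?M (delta K ` S)) ?M" by (rule span_sub) auto
 have "\<forall>F. F\<in>|?M| & support K F\<subseteq>A --> F\<in>span ?M (delta K ` S)" if "finite A" for A
  using that
 proof (induction A rule: finite_induct)
  case empty
  have "F = 0\<^sub>?M" if "support K F\<subseteq>{}" for F using that by (auto simp: support_def free_simps)
  thus ?case using sub_zero[OF free_module sp] by metis
 next
  case (insert a A)
  show ?case
  proof (intro allI impI)
   fix F assume F: "F\<in>|?M| & support K F\<subseteq>insert a A"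
   show "F\<in>span ?M (delta K ` S)"
   proof (cases "F a = \<zero>")
    case True
    thus ?thesis using F insert by (auto simp: support_def subset_iff)
   next
    case False
    hence a: "a\<in>S" using F by (auto simp: free_carrier support_def)
    let ?G = "F(a := \<zero>)"
    have sG: "support K ?G = support K F - {a}" by (auto simp: support_def)
    have G: "?G\<in>|?M|" using F unfolding free_carrier sG by auto
    have "?G\<in>span ?M (delta K ` S)" using insert.IH G F sG by auto
    moreover have "F a \<odot>\<^sub>?M delta K a\<in>span ?M (delta K ` S)"
     using a F by (intro sub_smult[OF free_module sp] span_incl) (auto intro: free_carrierD)
    moreover have "F = F a \<odot>\<^sub>?M delta K a +\<^sub>?M ?G"
     using F by (auto simp: free_simps delta_def fun_eq_iff free_carrierD)
    ultimately show ?thesis using sub_add[OF free_module sp] by metis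
   qed
  qed
 qed
 thus ?thesis using assms by (auto simp: free_carrier)
qed

text \<open>The linear extension of g from the basis to the free space. \<open>tensor_lift\<close>
  and \<open>env_lift\<close> are both the common value of such a map on a coset, so one argument
  serves tensor products and enveloping algebras alike.\<close>

definition fs_lift :: "('k, 'p, 'z) module_scheme => ('x => 'p) => ('x => 'k) => 'p"
 where "fs_lift P g F = (\<Oplus>\<^sub>P w\<in>support K F. F w \<odot>\<^sub>P g w)"

lemma fs_lift_superset:
 assumes "vs P" "!!x. x\<in>S ==> g x\<in>|P|" "F\<in>|free S|" "finite A" "support K F\<subseteq>A" "A\<subseteq>S"
 shows "fs_lift P g F = (\<Oplus>\<^sub>P w\<in>A. F w \<odot>\<^sub>P g w)"
 unfolding fs_lift_def using assms(2)
 by (intro v_finsum_mono[symmetric] assms(1,4,5) v_smult_closed free_carrierD[OF assms(3)])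
  (use assms in "auto simp: support_def free_carrier")

lemma fs_lift_lin:
 assumes P: "vs P" and g: "!!x. x\<in>S ==> g x\<in>|P|"
 shows "lin (free S) P (fs_lift P g)"
proof (rule k_linearI)
 fix F G assume F: "F\<in>|free S|" and G: "G\<in>|free S|"
 let ?A = "support K F \<union> support K G"
 have A: "finite ?A" "?A\<subseteq>S" "support K (F +\<^sub>(free S) G)\<subseteq>?A"
  using F G by (auto simp: free_carrier support_def free_simps)
 have FG: "F +\<^sub>(free S) G\<in>|free S|" using F G by simp
 have "fs_lift P g (F +\<^sub>(free S) G) = (\<Oplus>\<^sub>P w\<in>?A. (F +\<^sub>(free S) G) w \<odot>\<^sub>P g w)"
  by (rule fs_lift_superset[OF P g FG A(1,3,2)])
 also have "... = (\<Oplus>\<^sub>P w\<in>?A. F w \<odot>\<^sub>P g w +\<^sub>P G w \<odot>\<^sub>P g w)"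
 proof (rule v_finsum_cong[OF P])
  fix w assume "w\<in>?A"
  hence w: "g w\<in>|P|" using g A(2) by auto
  show "F w \<odot>\<^sub>P g w +\<^sub>P G w \<odot>\<^sub>P g w\<in>|P|"
   using w P F G by (simp add: free_carrierD[OF F] free_carrierD[OF G])
  show "(F +\<^sub>(free S) G) w \<odot>\<^sub>P g w = F w \<odot>\<^sub>P g w +\<^sub>P G w \<odot>\<^sub>P g w"
   using w P by (simp add: free_simps v_smult_ldistr free_carrierD[OF F] free_carrierD[OF G])
 qed
 also have "... = (\<Oplus>\<^sub>P w\<in>?A. F w \<odot>\<^sub>P g w) +\<^sub>P (\<Oplus>\<^sub>P w\<in>?A. G w \<odot>\<^sub>P g w)"
  using g A(2) by (intro v_finsum_add[OF P] v_smult_closed[OF P] free_carrierD[OF F] free_carrierD[OF G]) auto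
 also have "... = fs_lift P g F +\<^sub>P fs_lift P g G"
  using fs_lift_superset[OF P g F A(1) _ A(2)] fs_lift_superset[OF P g G A(1) _ A(2)] by simp
 finally show "fs_lift P g (F +\<^sub>(free S) G) = fs_lift P g F +\<^sub>P fs_lift P g G" .
next
 fix k F assume k: "k\<in>|K|" and F: "F\<in>|free S|"
 let ?A = "support K F"
 have A: "finite ?A" "?A\<subseteq>S" "support K (k \<odot>\<^sub>(free S) F)\<subseteq>?A"
  using F k by (auto simp: free_carrier support_def free_simps)
 have FG: "k \<odot>\<^sub>(free S) F\<in>|free S|" using F k by simp
 have "fs_lift P g (k \<odot>\<^sub>(free S) F) = (\<Oplus>\<^sub>P w\<in>?A. (k \<odot>\<^sub>(free S) F) w \<odot>\<^sub>P g w)"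
  by (rule fs_lift_superset[OF P g FG A(1,3,2)])
 also have "... = (\<Oplus>\<^sub>P w\<in>?A. k \<odot>\<^sub>P (F w \<odot>\<^sub>P g w))"
  using g A(2) by (intro v_finsum_cong[OF P]) (auto simp: free_simps P k v_smult_assoc free_carrierD[OF F] subset_iff)
 also have "... = k \<odot>\<^sub>P fs_lift P g F"
  unfolding fs_lift_def using g A(1,2) by (intro v_finsum_smult[OF P, symmetric] k v_smult_closed[OF P] free_carrierD[OF F]) auto
 finally show "fs_lift P g (k \<odot>\<^sub>(free S) F) = k \<odot>\<^sub>P fs_lift P g F" .
next
 fix F assume F: "F\<in>|free S|"
 thus "fs_lift P g F\<in>|P|" unfolding fs_lift_def using g
  by (intro v_finsum_closed[OF P] v_smult_closed[OF P] free_carrierD[OF F]) (auto simp: free_carrier)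
qed

lemma fs_lift_delta:
 assumes P: "vs P" and g: "!!x. x\<in>S ==> g x\<in>|P|" and x: "x\<in>S"
 shows "fs_lift P g (delta K x) = g x"
proof -
 have "support K (delta K x) = {x}" by (auto simp: support_def delta_def)
 thus ?thesis unfolding fs_lift_def
  using v_finsum_single[OF P, of "{x}" x "%w. delta K x w \<odot>\<^sub>P g w"] P g[OF x] by (simp add: delta_def)
qed

subsection \<open>Tensor products\<close>

context
 fixes M :: "('k, 'm, 'z) module_scheme" and N :: "('k, 'n, 'y) module_scheme"
 assumes M: "vs M" and N: "vs N"
begin

abbreviation (input) "FMN \<equiv> free (carrier M \<times> carrier N)"

lemma tensor_rel_sub: "sub (tensor_relations K M N) (free (carrier M \<times> carrier N))"
 unfolding tensor_relations_def Let_def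
 by (rule span_sub) (auto simp: M N intro!: v_minus_closed[OF free_module] v_add_closed[OF free_module] v_smult_closed[OF free_module])

lemma tensor_module: "vs (TS M N)"
 unfolding tensor_space_def by (rule quot_module[OF free_module tensor_rel_sub])

lemma tens_rel:
 assumes "F\<in>|FMN|" "G\<in>|FMN|" "F -\<^sub>FMN G\<in>tensor_relations K M N"
 shows "tensor_relations K M N +>\<^sub>FMN F = tensor_relations K M N +>\<^sub>FMN G"
 using assms by (simp add: coset_eq[OF free_module tensor_rel_sub])

lemma tens_bilinear: "bil M N (TS M N) (ts M N)"
proof -
 note c = quot_cls_lin[OF free_module tensor_rel_sub]
 note r = tens_rel tensor_relations_def[unfolded Let_def]
 show ?thesis
 proof (rule k_bilinearI)
  fix x x' y assume a: "x\<in>|M|" "x'\<in>|M|" "y\<in>|N|"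
  have "ts M N (x +\<^sub>M x') y = tensor_relations K M N +>\<^sub>FMN (delta K (x, y) +\<^sub>FMN delta K (x', y))"
   unfolding tens_def by (rule tens_rel)
    (use a M N in "auto simp: tensor_relations_def Let_def intro!: span_incl v_add_closed[OF free_module]")
  thus "ts M N (x +\<^sub>M x') y = ts M N x y +\<^sub>(TS M N) ts M N x' y"
   using a by (simp add: tens_def tensor_space_def lin_add[OF c])
 next
  fix x y y' assume a: "x\<in>|M|" "y\<in>|N|" "y'\<in>|N|"
  have "ts M N x (y +\<^sub>N y') = tensor_relations K M N +>\<^sub>FMN (delta K (x, y) +\<^sub>FMN delta K (x, y'))"
   unfolding tens_def by (rule tens_rel)
    (use a M N in "auto simp: tensor_relations_def Let_def intro!: span_incl v_add_closed[OF free_module]")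
  thus "ts M N x (y +\<^sub>N y') = ts M N x y +\<^sub>(TS M N) ts M N x y'"
   using a by (simp add: tens_def tensor_space_def lin_add[OF c])
 next
  fix k x y assume a: "k\<in>|K|" "x\<in>|M|" "y\<in>|N|"
  have "ts M N (k \<odot>\<^sub>M x) y = tensor_relations K M N +>\<^sub>FMN (k \<odot>\<^sub>FMN delta K (x, y))"
   unfolding tens_def by (rule tens_rel)
    (use a M N in "auto simp: tensor_relations_def Let_def intro!: span_incl v_smult_closed[OF free_module]")
  thus "ts M N (k \<odot>\<^sub>M x) y = k \<odot>\<^sub>(TS M N) ts M N x y"
   using a by (simp add: tens_def tensor_space_def lin_smult[OF c])
  have "ts M N x (k \<odot>\<^sub>N y) = tensor_relations K M N +>\<^sub>FMN (k \<odot>\<^sub>FMN delta K (x, y))"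
   unfolding tens_def by (rule tens_rel)
    (use a M N in "auto simp: tensor_relations_def Let_def intro!: span_incl v_smult_closed[OF free_module]")
  thus "ts M N x (k \<odot>\<^sub>N y) = k \<odot>\<^sub>(TS M N) ts M N x y"
   using a by (simp add: tens_def tensor_space_def lin_smult[OF c])
 qed (use lin_closed[OF c] in "simp add: tens_def tensor_space_def")
qed

lemmas tens_closed = bil_closed[OF tens_bilinear]
lemmas tens_add_l = bil_add_l[OF tens_bilinear]
lemmas tens_add_r = bil_add_r[OF tens_bilinear]
lemmas tens_smult_l = bil_smult_l[OF tens_bilinear]
lemmas tens_smult_r = bil_smult_r[OF tens_bilinear]
lemmas tens_lin_l = bil_left[OF tens_bilinear]
lemmas tens_lin_r = bil_right[OF tens_bilinear]

lemma tens_zero_l: "y\<in>|N| ==> ts M N 0\<^sub>M y = 0\<^sub>(TS M N)"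
 by (rule lin_zero[OF tens_lin_l M tensor_module])
lemma tens_zero_r: "x\<in>|M| ==> ts M N x 0\<^sub>N = 0\<^sub>(TS M N)"
 by (rule lin_zero[OF tens_lin_r N tensor_module])

lemma tensor_span:
 assumes "u\<in>|TS M N|"
 shows "u\<in>span (TS M N) {ts M N x y | x y. x\<in>|M| & y\<in>|N|}" (is "_\<in>span ?T ?S")
proof -
 have S: "?S\<subseteq>|?T|" using tens_closed by auto
 note sp = span_sub[OF tensor_module S]
 note c = quot_cls_lin[OF free_module tensor_rel_sub, folded tensor_space_def]
 obtain F where F: "F\<in>|FMN|" "u = tensor_relations K M N +>\<^sub>FMN F"
  using assms unfolding tensor_space_def quot_carrier by auto
 have "span FMN (delta K ` (carrier M \<times> carrier N))\<subseteq>{F\<in>carrier FMN. tensor_relations K M N +>\<^sub>FMN F\<in>span ?T ?S}"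
  by (rule span_least[OF sub_preimage[OF c free_module tensor_module sp]])
   (auto intro!: span_incl simp: tens_def)
 thus ?thesis using free_span[OF F(1)] F(2) by blast
qed

text \<open>There is no case for scalars, because a scalar can be absorbed into the first factor of
  a pure tensor. To exploit this, the claim is strengthened to all multiples of u.\<close>

lemma tensor_induct [consumes 1, case_names tens add]:
 assumes u: "u\<in>|TS M N|"
  and b: "!!x y. x\<in>|M| ==> y\<in>|N| ==> P (ts M N x y)"
  and a: "!!u v. u\<in>|TS M N| ==> v\<in>|TS M N| ==> P u ==> P v ==>
   P (u +\<^sub>(TS M N) v)"
 shows "P u"
proof -
 let ?T = "TS M N"
 let ?S = "{ts M N x y | x y. x\<in>|M| & y\<in>|N|}"
 have S: "?S\<subseteq>|?T|" using tens_closed by auto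
 note T = tensor_module
 have "u\<in>|?T| & (\<forall>k\<in>carrier K. P (k \<odot>\<^sub>?T u))"
  using tensor_span[OF u] T S
 proof (induction rule: span_induct)
  case zero
  thus ?case using b[of "0\<^sub>M" "0\<^sub>N"] T M N by (simp add: tens_zero_l)
 next
  case (base s)
  then obtain x y where "s = ts M N x y" "x\<in>|M|" "y\<in>|N|" by auto
  thus ?case using b M by (auto simp: tens_smult_l[symmetric] tens_closed)
 next
  case (add x y)
  thus ?case using a T by (simp add: v_smult_rdistr)
 next
  case (smult k x)
  thus ?case using T by (simp add: v_smult_assoc[symmetric])
 qed
 thus ?thesis using T by (metis K.one_closed v_smult_one)
qed

lemma lin_eq_tensor:
 assumes "lin (TS M N) P f" "lin (TS M N) P g"
  "!!x y. x\<in>|M| ==> y\<in>|N| ==> f (ts M N x y) = g (ts M N x y)"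
  "u\<in>|TS M N|"
 shows "f u = g u"
 using assms(4)
 by (induction rule: tensor_induct) (simp_all add: assms(3) lin_add[OF assms(1)] lin_add[OF assms(2)])

lemma tensor_lift_eq: "tlift P f u = the_elem (fs_lift P (%p. f (fst p) (snd p)) ` u)"
 unfolding tensor_lift_def fs_lift_def ..

context
 fixes P :: "('k, 'p, 'x) module_scheme" and f
 assumes P: "vs P" and f: "bil M N P f"
begin

lemma fs_lift_rel:
 assumes "F\<in>tensor_relations K M N"
 shows "fs_lift P (%p. f (fst p) (snd p)) F = 0\<^sub>P"
proof -
 let ?g = "%p. f (fst p) (snd p)"
 have g: "?g x\<in>|P|" if "x\<in>|M| \<times> |N|" for x
  using that bil_closed[OF f] by auto
 note l = fs_lift_lin[of P "|M| \<times> |N|" ?g, OF P g]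
  and d = fs_lift_delta[of P "|M| \<times> |N|" ?g, OF P g]
 have ld: "fs_lift P ?g (delta K (x, y)) = f x y" if "x\<in>|M|" "y\<in>|N|" for x y
  using d[of "(x, y)"] that by simp
 have "tensor_relations K M N\<subseteq>{F\<in>carrier FMN. fs_lift P ?g F\<in>{0\<^sub>P}}"
  unfolding tensor_relations_def Let_def
  by (rule span_least[OF sub_preimage[OF l free_module P sub_null[OF P]]])
   (auto simp: M N P ld lin_minus[OF l free_module P] lin_add[OF l] lin_smult[OF l] bil_add_l[OF f] bil_add_r[OF f] bil_smult_l[OF f]
    bil_smult_r[OF f] bil_closed[OF f])
 thus ?thesis using assms by auto
qed

lemma tensor_lift_lin: "lin (TS M N) P (tlift P f)"
 unfolding tensor_space_def tensor_lift_eq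
 by (rule quot_lift_lin[OF free_module tensor_rel_sub fs_lift_lin[OF P] P fs_lift_rel]) (use bil_closed[OF f] in auto)

lemma tensor_lift_tens: "x\<in>|M| ==> y\<in>|N| ==> tlift P f (ts M N x y) = f x y"
proof -
 assume xy: "x\<in>|M|" "y\<in>|N|"
 have g: "(%p. f (fst p) (snd p)) q\<in>|P|" if "q\<in>|M| \<times> |N|" for q
  using that bil_closed[OF f] by auto
 have "the_elem (fs_lift P (%p. f (fst p) (snd p)) ` (tensor_relations K M N +>\<^sub>FMN delta K (x, y))) =
  fs_lift P (%p. f (fst p) (snd p)) (delta K (x, y))"
  by (rule quot_lift_cls[OF free_module tensor_rel_sub fs_lift_lin[OF P g] P fs_lift_rel]) (use xy in auto)
 thus ?thesis unfolding tens_def tensor_lift_eq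
  using fs_lift_delta[of P "|M| \<times> |N|" "%p. f (fst p) (snd p)" "(x, y)", OF P g] xy by simp
qed

end
end

end

text \<open>A tensor space sees only carrier, addition and scalars of the two records. This
  identifies tensors over \<open>gr_alg K B\<close> with those over \<open>gr K B\<close>, and
  tensors over the record of kG with those over a mere subspace of C.\<close>

lemma tensor_space_cong:
 assumes "|M| = |M'|" "add M = add M'" "smult M = smult M'"
  "|N| = |N'|" "add N = add N'" "smult N = smult N'"
 shows "tensor_space K M N = tensor_space K M' N'" "tens K M N = tens K M' N'"
 using assms by (simp_all add: tensor_space_def tensor_relations_def Let_def tens_def fun_eq_iff)

context base
begin

lemma tensor_lift_cong:
 assumes "vs M" "vs N" "vs P" "bil M N P f" "bil M N P g"
  "!!x y. x\<in>|M| ==> y\<in>|N| ==> f x y = g x y" "u\<in>|TS M N|"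
 shows "tlift P f u = tlift P g u"
 by (rule lin_eq_tensor[OF assms(1,2) tensor_lift_lin tensor_lift_lin _ assms(7)])
  (use assms in "simp_all add: tensor_lift_tens")

lemma lin_tensor_lift:
 assumes "vs M" "vs N" "vs P" "vs Q" "bil M N P f" "lin P Q g"
  "u\<in>|TS M N|"
 shows "g (tlift P f u) = tlift Q (%x y. g (f x y)) u"
proof (rule lin_eq_tensor[OF assms(1,2) _ _ _ assms(7)])
 note b = bil_post[OF assms(5,6)]
 show "lin (TS M N) Q (%u. g (tlift P f u))"
  by (rule lin_comp[OF tensor_lift_lin[OF assms(1,2,3,5)] assms(6)])
 show "lin (TS M N) Q (tlift Q (%x y. g (f x y)))"
  by (rule tensor_lift_lin[OF assms(1,2,4) b])
 show "g (tlift P f (ts M N x y)) = tlift Q (%x y. g (f x y)) (ts M N x y)"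
  if "x\<in>|M|" "y\<in>|N|" for x y
  using that by (simp add: tensor_lift_tens[OF assms(1,2,3,5)] tensor_lift_tens[OF assms(1,2,4) b])
qed

lemma tensor_lift_closed:
 assumes "vs M" "vs N" "vs P" "bil M N P f" "u\<in>|TS M N|"
 shows "tlift P f u\<in>|P|"
 by (rule lin_closed[OF tensor_lift_lin[OF assms(1-4)] assms(5)])

lemma tensor_map_bil:
 assumes "vs M'" "vs N'" "lin M M' f" "lin N N' g"
 shows "bil M N (TS M' N') (%x y. ts M' N' (f x) (g y))"
 by (rule bil_comp[OF tens_bilinear[OF assms(1,2)] assms(3,4)])

lemma tensor_map_lin:
 assumes "vs M" "vs N" "vs M'" "vs N'" "lin M M' f" "lin N N' g"
 shows "lin (TS M N) (TS M' N') (tmap M' N' f g)"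
 unfolding tensor_map_def
 by (rule tensor_lift_lin[OF assms(1,2) tensor_module[OF assms(3,4)] tensor_map_bil[OF assms(3-6)]])

lemma tensor_map_tens:
 assumes "vs M" "vs N" "vs M'" "vs N'" "lin M M' f" "lin N N' g"
  "x\<in>|M|" "y\<in>|N|"
 shows "tmap M' N' f g (ts M N x y) = ts M' N' (f x) (g y)"
 unfolding tensor_map_def
 by (rule tensor_lift_tens[OF assms(1,2) tensor_module[OF assms(3,4)] tensor_map_bil[OF assms(3-6)] assms(7,8)])

subsection \<open>Slices and subspaces of tensor products\<close>

text \<open>The contraction \<phi> \<otimes> id on M \<otimes> N, with k \<otimes> N read as N;
  \<open>rsl\<close> contracts the other leg.\<close>

definition lsl :: "('k, 'n, 'y) module_scheme => ('m => 'k) => ('m \<times> 'n => 'k) set => 'n"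
 where "lsl N \<phi> = tlift N (%a b. \<phi> a \<odot>\<^sub>N b)"

definition rsl :: "('k, 'm, 'z) module_scheme => ('n => 'k) => ('m \<times> 'n => 'k) set => 'm"
 where "rsl M \<psi> = tlift M (%a b. \<psi> b \<odot>\<^sub>M a)"

context
 fixes M :: "('k, 'm, 'z) module_scheme" and N :: "('k, 'n, 'y) module_scheme"
 assumes M: "vs M" and N: "vs N"
begin

lemma lsl_bil: assumes "fnl M \<phi>" shows "bil M N N (%a b. \<phi> a \<odot>\<^sub>N b)"
 by (rule k_bilinearI) (auto simp: N fnl_closed[OF assms] fnl_add[OF assms] fnl_smult[OF assms] v_smult_ldistr
   v_smult_rdistr v_smult_assoc[symmetric] K.m_comm)

lemma rsl_bil: assumes "fnl N \<psi>" shows "bil M N M (%a b. \<psi> b \<odot>\<^sub>M a)"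
 by (rule k_bilinearI) (auto simp: M fnl_closed[OF assms] fnl_add[OF assms] fnl_smult[OF assms] v_smult_ldistr
   v_smult_rdistr v_smult_assoc[symmetric] K.m_comm)

lemma lsl_lin: "fnl M \<phi> ==> lin (TS M N) N (lsl N \<phi>)"
 unfolding lsl_def by (rule tensor_lift_lin[OF M N N lsl_bil])

lemma rsl_lin: "fnl N \<psi> ==> lin (TS M N) M (rsl M \<psi>)"
 unfolding rsl_def by (rule tensor_lift_lin[OF M N M rsl_bil])

lemma lsl_tens: "fnl M \<phi> ==> x\<in>|M| ==> y\<in>|N| ==> lsl N \<phi> (ts M N x y) = \<phi> x \<odot>\<^sub>N y"
 unfolding lsl_def by (rule tensor_lift_tens[OF M N N lsl_bil])

lemma rsl_tens: "fnl N \<psi> ==> x\<in>|M| ==> y\<in>|N| ==> rsl M \<psi> (ts M N x y) = \<psi> y \<odot>\<^sub>M x"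
 unfolding rsl_def by (rule tensor_lift_tens[OF M N M rsl_bil])

lemma lsl_rsl:
 assumes f: "fnl M \<phi>" and g: "fnl N \<psi>" and u: "u\<in>|TS M N|"
 shows "\<psi> (lsl N \<phi> u) = \<phi> (rsl M \<psi> u)"
proof (rule lin_eq_tensor[OF M N lin_comp[OF lsl_lin[OF f] g] lin_comp[OF rsl_lin[OF g] f] _ u])
 fix x y assume "x\<in>|M|" "y\<in>|N|"
 thus "\<psi> (lsl N \<phi> (ts M N x y)) = \<phi> (rsl M \<psi> (ts M N x y))"
  using f g by (simp add: lsl_tens rsl_tens fnl_smult fnl_closed K.m_comm)
qed

lemma tensor_sub_subset:
 assumes "sub U M" "sub V N"
 shows "{ts M N x y | x y. x\<in>U & y\<in>V}\<subseteq>|TS M N|"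
 using tens_closed[OF M N] sub_carrier[OF M assms(1)] sub_carrier[OF N assms(2)] by auto

lemma tensor_sub_sub:
 assumes "sub U M" "sub V N"
 shows "sub (tsub M N U V) (TS M N)"
 unfolding tensor_sub_def by (rule span_sub[OF tensor_module[OF M N] tensor_sub_subset[OF assms]])

lemma tensor_sub_carrier:
 assumes "sub U M" "sub V N" "u\<in>tsub M N U V"
 shows "u\<in>|TS M N|"
 by (rule sub_carrier[OF tensor_module[OF M N] tensor_sub_sub[OF assms(1,2)] assms(3)])

lemma tensor_sub_tens: "x\<in>U ==> y\<in>V ==> ts M N x y\<in>tsub M N U V"
 unfolding tensor_sub_def by (rule span_incl) auto

lemma tensor_sub_mono: "U\<subseteq>U' ==> V\<subseteq>V' ==> tsub M N U V\<subseteq>tsub M N U' V'"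
 unfolding tensor_sub_def by (rule span_mono) auto

lemma tensor_sub_least:
 assumes "sub X (TS M N)" "!!x y. x\<in>U ==> y\<in>V ==> ts M N x y\<in>X"
 shows "tsub M N U V\<subseteq>X"
 unfolding tensor_sub_def by (rule span_least[OF assms(1)]) (use assms(2) in auto)

lemma tensor_sub_full: "tsub M N (carrier M) (carrier N) = |TS M N|"
 using tensor_span[OF M N] tensor_sub_carrier[OF sub_full[OF M] sub_full[OF N]] unfolding tensor_sub_def by blast

lemma tensor_sub_null_l: "sub V N ==> tsub M N {0\<^sub>M} V = {0\<^sub>(TS M N)}"
proof -
 assume V: "sub V N"
 have "tsub M N {0\<^sub>M} V\<subseteq>{0\<^sub>(TS M N)}"
  by (rule tensor_sub_least[OF sub_null[OF tensor_module[OF M N]]]) (auto simp: tens_zero_l[OF M N] sub_carrier[OF N V])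
 thus ?thesis using sub_zero[OF tensor_module[OF M N] tensor_sub_sub[OF sub_null[OF M] V]] by auto
qed

lemma tensor_sub_null_r: "sub U M ==> tsub M N U {0\<^sub>N} = {0\<^sub>(TS M N)}"
proof -
 assume V: "sub U M"
 have "tsub M N U {0\<^sub>N}\<subseteq>{0\<^sub>(TS M N)}"
  by (rule tensor_sub_least[OF sub_null[OF tensor_module[OF M N]]]) (auto simp: tens_zero_r[OF M N] sub_carrier[OF M V])
 thus ?thesis using sub_zero[OF tensor_module[OF M N] tensor_sub_sub[OF V sub_null[OF N]]] by auto
qed

lemma lsl_sub:
 assumes \<phi>: "fnl M \<phi>" and U: "sub U M" and V: "sub V N" and u: "u\<in>tsub M N U V"
  and H: "sub H N" "!!x y. x\<in>U ==> y\<in>V ==> \<phi> x \<odot>\<^sub>N y\<in>H"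
 shows "lsl N \<phi> u\<in>H"
proof -
 have "tsub M N U V\<subseteq>{u\<in>|TS M N|. lsl N \<phi> u\<in>H}"
  by (rule tensor_sub_least[OF sub_preimage[OF lsl_lin[OF \<phi>] tensor_module[OF M N] N H(1)]])
   (use H(2) sub_carrier[OF M U] sub_carrier[OF N V] in "auto simp: lsl_tens[OF \<phi>] tens_closed[OF M N]")
 thus ?thesis using u by blast
qed

lemma rsl_sub:
 assumes \<psi>: "fnl N \<psi>" and U: "sub U M" and V: "sub V N" and u: "u\<in>tsub M N U V"
  and H: "sub H M" "!!x y. x\<in>U ==> y\<in>V ==> \<psi> y \<odot>\<^sub>M x\<in>H"
 shows "rsl M \<psi> u\<in>H"
proof -
 have "tsub M N U V\<subseteq>{u\<in>|TS M N|. rsl M \<psi> u\<in>H}"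
  by (rule tensor_sub_least[OF sub_preimage[OF rsl_lin[OF \<psi>] tensor_module[OF M N] M H(1)]])
   (use H(2) sub_carrier[OF M U] sub_carrier[OF N V] in "auto simp: rsl_tens[OF \<psi>] tens_closed[OF M N]")
 thus ?thesis using u by blast
qed

text \<open>Indexing the summands by the vectors h of S themselves lets terms with the same second
  leg be merged, so a sum of two such forms has this form again. S may be linearly dependent, so the
  coefficients are not unique in general.\<close>

lemma tensor_normal_form:
 assumes S: "S\<subseteq>|N|" and U: "sub U M" and u: "u\<in>tsub M N U (span N S)"
 shows "\<exists>H c. finite H & H\<subseteq>S & (\<forall>h. c h\<in>U) & u = (\<Oplus>\<^sub>(TS M N) h\<in>H. ts M N (c h) h)"
proof -
 let ?T = "TS M N"
 note T = tensor_module[OF M N]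
 define Q where "Q u \<longleftrightarrow> (\<exists>H c. finite H & H\<subseteq>S & (\<forall>h. c h\<in>U) & u = (\<Oplus>\<^sub>?T h\<in>H. ts M N (c h) h))" for u
 note Uc = sub_carrier[OF M U]
 have tc: "ts M N (c h) h\<in>|?T|" if "h\<in>H" "H\<subseteq>S" "\<forall>h. c h\<in>U" for c h H
  using that S Uc by (intro tens_closed[OF M N]) auto
 have Qc: "u\<in>|?T|" if "Q u" for u using that tc T unfolding Q_def by (auto intro!: v_finsum_closed)
 have Q0: "Q 0\<^sub>?T" unfolding Q_def
  by (rule exI[of _ "{}"], rule exI[of _ "%_. 0\<^sub>M"]) (use T sub_zero[OF M U] in simp)
 have Qa: "Q (u +\<^sub>?T v)" if "Q u" "Q v" for u v
 proof -
  obtain H c where u: "finite H" "H\<subseteq>S" "\<forall>h. c h\<in>U" "u = (\<Oplus>\<^sub>?T h\<in>H. ts M N (c h) h)"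
   using \<open>Q u\<close> unfolding Q_def by blast
  obtain J d where v: "finite J" "J\<subseteq>S" "\<forall>h. d h\<in>U" "v = (\<Oplus>\<^sub>?T h\<in>J. ts M N (d h) h)"
   using \<open>Q v\<close> unfolding Q_def by blast
  \<comment> \<open>Both coefficient functions are extended by zero to the union of the index
    sets.\<close>
  let ?c = "%h. if h\<in>H then c h else 0\<^sub>M" and ?d = "%h. if h\<in>J then d h else 0\<^sub>M"
  have cU: "\<forall>h. ?c h\<in>U" "\<forall>h. ?d h\<in>U" using u v sub_zero[OF M U] by auto
  have HJ: "finite (H \<union> J)" "H \<union> J\<subseteq>S" using u v by auto
  have "(\<Oplus>\<^sub>?T h\<in>H \<union> J. ts M N (?c h) h) = (\<Oplus>\<^sub>?T h\<in>H. ts M N (?c h) h)"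
   using u v S Uc by (intro v_finsum_mono[OF T]) (auto simp: tens_zero_l[OF M N] tens_closed[OF M N] subset_iff)
  also have "... = u" unfolding u(4) using tc[OF _ u(2,3)] by (intro v_finsum_cong[OF T]) auto
  finally have 1: "u = (\<Oplus>\<^sub>?T h\<in>H \<union> J. ts M N (?c h) h)" by simp
  have "(\<Oplus>\<^sub>?T h\<in>H \<union> J. ts M N (?d h) h) = (\<Oplus>\<^sub>?T h\<in>J. ts M N (?d h) h)"
   using u v S Uc by (intro v_finsum_mono[OF T]) (auto simp: tens_zero_l[OF M N] tens_closed[OF M N] subset_iff)
  also have "... = v" unfolding v(4) using tc[OF _ v(2,3)] by (intro v_finsum_cong[OF T]) auto
  finally have 2: "v = (\<Oplus>\<^sub>?T h\<in>H \<union> J. ts M N (?d h) h)" by simp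
  have "u +\<^sub>?T v = (\<Oplus>\<^sub>?T h\<in>H \<union> J. ts M N (?c h) h +\<^sub>?T ts M N (?d h) h)"
   unfolding 1 2 by (rule v_finsum_add[OF T, symmetric]) (use tc[OF _ HJ(2) cU(1)] tc[OF _ HJ(2) cU(2)] in auto)
  also have "... = (\<Oplus>\<^sub>?T h\<in>H \<union> J. ts M N (?c h +\<^sub>M ?d h) h)"
  proof (rule v_finsum_cong[OF T])
   fix h assume h: "h\<in>H \<union> J"
   have cc: "?c h\<in>|M|" "?d h\<in>|M|" "h\<in>|N|" using cU Uc h HJ(2) S by blast+
   show "ts M N (?c h +\<^sub>M ?d h) h\<in>|?T|"
    by (rule tens_closed[OF M N v_add_closed[OF M cc(1,2)] cc(3)])
   show "ts M N (?c h) h +\<^sub>?T ts M N (?d h) h = ts M N (?c h +\<^sub>M ?d h) h"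
    by (rule tens_add_l[OF M N cc, symmetric])
  qed
  finally show ?thesis unfolding Q_def
   using HJ cU sub_add[OF M U] by (intro exI[of _ "H \<union> J"] exI[of _ "%h. ?c h +\<^sub>M ?d h"]) blast
 qed
 have Qs: "Q (k \<odot>\<^sub>?T u)" if "k\<in>|K|" "Q u" for k u
 proof -
  obtain H c where u: "finite H" "H\<subseteq>S" "\<forall>h. c h\<in>U" "u = (\<Oplus>\<^sub>?T h\<in>H. ts M N (c h) h)"
   using \<open>Q u\<close> unfolding Q_def by blast
  have "k \<odot>\<^sub>?T u = (\<Oplus>\<^sub>?T h\<in>H. k \<odot>\<^sub>?T ts M N (c h) h)"
   unfolding u(4) using tc[OF _ u(2,3)] by (intro v_finsum_smult[OF T u(1) that(1)]) auto
  also have "... = (\<Oplus>\<^sub>?T h\<in>H. ts M N (k \<odot>\<^sub>M c h) h)"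
   using u S Uc that(1) by (intro v_finsum_cong[OF T]) (auto simp: M T tens_smult_l[OF M N] tens_closed[OF M N] subset_iff)
  finally show ?thesis unfolding Q_def
   using u sub_smult[OF M U that(1)] by (intro exI[of _ H] exI[of _ "%h. k \<odot>\<^sub>M c h"]) auto
 qed
 have Qb: "Q (ts M N x s)" if x: "x\<in>U" and s: "s\<in>span N S" for x s
  using s N S
 proof (induction rule: span_induct)
  case zero
  thus ?case using Q0 Uc[OF x] by (simp add: tens_zero_r[OF M N])
 next
  case (base s)
  hence "ts M N x s = (\<Oplus>\<^sub>?T h\<in>{s}. ts M N x h)"
   using S Uc[OF x] by (intro v_finsum_single[OF T, symmetric]) (auto intro: tens_closed[OF M N])
  thus ?case unfolding Q_def using base x
   by (intro exI[of _ "{s}"] exI[of _ "%_. x"]) simp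
 next
  case (add a b)
  thus ?case using Qa Uc[OF x] sub_carrier[OF N span_sub[OF N S]] by (simp add: tens_add_r[OF M N])
 next
  case (smult k a)
  thus ?case using Qs Uc[OF x] sub_carrier[OF N span_sub[OF N S]] by (simp add: tens_smult_r[OF M N])
 qed
 have "sub {u. Q u} ?T" by (rule submodule_crit[OF T]) (use Qc Q0 Qa Qs in auto)
 hence "tsub M N U (span N S)\<subseteq>{u. Q u}" by (rule tensor_sub_least) (use Qb in auto)
 thus ?thesis using u unfolding Q_def by blast
qed

lemma tensor_zeroI:
 assumes u: "u\<in>|TS M N|" and z: "!!\<phi>. fnl M \<phi> ==> lsl N \<phi> u = 0\<^sub>N"
 shows "u = 0\<^sub>(TS M N)"
proof -
 note T = tensor_module[OF M N]
 note full = sub_full[OF M]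
 have nf: "\<exists>H c. finite H & H\<subseteq>S & (\<forall>h. c h\<in>carrier M) & u = (\<Oplus>\<^sub>(TS M N) h\<in>H. ts M N (c h) h)"
  if "S\<subseteq>|N|" "u\<in>tsub M N (carrier M) (span N S)" for S
  by (rule tensor_normal_form[OF that(1) full that(2)])
 define Q where "Q n \<longleftrightarrow> (\<exists>H\<subseteq>carrier N. finite H & card H = n & u\<in>tsub M N (carrier M) (span N H))" for n
 have "u\<in>tsub M N (carrier M) (span N (carrier N))"
  using u tensor_sub_mono[OF subset_refl subsetI[OF span_incl]] tensor_sub_full by blast
 from nf[OF subset_refl this] obtain H c where H: "finite H" "H\<subseteq>|N|" "\<forall>h. c h\<in>|M|" "u = (\<Oplus>\<^sub>(TS M N) h\<in>H. ts M N (c h) h)" by blast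
 have "ts M N (c h) h\<in>tsub M N (carrier M) (span N H)" if "h\<in>H" for h
  using that H(3) by (intro tensor_sub_tens span_incl) auto
 hence "u\<in>tsub M N (carrier M) (span N H)"
  unfolding H(4) by (rule sub_finsum[OF T tensor_sub_sub[OF full span_sub[OF N H(2)]]])
 hence "Q (card H)" unfolding Q_def using H(1,2) by blast
 hence "Q 0"
 proof (induction "card H" arbitrary: H rule: less_induct)
  case less
  then obtain J where J: "J\<subseteq>|N|" "finite J" "card J = card H" "u\<in>tsub M N (carrier M) (span N J)"
   unfolding Q_def by blast
  obtain H' c where H: "finite H'" "H'\<subseteq>J" "\<forall>h. c h\<in>|M|" "u = (\<Oplus>\<^sub>(TS M N) h\<in>H'. ts M N (c h) h)"
   using nf[OF J(1,4)] by blast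
  show ?case
  proof (cases "H' = {}")
   case True
   hence "u\<in>tsub M N (carrier M) (span N {})"
    using H(4) T sub_zero[OF T tensor_sub_sub[OF full span_sub[OF N]]] by simp
   thus ?thesis unfolding Q_def by (intro exI[of _ "{}"]) auto
  next
   case False
   then obtain h where h: "h\<in>H'" by blast
   let ?D = "H' - {h}" and ?Z = "tsub M N (carrier M) (span N (H' - {h}))"
   have c: "H'\<subseteq>|N|" "h\<in>|N|" "?D\<subseteq>|N|" using H J h by auto
   note D = span_sub[OF N c(3)]
   note Z = tensor_sub_sub[OF full D]
   have tc: "ts M N (c x) x\<in>|TS M N|" if "x\<in>H'" for x
    using that H c tens_closed[OF M N] by blast
   have "ts M N (c h) h\<in>?Z"
   proof (cases "h\<in>span N ?D")
    case True
    thus ?thesis using H by (intro tensor_sub_tens) auto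
   next
    case False
    then obtain \<psi> where \<psi>: "fnl N \<psi>" "!!x. x\<in>span N ?D ==> \<psi> x = \<zero>" "\<psi> h = \<one>"
     using separation[OF N D c(2)] by blast
    have e: "rsl M \<psi> (ts M N (c x) x) = (if x = h then c h else 0\<^sub>M)" if "x\<in>H'" for x
     using that H(3) c M \<psi>(2)[OF span_incl, of x] \<psi>(3) by (auto simp: rsl_tens[OF \<psi>(1)])
    have "rsl M \<psi> u = (\<Oplus>\<^sub>M x\<in>H'. rsl M \<psi> (ts M N (c x) x))"
     unfolding H(4) by (rule lin_finsum[OF rsl_lin[OF \<psi>(1)] T M H(1) tc])
    also have "... = rsl M \<psi> (ts M N (c h) h)"
     using e h H by (intro v_finsum_single[OF M]) auto
    finally have r: "rsl M \<psi> u = c h" using e[OF h] by simp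
    have "\<phi> (c h) = \<zero>" if "fnl M \<phi>" for \<phi>
     using lsl_rsl[OF that \<psi>(1) u] z[OF that] fnl_zero[OF \<psi>(1) N] r by simp
    hence "c h = 0\<^sub>M" using fnl_zeroI[OF M, of "c h"] H(3) by blast
    thus ?thesis using sub_zero[OF T Z] tens_zero_l[OF M N c(2)] by simp
   qed
   hence "ts M N (c x) x\<in>?Z" if "x\<in>H'" for x
    using that H(3) by (cases "x = h") (auto intro!: tensor_sub_tens span_incl)
   hence "u\<in>?Z" unfolding H(4) by (rule sub_finsum[OF T Z])
   hence "Q (card ?D)" unfolding Q_def using c(3) H(1) by blast
   moreover have "card ?D < card H"
    using card_Diff1_less[OF H(1) h] card_mono[OF J(2) H(2)] J(3) by simp
   ultimately show ?thesis using less.hyps by blast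
  qed
 qed
 hence "u\<in>tsub M N (carrier M) (span N {})" by (auto simp: Q_def)
 thus ?thesis using nf[of "{}"] T by auto
qed

lemma lsl_endo:
 assumes f: "lin M M f" and g: "lin N N g" and \<phi>: "fnl M \<phi>" and u: "u\<in>|TS M N|"
 shows "lsl N \<phi> (tmap M N f g u) = g (lsl N (%x. \<phi> (f x)) u)"
proof (rule lin_eq_tensor[OF M N lin_comp[OF tensor_map_lin[OF M N M N f g] lsl_lin[OF \<phi>]]
   lin_comp[OF lsl_lin[OF lin_comp[OF f \<phi>]] g] _ u])
 fix x y assume xy: "x\<in>|M|" "y\<in>|N|"
 thus "lsl N \<phi> (tmap M N f g (ts M N x y)) = g (lsl N (%x. \<phi> (f x)) (ts M N x y))"
  by (simp add: tensor_map_tens[OF M N M N f g] lsl_tens[OF \<phi>] lsl_tens[OF lin_comp[OF f \<phi>]]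
   lin_closed[OF f] lin_closed[OF g] lin_smult[OF g] fnl_closed[OF \<phi>])
qed

lemma tensor_sub_endo:
 assumes f: "lin M M f" and g: "lin N N g" and U: "sub U M" "sub V N"
  and X: "sub X M" "sub Y N"
  and fg: "!!x. x\<in>U ==> f x\<in>X" "!!y. y\<in>V ==> g y\<in>Y" and u: "u\<in>tsub M N U V"
 shows "tmap M N f g u\<in>tsub M N X Y"
proof -
 note T = tensor_module[OF M N]
 have "tsub M N U V\<subseteq>{u\<in>|TS M N|. tmap M N f g u\<in>tsub M N X Y}"
  by (rule tensor_sub_least[OF sub_preimage[OF tensor_map_lin[OF M N M N f g] T T tensor_sub_sub[OF X]]])
   (use fg U in \<open>auto simp: tensor_map_tens[OF M N M N f g] sub_carrier[OF M U(1)] sub_carrier[OF N U(2)]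
    intro!: tens_closed[OF M N] tensor_sub_tens\<close>)
 thus ?thesis using u by blast
qed

text \<open>With projections p onto X and q onto Y and d = id - p, the point is that u = (p
  \<otimes> id) u + (d \<otimes> q) u. Slicing by \<phi> reduces this to the slice of u by \<phi>
  after d: that functional kills X, so its slice lies in Y and is fixed by q.\<close>

theorem tensor_criterion:
 assumes F: "sub F M" and G: "sub G N" and X: "sub X M" "X\<subseteq>F" and Y: "sub Y N"
  and u: "u\<in>tsub M N F G"
  and c: "!!\<phi>. fnl M \<phi> ==> (!!x. x\<in>X ==> \<phi> x = \<zero>) ==> lsl N \<phi> u\<in>Y"
 shows "u\<in>tsub M N X G <+>\<^sub>(TS M N) tsub M N F Y"
proof -
 let ?T = "TS M N"
 note T = tensor_module[OF M N]
 have id: "lin L L (%x. x)" for L :: "('k, 'l, 'w) module_scheme" by (rule lin_id) auto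
 note uc = tensor_sub_carrier[OF F G u]
 obtain p where p: "lin M M p" "!!x. x\<in>|M| ==> p x\<in>X" "!!x. x\<in>X ==> p x = x"
  using projection_exists[OF M sub_null[OF M] X(1)] by (metis inf_le1)
 obtain q where q: "lin N N q" "!!x. x\<in>|N| ==> q x\<in>Y" "!!x. x\<in>Y ==> q x = x"
  using projection_exists[OF N sub_null[OF N] Y] by (metis inf_le1)
 define d where "d x = x -\<^sub>M p x" for x
 have d: "lin M M d" unfolding d_def by (rule lin_diff[OF M id p(1)])
 have dF: "d x\<in>F" if "x\<in>F" for x
  unfolding d_def using that X(2) p(2) sub_carrier[OF M F] by (intro sub_minus[OF M F]) auto
 have dX: "d x = 0\<^sub>M" if "x\<in>X" for x using p(3) that M sub_carrier[OF M X(1)] by (simp add: d_def)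
 let ?a = "tmap M N p (%x. x) u" and ?b = "tmap M N d q u"
 have a: "?a\<in>tsub M N X G"
  by (rule tensor_sub_endo[OF p(1) id F G X(1) G _ _ u]) (use p(2) sub_carrier[OF M F] in auto)
 have b: "?b\<in>tsub M N F Y"
  by (rule tensor_sub_endo[OF d q(1) F G F Y _ _ u]) (use dF q(2) sub_carrier[OF N G] in auto)
 note ac = tensor_sub_carrier[OF X(1) G a] and bc = tensor_sub_carrier[OF F Y b]
 have "u -\<^sub>?T (?a +\<^sub>?T ?b) = 0\<^sub>?T"
 proof (rule tensor_zeroI)
  fix \<phi> assume f: "fnl M \<phi>"
  note l = lsl_lin[OF f] and fd = lin_comp[OF d f] and fp = lin_comp[OF p(1) f]
  have "lsl N (%x. \<phi> (d x)) u\<in>Y" using dX fnl_zero[OF f M] by (intro c[OF fd]) simp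
  hence "lsl N \<phi> ?b = lsl N (%x. \<phi> (d x)) u" using q(3) by (simp add: lsl_endo[OF d q(1) f uc])
  moreover have "lsl N \<phi> u = lsl N (%x. \<phi> (p x)) u +\<^sub>N lsl N (%x. \<phi> (d x)) u"
  proof (rule lin_eq_tensor[OF M N l lin_plus[OF N lsl_lin[OF fp] lsl_lin[OF fd]] _ uc])
   fix x y assume xy: "x\<in>|M|" "y\<in>|N|"
   have x: "p x\<in>|M|" "d x\<in>|M|" using xy lin_closed[OF p(1)] lin_closed[OF d] by auto
   have "p x +\<^sub>M d x = x" using xy x M by (simp add: d_def v_comm[OF M x(1)])
   hence "\<phi> x = \<phi> (p x) \<oplus> \<phi> (d x)" using fnl_add[OF f x] by simp
   thus "lsl N \<phi> (ts M N x y) = lsl N (%x. \<phi> (p x)) (ts M N x y) +\<^sub>N lsl N (%x. \<phi> (d x)) (ts M N x y)"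
    using xy x N by (simp add: lsl_tens[OF f] lsl_tens[OF fp] lsl_tens[OF fd] fnl_closed[OF f] v_smult_ldistr)
  qed
  ultimately show "lsl N \<phi> (u -\<^sub>?T (?a +\<^sub>?T ?b)) = 0\<^sub>N"
   using uc ac bc T N lin_closed[OF l] lin_closed[OF lsl_lin[OF fp] uc] lin_closed[OF lsl_lin[OF fd] uc]
   by (simp add: lin_minus[OF l T N] lin_add[OF l] lsl_endo[OF p(1) id f uc])
 qed (use uc ac bc T in auto)
 thus ?thesis using a b v_eq_diff[OF T] uc ac bc T unfolding set_add_iff by (metis v_add_closed)
qed

lemma tensor_zeroI2:
 assumes u: "u\<in>|TS M N|"
  and z: "!!\<phi> \<psi>. fnl M \<phi> ==> fnl N \<psi> ==> \<psi> (lsl N \<phi> u) = \<zero>"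
 shows "u = 0\<^sub>(TS M N)"
 using u lin_closed[OF lsl_lin u] z by (intro tensor_zeroI fnl_zeroI[OF N]) auto

lemma tensor_eqI2:
 assumes u: "u\<in>|TS M N|" and v: "v\<in>|TS M N|"
  and z: "!!\<phi> \<psi>. fnl M \<phi> ==> fnl N \<psi> ==> \<psi> (lsl N \<phi> u) = \<psi> (lsl N \<phi> v)"
 shows "u = v"
proof -
 note T = tensor_module[OF M N]
 have "u -\<^sub>(TS M N) v = 0\<^sub>(TS M N)"
 proof (rule tensor_zeroI2)
  fix \<phi> \<psi> assume f: "fnl M \<phi>" "fnl N \<psi>"
  note l = lin_comp[OF lsl_lin[OF f(1)] f(2)]
  show "\<psi> (lsl N \<phi> (u -\<^sub>(TS M N) v)) = \<zero>"
   using lin_minus[OF l T base_module u v] z[OF f] v_neg(3)[OF base_module] lin_closed[OF l v] by simp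
 qed (use u v T in auto)
 thus ?thesis using v_eq_diff[OF T u v] by simp
qed

lemma tensor_criterion_rev:
 assumes X: "sub X M" and Y: "sub Y N"
  and u: "u\<in>tsub M N X (carrier N) <+>\<^sub>(TS M N) tsub M N (carrier M) Y"
  and \<phi>: "fnl M \<phi>" "!!x. x\<in>X ==> \<phi> x = \<zero>"
 shows "lsl N \<phi> u\<in>Y"
proof -
 obtain a b where ab: "a\<in>tsub M N X (carrier N)" "b\<in>tsub M N (carrier M) Y"
  "u = a +\<^sub>(TS M N) b" using u unfolding set_add_iff by blast
 have "lsl N \<phi> a\<in>Y"
  by (rule lsl_sub[OF \<phi>(1) X sub_full[OF N] ab(1) Y]) (use N \<phi>(2) sub_zero[OF N Y] in simp)
 moreover have "lsl N \<phi> b\<in>Y"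
  by (rule lsl_sub[OF \<phi>(1) sub_full[OF M] Y ab(2) Y]) (simp add: fnl_closed[OF \<phi>(1)] sub_smult[OF N Y])
 moreover have "lsl N \<phi> u = lsl N \<phi> a +\<^sub>N lsl N \<phi> b"
  unfolding ab(3) using tensor_sub_carrier[OF X sub_full[OF N] ab(1)] tensor_sub_carrier[OF sub_full[OF M] Y ab(2)]
  by (rule lin_add[OF lsl_lin[OF \<phi>(1)]])
 ultimately show ?thesis using sub_add[OF N Y] by simp
qed

text \<open>If \<open>u\<close> lies in every \<open>F\<^bsub>i-1\<^esub> \<otimes> N + M \<otimes> G\<^bsub>n-i\<^esub>\<close>, then it lies in \<open>\<Sum>\<^sub>i F\<^sub>i \<otimes> G\<^bsub>n-i\<^esub>\<close>; in terms of
  slices, the hypothesis says that functionals vanishing on \<open>F\<^bsub>i-1\<^esub>\<close> slice \<open>u\<close> into \<open>G\<^bsub>n-i\<^esub>\<close>.\<close>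

lemma tensor_filtration:
 assumes F: "!!i. sub (F i) M" and Fm: "!!i j. i \<le> j ==> F i\<subseteq>F j"
  and G: "!!i. sub (G i) N" and Gm: "!!i j. i \<le> j ==> G i\<subseteq>G j"
  and u: "u\<in>tsub M N (carrier M) (G n)"
  and c: "!!i \<phi>. i < n ==> fnl M \<phi> ==> (!!x. x\<in>F i ==> \<phi> x = \<zero>) ==> lsl N \<phi> u\<in>G (n - Suc i)"
  and c': "!!\<phi>. fnl M \<phi> ==> (!!x. x\<in>F n ==> \<phi> x = \<zero>) ==> lsl N \<phi> u = 0\<^sub>N"
 shows "u\<in>span (TS M N) (\<Union>i\<le>n. tsub M N (F i) (G (n - i)))"
proof -
 let ?T = "TS M N"
 let ?W = "span ?T (\<Union>i\<le>n. tsub M N (F i) (G (n - i)))"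
 note T = tensor_module[OF M N]
 have Ws: "(\<Union>i\<le>n. tsub M N (F i) (G (n - i)))\<subseteq>|?T|"
  using tensor_sub_carrier[OF F G] by auto
 note W = span_sub[OF T Ws]
 have FG: "tsub M N (F i) (G (n - i))\<subseteq>?W" if "i \<le> n" for i
 proof
  fix v assume "v\<in>tsub M N (F i) (G (n - i))"
  thus "v\<in>?W" using that by (intro span_incl) auto
 qed
 note MG = tensor_sub_sub[OF sub_full[OF M] G]
 \<comment> \<open>Invariant of the peeling: w collects the summands found so far, the remainder t
   has its second leg in G (n - i), and functionals killing F j with j \<ge> i do not see w. Such
   functionals therefore slice t and u alike, and \<open>tensor_criterion\<close> splits the next
   summand F i \<otimes> G (n - i) off t.\<close>
 have step: "\<exists>w t. w\<in>?W & t\<in>tsub M N (carrier M) (G (n - i)) & u = w +\<^sub>?T t &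
   (\<forall>j \<phi>. i \<le> j --> fnl M \<phi> --> (\<forall>x\<in>F j. \<phi> x = \<zero>) --> lsl N \<phi> w = 0\<^sub>N)" if "i \<le> n" for i
  using that
 proof (induction i)
  case 0
  show ?case
   by (rule exI[of _ "0\<^sub>?T"], rule exI[of _ u])
    (use u sub_zero[OF T W] in "simp add: lin_zero[OF lsl_lin T N] v_zero(1)[OF T tensor_sub_carrier[OF sub_full[OF M] G u]]")
 next
  case (Suc i)
  then obtain w t where wt: "w\<in>?W" "t\<in>tsub M N (carrier M) (G (n - i))" "u = w +\<^sub>?T t"
   and w0: "!!j \<phi>. i \<le> j ==> fnl M \<phi> ==> (!!x. x\<in>F j ==> \<phi> x = \<zero>) ==> lsl N \<phi> w = 0\<^sub>N" by auto
  have wc: "w\<in>|?T|" by (rule sub_carrier[OF T W wt(1)])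
  have tc: "t\<in>|?T|" by (rule tensor_sub_carrier[OF sub_full[OF M] G wt(2)])
  have "t\<in>tsub M N (F i) (G (n - i)) <+>\<^sub>?T tsub M N (carrier M) (G (n - Suc i))"
  proof (rule tensor_criterion[OF sub_full[OF M] G F sub_subset[OF M F] G wt(2)])
   fix \<phi> assume f: "fnl M \<phi>" "!!x. x\<in>F i ==> \<phi> x = \<zero>"
   have "lsl N \<phi> u = lsl N \<phi> t"
    using w0[OF le_refl f] N lin_closed[OF lsl_lin[OF f(1)] tc] by (simp add: wt(3) lin_add[OF lsl_lin[OF f(1)] wc tc])
   thus "lsl N \<phi> t\<in>G (n - Suc i)" using c[of i \<phi>] f Suc.prems by simp
  qed
  then obtain a b where ab: "a\<in>tsub M N (F i) (G (n - i))" "b\<in>tsub M N (carrier M) (G (n - Suc i))"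
   "t = a +\<^sub>?T b" unfolding set_add_iff by blast
  have ac: "a\<in>|?T|" by (rule tensor_sub_carrier[OF F G ab(1)])
  have bc: "b\<in>|?T|" by (rule tensor_sub_carrier[OF sub_full[OF M] G ab(2)])
  have "w +\<^sub>?T a\<in>?W" using sub_add[OF T W wt(1)] FG[of i] Suc.prems ab(1) by auto
  moreover have "u = (w +\<^sub>?T a) +\<^sub>?T b" using wt(3) ab(3) wc ac bc by (simp add: v_assoc[OF T])
  moreover have "lsl N \<phi> (w +\<^sub>?T a) = 0\<^sub>N" if j: "Suc i \<le> j" and f: "fnl M \<phi>" "!!x. x\<in>F j ==> \<phi> x = \<zero>" for j \<phi>
  proof -
   have "F i\<subseteq>F j" using Fm[of i j] j by simp
   hence "lsl N \<phi> a\<in>{0\<^sub>N}"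
    by (intro lsl_sub[OF f(1) F G ab(1) sub_null[OF N]]) (use f(2) N sub_carrier[OF N G] in auto)
   moreover have "lsl N \<phi> w = 0\<^sub>N" by (rule w0[OF _ f]) (use j in auto)
   ultimately show ?thesis using N by (simp add: lin_add[OF lsl_lin[OF f(1)] wc ac])
  qed
  ultimately show ?case using ab(2) by blast
 qed
 obtain w t where wt: "w\<in>?W" "t\<in>tsub M N (carrier M) (G (n - n))" "u = w +\<^sub>?T t"
  and w0: "!!j \<phi>. n \<le> j ==> fnl M \<phi> ==> (!!x. x\<in>F j ==> \<phi> x = \<zero>) ==> lsl N \<phi> w = 0\<^sub>N" using step[OF le_refl] by blast
 have wc: "w\<in>|?T|" by (rule sub_carrier[OF T W wt(1)])
 have tc: "t\<in>|?T|" by (rule tensor_sub_carrier[OF sub_full[OF M] G wt(2)])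
 \<comment> \<open>Functionals killing F n slice the remainder to zero, so the criterion with Y = 0
   puts all of it into F n \<otimes> G 0.\<close>
 have "t\<in>tsub M N (F n) (G (n - n)) <+>\<^sub>?T tsub M N (carrier M) {0\<^sub>N}"
 proof (rule tensor_criterion[OF sub_full[OF M] G F sub_subset[OF M F] sub_null[OF N] wt(2)])
  fix \<phi> assume f: "fnl M \<phi>" "!!x. x\<in>F n ==> \<phi> x = \<zero>"
  have "lsl N \<phi> u = lsl N \<phi> t"
   using w0[OF le_refl f] N lin_closed[OF lsl_lin[OF f(1)] tc] by (simp add: wt(3) lin_add[OF lsl_lin[OF f(1)] wc tc])
  thus "lsl N \<phi> t\<in>{0\<^sub>N}" using c'[OF f] by simp
 qed
 hence "t\<in>tsub M N (F n) (G (n - n))"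
  unfolding tensor_sub_null_r[OF sub_full[OF M]] set_add_iff using tensor_sub_carrier[OF F G] T by auto
 thus ?thesis using FG[of n] wt sub_add[OF T W] by auto
qed

end

subsection \<open>Bilinear operations on tensor products\<close>

text \<open>Linear extension in two tensor arguments at once. The product of a tensor algebra, the
  bracket on A \<otimes> A and the smash product are all of this shape.\<close>

definition tensor_lift2 :: "('k, 'p, 'x) module_scheme => ('a => 'b => 'c => 'd => 'p) =>
  ('a \<times> 'b => 'k) set => ('c \<times> 'd => 'k) set => 'p"
 where "tensor_lift2 P f u v = tlift P (%a b. tlift P (%c d. f a b c d) v) u"

context
 fixes A :: "('k, 'a, 'z) module_scheme" and B :: "('k, 'b, 'y) module_scheme"
  and C :: "('k, 'c, 'x) module_scheme" and D :: "('k, 'd, 'w) module_scheme" and P :: "('k, 'p, 'v) module_scheme"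
  and f :: "'a => 'b => 'c => 'd => 'p"
 assumes A: "vs A" and B: "vs B" and C: "vs C" and D: "vs D" and P: "vs P"
  and f1: "!!a b. a\<in>|A| ==> b\<in>|B| ==> bil C D P (f a b)"
  and f2: "!!c d. c\<in>|C| ==> d\<in>|D| ==> bil A B P (%a b. f a b c d)"
begin

text \<open>For fixed outer arguments both sides of each linearity law are linear in v and agree on
  pure tensors.\<close>

lemma tensor_lift2_bil_aux:
 assumes v: "v\<in>|TS C D|"
 shows "bil A B P (%a b. tlift P (f a b) v)"
proof -
 note l = tensor_lift_lin[OF C D P f1] and t = tensor_lift_tens[OF C D P f1]
 show ?thesis
 proof (rule k_bilinearI)
  show "tlift P (f x y) v\<in>|P|" if "x\<in>|A|" "y\<in>|B|" for x y
   by (rule lin_closed[OF l[OF that] v])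
  show "tlift P (f (x +\<^sub>A x') y) v = tlift P (f x y) v +\<^sub>P tlift P (f x' y) v"
   if a: "x\<in>|A|" "x'\<in>|A|" "y\<in>|B|" for x x' y
   by (rule lin_eq_tensor[OF C D l lin_plus[OF P l l] _ v])
    (use a A in "auto simp: t bil_add_l[OF f2]")
  show "tlift P (f x (y +\<^sub>B y')) v = tlift P (f x y) v +\<^sub>P tlift P (f x y') v"
   if a: "x\<in>|A|" "y\<in>|B|" "y'\<in>|B|" for x y y'
   by (rule lin_eq_tensor[OF C D l lin_plus[OF P l l] _ v])
    (use a B in "auto simp: t bil_add_r[OF f2]")
  show "tlift P (f (k \<odot>\<^sub>A x) y) v = k \<odot>\<^sub>P tlift P (f x y) v"
   if a: "k\<in>|K|" "x\<in>|A|" "y\<in>|B|" for k x y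
   by (rule lin_eq_tensor[OF C D l lin_scale[OF P l] _ v])
    (use a A in "auto simp: t bil_smult_l[OF f2]")
  show "tlift P (f x (k \<odot>\<^sub>B y)) v = k \<odot>\<^sub>P tlift P (f x y) v"
   if a: "k\<in>|K|" "x\<in>|A|" "y\<in>|B|" for k x y
   by (rule lin_eq_tensor[OF C D l lin_scale[OF P l] _ v])
    (use a B in "auto simp: t bil_smult_r[OF f2]")
 qed
qed

lemma tensor_lift2_lin_l: "v\<in>|TS C D| ==> lin (TS A B) P (%u. tensor_lift2 P f u v)"
 unfolding tensor_lift2_def by (rule tensor_lift_lin[OF A B P tensor_lift2_bil_aux])

lemma tensor_lift2_tens_l:
 "a\<in>|A| ==> b\<in>|B| ==> v\<in>|TS C D| ==>
  tensor_lift2 P f (ts A B a b) v = tlift P (f a b) v"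
 unfolding tensor_lift2_def by (rule tensor_lift_tens[OF A B P tensor_lift2_bil_aux])

lemma tensor_lift2_tens:
 "a\<in>|A| ==> b\<in>|B| ==> c\<in>|C| ==> d\<in>|D| ==>
  tensor_lift2 P f (ts A B a b) (ts C D c d) = f a b c d"
 by (simp add: tensor_lift2_tens_l tens_closed[OF C D] tensor_lift_tens[OF C D P f1])

lemma tensor_lift2_lin_r:
 assumes u: "u\<in>|TS A B|"
 shows "lin (TS C D) P (tensor_lift2 P f u)"
 using u
proof (induction rule: tensor_induct[OF A B, consumes 1, case_names tens add])
 case (tens a b)
 show ?case
  by (rule lin_cong[OF tensor_lift_lin[OF C D P f1] tensor_module[OF C D]]) (use tens in "auto simp: tensor_lift2_tens_l")
next
 case (add u v)
 show ?case
  by (rule lin_cong[OF lin_plus[OF P add(3,4)] tensor_module[OF C D]]) (use add(1,2) in "simp add: lin_add[OF tensor_lift2_lin_l]")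
qed

lemma tensor_lift2_bil: "bil (TS A B) (TS C D) P (tensor_lift2 P f)"
 unfolding k_bilinear_def using tensor_lift2_lin_l tensor_lift2_lin_r by auto

end
end

context base
begin

subsection \<open>Algebras\<close>

lemma k_algebraI:
 assumes M: "vs A"
  and c: "!!x y. x\<in>|A| ==> y\<in>|A| ==> x *\<^sub>A y\<in>|A|" "1\<^sub>A\<in>|A|"
  and m: "!!x y z. x\<in>|A| ==> y\<in>|A| ==> z\<in>|A| ==> (x *\<^sub>A y) *\<^sub>A z = x *\<^sub>A (y *\<^sub>A z)"
   "!!x. x\<in>|A| ==> 1\<^sub>A *\<^sub>A x = x" "!!x. x\<in>|A| ==> x *\<^sub>A 1\<^sub>A = x"
  and b: "bil A A A (%x y. x *\<^sub>A y)"
 shows "k_algebra K A"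
proof -
 interpret M: module K A by (rule M)
 have "ring A"
  by (rule ringI[OF M.M.abelian_group_axioms monoidI])
   (use c m in "auto simp: bil_add_l[OF b] bil_add_r[OF b]")
 thus ?thesis
  by (intro k_algebra.intro k_algebra_axioms.intro K.field_axioms M)
   (auto simp: bil_smult_l[OF b] bil_smult_r[OF b])
qed

context
 fixes A :: "('k, 'a, 'z) module_scheme"
 assumes A: "k_algebra K A"
begin

interpretation A: k_algebra K A by (rule A)

lemma alg_module [simp]: "vs A" by unfold_locales
lemma alg_ring: "ring A" by (rule A.A.ring_axioms)
lemma alg_mult_closed [simp, intro]: "x\<in>|A| ==> y\<in>|A| ==> x *\<^sub>A y\<in>|A|" by simp
lemma alg_one_closed [simp, intro]: "1\<^sub>A\<in>|A|" by simp
lemma alg_assoc: "x\<in>|A| ==> y\<in>|A| ==> z\<in>|A| ==> (x *\<^sub>A y) *\<^sub>A z = x *\<^sub>A (y *\<^sub>A z)"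
 by (rule A.A.m_assoc)
lemma alg_one [simp]: "x\<in>|A| ==> 1\<^sub>A *\<^sub>A x = x" "x\<in>|A| ==> x *\<^sub>A 1\<^sub>A = x" by simp_all
lemma alg_null [simp]: "x\<in>|A| ==> 0\<^sub>A *\<^sub>A x = 0\<^sub>A" "x\<in>|A| ==> x *\<^sub>A 0\<^sub>A = 0\<^sub>A" by simp_all
lemma alg_ldistr: "x\<in>|A| ==> y\<in>|A| ==> z\<in>|A| ==> (x +\<^sub>A y) *\<^sub>A z = x *\<^sub>A z +\<^sub>A y *\<^sub>A z"
 by (rule A.A.l_distr)
lemma alg_rdistr: "x\<in>|A| ==> y\<in>|A| ==> z\<in>|A| ==> z *\<^sub>A (x +\<^sub>A y) = z *\<^sub>A x +\<^sub>A z *\<^sub>A y"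
 by (rule A.A.r_distr)
lemma alg_neg: "x\<in>|A| ==> y\<in>|A| ==> (\<ominus>\<^sub>A x) *\<^sub>A y = \<ominus>\<^sub>A (x *\<^sub>A y)"
  "x\<in>|A| ==> y\<in>|A| ==> x *\<^sub>A (\<ominus>\<^sub>A y) = \<ominus>\<^sub>A (x *\<^sub>A y)"
 by (simp_all add: A.A.l_minus A.A.r_minus)
lemma alg_smult: "k\<in>|K| ==> x\<in>|A| ==> y\<in>|A| ==> (k \<odot>\<^sub>A x) *\<^sub>A y = k \<odot>\<^sub>A (x *\<^sub>A y)"
  "k\<in>|K| ==> x\<in>|A| ==> y\<in>|A| ==> x *\<^sub>A (k \<odot>\<^sub>A y) = k \<odot>\<^sub>A (x *\<^sub>A y)"
 by (simp_all add: A.smult_mult_left A.smult_mult_right)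
lemma alg_bilinear: "bil A A A (%x y. x *\<^sub>A y)"
 by (rule k_bilinearI) (auto simp: alg_ldistr alg_rdistr alg_smult)
text \<open>Scaling by k is multiplication by k 1, so ring ideals are subspaces.\<close>

lemma alg_ideal_sub:
 assumes "ideal I A"
 shows "sub I A"
proof -
 interpret I: ideal I A by (rule assms)
 show ?thesis
 proof (rule submodule_crit[OF alg_module])
  fix k x assume k: "k\<in>|K|" and x: "x\<in>I"
  have "(k \<odot>\<^sub>A 1\<^sub>A) *\<^sub>A x\<in>I" using x k by (intro I.I_l_closed) auto
  thus "k \<odot>\<^sub>A x\<in>I" using k x I.a_subset by (simp add: alg_smult subset_iff)
 qed (use I.a_subset in auto)
qed
lemma alg_quot:
 assumes I: "ideal I A"
 shows "k_algebra K (quot A I)"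
  "x\<in>|A| ==> y\<in>|A| ==> (I +>\<^sub>A x) *\<^sub>(quot A I) (I +>\<^sub>A y) = I +>\<^sub>A (x *\<^sub>A y)"
proof -
 interpret I: ideal I A by (rule assms)
 note s = alg_ideal_sub[OF I]
 have m: "(I +>\<^sub>A x) *\<^sub>(quot A I) (I +>\<^sub>A y) = I +>\<^sub>A (x *\<^sub>A y)" if "x\<in>|A|" "y\<in>|A|" for x y
  using that by (simp add: quot_simps I.rcoset_mult_add)
 show "k_algebra K (quot A I)"
 proof (rule k_algebraI)
  show "bil (quot A I) (quot A I) (quot A I) (%x y. x *\<^sub>(quot A I) y)"
   by (rule k_bilinearI) (auto simp: quot_carrier m quot_add[OF alg_module s] quot_smult[OF alg_module s] alg_ldistr alg_rdistr alg_smult)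
 qed (auto simp: quot_module[OF alg_module s] quot_carrier m alg_assoc quot_simps(5))
 show "x\<in>|A| ==> y\<in>|A| ==> (I +>\<^sub>A x) *\<^sub>(quot A I) (I +>\<^sub>A y) = I +>\<^sub>A (x *\<^sub>A y)"
  by (rule m)
qed

end

definition alg_hom :: "('k, 'a, 'z) module_scheme => ('k, 'b, 'y) module_scheme => ('a => 'b) => bool"
 where "alg_hom A B f \<longleftrightarrow> lin A B f & f 1\<^sub>A = 1\<^sub>B &
  (\<forall>x\<in>carrier A. \<forall>y\<in>carrier A. f (x *\<^sub>A y) = f x *\<^sub>B f y)"

lemma hom_lin: "alg_hom A B f ==> lin A B f"
 and hom_one: "alg_hom A B f ==> f 1\<^sub>A = 1\<^sub>B"
 and hom_mult: "alg_hom A B f ==> x\<in>|A| ==> y\<in>|A| ==> f (x *\<^sub>A y) = f x *\<^sub>B f y"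
 by (auto simp: alg_hom_def)
lemma hom_closed: "alg_hom A B f ==> x\<in>|A| ==> f x\<in>|B|"
 by (rule lin_closed[OF hom_lin])
lemma hom_add: "alg_hom A B f ==> x\<in>|A| ==> y\<in>|A| ==> f (x +\<^sub>A y) = f x +\<^sub>B f y"
 by (rule lin_add[OF hom_lin])
lemma hom_smult: "alg_hom A B f ==> k\<in>|K| ==> x\<in>|A| ==> f (k \<odot>\<^sub>A x) = k \<odot>\<^sub>B f x"
 by (rule lin_smult[OF hom_lin])

lemma hom_comp: "alg_hom A B f ==> alg_hom B C g ==> alg_hom A C (%x. g (f x))"
 using hom_closed[of A B f] hom_mult[of A B f] hom_mult[of B C g] hom_one[of A B f] hom_one[of B C g]
 by (simp add: alg_hom_def[of A C] lin_comp[OF hom_lin hom_lin])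

subsection \<open>Tensor products of algebras\<close>

lemma tensor_alg_simps [simp]: "|tensor_alg K A B| = |TS A B|"
 "zero (tensor_alg K A B) = zero (TS A B)" "add (tensor_alg K A B) = add (TS A B)"
 "smult (tensor_alg K A B) = smult (TS A B)" "one (tensor_alg K A B) = ts A B 1\<^sub>A 1\<^sub>B"
 by (simp_all add: tensor_alg_def Let_def)

lemma tensor_alg_mult: "u *\<^sub>(tensor_alg K A B) v =
  tensor_lift2 (TS A B) (%a b c d. ts A B (a *\<^sub>A c) (b *\<^sub>B d)) u v"
 by (simp add: tensor_alg_def Let_def tensor_lift2_def)

lemma module_cong:
 assumes "vs M" "|M'| = |M|" "zero M' = zero M" "add M' = add M" "smult M' = smult M"
 shows "vs M'"
proof (rule moduleI)
 show "abelian_group M'"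
 proof (rule abelian_groupI)
  fix x assume "x\<in>|M'|"
  thus "\<exists>y\<in>carrier M'. y +\<^sub>M' x = 0\<^sub>M'"
   unfolding assms(2-4) using assms(1) by (intro bexI[of _ "\<ominus>\<^sub>M x"]) auto
 qed (use assms in "auto simp: v_assoc intro: v_comm")
qed (use assms in "auto simp: v_smult_ldistr v_smult_rdistr v_smult_assoc")

context
 fixes A :: "('k, 'a, 'z) module_scheme" and B :: "('k, 'b, 'y) module_scheme"
 assumes A: "k_algebra K A" and B: "k_algebra K B"
begin

private lemma AB: "vs A" "vs B"
 using A B by auto

text \<open>Formulated for two arbitrary operations because, besides the product of A \<otimes> B,
  the operation {-, -} \<otimes> product is needed: it is what the projection onto kG makes of the
  tensor bracket.\<close>

lemma tensor_op_bil:
 assumes f: "bil A A A f" and g: "bil B B B g"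
 shows "bil (TS A B) (TS A B) (TS A B)
   (tensor_lift2 (TS A B) (%a b c d. ts A B (f a c) (g b d)))"
  "a\<in>|A| ==> b\<in>|B| ==> c\<in>|A| ==> d\<in>|B| ==>
   tensor_lift2 (TS A B) (%a b c d. ts A B (f a c) (g b d)) (ts A B a b) (ts A B c d) = ts A B (f a c) (g b d)"
proof -
 have 1: "bil A B (TS A B) (%c d. ts A B (f a c) (g b d))" if "a\<in>|A|" "b\<in>|B|" for a b
  by (rule bil_comp[OF tens_bilinear[OF AB] bil_right[OF f that(1)] bil_right[OF g that(2)]])
 have 2: "bil A B (TS A B) (%a b. ts A B (f a c) (g b d))" if "c\<in>|A|" "d\<in>|B|" for c d
  by (rule bil_comp[OF tens_bilinear[OF AB] bil_left[OF f that(1)] bil_left[OF g that(2)]])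
 show "bil (TS A B) (TS A B) (TS A B)
   (tensor_lift2 (TS A B) (%a b c d. ts A B (f a c) (g b d)))"
  by (rule tensor_lift2_bil[OF AB AB tensor_module[OF AB] 1 2])
 show "a\<in>|A| ==> b\<in>|B| ==> c\<in>|A| ==> d\<in>|B| ==>
   tensor_lift2 (TS A B) (%a b c d. ts A B (f a c) (g b d)) (ts A B a b) (ts A B c d) = ts A B (f a c) (g b d)"
  by (rule tensor_lift2_tens[OF AB AB tensor_module[OF AB] 1 2])
qed

lemma tensor_mult_bil:
 "bil (TS A B) (TS A B) (TS A B) (%u v. u *\<^sub>(tensor_alg K A B) v)"
 unfolding tensor_alg_mult by (rule tensor_op_bil(1)[OF alg_bilinear[OF A] alg_bilinear[OF B]])

lemma tensor_mult_tens: "a\<in>|A| ==> b\<in>|B| ==> c\<in>|A| ==> d\<in>|B| ==>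
  ts A B a b *\<^sub>(tensor_alg K A B) ts A B c d = ts A B (a *\<^sub>A c) (b *\<^sub>B d)"
 unfolding tensor_alg_mult by (rule tensor_op_bil(2)[OF alg_bilinear[OF A] alg_bilinear[OF B]])

lemma tensor_alg_algebra: "k_algebra K (tensor_alg K A B)"
proof (rule k_algebraI)
 let ?T = "TS A B" and ?E = "tensor_alg K A B"
 note T = tensor_module[OF AB]
 note b = tensor_mult_bil and t = tensor_mult_tens and tc = tens_closed[OF AB]
 note dist = bil_add_l[OF b] bil_add_r[OF b] bil_closed[OF b]
 show "vs ?E" by (rule module_cong[OF T]) simp_all
 show "bil ?E ?E ?E (%x y. x *\<^sub>?E y)"
  by (rule k_bilinearI) (simp_all add: bil_add_l[OF b] bil_add_r[OF b] bil_closed[OF b] bil_smult_l[OF b] bil_smult_r[OF b])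
 show "x *\<^sub>?E y\<in>|?E|" if "x\<in>|?E|" "y\<in>|?E|" for x y
  using that by (simp add: bil_closed[OF b])
 show "1\<^sub>?E\<in>|?E|" using A B tc by simp
 show "1\<^sub>?E *\<^sub>?E x = x" if "x\<in>|?E|" for x
 proof -
  have 1: "1\<^sub>?E\<in>|?T|" using A B tc by simp
  have "x\<in>|?T|" using that by simp
  thus ?thesis
   by (induction rule: tensor_induct[OF AB, consumes 1, case_names tens add])
    (use A B 1 in \<open>simp_all add: t dist del: tensor_alg_simps(5)\<close>, simp add: t A B)
 qed
 show "x *\<^sub>?E 1\<^sub>?E = x" if "x\<in>|?E|" for x
 proof -
  have 1: "1\<^sub>?E\<in>|?T|" using A B tc by simp
  have "x\<in>|?T|" using that by simp
  thus ?thesis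
   by (induction rule: tensor_induct[OF AB, consumes 1, case_names tens add])
    (use A B 1 in \<open>simp_all add: t dist del: tensor_alg_simps(5)\<close>, simp add: t A B)
 qed
 show "(x *\<^sub>?E y) *\<^sub>?E z = x *\<^sub>?E (y *\<^sub>?E z)" if xyz: "x\<in>|?E|" "y\<in>|?E|" "z\<in>|?E|" for x y z
 proof -
  have c: "x\<in>|?T|" "y\<in>|?T|" "z\<in>|?T|" using xyz by simp_all
  show ?thesis using c(1)
  proof (induction rule: tensor_induct[OF AB, consumes 1, case_names tens add])
   case (tens a1 a2)
   show ?case using c(2)
   proof (induction rule: tensor_induct[OF AB, consumes 1, case_names tens add])
    case (tens b1 b2)
    show ?case using c(3)
     by (induction rule: tensor_induct[OF AB, consumes 1, case_names tens add])
      (use \<open>a1\<in>|A|\<close> \<open>a2\<in>|B|\<close> tens A B in "simp_all add: t tc dist alg_assoc")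
   next
    case (add u v)
    thus ?case using tens c tc by (simp add: dist)
   qed
  next
   case (add u v)
   thus ?case using c by (simp add: dist)
  qed
 qed
qed

end

subsection \<open>Free algebras\<close>

lemma finsum_base: "finsum (base_algebra K) f I = finsum K f I"
 by (simp add: finsum_def finprod_def)

lemma free_alg_simps [simp]: "|free_algebra K S| = |free (lists S)|"
 "zero (free_algebra K S) = zero (free (lists S))" "add (free_algebra K S) = add (free (lists S))"
 "smult (free_algebra K S) = smult (free (lists S))" "one (free_algebra K S) = delta K []"
 by (simp_all add: free_algebra_def)

lemma free_alg_mult: "F *\<^sub>(free_algebra K S) G = (%w. \<Oplus>i\<in>{..length w}. F (take i w) \<otimes> G (drop i w))"
 by (simp add: free_algebra_def)

context
 fixes S :: "'x set"
begin

abbreviation (input) "FS \<equiv> free (lists S)"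
abbreviation (input) "FA \<equiv> free_algebra K S"

lemma free_alg_closed:
 assumes F: "F\<in>|FS|" and G: "G\<in>|FS|"
 shows "F *\<^sub>FA G\<in>|FS|"
proof -
 note c = free_carrierD[OF F] free_carrierD[OF G]
 \<comment> \<open>A nonzero coefficient at w comes from a splitting of w into a word of F and a
   word of G.\<close>
 have s: "support K (F *\<^sub>FA G)\<subseteq>(%(v, w). v @ w) ` (support K F \<times> support K G)"
 proof
  fix w assume w: "w\<in>support K (F *\<^sub>FA G)"
  have "\<exists>i\<in>{..length w}. F (take i w) \<otimes> G (drop i w) ~= \<zero>"
  proof (rule ccontr)
   assume "\<not> (\<exists>i\<in>{..length w}. F (take i w) \<otimes> G (drop i w) ~= \<zero>)"
   hence "(\<Oplus>i\<in>{..length w}. F (take i w) \<otimes> G (drop i w)) = \<zero>" by (intro K.add.finprod_one_eqI) auto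
   thus False using w by (simp add: support_def free_alg_mult)
  qed
  then obtain i where "F (take i w) ~= \<zero>" "G (drop i w) ~= \<zero>" using c by (metis K.integral_iff)
  thus "w\<in>(%(v, w). v @ w) ` (support K F \<times> support K G)"
   by (intro image_eqI[of _ _ "(take i w, drop i w)"]) (auto simp: support_def)
 qed
 have "(%(v, w). v @ w) ` (support K F \<times> support K G)\<subseteq>lists S"
  using F G by (auto simp: free_carrier) blast+
 moreover have "finite ((%(v, w). v @ w) ` (support K F \<times> support K G))" using F G by (auto simp: free_carrier)
 moreover have "(F *\<^sub>FA G) w\<in>|K|" for w unfolding free_alg_mult using c by (intro K.finsum_closed) auto
 ultimately show ?thesis using s subset_trans[OF s] finite_subset[OF s] unfolding free_carrier by (simp add: image_subset_iff)
qed

lemma free_alg_bil: "bil FS FS FS (%F G. F *\<^sub>FA G)"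
proof (rule k_bilinearI)
 fix F F' G assume a: "F\<in>|FS|" "F'\<in>|FS|" "G\<in>|FS|"
 note c = free_carrierD[OF a(1)] free_carrierD[OF a(2)] free_carrierD[OF a(3)]
 show "(F +\<^sub>FS F') *\<^sub>FA G = F *\<^sub>FA G +\<^sub>FS F' *\<^sub>FA G"
  unfolding free_alg_mult free_simps
  by (rule ext, subst K.finsum_addf[symmetric]) (use c in "auto simp: K.l_distr")
 show "G *\<^sub>FA (F +\<^sub>FS F') = G *\<^sub>FA F +\<^sub>FS G *\<^sub>FA F'"
  unfolding free_alg_mult free_simps
  by (rule ext, subst K.finsum_addf[symmetric]) (use c in "auto simp: K.r_distr")
next
 fix k F G assume a: "k\<in>|K|" "F\<in>|FS|" "G\<in>|FS|"
 note c = free_carrierD[OF a(2)] free_carrierD[OF a(3)]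
 show "(k \<odot>\<^sub>FS F) *\<^sub>FA G = k \<odot>\<^sub>FS (F *\<^sub>FA G)"
  unfolding free_alg_mult free_simps
  by (rule ext, subst K.finsum_rdistr) (use c a(1) in "auto simp: K.m_assoc")
 show "F *\<^sub>FA (k \<odot>\<^sub>FS G) = k \<odot>\<^sub>FS (F *\<^sub>FA G)"
  unfolding free_alg_mult free_simps
  by (rule ext, subst K.finsum_rdistr) (use c a(1) in "auto simp: K.m_lcomm")
qed (rule free_alg_closed)

lemma free_alg_delta: "delta K v *\<^sub>FA delta K w = delta K (v @ w)"
proof
 fix u
 have dc: "delta K x y\<in>|K|" for x y :: "'x list" by (simp add: delta_def)
 show "(delta K v *\<^sub>FA delta K w) u = delta K (v @ w) u"
 proof (cases "u = v @ w")
  case True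
  have "(\<Oplus>i\<in>{..length u}. delta K v (take i u) \<otimes> delta K w (drop i u)) = delta K v (take (length v) u) \<otimes> delta K w (drop (length v) u)"
   unfolding finsum_base[symmetric]
  proof (rule v_finsum_single[OF base_module])
   fix j assume "j\<in>{..length u}" "j ~= length v"
   hence "length (take j u) ~= length v" by simp
   hence "take j u ~= v" by metis
   hence "delta K v (take j u) = \<zero>" by (simp add: delta_def)
   thus "delta K v (take j u) \<otimes> delta K w (drop j u) = 0\<^sub>(base_algebra K)" using dc by simp
  qed (use True dc in auto)
  thus ?thesis using True by (simp add: free_alg_mult) (simp add: delta_def)
 next
  case False
  have "delta K v (take i u) \<otimes> delta K w (drop i u) = \<zero>" for i
   using False append_take_drop_id[of i u] by (auto simp: delta_def)
  hence "(\<Oplus>i\<in>{..length u}. delta K v (take i u) \<otimes> delta K w (drop i u)) = \<zero>" by (intro K.add.finprod_one_eqI) auto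
  thus ?thesis using False by (simp add: free_alg_mult) (simp add: delta_def)
 qed
qed

lemma free_induct [consumes 1]:
 assumes "F\<in>|free X|"
  "!!x. x\<in>X ==> P (delta K x)" "P (0\<^sub>(free X))"
  "!!F G. F\<in>|free X| ==> G\<in>|free X| ==> P F ==> P G ==> P (F +\<^sub>(free X) G)"
  "!!k F. k\<in>|K| ==> F\<in>|free X| ==> P F ==> P (k \<odot>\<^sub>(free X) F)"
 shows "P F"
proof -
 have s: "delta K ` X\<subseteq>|free X|" by auto
 note c = sub_carrier[OF free_module span_sub[OF free_module s]]
 show ?thesis using free_span[OF assms(1)] free_module s
  by (induction rule: span_induct) (use assms(2-) c in auto)
qed

lemma free_lin_eq:
 assumes "lin (free X) P f" "lin (free X) P g" "vs P"
  "!!x. x\<in>X ==> f (delta K x) = g (delta K x)" "F\<in>|free X|"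
 shows "f F = g F"
 by (rule lin_eq_span[OF assms(1,2) free_module assms(3) _ _ free_span[OF assms(5)]]) (use assms(4) in auto)

lemma free_algebra_algebra: "k_algebra K FA"
proof (rule k_algebraI)
 note b = free_alg_bil
 show "vs FA" by (rule module_cong[OF free_module]) simp_all
 show "bil FA FA FA (%x y. x *\<^sub>FA y)"
  by (rule k_bilinearI) (simp_all add: bil_add_l[OF b] bil_add_r[OF b] bil_closed[OF b] bil_smult_l[OF b] bil_smult_r[OF b])
 show "x *\<^sub>FA y\<in>|FA|" if "x\<in>|FA|" "y\<in>|FA|" for x y
  using that by (simp add: bil_closed[OF b])
 have 1: "delta K []\<in>|FS|" by simp
 thus "1\<^sub>FA\<in>|FA|" by simp
 show "1\<^sub>FA *\<^sub>FA x = x" if "x\<in>|FA|" for x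
  by (rule free_lin_eq[OF bil_right[OF b] lin_id free_module])
   (use that 1 in "auto simp: free_alg_delta")
 show "x *\<^sub>FA 1\<^sub>FA = x" if "x\<in>|FA|" for x
  by (rule free_lin_eq[OF bil_left[OF b] lin_id free_module])
   (use that 1 in "auto simp: free_alg_delta")
 show "(x *\<^sub>FA y) *\<^sub>FA z = x *\<^sub>FA (y *\<^sub>FA z)" if xyz: "x\<in>|FA|" "y\<in>|FA|" "z\<in>|FA|" for x y z
 proof -
  have c: "x\<in>|FS|" "y\<in>|FS|" "z\<in>|FS|" using xyz by simp_all
  have "(delta K u *\<^sub>FA delta K v) *\<^sub>FA z = delta K u *\<^sub>FA (delta K v *\<^sub>FA z)" if "u\<in>lists S" "v\<in>lists S" for u v
   by (rule free_lin_eq[OF bil_right[OF b] lin_comp[OF bil_right[OF b] bil_right[OF b]] free_module _ c(3)])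
    (use that in "auto simp: free_alg_delta")
  hence "(delta K u *\<^sub>FA y) *\<^sub>FA z = delta K u *\<^sub>FA (y *\<^sub>FA z)" if "u\<in>lists S" for u
   using that c by (intro free_lin_eq[OF lin_comp[OF bil_right[OF b] bil_left[OF b]] lin_comp[OF bil_left[OF b] bil_right[OF b]] free_module _ c(2)]) auto
  thus ?thesis
   using c by (intro free_lin_eq[OF lin_comp[OF bil_left[OF b] bil_left[OF b]] bil_left[OF b] free_module _ c(1)]) (auto intro: bil_closed[OF b])
 qed
qed

lemma word_closed:
 assumes T: "k_algebra K T" and c: "!!s. s\<in>S ==> c s\<in>|T|"
 shows "w\<in>lists S ==> foldr (%s t. c s *\<^sub>T t) w 1\<^sub>T\<in>|T|"
 by (induction w) (use T c in auto)

lemma free_lift_hom: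
 assumes T: "k_algebra K T" and c: "!!s. s\<in>S ==> c s\<in>|T|"
 shows "alg_hom FA T (fs_lift T (%w. foldr (%s t. c s *\<^sub>T t) w 1\<^sub>T))"
  "w\<in>lists S ==> fs_lift T (%w. foldr (%s t. c s *\<^sub>T t) w 1\<^sub>T) (delta K w) = foldr (%s t. c s *\<^sub>T t) w 1\<^sub>T"
proof -
 let ?p = "%w. foldr (%s t. c s *\<^sub>T t) w 1\<^sub>T"
 let ?f = "fs_lift T ?p"
 have pc: "?p w\<in>|T|" if "w\<in>lists S" for w
  by (rule word_closed[OF T _ that]) (rule c)
 note T' = alg_module[OF T]
 have lin: "lin FS T ?f" by (rule fs_lift_lin[OF T' pc])
 have d: "?f (delta K w) = ?p w" if "w\<in>lists S" for w by (rule fs_lift_delta[OF T' pc that])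
 have app: "?p (v @ w) = ?p v *\<^sub>T ?p w" if "v\<in>lists S" "w\<in>lists S" for v w
  using that(1)
 proof (induction v)
  case Nil
  thus ?case using pc[OF that(2)] T by simp
 next
  case (Cons a v)
  thus ?case using pc[OF that(2)] pc[of v] c[of a] T by (simp add: alg_assoc)
 qed
 note b = free_alg_bil and bt = alg_bilinear[OF T]
 have 1: "?f (delta K v *\<^sub>FA G) = ?f (delta K v) *\<^sub>T ?f G" if "v\<in>lists S" "G\<in>|FS|" for v G
  by (rule free_lin_eq[OF lin_comp[OF bil_right[OF b] lin] lin_comp[OF lin bil_right[OF bt]] T' _ that(2)])
   (use that(1) d app pc lin_closed[OF lin] in "auto simp: free_alg_delta")
 have "?f (F *\<^sub>FA G) = ?f F *\<^sub>T ?f G" if "F\<in>|FS|" "G\<in>|FS|" for F G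
  by (rule free_lin_eq[OF lin_comp[OF bil_left[OF b that(2)] lin] lin_comp[OF lin bil_left[OF bt]] T' _ that(1)])
   (use that 1 lin_closed[OF lin] in auto)
 moreover have "lin FA T ?f" using lin unfolding k_linear_def by simp
 ultimately show "alg_hom FA T ?f" unfolding alg_hom_def using d[of "[]"] by simp
 show "w\<in>lists S ==> ?f (delta K w) = ?p w" by (rule d)
qed

end

end

context base
begin

subsection \<open>Poisson algebras\<close>

context
 fixes A :: "('k, 'a, 'z) poisson_scheme"
 assumes A: "poisson_algebra K A"
begin

interpretation A: poisson_algebra K A by (rule A)

lemma pa_algebra [simp]: "k_algebra K A"
proof (rule k_algebraI)
 show m: "vs A" by (rule A.module)
 show "bil A A A (%x y. x *\<^sub>A y)"
 proof (rule k_bilinearI)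
  fix k x y assume a: "k\<in>|K|" "x\<in>|A|" "y\<in>|A|"
  show "x *\<^sub>A (k \<odot>\<^sub>A y) = k \<odot>\<^sub>A (x *\<^sub>A y)"
   using A.m_comm[of x "k \<odot>\<^sub>A y"] A.m_comm[of x y] A.smult_assoc2[of k y x] a by simp
 qed (auto simp: A.l_distr A.r_distr A.smult_assoc2)
qed (auto simp: A.m_assoc)

lemma pa_comm: "x\<in>|A| ==> y\<in>|A| ==> x *\<^sub>A y = y *\<^sub>A x"
 by (rule A.m_comm)
lemma pa_lcomm: "x\<in>|A| ==> y\<in>|A| ==> z\<in>|A| ==> x *\<^sub>A (y *\<^sub>A z) = y *\<^sub>A (x *\<^sub>A z)"
 by (rule A.m_lcomm)
lemmas pa_bilinear = A.bracket_bilinear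
lemma pa_closed [simp, intro]: "x\<in>|A| ==> y\<in>|A| ==> {x, y}\<^sub>A\<in>|A|"
 by (rule bil_closed[OF pa_bilinear])
lemmas pa_add_l = bil_add_l[OF pa_bilinear]
lemmas pa_add_r = bil_add_r[OF pa_bilinear]
lemmas pa_smult_l = bil_smult_l[OF pa_bilinear]
lemmas pa_smult_r = bil_smult_r[OF pa_bilinear]
lemmas pa_self = A.bracket_self
lemma pa_anti:
 assumes "x\<in>|A|" "y\<in>|A|"
 shows "{x, y}\<^sub>A = \<ominus>\<^sub>A {y, x}\<^sub>A"
proof -
 have "{x +\<^sub>A y, x +\<^sub>A y}\<^sub>A = {x, y}\<^sub>A +\<^sub>A {y, x}\<^sub>A"
  using assms by (simp add: pa_add_l pa_add_r pa_self[OF assms(1)] pa_self[OF assms(2)] A.a_comm)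
 hence "{x, y}\<^sub>A +\<^sub>A {y, x}\<^sub>A = 0\<^sub>A" using pa_self[of "x +\<^sub>A y"] assms by simp
 thus ?thesis using A.minus_equality[of "{x, y}\<^sub>A" "{y, x}\<^sub>A"] assms by simp
qed
lemmas pa_leibniz_r = A.leibniz
lemma pa_leibniz_l:
 assumes "a\<in>|A|" "b\<in>|A|" "c\<in>|A|"
 shows "{b *\<^sub>A c, a}\<^sub>A = {b, a}\<^sub>A *\<^sub>A c +\<^sub>A b *\<^sub>A {c, a}\<^sub>A"
 using assms pa_anti[of "b *\<^sub>A c" a] pa_anti[of b a] pa_anti[of c a]
 by (simp add: pa_leibniz_r v_neg_add[OF alg_module[OF pa_algebra]] alg_neg[OF pa_algebra])
lemma pa_zero [simp]: "x\<in>|A| ==> {x, 0\<^sub>A}\<^sub>A = 0\<^sub>A" "x\<in>|A| ==> {0\<^sub>A, x}\<^sub>A = 0\<^sub>A"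
 by (auto intro: lin_zero[OF bil_right[OF pa_bilinear]] lin_zero[OF bil_left[OF pa_bilinear]])
lemma pa_one [simp]:
 assumes "x\<in>|A|"
 shows "{x, 1\<^sub>A}\<^sub>A = 0\<^sub>A" "{1\<^sub>A, x}\<^sub>A = 0\<^sub>A"
proof -
 have "{x, 1\<^sub>A}\<^sub>A = {x, 1\<^sub>A}\<^sub>A +\<^sub>A {x, 1\<^sub>A}\<^sub>A" using pa_leibniz_r[of x "1\<^sub>A" "1\<^sub>A"] assms by simp
 thus 1: "{x, 1\<^sub>A}\<^sub>A = 0\<^sub>A" using assms A.add.l_cancel_one'[of "{x, 1\<^sub>A}\<^sub>A" "{x, 1\<^sub>A}\<^sub>A"] by simp
 show "{1\<^sub>A, x}\<^sub>A = 0\<^sub>A" using pa_anti[of "1\<^sub>A" x] assms 1 by simp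
qed
text \<open>The derivation form of the Jacobi identity, from which the operators g^-1 {g, -} inherit
  their compatibility with the bracket.\<close>

lemma pa_jacobi:
 assumes "x\<in>|A|" "y\<in>|A|" "z\<in>|A|"
 shows "{x, {y, z}\<^sub>A}\<^sub>A = {{x, y}\<^sub>A, z}\<^sub>A +\<^sub>A {y, {x, z}\<^sub>A}\<^sub>A"
proof -
 note m = alg_module[OF pa_algebra]
 have n: "{x, \<ominus>\<^sub>A y}\<^sub>A = \<ominus>\<^sub>A {x, y}\<^sub>A" if "x\<in>|A|" "y\<in>|A|" for x y
  using lin_neg[OF bil_right[OF pa_bilinear that(1)] m m that(2)] .
 have a: "{z, {x, y}\<^sub>A}\<^sub>A = \<ominus>\<^sub>A {{x, y}\<^sub>A, z}\<^sub>A" using assms by (intro pa_anti) auto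
 have b: "{y, {z, x}\<^sub>A}\<^sub>A = \<ominus>\<^sub>A {y, {x, z}\<^sub>A}\<^sub>A" using assms pa_anti[of z x] n by simp
 have "({x, {y, z}\<^sub>A}\<^sub>A -\<^sub>A {y, {x, z}\<^sub>A}\<^sub>A) -\<^sub>A {{x, y}\<^sub>A, z}\<^sub>A = 0\<^sub>A"
  using A.jacobi[OF assms] a b assms by (simp add: a_minus_def)
 hence "{x, {y, z}\<^sub>A}\<^sub>A -\<^sub>A {y, {x, z}\<^sub>A}\<^sub>A = {{x, y}\<^sub>A, z}\<^sub>A"
  using assms by (subst (asm) v_eq_diff[OF m]) auto
 thus ?thesis using assms v_diff_add[OF m, of "{x, {y, z}\<^sub>A}\<^sub>A" "{y, {x, z}\<^sub>A}\<^sub>A"] by simp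
qed

end

text \<open>The record A' may have another type than A: R is a truncated record and kG carries its
  own comultiplication, so they are subalgebras of C only in this sense.\<close>

lemma poisson_subI:
 fixes A :: "('k, 'a, 'z) poisson_scheme" and A' :: "('k, 'a, 'y) poisson_scheme"
 assumes A: "poisson_algebra K A" and D: "sub (carrier A') A"
  and c: "!!x y. x\<in>|A'| ==> y\<in>|A'| ==> x *\<^sub>A y\<in>|A'|" "1\<^sub>A\<in>|A'|"
   "!!x y. x\<in>|A'| ==> y\<in>|A'| ==> {x, y}\<^sub>A\<in>|A'|"
  and e: "mult A' = mult A" "one A' = one A" "zero A' = zero A" "add A' = add A" "smult A' = smult A" "bracket A' = bracket A"
 shows "poisson_algebra K A'"
proof -
 interpret A: poisson_algebra K A by (rule A)
 have m: "vs A'" by (rule module_cong[OF sub_module[OF A.module D]]) (simp_all add: e)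
 have s: "x\<in>|A|" if "x\<in>|A'|" for x by (rule sub_carrier[OF A.module D that])
 have "algebra K A'"
 proof (rule algebraI)
  show "cring A'"
   by (rule cringI[OF mod_agrp[OF m] comm_monoidI]) (auto simp: e s c A.m_ac A.l_distr A.r_distr)
 qed (use m in \<open>auto simp: v_smult_ldistr v_smult_rdistr v_smult_assoc\<close>, auto simp: e s A.smult_assoc2)
 thus ?thesis
  by (intro poisson_algebra.intro K.field_axioms poisson_algebra_axioms.intro k_bilinearI)
   (auto simp: e s c pa_add_l[OF A] pa_add_r[OF A] pa_smult_l[OF A] pa_smult_r[OF A] A.leibniz A.jacobi A.bracket_self)
qed

subsection \<open>The universal enveloping algebra\<close>

text \<open>A pair of maps into T obeying the defining relations of A^e, that is, an algebra map A^e
  \<rightarrow> T given on generators. The commutator relations are written without subtraction, as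
  rules that move h to the right.\<close>

definition env_rep :: "('k, 'a, 'z) poisson_scheme => ('k, 't, 'y) module_scheme => ('a => 't) => ('a => 't) => bool"
 where "env_rep A T \<mu> \<eta> \<longleftrightarrow> lin A T \<mu> & lin A T \<eta> & \<mu> 1\<^sub>A = 1\<^sub>T &
  (\<forall>x\<in>carrier A. \<forall>y\<in>carrier A. \<mu> (x *\<^sub>A y) = \<mu> x *\<^sub>T \<mu> y &
   \<eta> x *\<^sub>T \<eta> y = \<eta> y *\<^sub>T \<eta> x +\<^sub>T \<eta> {x, y}\<^sub>A &
   \<eta> (x *\<^sub>A y) = \<mu> y *\<^sub>T \<eta> x +\<^sub>T \<mu> x *\<^sub>T \<eta> y &
   \<eta> x *\<^sub>T \<mu> y = \<mu> y *\<^sub>T \<eta> x +\<^sub>T \<mu> {x, y}\<^sub>A)"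

lemma env_repD:
 assumes "env_rep A T \<mu> \<eta>"
 shows "lin A T \<mu>" "lin A T \<eta>" "\<mu> 1\<^sub>A = 1\<^sub>T"
  "x\<in>|A| ==> y\<in>|A| ==> \<mu> (x *\<^sub>A y) = \<mu> x *\<^sub>T \<mu> y"
  "x\<in>|A| ==> y\<in>|A| ==> \<eta> x *\<^sub>T \<eta> y = \<eta> y *\<^sub>T \<eta> x +\<^sub>T \<eta> {x, y}\<^sub>A"
  "x\<in>|A| ==> y\<in>|A| ==> \<eta> (x *\<^sub>A y) = \<mu> y *\<^sub>T \<eta> x +\<^sub>T \<mu> x *\<^sub>T \<eta> y"
  "x\<in>|A| ==> y\<in>|A| ==> \<eta> x *\<^sub>T \<mu> y = \<mu> y *\<^sub>T \<eta> x +\<^sub>T \<mu> {x, y}\<^sub>A"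
 using assms unfolding env_rep_def by blast+

text \<open>The rule for h_{xy} at x = y = 1 reads h_1 = h_1 + h_1.\<close>

lemma env_rep_one:
 assumes r: "env_rep A T \<mu> \<eta>" and A: "poisson_algebra K A" and T: "k_algebra K T"
 shows "\<eta> 1\<^sub>A = 0\<^sub>T"
proof -
 have o: "1\<^sub>A\<in>|A|" using A by simp
 note c = lin_closed[OF env_repD(2)[OF r] o] and Tm = alg_module[OF T]
 have "\<eta> 1\<^sub>A +\<^sub>T 0\<^sub>T = \<eta> 1\<^sub>A" by (rule v_zero(2)[OF Tm c])
 also have "... = \<eta> (1\<^sub>A *\<^sub>A 1\<^sub>A)" unfolding alg_one(1)[OF pa_algebra[OF A] o] ..
 also have "... = \<eta> 1\<^sub>A +\<^sub>T \<eta> 1\<^sub>A"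
  unfolding env_repD(6)[OF r o o] env_repD(3)[OF r] alg_one(1)[OF T c] ..
 finally show ?thesis using v_cancel_l[OF Tm c v_zero_closed[OF Tm] c] by simp
qed

context
 fixes A :: "('k, 'a, 'z) poisson_scheme"
 assumes A: "poisson_algebra K A"
begin

abbreviation (input) "envS \<equiv> Inl ` |A| \<union> Inr ` |A|"

lemma env_free_algebra: "k_algebra K (env_free K A)"
 unfolding env_free_def by (rule free_algebra_algebra)

lemma env_delta_closed: "s\<in>envS ==> delta K [s]\<in>|env_free K A|"
 unfolding env_free_def by auto

lemma env_rel_carrier: "env_relations K A\<subseteq>|env_free K A|"
 using env_free_algebra A unfolding env_relations_def Let_def
 by (auto intro!: v_minus_closed v_add_closed v_smult_closed alg_mult_closed env_delta_closed alg_module)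

lemma env_ideal_ideal: "ideal (env_ideal K A) (env_free K A)"
 unfolding env_ideal_def by (rule ring.genideal_ideal[OF alg_ring[OF env_free_algebra] env_rel_carrier])

lemma env_algebra: "k_algebra K (env K A)"
 unfolding env_def by (rule alg_quot(1)[OF env_free_algebra env_ideal_ideal])

lemma env_cls_hom: "alg_hom (env_free K A) (env K A) (%F. env_ideal K A +>\<^sub>(env_free K A) F)"
 unfolding alg_hom_def env_def
 using alg_quot(2)[OF env_free_algebra env_ideal_ideal]
  quot_cls_lin[OF alg_module[OF env_free_algebra] alg_ideal_sub[OF env_free_algebra env_ideal_ideal]]
 by (simp add: quot_simps)

lemma env_m_h_rep: "env_rep A (env K A) (env_m K A) (env_h K A)"
proof -
 let ?F = "env_free K A" and ?I = "env_ideal K A" and ?E = "env K A"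
 let ?c = "%F. ?I +>\<^sub>?F F"
 note Fa = env_free_algebra and h = env_cls_hom
 note Fm = alg_module[OF Fa] and Em = alg_module[OF env_algebra]
 note Is = alg_ideal_sub[OF Fa env_ideal_ideal]
 define m where "m a = delta K [Inl a :: 'a + 'a]" for a
 define e where "e a = delta K [Inr a :: 'a + 'a]" for a
 have mc: "m a\<in>|?F|" "e a\<in>|?F|" if "a\<in>|A|" for a
  unfolding m_def e_def using that by (auto intro!: env_delta_closed)
 have M: "env_m K A a = ?c (m a)" "env_h K A a = ?c (e a)" for a by (auto simp: env_m_def env_h_def m_def e_def)
 have rel: "?c X = ?c Y" if "X\<in>|?F|" "Y\<in>|?F|" "X -\<^sub>?F Y\<in>env_relations K A" for X Y
  using coset_eq[OF Fm Is that(1,2)] that(3) ring.genideal_self[OF alg_ring[OF Fa] env_rel_carrier] unfolding env_ideal_def by blast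
 note r = env_relations_def[of K A, unfolded Let_def, folded m_def e_def]
 note cl = v_add_closed[OF Fm] v_smult_closed[OF Fm] v_minus_closed[OF Fm] alg_mult_closed[OF Fa]
 note hm = hom_add[OF h] hom_smult[OF h] hom_mult[OF h] lin_minus[OF hom_lin[OF h] Fm Em]
 have Ac [simp]: "k_algebra K A" "vs A" using A by auto
 have lin: "lin A ?E (env_m K A)" "lin A ?E (env_h K A)"
 proof -
  have 1: "?c (m (x +\<^sub>A y)) = ?c (m x) +\<^sub>?E ?c (m y)" if "x\<in>|A|" "y\<in>|A|" for x y
  proof -
   have "?c (m (x +\<^sub>A y)) = ?c (m x +\<^sub>?F m y)" using that by (intro rel cl mc) (auto simp: r)
   also have "... = ?c (m x) +\<^sub>?E ?c (m y)" by (rule hom_add[OF h mc(1)[OF that(1)] mc(1)[OF that(2)]])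
   finally show ?thesis .
  qed
  have 2: "?c (e (x +\<^sub>A y)) = ?c (e x) +\<^sub>?E ?c (e y)" if "x\<in>|A|" "y\<in>|A|" for x y
  proof -
   have "e (x +\<^sub>A y) -\<^sub>?F (e x +\<^sub>?F e y)\<in>env_relations K A" unfolding r using that by blast
   hence "?c (e (x +\<^sub>A y)) = ?c (e x +\<^sub>?F e y)" using that mc(2) Fm by (intro rel) simp_all
   also have "... = ?c (e x) +\<^sub>?E ?c (e y)" by (rule hom_add[OF h mc(2)[OF that(1)] mc(2)[OF that(2)]])
   finally show ?thesis .
  qed
  have 3: "?c (m (k \<odot>\<^sub>A x)) = k \<odot>\<^sub>?E ?c (m x)" if "k\<in>|K|" "x\<in>|A|" for k x
  proof -
   have "m (k \<odot>\<^sub>A x) -\<^sub>?F (k \<odot>\<^sub>?F m x)\<in>env_relations K A" unfolding r using that by blast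
   hence "?c (m (k \<odot>\<^sub>A x)) = ?c (k \<odot>\<^sub>?F m x)" using that mc Fm by (intro rel) simp_all
   also have "... = k \<odot>\<^sub>?E ?c (m x)" by (rule hom_smult[OF h that(1) mc(1)[OF that(2)]])
   finally show ?thesis .
  qed
  have 4: "?c (e (k \<odot>\<^sub>A x)) = k \<odot>\<^sub>?E ?c (e x)" if "k\<in>|K|" "x\<in>|A|" for k x
  proof -
   have "e (k \<odot>\<^sub>A x) -\<^sub>?F (k \<odot>\<^sub>?F e x)\<in>env_relations K A" unfolding r using that by blast
   hence "?c (e (k \<odot>\<^sub>A x)) = ?c (k \<odot>\<^sub>?F e x)" using that mc Fm by (intro rel) simp_all
   also have "... = k \<odot>\<^sub>?E ?c (e x)" by (rule hom_smult[OF h that(1) mc(2)[OF that(2)]])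
   finally show ?thesis .
  qed
  show "lin A ?E (env_m K A)" unfolding M by (rule k_linearI[OF hom_closed[OF h mc(1)] 1 3])
  show "lin A ?E (env_h K A)" unfolding M by (rule k_linearI[OF hom_closed[OF h mc(2)] 2 4])
 qed
 have one: "?c (m 1\<^sub>A) = ?c 1\<^sub>?F"
  by (intro rel cl mc alg_one_closed[OF Fa]) (auto simp: r)
 have "env_m K A (x *\<^sub>A y) = env_m K A x *\<^sub>?E env_m K A y &
   env_h K A x *\<^sub>?E env_h K A y = env_h K A y *\<^sub>?E env_h K A x +\<^sub>?E env_h K A {x, y}\<^sub>A &
   env_h K A (x *\<^sub>A y) = env_m K A y *\<^sub>?E env_h K A x +\<^sub>?E env_m K A x *\<^sub>?E env_h K A y &
   env_h K A x *\<^sub>?E env_m K A y = env_m K A y *\<^sub>?E env_h K A x +\<^sub>?E env_m K A {x, y}\<^sub>A"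
  if xy: "x\<in>|A|" "y\<in>|A|" for x y
 proof -
  have "x *\<^sub>A y\<in>|A|" "{x, y}\<^sub>A\<in>|A|" using xy A by auto
  note c = mc[OF xy(1)] mc[OF xy(2)] this[THEN mc(1)] this[THEN mc(2)]
  have "m (x *\<^sub>A y) -\<^sub>?F (m x *\<^sub>?F m y)\<in>env_relations K A" unfolding r using xy by blast
  hence 1: "?c (m (x *\<^sub>A y)) = ?c (m x *\<^sub>?F m y)" using c A Fa Fm by (intro rel) simp_all
  have "e {x, y}\<^sub>A -\<^sub>?F (e x *\<^sub>?F e y -\<^sub>?F e y *\<^sub>?F e x)\<in>env_relations K A" unfolding r using xy by blast
  hence 2: "?c (e {x, y}\<^sub>A) = ?c (e x *\<^sub>?F e y -\<^sub>?F e y *\<^sub>?F e x)" using c A Fa Fm by (intro rel) simp_all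
  have "e (x *\<^sub>A y) -\<^sub>?F (m y *\<^sub>?F e x +\<^sub>?F m x *\<^sub>?F e y)\<in>env_relations K A" unfolding r using xy by blast
  hence 3: "?c (e (x *\<^sub>A y)) = ?c (m y *\<^sub>?F e x +\<^sub>?F m x *\<^sub>?F e y)" using c A Fa Fm by (intro rel) simp_all
  have "m {x, y}\<^sub>A -\<^sub>?F (e x *\<^sub>?F m y -\<^sub>?F m y *\<^sub>?F e x)\<in>env_relations K A" unfolding r using xy by blast
  hence 4: "?c (m {x, y}\<^sub>A) = ?c (e x *\<^sub>?F m y -\<^sub>?F m y *\<^sub>?F e x)" using c A Fa Fm by (intro rel) simp_all
  note hc = hom_closed[OF h] and Ea = env_algebra
  have "?c (e y) *\<^sub>?E ?c (e x) +\<^sub>?E ?c (e {x, y}\<^sub>A) = ?c (e x) *\<^sub>?E ?c (e y)"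
   unfolding 2 using c xy hc Ea Fa Em v_comm[OF Em, of "?c (e y) *\<^sub>?E ?c (e x)"] by (simp add: hm)
  moreover have "?c (m y) *\<^sub>?E ?c (e x) +\<^sub>?E ?c (m {x, y}\<^sub>A) = ?c (e x) *\<^sub>?E ?c (m y)"
   unfolding 4 using c xy hc Ea Fa Em v_comm[OF Em, of "?c (m y) *\<^sub>?E ?c (e x)"] by (simp add: hm)
  ultimately show ?thesis unfolding M 1 3 using c xy Fa by (simp add: hm)
 qed
 moreover have "env_m K A 1\<^sub>A = 1\<^sub>?E" unfolding M one by (rule hom_one[OF h])
 ultimately show ?thesis unfolding env_rep_def using lin by blast
qed

lemmas env_m_lin = env_repD(1)[OF env_m_h_rep]
lemmas env_h_lin = env_repD(2)[OF env_m_h_rep]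
lemmas env_m_closed = lin_closed[OF env_m_lin]
lemmas env_h_closed = lin_closed[OF env_h_lin]
lemmas env_m_one = env_repD(3)[OF env_m_h_rep]

text \<open>Left multiplication by generators, starting from 1, produces all words, and the classes
  of words span A^e.\<close>

lemma env_induct [consumes 1, case_names one add smult m h]:
 assumes "S\<in>|env K A|"
  and one: "P 1\<^sub>(env K A)"
  and add: "!!x y. x\<in>|env K A| ==> y\<in>|env K A| ==> P x ==> P y ==> P (x +\<^sub>(env K A) y)"
  and smult: "!!k x. k\<in>|K| ==> x\<in>|env K A| ==> P x ==> P (k \<odot>\<^sub>(env K A) x)"
  and m: "!!a x. a\<in>|A| ==> x\<in>|env K A| ==> P x ==> P (env_m K A a *\<^sub>(env K A) x)"
  and e: "!!a x. a\<in>|A| ==> x\<in>|env K A| ==> P x ==> P (env_h K A a *\<^sub>(env K A) x)"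
 shows "P S"
proof -
 let ?F = "env_free K A" and ?I = "env_ideal K A" and ?E = "env K A"
 let ?c = "%F. ?I +>\<^sub>?F F"
 note h = env_cls_hom
 obtain F where F: "F\<in>|?F|" "S = ?c F" using assms(1) by (auto simp: env_def quot_carrier)
 have ad: "k_algebra K ?E" "vs ?E" "vs ?F" using env_algebra env_free_algebra by auto
 have one': "1\<^sub>?F = delta K []" by (simp add: env_free_def)
 have W: "delta K w\<in>|?F|" if "w\<in>lists envS" for w using that by (simp add: env_free_def)
 have "P (?c (delta K w))" if "w\<in>lists envS" for w
  using that
 proof (induction w)
  case Nil
  thus ?case using one hom_one[OF h] one' by simp
 next
  case (Cons s w)
  hence s: "s\<in>envS" "w\<in>lists envS" and IH: "P (?c (delta K w))" by auto
  have "delta K (s # w) = delta K [s] *\<^sub>?F delta K w" unfolding env_free_def by (simp add: free_alg_delta)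
  hence "?c (delta K (s # w)) = ?c (delta K [s]) *\<^sub>?E ?c (delta K w)"
   using hom_mult[OF h W W, of "[s]" w] s by simp
  thus ?case using s m[OF _ hom_closed[OF h W[OF s(2)]] IH] e[OF _ hom_closed[OF h W[OF s(2)]] IH]
   by (auto simp: env_m_def env_h_def)
 qed
 note Pw = this
 have P0: "P (0\<^sub>?E)" using smult[OF K.zero_closed _ one] ad by simp
 have e: "|?F| = |free (lists envS)|" "add ?F = add (free (lists envS))"
  "smult ?F = smult (free (lists envS))" "zero ?F = zero (free (lists envS))" by (simp_all add: env_free_def)
 have "P (?c F)" if "F\<in>|free (lists envS)|" for F
  using that
 proof (induction rule: free_induct)
  case (3 F G)
  thus ?case using add[OF hom_closed[OF h] hom_closed[OF h]] hom_add[OF h, of F G] by (simp add: e)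
 next
  case (4 k F)
  thus ?case using smult[OF _ hom_closed[OF h]] hom_smult[OF h, of k F] by (simp add: e)
 qed (use Pw P0 lin_zero[OF hom_lin[OF h] ad(3,2)] e in auto)
 thus ?thesis using F by (simp add: env_free_def)
qed

text \<open>The universal property: the map induced on words is an algebra map whose kernel is an
  ideal containing the relations, so it is constant on the cosets of
  \<open>env_ideal\<close>.\<close>

lemma env_lift_hom:
 assumes T: "k_algebra K T" and r: "env_rep A T \<mu> \<eta>"
 shows "alg_hom (env K A) T (env_lift K T \<mu> \<eta>)"
  "a\<in>|A| ==> env_lift K T \<mu> \<eta> (env_m K A a) = \<mu> a"
  "a\<in>|A| ==> env_lift K T \<mu> \<eta> (env_h K A a) = \<eta> a"
proof -
 let ?F = "env_free K A" and ?I = "env_ideal K A" and ?E = "env K A"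
 let ?c = "%F. ?I +>\<^sub>?F F"
 let ?p = "%w. foldr (%s t. case_sum \<mu> \<eta> s *\<^sub>T t) w 1\<^sub>T"
 let ?f = "fs_lift T ?p"
 note Fa = env_free_algebra
 note Fm = alg_module[OF Fa] and Tm = alg_module[OF T]
 note Is = alg_ideal_sub[OF Fa env_ideal_ideal]
 have cs: "case_sum \<mu> \<eta> s\<in>|T|" if "s\<in>envS" for s
  using that lin_closed[OF env_repD(1)[OF r]] lin_closed[OF env_repD(2)[OF r]] by auto
 have f: "alg_hom ?F T ?f" unfolding env_free_def by (rule free_lift_hom(1)[OF T cs])
 note fl = hom_lin[OF f]
 have d: "?f (delta K [s]) = case_sum \<mu> \<eta> s" if "s\<in>envS" for s
  using free_lift_hom(2)[of T envS "case_sum \<mu> \<eta>" "[s]", OF T cs] that cs[OF that] T by simp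
 have dm: "?f (delta K [Inl a]) = \<mu> a" "?f (delta K [Inr a]) = \<eta> a" if "a\<in>|A|" for a using d that by auto
 note rc = lin_closed[OF env_repD(1)[OF r]] lin_closed[OF env_repD(2)[OF r]]
 have kI: "ideal {F\<in>carrier ?F. ?f F = 0\<^sub>T} ?F"
 proof -
  interpret F: ring ?F by (rule alg_ring[OF Fa])
  interpret T: ring T by (rule alg_ring[OF T])
  have "?f\<in>ring_hom ?F T" using f unfolding alg_hom_def k_linear_def ring_hom_def by auto
  then interpret f: ring_hom_ring ?F T ?f by unfold_locales
  show ?thesis using f.kernel_is_ideal unfolding a_kernel_def' .
 qed
 have Ac [simp]: "k_algebra K A" "vs A" using A by auto
 note dc = env_delta_closed
 have dcm: "delta K [Inl a]\<in>|?F|" "delta K [Inr a]\<in>|?F|" if "a\<in>|A|" for a using dc that by auto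
 note hm = lin_minus[OF fl Fm Tm] hom_add[OF f] hom_smult[OF f] hom_mult[OF f] hom_one[OF f]
  lin_add[OF env_repD(1)[OF r]] lin_add[OF env_repD(2)[OF r]] lin_smult[OF env_repD(1)[OF r]] lin_smult[OF env_repD(2)[OF r]]
  env_repD(3,4,6)[OF r]
 have "\<mu> {x, y}\<^sub>A = \<eta> x *\<^sub>T \<mu> y -\<^sub>T \<mu> y *\<^sub>T \<eta> x & \<eta> {x, y}\<^sub>A = \<eta> x *\<^sub>T \<eta> y -\<^sub>T \<eta> y *\<^sub>T \<eta> x"
  if "x\<in>|A|" "y\<in>|A|" for x y
  using env_repD(5,7)[OF r that] that rc A T by (simp add: v_comm[OF Tm, of "_ *\<^sub>T _" "\<mu> _"] v_comm[OF Tm, of "_ *\<^sub>T _" "\<eta> _"])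
 note br = this
 have "env_relations K A\<subseteq>{F\<in>carrier ?F. ?f F = 0\<^sub>T}"
  unfolding env_relations_def Let_def
  using A Fa Fm T Tm
  by (auto simp: hm dm dcm rc br env_repD(1,2)[OF r])
 hence z: "?f F = 0\<^sub>T" if "F\<in>?I" for F
  using that ring.genideal_minimal[OF alg_ring[OF Fa] kI] unfolding env_ideal_def by blast
 have l: "env_lift K T \<mu> \<eta> S = the_elem (?f ` S)" for S unfolding env_lift_def fs_lift_def ..
 have lc: "env_lift K T \<mu> \<eta> (?c F) = ?f F" if "F\<in>|?F|" for F
  unfolding l by (rule quot_lift_cls[OF Fm Is fl Tm z that])
 have lin: "lin ?E T (env_lift K T \<mu> \<eta>)"
  unfolding l env_def by (rule quot_lift_lin[OF Fm Is fl Tm z])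
 show "alg_hom ?E T (env_lift K T \<mu> \<eta>)" unfolding alg_hom_def
 proof (intro conjI ballI lin)
  show "env_lift K T \<mu> \<eta> 1\<^sub>?E = 1\<^sub>T" using lc[of "1\<^sub>?F"] hom_one[OF f] hom_one[OF env_cls_hom] Fa by simp
  fix x y assume "x\<in>|?E|" "y\<in>|?E|"
  then obtain F G where FG: "F\<in>|?F|" "x = ?c F" "G\<in>|?F|" "y = ?c G" by (auto simp: env_def quot_carrier)
  thus "env_lift K T \<mu> \<eta> (x *\<^sub>?E y) = env_lift K T \<mu> \<eta> x *\<^sub>T env_lift K T \<mu> \<eta> y"
   using Fa by (simp add: hom_mult[OF env_cls_hom, symmetric] lc hom_mult[OF f])
 qed
 show "a\<in>|A| ==> env_lift K T \<mu> \<eta> (env_m K A a) = \<mu> a"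
  using lc dcm dm by (simp add: env_m_def)
 show "a\<in>|A| ==> env_lift K T \<mu> \<eta> (env_h K A a) = \<eta> a"
  using lc dcm dm by (simp add: env_h_def)
qed

lemma env_hom_eq:
 assumes T: "k_algebra K T" and f: "alg_hom (env K A) T f" and g: "alg_hom (env K A) T g"
  and m: "!!a. a\<in>|A| ==> f (env_m K A a) = g (env_m K A a)"
  and h: "!!a. a\<in>|A| ==> f (env_h K A a) = g (env_h K A a)"
  and x: "x\<in>|env K A|"
 shows "f x = g x"
 using x
 by (induction rule: env_induct)
  (simp_all add: hom_one[OF f] hom_one[OF g] hom_add[OF f] hom_add[OF g] hom_smult[OF f] hom_smult[OF g]
   hom_mult[OF f] hom_mult[OF g] env_m_closed env_h_closed m h)

end

definition poisson_hom :: "('k, 'a, 'z) poisson_scheme => ('k, 'b, 'y) poisson_scheme => ('a => 'b) => bool"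
 where "poisson_hom A B f \<longleftrightarrow> alg_hom A B f & (\<forall>x\<in>carrier A. \<forall>y\<in>carrier A. f {x, y}\<^sub>A = {f x, f y}\<^sub>B)"

lemma env_rep_comp:
 assumes f: "poisson_hom A B f" and r: "env_rep B T \<mu> \<eta>"
 shows "env_rep A T (%x. \<mu> (f x)) (%x. \<eta> (f x))"
proof -
 have h: "alg_hom A B f" and br: "!!x y. x\<in>|A| ==> y\<in>|A| ==> f {x, y}\<^sub>A = {f x, f y}\<^sub>B"
  using f by (auto simp: poisson_hom_def)
 note c = hom_closed[OF h]
 show ?thesis unfolding env_rep_def
 proof (intro conjI ballI)
  fix x y assume xy: "x\<in>|A|" "y\<in>|A|"
  note d = c[OF xy(1)] c[OF xy(2)]
  note e = br[OF xy] hom_mult[OF h xy]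
  show "\<mu> (f (x *\<^sub>A y)) = \<mu> (f x) *\<^sub>T \<mu> (f y)" unfolding e by (rule env_repD(4)[OF r d])
  show "\<eta> (f x) *\<^sub>T \<eta> (f y) = \<eta> (f y) *\<^sub>T \<eta> (f x) +\<^sub>T \<eta> (f {x, y}\<^sub>A)" unfolding e by (rule env_repD(5)[OF r d])
  show "\<eta> (f (x *\<^sub>A y)) = \<mu> (f y) *\<^sub>T \<eta> (f x) +\<^sub>T \<mu> (f x) *\<^sub>T \<eta> (f y)" unfolding e by (rule env_repD(6)[OF r d])
  show "\<eta> (f x) *\<^sub>T \<mu> (f y) = \<mu> (f y) *\<^sub>T \<eta> (f x) +\<^sub>T \<mu> (f {x, y}\<^sub>A)" unfolding e by (rule env_repD(7)[OF r d])
 qed (use lin_comp[OF hom_lin[OF h]] env_repD(1-3)[OF r] hom_one[OF h] in auto)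
qed

lemma env_map_hom:
 assumes A: "poisson_algebra K A" and B: "poisson_algebra K B" and f: "poisson_hom A B f"
 shows "alg_hom (env K A) (env K B) (env_map K B f)"
  "a\<in>|A| ==> env_map K B f (env_m K A a) = env_m K B (f a)"
  "a\<in>|A| ==> env_map K B f (env_h K A a) = env_h K B (f a)"
 unfolding env_map_def
 using env_lift_hom[OF A env_algebra[OF B] env_rep_comp[OF f env_m_h_rep[OF B]]] by auto

end

context base
begin

subsection \<open>Extending relations of the enveloping algebra along products\<close>

text \<open>The commutator relations for a single pair of elements, isolated so that they can be
  spread from generators to products one argument at a time.\<close>

definition rel_hm :: "('k, 'a, 'z) poisson_scheme => ('k, 't, 'y) module_scheme => ('a => 't) => ('a => 't) => 'a => 'a => bool"
 where "rel_hm A T \<mu> \<eta> x y \<longleftrightarrow> \<eta> x *\<^sub>T \<mu> y = \<mu> y *\<^sub>T \<eta> x +\<^sub>T \<mu> {x, y}\<^sub>A"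

definition rel_hh :: "('k, 'a, 'z) poisson_scheme => ('k, 't, 'y) module_scheme => ('a => 't) => 'a => 'a => bool"
 where "rel_hh A T \<eta> x y \<longleftrightarrow> \<eta> x *\<^sub>T \<eta> y = \<eta> y *\<^sub>T \<eta> x +\<^sub>T \<eta> {x, y}\<^sub>A"

context
 fixes A :: "('k, 'a, 'z) poisson_scheme" and T :: "('k, 't, 'y) module_scheme" and \<mu> \<eta>
 assumes A: "poisson_algebra K A" and T: "k_algebra K T"
  and \<mu>: "lin A T \<mu>" and \<eta>: "lin A T \<eta>"
  and mm: "!!x y. x\<in>|A| ==> y\<in>|A| ==> \<mu> (x *\<^sub>A y) = \<mu> x *\<^sub>T \<mu> y"
  and hm: "!!x y. x\<in>|A| ==> y\<in>|A| ==> \<eta> (x *\<^sub>A y) = \<mu> y *\<^sub>T \<eta> x +\<^sub>T \<mu> x *\<^sub>T \<eta> y"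
begin

private lemma Tm: "vs T" using T by simp
private lemmas mc = lin_closed[OF \<mu>]
private lemmas hc = lin_closed[OF \<eta>]
private lemmas la = lin_add[OF \<mu>] lin_add[OF \<eta>]
private lemmas ac = v_assoc[OF Tm] v_comm[OF Tm] v_lcomm[OF Tm]
private lemmas cl = mc hc alg_mult_closed[OF T] v_add_closed[OF Tm]

lemma mu_comm:
 assumes "x\<in>|A|" "y\<in>|A|"
 shows "\<mu> x *\<^sub>T \<mu> y = \<mu> y *\<^sub>T \<mu> x"
 using mm[OF assms] mm[OF assms(2,1)] pa_comm[OF A assms] by simp

text \<open>The commutator with \<eta> x and the bracket with x obey the same Leibniz rule.\<close>

lemma rel_hm_prod_r:
 assumes x: "x\<in>|A|" "y\<in>|A|" "z\<in>|A|" and r: "rel_hm A T \<mu> \<eta> x y" "rel_hm A T \<mu> \<eta> x z"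
 shows "rel_hm A T \<mu> \<eta> x (y *\<^sub>A z)"
proof -
 have b: "{x, y}\<^sub>A\<in>|A|" "{x, z}\<^sub>A\<in>|A|" using A x by auto
 note c = cl x b
 have "\<eta> x *\<^sub>T \<mu> (y *\<^sub>A z) = (\<eta> x *\<^sub>T \<mu> y) *\<^sub>T \<mu> z" using c by (simp add: mm alg_assoc[OF T])
 also have "... = \<mu> y *\<^sub>T (\<eta> x *\<^sub>T \<mu> z) +\<^sub>T \<mu> {x, y}\<^sub>A *\<^sub>T \<mu> z"
  unfolding r(1)[unfolded rel_hm_def] using c by (simp add: alg_ldistr[OF T] alg_assoc[OF T])
 also have "... = \<mu> (y *\<^sub>A z) *\<^sub>T \<eta> x +\<^sub>T \<mu> {x, y *\<^sub>A z}\<^sub>A"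
  unfolding r(2)[unfolded rel_hm_def] using c A
  by (simp add: alg_rdistr[OF T] alg_assoc[OF T] pa_leibniz_r[OF A] la mm ac)
 finally show ?thesis unfolding rel_hm_def .
qed

lemma rel_hm_prod_l:
 assumes x: "x\<in>|A|" "y\<in>|A|" "z\<in>|A|" and r: "rel_hm A T \<mu> \<eta> y x" "rel_hm A T \<mu> \<eta> z x"
 shows "rel_hm A T \<mu> \<eta> (y *\<^sub>A z) x"
proof -
 have b: "{y, x}\<^sub>A\<in>|A|" "{z, x}\<^sub>A\<in>|A|" using A x by auto
 note c = cl x b
 have "\<eta> (y *\<^sub>A z) *\<^sub>T \<mu> x = \<mu> z *\<^sub>T (\<eta> y *\<^sub>T \<mu> x) +\<^sub>T \<mu> y *\<^sub>T (\<eta> z *\<^sub>T \<mu> x)"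
  using c by (simp add: hm alg_ldistr[OF T] alg_assoc[OF T])
 also have "... = ((\<mu> z *\<^sub>T \<mu> x) *\<^sub>T \<eta> y +\<^sub>T \<mu> z *\<^sub>T \<mu> {y, x}\<^sub>A) +\<^sub>T ((\<mu> y *\<^sub>T \<mu> x) *\<^sub>T \<eta> z +\<^sub>T \<mu> y *\<^sub>T \<mu> {z, x}\<^sub>A)"
  unfolding r[unfolded rel_hm_def] using c by (simp add: alg_rdistr[OF T] alg_assoc[OF T])
 also have "... = \<mu> x *\<^sub>T \<eta> (y *\<^sub>A z) +\<^sub>T \<mu> {y *\<^sub>A z, x}\<^sub>A"
  unfolding mu_comm[OF x(3,1)] mu_comm[OF x(2,1)] mu_comm[OF x(3) b(1)]
  using c A by (simp add: alg_rdistr[OF T] alg_assoc[OF T] pa_leibniz_l[OF A] la mm hm ac)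
 finally show ?thesis unfolding rel_hm_def .
qed

text \<open>Expanding \<eta> (y z) forces \<eta> x past \<mu> y and \<mu> z as well, which is why
  the mixed relations enter.\<close>

lemma rel_hh_prod_r:
 assumes x: "x\<in>|A|" "y\<in>|A|" "z\<in>|A|" and m: "rel_hm A T \<mu> \<eta> x y" "rel_hm A T \<mu> \<eta> x z" and r: "rel_hh A T \<eta> x y" "rel_hh A T \<eta> x z"
 shows "rel_hh A T \<eta> x (y *\<^sub>A z)"
proof -
 have b: "{x, y}\<^sub>A\<in>|A|" "{x, z}\<^sub>A\<in>|A|" using A x by auto
 note c = cl x b
 have "\<eta> x *\<^sub>T \<eta> (y *\<^sub>A z) = (\<eta> x *\<^sub>T \<mu> z) *\<^sub>T \<eta> y +\<^sub>T (\<eta> x *\<^sub>T \<mu> y) *\<^sub>T \<eta> z"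
  using c by (simp add: hm alg_rdistr[OF T] alg_assoc[OF T])
 also have "... = (\<mu> z *\<^sub>T (\<eta> x *\<^sub>T \<eta> y) +\<^sub>T \<mu> {x, z}\<^sub>A *\<^sub>T \<eta> y) +\<^sub>T (\<mu> y *\<^sub>T (\<eta> x *\<^sub>T \<eta> z) +\<^sub>T \<mu> {x, y}\<^sub>A *\<^sub>T \<eta> z)"
  unfolding m[unfolded rel_hm_def] using c by (simp add: alg_ldistr[OF T] alg_assoc[OF T])
 also have "... = \<eta> (y *\<^sub>A z) *\<^sub>T \<eta> x +\<^sub>T \<eta> {x, y *\<^sub>A z}\<^sub>A"
  unfolding r[unfolded rel_hh_def] using c A
  by (simp add: alg_rdistr[OF T] alg_ldistr[OF T] alg_assoc[OF T] pa_leibniz_r[OF A] la mm hm ac)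
 finally show ?thesis unfolding rel_hh_def .
qed

lemma rel_hh_sym:
 assumes x: "x\<in>|A|" "y\<in>|A|" and r: "rel_hh A T \<eta> x y"
 shows "rel_hh A T \<eta> y x"
proof -
 have b: "{x, y}\<^sub>A\<in>|A|" using A x by auto
 have "\<eta> {y, x}\<^sub>A = \<ominus>\<^sub>T \<eta> {x, y}\<^sub>A"
  using lin_neg[OF \<eta> _ Tm b] pa_anti[OF A x(2,1)] A by simp
 thus ?thesis using cl x b Tm unfolding rel_hh_def r[unfolded rel_hh_def] by (simp add: v_assoc[OF Tm])
qed

lemma rel_sub:
 assumes x: "x\<in>|A|"
 shows "sub {y\<in>carrier A. rel_hm A T \<mu> \<eta> x y} A" "sub {y\<in>carrier A. rel_hm A T \<mu> \<eta> y x} A"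
  "sub {y\<in>carrier A. rel_hh A T \<eta> x y} A"
proof -
 have Am: "vs A" using A by simp
 note bt = alg_bilinear[OF T] and br = pa_bilinear[OF A]
 show "sub {y\<in>carrier A. rel_hm A T \<mu> \<eta> x y} A" unfolding rel_hm_def
  by (rule sub_eq[OF lin_comp[OF \<mu> bil_right[OF bt hc[OF x]]]
   lin_plus[OF Tm lin_comp[OF \<mu> bil_left[OF bt hc[OF x]]] lin_comp[OF bil_right[OF br x] \<mu>]] Am Tm])
 show "sub {y\<in>carrier A. rel_hm A T \<mu> \<eta> y x} A" unfolding rel_hm_def
  by (rule sub_eq[OF lin_comp[OF \<eta> bil_left[OF bt mc[OF x]]]
   lin_plus[OF Tm lin_comp[OF \<eta> bil_right[OF bt mc[OF x]]] lin_comp[OF bil_left[OF br x] \<mu>]] Am Tm])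
 show "sub {y\<in>carrier A. rel_hh A T \<eta> x y} A" unfolding rel_hh_def
  by (rule sub_eq[OF lin_comp[OF \<eta> bil_right[OF bt hc[OF x]]]
   lin_plus[OF Tm lin_comp[OF \<eta> bil_left[OF bt hc[OF x]]] lin_comp[OF bil_right[OF br x] \<eta>]] Am Tm])
qed

text \<open>The elements in relation with a fixed one form a subspace that is closed under products,
  so a set X whose pairwise products span A suffices. The mixed relation is spread in the right and
  then in the left argument; the relation between two h is spread on the right only and turned
  around by antisymmetry.\<close>

lemma env_repI:
 assumes one: "\<mu> 1\<^sub>A = 1\<^sub>T"
  and X: "X\<subseteq>|A|" "|A|\<subseteq>span A {x *\<^sub>A y | x y. x\<in>X & y\<in>X}"
  and r: "!!x y. x\<in>X ==> y\<in>X ==> rel_hm A T \<mu> \<eta> x y" "!!x y. x\<in>X ==> y\<in>X ==> rel_hh A T \<eta> x y"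
 shows "env_rep A T \<mu> \<eta>"
proof -
 have X': "x\<in>|A|" if "x\<in>X" for x using that X by auto
 have gen: "y\<in>H" if "sub H A" "!!x z. x\<in>X ==> z\<in>X ==> x *\<^sub>A z\<in>H" "y\<in>|A|" for H y
  using span_least[OF that(1), of "{x *\<^sub>A y | x y. x\<in>X & y\<in>X}"] that(2,3) X(2) by blast
 have m1: "rel_hm A T \<mu> \<eta> x y" if x: "x\<in>X" and y: "y\<in>|A|" for x y
  using gen[OF rel_sub(1)[OF X'[OF x]] _ y] rel_hm_prod_r[OF X'[OF x]] X' r(1) x A by auto
 have m: "rel_hm A T \<mu> \<eta> x y" if x: "x\<in>|A|" and y: "y\<in>|A|" for x y
  using gen[OF rel_sub(2)[OF y] _ x] rel_hm_prod_l[OF y] X' m1 y A by auto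
 have h1: "rel_hh A T \<eta> x y" if x: "x\<in>X" and y: "y\<in>|A|" for x y
  using gen[OF rel_sub(3)[OF X'[OF x]] _ y] rel_hh_prod_r[OF X'[OF x]] m X' r(2) x A by auto
 have h: "rel_hh A T \<eta> x y" if x: "x\<in>|A|" and y: "y\<in>|A|" for x y
 proof (rule rel_hh_sym[OF y x])
  show "rel_hh A T \<eta> y x"
   using gen[OF rel_sub(3)[OF y] _ x] rel_hh_prod_r[OF y] m X' rel_hh_sym[OF X' y h1] y A by auto
 qed
 show ?thesis unfolding env_rep_def using \<mu> \<eta> one mm hm m h unfolding rel_hm_def rel_hh_def by blast
qed

end

lemma env_rep_post:
 assumes r: "env_rep A T \<mu> \<eta>" and f: "alg_hom T T' f" and A: "poisson_algebra K A" and T: "k_algebra K T"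
 shows "env_rep A T' (%x. f (\<mu> x)) (%x. f (\<eta> x))"
 unfolding env_rep_def
proof (intro conjI ballI)
 note c = lin_closed[OF env_repD(1)[OF r]] lin_closed[OF env_repD(2)[OF r]] alg_mult_closed[OF T] alg_mult_closed[OF pa_algebra[OF A]] pa_closed[OF A]
 note fm = hom_mult[OF f] and fa = hom_add[OF f]
 fix x y assume xy: "x\<in>|A|" "y\<in>|A|"
 show "f (\<mu> (x *\<^sub>A y)) = f (\<mu> x) *\<^sub>T' f (\<mu> y)" using env_repD(4)[OF r xy] fm c xy by simp
 show "f (\<eta> x) *\<^sub>T' f (\<eta> y) = f (\<eta> y) *\<^sub>T' f (\<eta> x) +\<^sub>T' f (\<eta> {x, y}\<^sub>A)"
  unfolding fm[OF c(2)[OF xy(1)] c(2)[OF xy(2)], symmetric] env_repD(5)[OF r xy]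
  using xy c by (simp add: fa fm)
 show "f (\<eta> (x *\<^sub>A y)) = f (\<mu> y) *\<^sub>T' f (\<eta> x) +\<^sub>T' f (\<mu> x) *\<^sub>T' f (\<eta> y)" using env_repD(6)[OF r xy] fm fa c xy by simp
 show "f (\<eta> x) *\<^sub>T' f (\<mu> y) = f (\<mu> y) *\<^sub>T' f (\<eta> x) +\<^sub>T' f (\<mu> {x, y}\<^sub>A)"
  unfolding fm[OF c(2)[OF xy(1)] c(1)[OF xy(2)], symmetric] env_repD(7)[OF r xy]
  using xy c by (simp add: fa fm)
qed (use lin_comp[OF env_repD(1)[OF r] hom_lin[OF f]] lin_comp[OF env_repD(2)[OF r] hom_lin[OF f]] env_repD(3)[OF r] hom_one[OF f] in auto)

subsection \<open>Endomorphism algebras and dual numbers\<close>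

text \<open>Endomorphisms are kept extensional, so that two operators agreeing at all vectors of M
  are equal, as the algebra axioms require.\<close>

definition end_alg :: "('k, 'm, 'z) module_scheme => ('k, 'm => 'm) module"
 where "end_alg M = \<lparr>carrier = {f. lin M M f & f\<in>extensional (carrier M)},
  mult = (%f g. restrict (%x. f (g x)) (carrier M)), one = restrict (%x. x) (carrier M),
  zero = restrict (%x. 0\<^sub>M) (carrier M), add = (%f g. restrict (%x. f x +\<^sub>M g x) (carrier M)),
  smult = (%k f. restrict (%x. k \<odot>\<^sub>M f x) (carrier M))\<rparr>"

lemma end_simps:
 "f *\<^sub>(end_alg M) g = restrict (%x. f (g x)) (carrier M)" "1\<^sub>(end_alg M) = restrict (%x. x) (carrier M)"
 "0\<^sub>(end_alg M) = restrict (%x. 0\<^sub>M) (carrier M)"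
 "f +\<^sub>(end_alg M) g = restrict (%x. f x +\<^sub>M g x) (carrier M)"
 "k \<odot>\<^sub>(end_alg M) f = restrict (%x. k \<odot>\<^sub>M f x) (carrier M)"
 by (simp_all add: end_alg_def)

lemma end_carrier: "f\<in>|end_alg M| \<longleftrightarrow> lin M M f & f\<in>extensional (carrier M)"
 by (simp add: end_alg_def)

lemma end_restrict:
 assumes "vs M" "lin M M f"
 shows "restrict f (carrier M)\<in>|end_alg M|"
 unfolding end_carrier using lin_cong[OF assms(2,1), of "restrict f (carrier M)"] by simp

lemma end_eqI:
 assumes "f\<in>|end_alg M|" "g\<in>|end_alg M|" "!!x. x\<in>|M| ==> f x = g x"
 shows "f = g"
 using assms unfolding end_carrier by (auto intro: extensionalityI)

lemma end_algebra:
 assumes M: "vs M"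
 shows "k_algebra K (end_alg M)"
proof -
 note r = end_restrict[OF M]
 let ?E = "end_alg M"
 have l: "lin M M f" if "f\<in>|?E|" for f using that by (simp add: end_carrier)
 have ap: "f x\<in>|M|" if "f\<in>|?E|" "x\<in>|M|" for f x by (rule lin_closed[OF l[OF that(1)] that(2)])
 have ca: "f +\<^sub>?E g\<in>|?E|" if "f\<in>|?E|" "g\<in>|?E|" for f g
  unfolding end_simps by (rule r[OF lin_plus[OF M l l]]) (use that in auto)
 have cm: "f *\<^sub>?E g\<in>|?E|" if "f\<in>|?E|" "g\<in>|?E|" for f g
  unfolding end_simps by (rule r[OF lin_comp[OF l l]]) (use that in auto)
 have cs: "k \<odot>\<^sub>?E g\<in>|?E|" if "k\<in>|K|" "g\<in>|?E|" for k g
  unfolding end_simps by (rule r[OF lin_scale[OF M l]]) (use that in auto)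
 have c0: "0\<^sub>?E\<in>|?E|" unfolding end_simps by (rule r[OF lin_null[OF M]])
 have c1: "1\<^sub>?E\<in>|?E|" unfolding end_simps by (rule r[OF lin_id]) auto
 have e: "(f *\<^sub>?E g) x = f (g x)" "(f +\<^sub>?E g) x = f x +\<^sub>M g x" "(k \<odot>\<^sub>?E f) x = k \<odot>\<^sub>M f x" "1\<^sub>?E x = x" "0\<^sub>?E x = 0\<^sub>M"
  if "x\<in>|M|" for f g x k using that by (simp_all add: end_simps)
 have m: "vs ?E"
 proof (rule moduleI)
  show "abelian_group ?E"
  proof (rule abelian_groupI)
   fix f assume f: "f\<in>|?E|"
   show "f +\<^sub>?E g = g +\<^sub>?E f" if g: "g\<in>|?E|" for g
    by (rule end_eqI[OF ca ca]) (use f g ap in "auto simp: e v_comm[OF M]")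
   show "(f +\<^sub>?E g) +\<^sub>?E h = f +\<^sub>?E (g +\<^sub>?E h)" if g: "g\<in>|?E|" and h: "h\<in>|?E|" for g h
    by (rule end_eqI[of _ M]) (use f g h ca ap in "auto simp: e v_assoc[OF M]")
   show "0\<^sub>?E +\<^sub>?E f = f" by (rule end_eqI[OF ca]) (use f c0 ap M in "auto simp: e")
   have n: "restrict (%x. \<ominus>\<^sub>M f x) (carrier M)\<in>|?E|" by (rule r[OF lin_uminus[OF M l[OF f]]])
   show "\<exists>h\<in>carrier ?E. h +\<^sub>?E f = 0\<^sub>?E"
    by (rule bexI[OF _ n], rule end_eqI[OF ca[OF n f] c0]) (use f ap M in "auto simp: e")
  qed (use ca c0 in auto)
  fix k f assume k: "k\<in>|K|" and f: "f\<in>|?E|"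
  show "(k \<oplus> j) \<odot>\<^sub>?E f = k \<odot>\<^sub>?E f +\<^sub>?E j \<odot>\<^sub>?E f" if "j\<in>|K|" for j
   by (rule end_eqI[of _ M]) (use that f k ca cs ap in "auto simp: e v_smult_ldistr[OF M]")
  show "k \<odot>\<^sub>?E (f +\<^sub>?E g) = k \<odot>\<^sub>?E f +\<^sub>?E k \<odot>\<^sub>?E g" if "g\<in>|?E|" for g
   by (rule end_eqI[of _ M]) (use that f k ca cs ap in "auto simp: e v_smult_rdistr[OF M]")
  show "(k \<otimes> j) \<odot>\<^sub>?E f = k \<odot>\<^sub>?E (j \<odot>\<^sub>?E f)" if "j\<in>|K|" for j
   by (rule end_eqI[of _ M]) (use that f k ca cs ap in "auto simp: e v_smult_assoc[OF M]")
 next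
  fix f assume f: "f\<in>|?E|"
  show "\<one> \<odot>\<^sub>?E f = f"
   by (rule end_eqI[of _ M]) (use f ca cs ap M in "auto simp: e")
 qed (use cs in auto)
 show ?thesis
 proof (rule k_algebraI[OF m cm c1])
  fix f g h assume f: "f\<in>|?E|" and g: "g\<in>|?E|" and h: "h\<in>|?E|"
  show "(f *\<^sub>?E g) *\<^sub>?E h = f *\<^sub>?E (g *\<^sub>?E h)"
   by (rule end_eqI[of _ M]) (use f g h cm ap in "auto simp: e")
 next
  fix f assume f: "f\<in>|?E|"
  show "1\<^sub>?E *\<^sub>?E f = f" "f *\<^sub>?E 1\<^sub>?E = f"
   by (rule end_eqI[of _ M]; use f c1 cm ap in \<open>auto simp: e\<close>)+
 next
  show "bil ?E ?E ?E (%x y. x *\<^sub>?E y)"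
  proof (rule k_bilinearI)
   fix f g h assume f: "f\<in>|?E|" and g: "g\<in>|?E|" and h: "h\<in>|?E|"
   show "(f +\<^sub>?E g) *\<^sub>?E h = f *\<^sub>?E h +\<^sub>?E g *\<^sub>?E h"
    by (rule end_eqI[of _ M]) (use f g h cm ca ap in "auto simp: e")
   show "f *\<^sub>?E (g +\<^sub>?E h) = f *\<^sub>?E g +\<^sub>?E f *\<^sub>?E h"
    by (rule end_eqI[of _ M]) (use f g h cm ca ap in "auto simp: e lin_add[OF l[OF f]]")
  next
   fix k f g assume k: "k\<in>|K|" and f: "f\<in>|?E|" and g: "g\<in>|?E|"
   show "(k \<odot>\<^sub>?E f) *\<^sub>?E g = k \<odot>\<^sub>?E (f *\<^sub>?E g)"
    by (rule end_eqI[of _ M]) (use k f g cm cs ap in "auto simp: e")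
   show "f *\<^sub>?E (k \<odot>\<^sub>?E g) = k \<odot>\<^sub>?E (f *\<^sub>?E g)"
    by (rule end_eqI[of _ M]) (use k f g cm cs ap in "auto simp: e lin_smult[OF l[OF f]]")
  qed (use cm in auto)
 qed
qed

definition lmul :: "('k, 'a, 'z) module_scheme => 'a => 'a => 'a"
 where "lmul A a = restrict (%x. a *\<^sub>A x) (carrier A)"

lemma lmul_hom:
 assumes A: "k_algebra K A"
 shows "alg_hom A (end_alg A) (lmul A)"
proof -
 have c: "lmul A a\<in>|end_alg A|" if "a\<in>|A|" for a
  unfolding lmul_def by (rule end_restrict[OF alg_module[OF A] bil_right[OF alg_bilinear[OF A] that]])
 show ?thesis unfolding alg_hom_def k_linear_def using c A
  by (auto simp: end_simps lmul_def alg_ldistr[OF A] alg_smult[OF A] alg_assoc[OF A] intro!: restrict_ext)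
qed

text \<open>The dual numbers A[e]/(e^2), as pairs. An algebra map from A into them whose first
  component is the identity is the same as a derivation in the second component.\<close>

definition dual :: "('k, 'a, 'z) module_scheme => ('k, 'a \<times> 'a) module"
 where "dual A = \<lparr>carrier = |A| \<times> |A|,
  mult = (%p q. (fst p *\<^sub>A fst q, fst p *\<^sub>A snd q +\<^sub>A snd p *\<^sub>A fst q)), one = (1\<^sub>A, 0\<^sub>A),
  zero = (0\<^sub>A, 0\<^sub>A), add = (%p q. (fst p +\<^sub>A fst q, snd p +\<^sub>A snd q)),
  smult = (%k p. (k \<odot>\<^sub>A fst p, k \<odot>\<^sub>A snd p))\<rparr>"

lemma dual_simps [simp]: "|dual A| = |A| \<times> |A|"
 "p *\<^sub>(dual A) q = (fst p *\<^sub>A fst q, fst p *\<^sub>A snd q +\<^sub>A snd p *\<^sub>A fst q)" "1\<^sub>(dual A) = (1\<^sub>A, 0\<^sub>A)"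
 "0\<^sub>(dual A) = (0\<^sub>A, 0\<^sub>A)" "p +\<^sub>(dual A) q = (fst p +\<^sub>A fst q, snd p +\<^sub>A snd q)"
 "k \<odot>\<^sub>(dual A) p = (k \<odot>\<^sub>A fst p, k \<odot>\<^sub>A snd p)"
 by (simp_all add: dual_def)

lemma dual_algebra:
 assumes A: "k_algebra K A"
 shows "k_algebra K (dual A)"
proof -
 note Am = alg_module[OF A]
 have m: "vs (dual A)"
 proof (rule moduleI)
  show "abelian_group (dual A)"
  proof (rule abelian_groupI)
   fix p assume "p\<in>|dual A|"
   thus "\<exists>q\<in>|dual A|. q +\<^sub>(dual A) p = 0\<^sub>(dual A)"
    using A by (intro bexI[of _ "(\<ominus>\<^sub>A fst p, \<ominus>\<^sub>A snd p)"]) auto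
  qed (use A in "auto simp: v_assoc[OF Am] intro: v_comm[OF Am]")
 qed (use A in "auto simp: v_smult_ldistr[OF Am] v_smult_rdistr[OF Am] v_smult_assoc[OF Am]")
 note ac = v_assoc[OF Am] v_comm[OF Am] v_lcomm[OF Am]
 show ?thesis
 proof (rule k_algebraI[OF m])
  show "bil (dual A) (dual A) (dual A) (%x y. x *\<^sub>(dual A) y)"
   by (rule k_bilinearI) (use A in "auto simp: alg_ldistr[OF A] alg_rdistr[OF A] ac alg_smult[OF A] v_smult_rdistr[OF Am]")
 qed (use A in "auto simp: alg_ldistr[OF A] alg_rdistr[OF A] ac alg_assoc[OF A]")
qed

end

subsection \<open>Poisson algebras graded by a group of units\<close>

text \<open>\<open>C = \<Oplus>\<^sub>g R g\<close> is graded by a group \<open>G\<close> of units with \<open>{g, t} = 0\<close>; \<open>pr g\<close> projects onto \<open>R g\<close>, \<open>gi\<close> is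
  the inverse of \<open>G\<close>, and \<open>H\<close> is the span of \<open>G\<close>. This is all of the Hopf structure of \<open>gr B\<close> that matters
  for the decomposition of the enveloping algebra.\<close>

locale graded_pa = base K for K :: "('k, 'r) ring_scheme" (structure) +
 fixes C :: "('k, 'c, 'z) poisson_scheme" and R :: "('k, 'c, 'y) poisson_scheme" and H :: "('k, 'c, 'x) poisson_hopf_scheme"
  and G :: "'c set" and gi :: "'c => 'c" and pr :: "'c => 'c => 'c"
 assumes C: "poisson_algebra K C"
  and R_sub: "sub (carrier R) C"
  and R_closed: "!!x y. x\<in>|R| ==> y\<in>|R| ==> x *\<^sub>C y\<in>|R|" "1\<^sub>C\<in>|R|"
   "!!x y. x\<in>|R| ==> y\<in>|R| ==> {x, y}\<^sub>C\<in>|R|"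
  and R_eq: "mult R = mult C" "one R = one C" "zero R = zero C" "add R = add C" "smult R = smult C" "bracket R = bracket C"
  and H_carrier: "|H| = span C G"
  and H_eq: "mult H = mult C" "one H = one C" "zero H = zero C" "add H = add C" "smult H = smult C" "bracket H = bracket C"
  and H_comult_lin: "lin H (TS H H) (comult H)"
  and H_counit_lin: "lin H (base_algebra K) (counit H)"
  and H_comult: "!!g. g\<in>G ==> comult H g = ts H H g g"
  and H_counit: "!!g. g\<in>G ==> counit H g = \<one>"
  and G_sub: "G\<subseteq>|C|" and G_one: "1\<^sub>C\<in>G"
  and G_mult: "!!g t. g\<in>G ==> t\<in>G ==> g *\<^sub>C t\<in>G"
  and gi_G: "!!g. g\<in>G ==> gi g\<in>G" and gi_inv: "!!g. g\<in>G ==> g *\<^sub>C gi g = 1\<^sub>C"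
  and G_bracket: "!!g t. g\<in>G ==> t\<in>G ==> {g, t}\<^sub>C = 0\<^sub>C"
  and ad_R: "!!g y. g\<in>G ==> y\<in>|R| ==> gi g *\<^sub>C {g, y}\<^sub>C\<in>|R|"
  and pr_lin: "!!g. g\<in>G ==> lin C C (pr g)"
  and pr_fin: "!!c. c\<in>|C| ==> finite {g\<in>G. pr g c ~= 0\<^sub>C}"
  and pr_sum: "!!c. c\<in>|C| ==> c = (\<Oplus>\<^sub>C g\<in>{g\<in>G. pr g c ~= 0\<^sub>C}. pr g c)"
  and pr_R: "!!g c. g\<in>G ==> c\<in>|C| ==> gi g *\<^sub>C pr g c\<in>|R|"
  and pr_hom: "!!g t y. g\<in>G ==> t\<in>G ==> y\<in>|R| ==>
   pr t (y *\<^sub>C g) = (if t = g then y *\<^sub>C g else 0\<^sub>C)"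
begin

lemma Ca [simp]: "k_algebra K C" "vs C"
 using C by auto
lemma RC: "y\<in>|R| ==> y\<in>|C|"
 by (rule sub_carrier[OF Ca(2) R_sub])
lemma GC: "g\<in>G ==> g\<in>|C|"
 using G_sub by auto
lemma giC: "g\<in>G ==> gi g\<in>|C|"
 using gi_G GC by auto
lemma prC: "g\<in>G ==> c\<in>|C| ==> pr g c\<in>|C|"
 by (rule lin_closed[OF pr_lin])

lemma R: "poisson_algebra K R"
 by (rule poisson_subI[OF C R_sub R_closed R_eq])

lemma H_sub: "sub (carrier H) C"
 unfolding H_carrier by (rule span_sub[OF Ca(2) G_sub])
lemma HC: "y\<in>|H| ==> y\<in>|C|"
 by (rule sub_carrier[OF Ca(2) H_sub])
lemma GH: "g\<in>G ==> g\<in>|H|"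
 unfolding H_carrier by (rule span_incl)

lemma bil_span_closed:
 assumes b: "bil C C C f" and c: "!!g t. g\<in>G ==> t\<in>G ==> f g t\<in>N" and N: "sub N C"
  and xy: "x\<in>|H|" "y\<in>|H|"
 shows "f x y\<in>N"
proof -
 have 1: "f g y\<in>N" if g: "g\<in>G" for g
  using span_least[OF sub_preimage[OF bil_right[OF b GC[OF g]] Ca(2) Ca(2) N], of G] c[OF g] GC xy(2) unfolding H_carrier by blast
 show ?thesis
  using span_least[OF sub_preimage[OF bil_left[OF b HC[OF xy(2)]] Ca(2) Ca(2) N], of G] 1 GC xy(1) unfolding H_carrier by blast
qed

lemma H_bracket: "x\<in>|H| ==> y\<in>|H| ==> {x, y}\<^sub>C = 0\<^sub>C"
 using bil_span_closed[OF pa_bilinear[OF C] _ sub_null[OF Ca(2)]] G_bracket by auto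

lemma H: "poisson_algebra K H"
proof (rule poisson_subI[OF C H_sub _ _ _ H_eq])
 show "x *\<^sub>C y\<in>|H|" if "x\<in>|H|" "y\<in>|H|" for x y
  using bil_span_closed[OF alg_bilinear[OF Ca(1)] _ H_sub that] G_mult GH by auto
qed (use GH G_one H_bracket sub_zero[OF Ca(2) H_sub] in auto)

lemma gi_inv': "g\<in>G ==> gi g *\<^sub>C g = 1\<^sub>C"
 using gi_inv pa_comm[OF C GC giC, of g g] by simp

lemma gi_mult:
 assumes "g\<in>G" "t\<in>G"
 shows "gi (g *\<^sub>C t) = gi g *\<^sub>C gi t"
proof -
 note c = GC[OF assms(1)] GC[OF assms(2)] giC[OF assms(1)] giC[OF assms(2)] giC[OF G_mult[OF assms]]
 note a = alg_assoc[OF Ca(1)] pa_comm[OF C] pa_lcomm[OF C]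
 have "gi g *\<^sub>C gi t = (gi g *\<^sub>C gi t) *\<^sub>C ((g *\<^sub>C t) *\<^sub>C gi (g *\<^sub>C t))"
  using gi_inv[OF G_mult[OF assms]] c by simp
 also have "... = ((g *\<^sub>C gi g) *\<^sub>C (t *\<^sub>C gi t)) *\<^sub>C gi (g *\<^sub>C t)" using c by (simp add: a)
 also have "... = gi (g *\<^sub>C t)" using gi_inv assms c by simp
 finally show ?thesis by simp
qed

text \<open>A logarithmic derivation: dividing by g turns the Leibniz rule for {gt, y} into
  additivity in g, and keeps R stable.\<close>

definition dd :: "'c => 'c => 'c"
 where "dd g y = gi g *\<^sub>C {g, y}\<^sub>C"

lemma dd_R: "g\<in>G ==> y\<in>|R| ==> dd g y\<in>|R|"
 unfolding dd_def by (rule ad_R)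

lemma dd_C: "g\<in>G ==> y\<in>|C| ==> dd g y\<in>|C|"
 unfolding dd_def using C giC GC by auto

lemma dd_lin: "g\<in>G ==> lin C C (dd g)"
 unfolding dd_def by (rule lin_comp[OF bil_right[OF pa_bilinear[OF C] GC] bil_right[OF alg_bilinear[OF Ca(1)] giC]])

lemma dd_lin_R: "g\<in>G ==> lin R R (dd g)"
 using dd_lin[of g] dd_R[of g] RC unfolding k_linear_def R_eq by auto

lemma cancel_gi: "g\<in>G ==> x\<in>|C| ==> g *\<^sub>C (gi g *\<^sub>C x) = x" "g\<in>G ==> x\<in>|C| ==> gi g *\<^sub>C (g *\<^sub>C x) = x"
 using GC giC by (simp_all add: alg_assoc[OF Ca(1), symmetric] gi_inv gi_inv')

lemma bracket_dd: "g\<in>G ==> y\<in>|C| ==> {g, y}\<^sub>C = dd g y *\<^sub>C g"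
 using dd_C[of g y] GC[of g] pa_comm[OF C, of "dd g y" g] C by (simp add: dd_def cancel_gi)

lemma dd_prod:
 assumes "g\<in>G" "y\<in>|C|" "z\<in>|C|"
 shows "dd g (y *\<^sub>C z) = dd g y *\<^sub>C z +\<^sub>C y *\<^sub>C dd g z"
 using assms GC[of g] giC[of g] C
 by (simp add: dd_def pa_leibniz_r[OF C] alg_rdistr[OF Ca(1)] alg_assoc[OF Ca(1)] pa_lcomm[OF C, of "gi g" y])

lemma dd_one: "g\<in>G ==> dd g 1\<^sub>C = 0\<^sub>C"
 using GC[of g] giC[of g] C by (simp add: dd_def)

lemma dd_unit: "y\<in>|C| ==> dd 1\<^sub>C y = 0\<^sub>C"
 using giC[OF G_one] C by (simp add: dd_def)

lemma dd_mult:
 assumes "g\<in>G" "t\<in>G" "y\<in>|C|"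
 shows "dd (g *\<^sub>C t) y = dd g y +\<^sub>C dd t y"
proof -
 note c = GC[OF assms(1)] GC[OF assms(2)] giC[OF assms(1)] giC[OF assms(2)] assms(3) dd_C[OF assms(1,3)] dd_C[OF assms(2,3)]
 note a = alg_assoc[OF Ca(1)] pa_comm[OF C] pa_lcomm[OF C]
 have "{g *\<^sub>C t, y}\<^sub>C = (g *\<^sub>C t) *\<^sub>C (dd g y +\<^sub>C dd t y)"
  using c assms by (simp add: pa_leibniz_l[OF C] bracket_dd alg_rdistr[OF Ca(1)] a)
 thus ?thesis unfolding dd_def[of "g *\<^sub>C t"] using c by (simp add: cancel_gi(2)[OF G_mult[OF assms(1,2)]])
qed

text \<open>Additivity of \<open>dd\<close> on g g^-1 = 1 makes \<open>dd (gi g)\<close> the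
  negative of \<open>dd g\<close>.\<close>

lemma bracket_gi:
 assumes "g\<in>G" "y\<in>|C|"
 shows "{gi g, y}\<^sub>C = \<ominus>\<^sub>C (gi g *\<^sub>C dd g y)"
proof -
 have "dd (g *\<^sub>C gi g) y = dd g y +\<^sub>C dd (gi g) y" by (rule dd_mult[OF assms(1) gi_G[OF assms(1)] assms(2)])
 hence "dd g y +\<^sub>C dd (gi g) y = 0\<^sub>C" using dd_unit assms by (simp add: gi_inv)
 hence "dd (gi g) y = \<ominus>\<^sub>C dd g y"
  using v_neg2(1)[OF Ca(2) dd_C[OF assms] dd_C[OF gi_G[OF assms(1)] assms(2)]] dd_C[OF assms] by simp
 thus ?thesis using bracket_dd[OF gi_G[OF assms(1)] assms(2)] dd_C[OF assms] giC[OF assms(1)] pa_comm[OF C]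
  by (simp add: alg_neg[OF Ca(1)])
qed

lemma bracket_gi_r:
 assumes "g\<in>G" "y\<in>|C|"
 shows "{y, gi g}\<^sub>C = gi g *\<^sub>C dd g y"
 using pa_anti[OF C assms(2) giC[OF assms(1)]] bracket_gi[OF assms] dd_C[OF assms] giC[OF assms(1)] by simp

text \<open>That {g, -} is a derivation of the bracket survives the factor g^-1: bracketing g^-1
  itself contributes the product of \<open>dd g y\<close> and \<open>dd g z\<close> to both summands
  on the right, with opposite signs.\<close>

lemma dd_bracket:
 assumes "g\<in>G" "y\<in>|C|" "z\<in>|C|"
 shows "dd g {y, z}\<^sub>C = {dd g y, z}\<^sub>C +\<^sub>C {y, dd g z}\<^sub>C"
proof -
 note c = GC[OF assms(1)] giC[OF assms(1)] assms(2,3) dd_C[OF assms(1,2)] dd_C[OF assms(1,3)]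
 note a = alg_assoc[OF Ca(1)] pa_comm[OF C] pa_lcomm[OF C]
 let ?w = "{g, y}\<^sub>C" and ?v = "{g, z}\<^sub>C"
 have wv: "?w\<in>|C|" "?v\<in>|C|" using C c by auto
 have 1: "{dd g y, z}\<^sub>C = \<ominus>\<^sub>C (dd g y *\<^sub>C dd g z) +\<^sub>C gi g *\<^sub>C {?w, z}\<^sub>C"
 proof -
  have "{gi g *\<^sub>C ?w, z}\<^sub>C = {gi g, z}\<^sub>C *\<^sub>C ?w +\<^sub>C gi g *\<^sub>C {?w, z}\<^sub>C"
   by (rule pa_leibniz_l[OF C c(4) c(2) wv(1)])
  moreover have "{gi g, z}\<^sub>C *\<^sub>C ?w = \<ominus>\<^sub>C (dd g y *\<^sub>C dd g z)"
   unfolding bracket_gi[OF assms(1,3)] dd_def[of g y] using c wv by (simp add: alg_neg[OF Ca(1)] a)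
  ultimately show ?thesis unfolding dd_def[of g y] by simp
 qed
 have 2: "{y, dd g z}\<^sub>C = dd g y *\<^sub>C dd g z +\<^sub>C gi g *\<^sub>C {y, ?v}\<^sub>C"
 proof -
  have "{y, gi g *\<^sub>C ?v}\<^sub>C = {y, gi g}\<^sub>C *\<^sub>C ?v +\<^sub>C gi g *\<^sub>C {y, ?v}\<^sub>C"
   by (rule pa_leibniz_r[OF C c(3) c(2) wv(2)])
  moreover have "{y, gi g}\<^sub>C *\<^sub>C ?v = dd g y *\<^sub>C dd g z"
   unfolding bracket_gi_r[OF assms(1,2)] dd_def[of g z] using c wv by (simp add: a)
  ultimately show ?thesis unfolding dd_def[of g z] by simp
 qed
 have 3: "dd g {y, z}\<^sub>C = gi g *\<^sub>C {?w, z}\<^sub>C +\<^sub>C gi g *\<^sub>C {y, ?v}\<^sub>C"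
  unfolding dd_def pa_jacobi[OF C c(1,3,4)] using c wv C by (simp add: alg_rdistr[OF Ca(1)])
 have m: "dd g y *\<^sub>C dd g z\<in>|C|" "gi g *\<^sub>C {?w, z}\<^sub>C\<in>|C|" "gi g *\<^sub>C {y, ?v}\<^sub>C\<in>|C|" using c wv C by auto
 show ?thesis unfolding 1 2 3 using m by (simp add: v_assoc v_lcomm[OF Ca(2) _ m(2)])
qed

text \<open>Jacobi with {g, t} = 0. Since g and t^-1 also have zero bracket, \<open>dd g\<close>
  passes over the factor t^-1.\<close>

lemma dd_comm:
 assumes "g\<in>G" "t\<in>G" "y\<in>|C|"
 shows "dd g (dd t y) = dd t (dd g y)"
proof -
 note c = GC[OF assms(1)] GC[OF assms(2)] giC[OF assms(1)] giC[OF assms(2)] assms(3)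
 have b: "{g, y}\<^sub>C\<in>|C|" "{t, y}\<^sub>C\<in>|C|" using C c by auto
 have e: "dd g (dd t y) = gi t *\<^sub>C (gi g *\<^sub>C {g, {t, y}\<^sub>C}\<^sub>C)" if "g\<in>G" "t\<in>G" for g t
 proof -
  note c = GC[OF that(1)] GC[OF that(2)] giC[OF that(1)] giC[OF that(2)] assms(3)
  have "{t, y}\<^sub>C\<in>|C|" using C c by auto
  hence "dd g (dd t y) = dd g (gi t) *\<^sub>C {t, y}\<^sub>C +\<^sub>C gi t *\<^sub>C dd g {t, y}\<^sub>C"
   unfolding dd_def[of t] by (rule dd_prod[OF that(1) c(4)])
  moreover have "dd g (gi t) = 0\<^sub>C" unfolding dd_def using c G_bracket[OF that(1) gi_G[OF that(2)]] by simp
  moreover have "dd g {t, y}\<^sub>C\<in>|C|" using that c C by (intro dd_C) auto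
  ultimately show ?thesis using c C \<open>{t, y}\<^sub>C\<in>|C|\<close> by (simp add: dd_def[of g "{t, y}\<^sub>C"])
 qed
 have j: "{g, {t, y}\<^sub>C}\<^sub>C = {t, {g, y}\<^sub>C}\<^sub>C"
  using pa_jacobi[OF C c(1,2,5)] G_bracket[OF assms(1,2)] b c C by simp
 have "{t, {g, y}\<^sub>C}\<^sub>C\<in>|C|" using b c C by auto
 thus ?thesis unfolding e[OF assms(1,2)] e[OF assms(2,1)] j by (rule pa_lcomm[OF C c(4,3)])
qed

text \<open>Explains the second-order term in the prescribed action of h_g on h_y: it is the square
  of the derivation attached to g.\<close>

lemma dd_dd:
 assumes "g\<in>G" "y\<in>|C|"
 shows "{g, {y, gi g}\<^sub>C}\<^sub>C = dd g (dd g y)"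
proof -
 note c = GC[OF assms(1)] giC[OF assms(1)] dd_C[OF assms]
 show ?thesis unfolding bracket_gi_r[OF assms] pa_leibniz_r[OF C c] dd_def[of g "dd g y"]
  using c C G_bracket[OF assms(1) gi_G[OF assms(1)]] by simp
qed

lemma C_span: "c\<in>|C| ==> c\<in>span C {y *\<^sub>C g | y g. y\<in>|R| & g\<in>G}" (is "_ ==> _\<in>span C ?S")
proof -
 assume c: "c\<in>|C|"
 have S: "?S\<subseteq>|C|" using RC GC by auto
 have "pr g c\<in>span C ?S" if "g\<in>G" for g
 proof -
  have "pr g c = (gi g *\<^sub>C pr g c) *\<^sub>C g"
   using that c prC[OF that c] GC[OF that] giC[OF that] pa_comm[OF C, of "gi g *\<^sub>C pr g c" g] by (simp add: cancel_gi)
  thus ?thesis using pr_R[OF that c] that by (intro span_incl) blast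
 qed
 hence "(\<Oplus>\<^sub>C g\<in>{g\<in>G. pr g c ~= 0\<^sub>C}. pr g c)\<in>span C ?S"
  by (intro sub_finsum[OF Ca(2) span_sub[OF Ca(2) S]]) auto
 thus ?thesis using pr_sum[OF c] by simp
qed

lemma bil_eq_C:
 assumes f: "bil C C T f" and h: "bil C C T h" and T: "vs T"
  and e: "!!y g z t. y\<in>|R| ==> g\<in>G ==> z\<in>|R| ==> t\<in>G ==> f (y *\<^sub>C g) (z *\<^sub>C t) = h (y *\<^sub>C g) (z *\<^sub>C t)"
  and c: "c\<in>|C|" "d\<in>|C|"
 shows "f c d = h c d"
proof -
 have S: "{y *\<^sub>C g | y g. y\<in>|R| & g\<in>G}\<subseteq>|C|" using RC GC by auto
 have yg: "y *\<^sub>C g\<in>|C|" if "y\<in>|R|" "g\<in>G" for y g using that RC GC by auto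
 have "f (y *\<^sub>C g) d = h (y *\<^sub>C g) d" if y: "y\<in>|R|" "g\<in>G" for y g
  by (rule lin_eq_span[OF bil_right[OF f yg[OF y]] bil_right[OF h yg[OF y]] Ca(2) T S _ C_span[OF c(2)]]) (use e[OF y] in auto)
 thus ?thesis
  by (intro lin_eq_span[OF bil_left[OF f c(2)] bil_left[OF h c(2)] Ca(2) T S _ C_span[OF c(1)]]) auto
qed

text \<open>Glues maps given on the components of C. The sum over the finitely many g with nonzero
  component is linear as soon as F g vanishes wherever the g-component does.\<close>

definition ext :: "('k, 't, 'w) module_scheme => ('c => 'c => 't) => 'c => 't"
 where "ext T F c = (\<Oplus>\<^sub>T g\<in>{g\<in>G. pr g c ~= 0\<^sub>C}. F g c)"

context
 fixes T :: "('k, 't, 'w) module_scheme" and F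
 assumes T: "vs T" and F: "!!g. g\<in>G ==> lin C T (F g)"
  and F0: "!!g c. g\<in>G ==> c\<in>|C| ==> pr g c = 0\<^sub>C ==> F g c = 0\<^sub>T"
begin

lemma ext_superset:
 assumes "c\<in>|C|" "finite J" "J\<subseteq>G" "{g\<in>G. pr g c ~= 0\<^sub>C}\<subseteq>J"
 shows "ext T F c = (\<Oplus>\<^sub>T g\<in>J. F g c)"
 unfolding ext_def
 by (rule v_finsum_mono[OF T assms(2,4), symmetric]) (use assms F0 lin_closed[OF F] in auto)

lemma ext_lin: "lin C T (ext T F)"
proof (rule k_linearI)
 fix c d assume c: "c\<in>|C|" and d: "d\<in>|C|"
 let ?J = "{g\<in>G. pr g c ~= 0\<^sub>C} \<union> {g\<in>G. pr g d ~= 0\<^sub>C}"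
 have J: "finite ?J" "?J\<subseteq>G" using pr_fin c d by auto
 have "{g\<in>G. pr g (c +\<^sub>C d) ~= 0\<^sub>C}\<subseteq>?J" using c d by (auto simp: lin_add[OF pr_lin])
 hence "ext T F (c +\<^sub>C d) = (\<Oplus>\<^sub>T g\<in>?J. F g (c +\<^sub>C d))" using c d by (intro ext_superset J) auto
 also have "... = (\<Oplus>\<^sub>T g\<in>?J. F g c +\<^sub>T F g d)"
  using c d J lin_closed[OF F] T by (intro v_finsum_cong[OF T]) (auto simp: lin_add[OF F])
 also have "... = (\<Oplus>\<^sub>T g\<in>?J. F g c) +\<^sub>T (\<Oplus>\<^sub>T g\<in>?J. F g d)"
  using c d J lin_closed[OF F] by (intro v_finsum_add[OF T]) auto
 also have "... = ext T F c +\<^sub>T ext T F d"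
  using ext_superset[OF c J] ext_superset[OF d J] by simp
 finally show "ext T F (c +\<^sub>C d) = ext T F c +\<^sub>T ext T F d" .
next
 fix k c assume k: "k\<in>|K|" and c: "c\<in>|C|"
 let ?J = "{g\<in>G. pr g c ~= 0\<^sub>C}"
 have J: "finite ?J" "?J\<subseteq>G" using pr_fin c by auto
 have "{g\<in>G. pr g (k \<odot>\<^sub>C c) ~= 0\<^sub>C}\<subseteq>?J" using c k by (auto simp: lin_smult[OF pr_lin])
 hence "ext T F (k \<odot>\<^sub>C c) = (\<Oplus>\<^sub>T g\<in>?J. F g (k \<odot>\<^sub>C c))" using c k by (intro ext_superset J) auto
 also have "... = (\<Oplus>\<^sub>T g\<in>?J. k \<odot>\<^sub>T F g c)"
  using c k lin_closed[OF F] T by (intro v_finsum_cong[OF T]) (auto simp: lin_smult[OF F])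
 also have "... = k \<odot>\<^sub>T ext T F c"
  unfolding ext_def using c k J lin_closed[OF F] by (intro v_finsum_smult[OF T, symmetric]) auto
 finally show "ext T F (k \<odot>\<^sub>C c) = k \<odot>\<^sub>T ext T F c" .
next
 fix c assume "c\<in>|C|"
 thus "ext T F c\<in>|T|" unfolding ext_def using lin_closed[OF F] by (intro v_finsum_closed[OF T]) auto
qed

lemma ext_hom:
 assumes "g\<in>G" "y\<in>|R|"
 shows "ext T F (y *\<^sub>C g) = F g (y *\<^sub>C g)"
proof -
 have c: "y *\<^sub>C g\<in>|C|" using assms RC GC by auto
 have "ext T F (y *\<^sub>C g) = (\<Oplus>\<^sub>T t\<in>{g}. F t (y *\<^sub>C g))"
  by (rule ext_superset[OF c]) (use assms pr_hom in "auto split: if_splits")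
 thus ?thesis using v_finsum_single[OF T, of "{g}" g "%t. F t (y *\<^sub>C g)"] lin_closed[OF F[OF assms(1)] c] by simp
qed

end

text \<open>What an algebra needs in order to receive C^e. \<open>Gm g\<close> is the image of m_g
  and \<open>X g\<close> that of m_{g^-1} h_g; in terms of the latter the rule for h_{gt} becomes
  additivity. The last conditions say that conjugation by \<open>Gm g\<close> fixes m_y and adds
  m_{dd g y} to h_y, and that the commutator with \<open>X g\<close> acts as \<open>dd g\<close> on
  both kinds of generators.\<close>

definition U_datum :: "('k, 't, 'w) module_scheme => ('c => 't) => ('c => 't) => ('c => 't) => ('c => 't) => bool"
 where "U_datum T Y Be Gm X \<longleftrightarrow> k_algebra K T & env_rep R T Y Be & (\<forall>g\<in>G. Gm g\<in>|T| & X g\<in>carrier T) &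
  Gm 1\<^sub>C = 1\<^sub>T &
  (\<forall>g\<in>G. \<forall>t\<in>G. Gm (g *\<^sub>C t) = Gm g *\<^sub>T Gm t & X (g *\<^sub>C t) = X g +\<^sub>T X t &
   X g *\<^sub>T Gm t = Gm t *\<^sub>T X g & X g *\<^sub>T X t = X t *\<^sub>T X g) &
  (\<forall>g\<in>G. \<forall>y\<in>carrier R. Gm g *\<^sub>T Y y = Y y *\<^sub>T Gm g &
   Gm g *\<^sub>T Be y = (Be y +\<^sub>T Y (dd g y)) *\<^sub>T Gm g &
   X g *\<^sub>T Y y = Y y *\<^sub>T X g +\<^sub>T Y (dd g y) &
   X g *\<^sub>T Be y = Be y *\<^sub>T X g +\<^sub>T Be (dd g y))"

text \<open>On the component R g the values are forced: \<mu> (y g) = Y y Gm g, and by the rule for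
  h of a product \<eta> (y g) = Gm g Be y + Y y Gm g X g. The product rules are then checked on
  homogeneous elements, the commutators on R \<union> G only.\<close>

theorem universal:
 fixes T :: "('k, 't, 'w) module_scheme"
 assumes U: "U_datum T Y Be Gm X"
 obtains \<mu> \<eta> where "env_rep C T \<mu> \<eta>" "!!y. y\<in>|R| ==> \<mu> y = Y y" "!!y. y\<in>|R| ==> \<eta> y = Be y"
  "!!g. g\<in>G ==> \<mu> g = Gm g" "!!g. g\<in>G ==> \<eta> g = Gm g *\<^sub>T X g"
proof -
 have T: "k_algebra K T" and r: "env_rep R T Y Be" and gc: "!!g. g\<in>G ==> Gm g\<in>|T|" "!!g. g\<in>G ==> X g\<in>|T|"
  and G1: "Gm 1\<^sub>C = 1\<^sub>T"
  and GG: "!!g t. g\<in>G ==> t\<in>G ==> Gm (g *\<^sub>C t) = Gm g *\<^sub>T Gm t"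
  and XX: "!!g t. g\<in>G ==> t\<in>G ==> X (g *\<^sub>C t) = X g +\<^sub>T X t"
  and XG: "!!g t. g\<in>G ==> t\<in>G ==> X g *\<^sub>T Gm t = Gm t *\<^sub>T X g"
  and Xc: "!!g t. g\<in>G ==> t\<in>G ==> X g *\<^sub>T X t = X t *\<^sub>T X g"
  and GY: "!!g y. g\<in>G ==> y\<in>|R| ==> Gm g *\<^sub>T Y y = Y y *\<^sub>T Gm g"
  and GB: "!!g y. g\<in>G ==> y\<in>|R| ==> Gm g *\<^sub>T Be y = (Be y +\<^sub>T Y (dd g y)) *\<^sub>T Gm g"
  and XY: "!!g y. g\<in>G ==> y\<in>|R| ==> X g *\<^sub>T Y y = Y y *\<^sub>T X g +\<^sub>T Y (dd g y)"
  and XB: "!!g y. g\<in>G ==> y\<in>|R| ==> X g *\<^sub>T Be y = Be y *\<^sub>T X g +\<^sub>T Be (dd g y)"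
  using U unfolding U_datum_def by blast+
 note Tm = alg_module[OF T] and as = alg_assoc[OF T]
 note Yl = env_repD(1)[OF r] and Bl = env_repD(2)[OF r]
 note yc = lin_closed[OF Yl] lin_closed[OF Bl]
 note mcl = alg_mult_closed[OF T] v_add_closed[OF Tm]
 have Y1: "Y 1\<^sub>C = 1\<^sub>T" using env_repD(3)[OF r] by (simp add: R_eq)
 have B1: "Be 1\<^sub>C = 0\<^sub>T" using env_rep_one[OF r R T] by (simp add: R_eq)
 have X1: "X 1\<^sub>C = 0\<^sub>T"
 proof -
  have c: "X 1\<^sub>C\<in>|T|" by (rule gc(2)[OF G_one])
  have "X 1\<^sub>C +\<^sub>T 0\<^sub>T = X (1\<^sub>C *\<^sub>C 1\<^sub>C)" using c Tm by simp
  also have "... = X 1\<^sub>C +\<^sub>T X 1\<^sub>C" by (rule XX[OF G_one G_one])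
  finally show ?thesis using v_cancel_l[OF Tm c v_zero_closed[OF Tm] c] by simp
 qed
 \<comment> \<open>The R-coordinate of the component of c in R g.\<close>
 define q where "q g c = gi g *\<^sub>C pr g c" for g c
 have ql: "lin C R (q g)" if "g\<in>G" for g
 proof -
  have "lin C C (q g)" unfolding q_def by (rule lin_comp[OF pr_lin[OF that] bil_right[OF alg_bilinear[OF Ca(1)] giC[OF that]]])
  thus ?thesis using pr_R[OF that] unfolding k_linear_def R_eq q_def by auto
 qed
 have qh: "q g (y *\<^sub>C g) = y" if "g\<in>G" "y\<in>|R|" for g y
  using pr_hom[OF that(1) that(1) that(2)] that GC giC RC pa_comm[OF C, of y g] by (simp add: q_def cancel_gi)
 have q0: "q g c = 0\<^sub>R" if "g\<in>G" "pr g c = 0\<^sub>C" for g c using that giC by (simp add: q_def R_eq)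
 note mb = alg_bilinear[OF T]
 define F where "F g c = Y (q g c) *\<^sub>T Gm g" for g c
 define E where "E g c = Gm g *\<^sub>T Be (q g c) +\<^sub>T Y (q g c) *\<^sub>T (Gm g *\<^sub>T X g)" for g c
 have Fl: "lin C T (F g)" if "g\<in>G" for g
  unfolding F_def by (rule lin_comp[OF lin_comp[OF ql[OF that] Yl] bil_left[OF mb gc(1)[OF that]]])
 have El: "lin C T (E g)" if "g\<in>G" for g
  unfolding E_def using gc that T
  by (intro lin_plus[OF Tm] lin_comp[OF lin_comp[OF ql[OF that] Bl] bil_right[OF mb]] lin_comp[OF lin_comp[OF ql[OF that] Yl] bil_left[OF mb]]) auto
 have Rm: "vs R" using R by simp
 have F0: "F g c = 0\<^sub>T" "E g c = 0\<^sub>T" if "g\<in>G" "c\<in>|C|" "pr g c = 0\<^sub>C" for g c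
  using gc[OF that(1)] T Tm by (simp_all add: F_def E_def q0[OF that(1,3)] lin_zero[OF Yl Rm Tm] lin_zero[OF Bl Rm Tm])
 define \<mu> where "\<mu> = ext T F"
 define \<eta> where "\<eta> = ext T E"
 have \<mu>: "lin C T \<mu>" unfolding \<mu>_def by (rule ext_lin[OF Tm Fl F0(1)])
 have \<eta>: "lin C T \<eta>" unfolding \<eta>_def by (rule ext_lin[OF Tm El F0(2)])
 have \<mu>v: "\<mu> (y *\<^sub>C g) = Y y *\<^sub>T Gm g" if "y\<in>|R|" "g\<in>G" for y g
 proof -
  have "ext T F (y *\<^sub>C g) = F g (y *\<^sub>C g)" by (rule ext_hom[OF Tm Fl F0(1) that(2,1)])
  thus ?thesis unfolding \<mu>_def by (simp add: F_def qh[OF that(2,1)])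
 qed
 have \<eta>v: "\<eta> (y *\<^sub>C g) = Gm g *\<^sub>T Be y +\<^sub>T Y y *\<^sub>T (Gm g *\<^sub>T X g)" if "y\<in>|R|" "g\<in>G" for y g
 proof -
  have "ext T E (y *\<^sub>C g) = E g (y *\<^sub>C g)" by (rule ext_hom[OF Tm El F0(2) that(2,1)])
  thus ?thesis unfolding \<eta>_def by (simp add: E_def qh[OF that(2,1)])
 qed
 have oneR: "1\<^sub>C\<in>|R|" by (rule R_closed(2))
 have vY: "\<mu> y = Y y" "\<eta> y = Be y" if "y\<in>|R|" for y
  using \<mu>v[OF that G_one] \<eta>v[OF that G_one] RC[OF that] yc[OF that] T Tm by (simp_all add: G1 X1)
 have vG: "\<mu> g = Gm g" "\<eta> g = Gm g *\<^sub>T X g" if "g\<in>G" for g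
  using \<mu>v[OF oneR that] \<eta>v[OF oneR that] GC[OF that] gc[OF that] T Tm by (simp_all add: Y1 B1)
 note prodb = alg_bilinear[OF Ca(1)]
 have hom_prod: "(y *\<^sub>C g) *\<^sub>C (z *\<^sub>C t) = (y *\<^sub>C z) *\<^sub>C (g *\<^sub>C t)" if "y\<in>|R|" "g\<in>G" "z\<in>|R|" "t\<in>G" for y g z t
  using that RC GC by (simp add: alg_assoc[OF Ca(1)] pa_lcomm[OF C])
 have lc: "x *\<^sub>T (y *\<^sub>T z) = y *\<^sub>T (x *\<^sub>T z)" if "x *\<^sub>T y = y *\<^sub>T x" "x\<in>|T|" "y\<in>|T|" "z\<in>|T|" for x y z
  using that by (simp add: as[symmetric])
 have YY: "Y (y *\<^sub>C z) = Y y *\<^sub>T Y z" "Be (y *\<^sub>C z) = Y z *\<^sub>T Be y +\<^sub>T Y y *\<^sub>T Be z" if "y\<in>|R|" "z\<in>|R|" for y z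
  using env_repD(4,6)[OF r that] by (simp_all add: R_eq)
 have Ycomm: "Y z *\<^sub>T Y y = Y y *\<^sub>T Y z" if "y\<in>|R|" "z\<in>|R|" for y z
  using YY(1)[OF that] YY(1)[OF that(2,1)] pa_comm[OF C RC[OF that(1)] RC[OF that(2)]] by simp
 have Gcomm: "Gm t *\<^sub>T Gm g = Gm g *\<^sub>T Gm t" if "g\<in>G" "t\<in>G" for g t
  using GG[OF that] GG[OF that(2,1)] pa_comm[OF C GC[OF that(1)] GC[OF that(2)]] by simp
 have mm: "\<mu> (c *\<^sub>C d) = \<mu> c *\<^sub>T \<mu> d" if "c\<in>|C|" "d\<in>|C|" for c d
 proof (rule bil_eq_C[OF bil_post[OF prodb \<mu>] bil_comp[OF mb \<mu> \<mu>] Tm _ that])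
  fix y g z t assume a: "y\<in>|R|" "g\<in>G" "z\<in>|R|" "t\<in>G"
  note c = yc[OF a(1)] yc[OF a(3)] gc[OF a(2)] gc[OF a(4)]
  show "\<mu> ((y *\<^sub>C g) *\<^sub>C (z *\<^sub>C t)) = \<mu> (y *\<^sub>C g) *\<^sub>T \<mu> (z *\<^sub>C t)"
   unfolding hom_prod[OF a] \<mu>v[OF R_closed(1)[OF a(1,3)] G_mult[OF a(2,4)]] \<mu>v[OF a(1,2)] \<mu>v[OF a(3,4)]
   using c T by (simp add: YY[OF a(1,3)] GG[OF a(2,4)] as lc[OF GY[OF a(2,3)]])
 qed
 have hm: "\<eta> (c *\<^sub>C d) = \<mu> d *\<^sub>T \<eta> c +\<^sub>T \<mu> c *\<^sub>T \<eta> d" if "c\<in>|C|" "d\<in>|C|" for c d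
 proof (rule bil_eq_C[of T "%c d. \<eta> (c *\<^sub>C d)" "%c d. \<mu> d *\<^sub>T \<eta> c +\<^sub>T \<mu> c *\<^sub>T \<eta> d", OF bil_post[OF prodb \<eta>] _ Tm _ that])
  show "bil C C T (%c d. \<mu> d *\<^sub>T \<eta> c +\<^sub>T \<mu> c *\<^sub>T \<eta> d)"
   unfolding k_bilinear_def
   using lin_closed[OF \<mu>] lin_closed[OF \<eta>]
   by (intro conjI ballI lin_plus[OF Tm] lin_comp[OF \<mu> bil_left[OF mb]] lin_comp[OF \<eta> bil_right[OF mb]]
    lin_comp[OF \<mu> bil_right[OF mb]] lin_comp[OF \<eta> bil_left[OF mb]]) auto
  fix y g z t assume a: "y\<in>|R|" "g\<in>G" "z\<in>|R|" "t\<in>G"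
  note c = yc[OF a(1)] yc[OF a(3)] gc[OF a(2)] gc[OF a(4)]
  have l: "Gm g *\<^sub>T (Y y *\<^sub>T w) = Y y *\<^sub>T (Gm g *\<^sub>T w)" "Gm g *\<^sub>T (Y z *\<^sub>T w) = Y z *\<^sub>T (Gm g *\<^sub>T w)"
   "Gm t *\<^sub>T (Y y *\<^sub>T w) = Y y *\<^sub>T (Gm t *\<^sub>T w)" "Gm t *\<^sub>T (Y z *\<^sub>T w) = Y z *\<^sub>T (Gm t *\<^sub>T w)"
   if "w\<in>|T|" for w using that c a by (auto intro: lc GY)
  have gt: "Gm t *\<^sub>T (Gm g *\<^sub>T w) = Gm g *\<^sub>T (Gm t *\<^sub>T w)" "Y z *\<^sub>T (Y y *\<^sub>T w) = Y y *\<^sub>T (Y z *\<^sub>T w)" if "w\<in>|T|" for w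
   using that c a by (auto intro: lc Gcomm Ycomm)
  show "\<eta> ((y *\<^sub>C g) *\<^sub>C (z *\<^sub>C t)) = \<mu> (z *\<^sub>C t) *\<^sub>T \<eta> (y *\<^sub>C g) +\<^sub>T \<mu> (y *\<^sub>C g) *\<^sub>T \<eta> (z *\<^sub>C t)"
   unfolding hom_prod[OF a] \<eta>v[OF R_closed(1)[OF a(1,3)] G_mult[OF a(2,4)]] \<mu>v[OF a(1,2)] \<mu>v[OF a(3,4)] \<eta>v[OF a(1,2)] \<eta>v[OF a(3,4)]
    YY[OF a(1,3)] GG[OF a(2,4)] XX[OF a(2,4)]
   using c T Tm by (simp add: as alg_rdistr[OF T] l gt v_assoc v_comm v_lcomm)
 qed
 note hmd = rel_hm_def and hhd = rel_hh_def
 have brg: "\<mu> {g, z}\<^sub>C = Y (dd g z) *\<^sub>T Gm g" "\<eta> {g, z}\<^sub>C = Gm g *\<^sub>T Be (dd g z) +\<^sub>T Y (dd g z) *\<^sub>T (Gm g *\<^sub>T X g)"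
  if "g\<in>G" "z\<in>|R|" for g z
  using \<mu>v[OF dd_R[OF that] that(1)] \<eta>v[OF dd_R[OF that] that(1)] bracket_dd[OF that(1) RC[OF that(2)]] by simp_all
 have "env_rep C T \<mu> \<eta>"
 proof (rule env_repI[OF C T \<mu> \<eta> mm hm])
  show "\<mu> 1\<^sub>C = 1\<^sub>T" using vG(1)[OF G_one] G1 by simp
  show "|R| \<union> G\<subseteq>|C|" using RC GC by auto
  have "{y *\<^sub>C g | y g. y\<in>|R| & g\<in>G}\<subseteq>{x *\<^sub>C y |x y. x\<in>|R| \<union> G & y\<in>|R| \<union> G}" by blast
  thus "|C|\<subseteq>span C {x *\<^sub>C y |x y. x\<in>|R| \<union> G & y\<in>|R| \<union> G}"
   using C_span span_mono by blast
  have RR: "\<mu> {y, z}\<^sub>C = Y {y, z}\<^sub>R" "\<eta> {y, z}\<^sub>C = Be {y, z}\<^sub>R" if "y\<in>|R|" "z\<in>|R|" for y z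
   using vY[OF R_closed(3)[OF that]] by (simp_all add: R_eq)
  \<comment> \<open>Both conditions on g are used: first \<open>X g\<close> and then
    \<open>Gm g\<close> is moved past \<open>Be z\<close>.\<close>
  have GR: "rel_hh C T \<eta> g z" if "g\<in>G" "z\<in>|R|" for g z
  proof -
   note c = yc[OF that(2)] yc[OF dd_R[OF that]] gc[OF that(1)]
   have "(Gm g *\<^sub>T X g) *\<^sub>T Be z = Gm g *\<^sub>T (Be z *\<^sub>T X g +\<^sub>T Be (dd g z))"
    using c by (simp add: as XB[OF that])
   also have "... = (Gm g *\<^sub>T Be z) *\<^sub>T X g +\<^sub>T Gm g *\<^sub>T Be (dd g z)"
    using c T by (simp add: as alg_rdistr[OF T])
   also have "... = Be z *\<^sub>T (Gm g *\<^sub>T X g) +\<^sub>T (Gm g *\<^sub>T Be (dd g z) +\<^sub>T Y (dd g z) *\<^sub>T (Gm g *\<^sub>T X g))"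
    unfolding GB[OF that] using c T Tm
    by (simp add: as alg_ldistr[OF T] v_assoc v_comm[OF Tm, of "Y (dd g z) *\<^sub>T (Gm g *\<^sub>T X g)"])
   finally show ?thesis unfolding hhd vG[OF that(1)] vY[OF that(2)] brg[OF that] .
  qed
  have z0: "\<mu> 0\<^sub>C = 0\<^sub>T" "\<eta> 0\<^sub>C = 0\<^sub>T" using lin_zero[OF \<mu> Ca(2) Tm] lin_zero[OF \<eta> Ca(2) Tm] by auto
  fix x y assume x: "x\<in>|R| \<union> G" and y: "y\<in>|R| \<union> G"
  show "rel_hm C T \<mu> \<eta> x y"
  proof (cases "x\<in>|R|")
   case xR: True
   show ?thesis
   proof (cases "y\<in>|R|")
    case True
    thus ?thesis unfolding hmd using env_repD(7)[OF r xR True] vY xR RR by simp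
   next
    case False
    hence yG: "y\<in>G" using y by auto
    note c = yc[OF xR] yc[OF dd_R[OF yG xR]] gc[OF yG]
    have bc: "{y, x}\<^sub>C\<in>|C|" using C GC[OF yG] RC[OF xR] by auto
    \<comment> \<open>The remaining case is the conjugation rule for \<open>Gm y\<close> read
      backwards, with the sign from {x, y} = - {y, x}.\<close>
    have "\<mu> {x, y}\<^sub>C = \<ominus>\<^sub>T (Y (dd y x) *\<^sub>T Gm y)"
     unfolding pa_anti[OF C RC[OF xR] GC[OF yG]] lin_neg[OF \<mu> Ca(2) Tm bc] brg[OF yG xR] ..
    thus ?thesis unfolding hmd vG[OF yG] vY[OF xR] GB[OF yG xR] using c T Tm
     by (simp add: alg_ldistr[OF T] v_assoc)
   qed
  next
   case False
   hence xG: "x\<in>G" using x by auto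
   show ?thesis
   proof (cases "y\<in>|R|")
    case True
    note c = yc[OF True] yc[OF dd_R[OF xG True]] gc[OF xG]
    show ?thesis unfolding hmd vG[OF xG] vY[OF True] brg[OF xG True] using c T Tm
     by (simp add: as XY[OF xG True] alg_rdistr[OF T] GY[OF xG dd_R[OF xG True]] lc[OF GY[OF xG True]])
   next
    case False
    hence yG: "y\<in>G" using y by auto
    note c = gc[OF xG] gc[OF yG]
    show ?thesis unfolding hmd vG[OF xG] vG[OF yG] G_bracket[OF xG yG] z0 using c T Tm
     by (simp add: as XG[OF xG yG] lc[OF Gcomm[OF yG xG]])
   qed
  qed
  show "rel_hh C T \<eta> x y"
  proof (cases "x\<in>|R|")
   case xR: True
   show ?thesis
   proof (cases "y\<in>|R|")
    case True
    show ?thesis unfolding hhd vY[OF xR] vY[OF True] RR[OF xR True] by (rule env_repD(5)[OF r xR True])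
   next
    case False
    hence yG: "y\<in>G" using y by auto
    show ?thesis by (rule rel_hh_sym[OF C T \<mu> \<eta> mm hm GC[OF yG] RC[OF xR] GR[OF yG xR]])
   qed
  next
   case False
   hence xG: "x\<in>G" using x by auto
   show ?thesis
   proof (cases "y\<in>|R|")
    case True
    thus ?thesis by (rule GR[OF xG])
   next
    case False
    hence yG: "y\<in>G" using y by auto
    note c = gc[OF xG] gc[OF yG]
    show ?thesis unfolding hhd vG[OF xG] vG[OF yG] G_bracket[OF xG yG] z0 using c T Tm
     by (simp add: as XG[OF xG yG] XG[OF yG xG] lc[OF XG[OF xG yG]] lc[OF XG[OF yG xG]] lc[OF Gcomm[OF yG xG]] Xc[OF xG yG])
   qed
  qed
 qed
 thus ?thesis using that vY vG by blast
qed

end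

context base
begin

lemma bil_plus: "vs P ==> bil M N P f ==> bil M N P g ==> bil M N P (%x y. f x y +\<^sub>P g x y)"
 unfolding k_bilinear_def by (simp add: lin_plus)

lemma lin_tensor_alg: "lin M (tensor_alg K A B) f \<longleftrightarrow> lin M (TS A B) f"
 "lin (tensor_alg K A B) M f' \<longleftrightarrow> lin (TS A B) M f'"
 unfolding k_linear_def by simp_all

lemma bil_tensor_alg: "bil M N (tensor_alg K A B) f \<longleftrightarrow> bil M N (TS A B) f"
 unfolding k_bilinear_def lin_tensor_alg ..

end

context graded_pa
begin

abbreviation "Re \<equiv> env K R"
abbreviation "He \<equiv> env K H"
abbreviation "Ce \<equiv> env K C"
abbreviation "rm \<equiv> env_m K R"
abbreviation "rh \<equiv> env_h K R"
abbreviation "gm \<equiv> env_m K H"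
abbreviation "gh \<equiv> env_h K H"

lemma env_algs [simp]: "k_algebra K Re" "k_algebra K He" "k_algebra K Ce"
 "vs Re" "vs He" "vs Ce"
 using env_algebra[OF R] env_algebra[OF H] env_algebra[OF C] alg_module by auto

lemma rc [simp]: "y\<in>|R| ==> rm y\<in>|Re|" "y\<in>|R| ==> rh y\<in>|Re|"
 by (rule env_m_closed[OF R], assumption, rule env_h_closed[OF R])
lemma gc [simp]: "y\<in>|H| ==> gm y\<in>|He|" "y\<in>|H| ==> gh y\<in>|He|"
 by (rule env_m_closed[OF H], assumption, rule env_h_closed[OF H])

lemma r_rel:
 assumes "x\<in>|R|" "y\<in>|R|"
 shows "rm (x *\<^sub>C y) = rm x *\<^sub>Re rm y" "rh x *\<^sub>Re rh y = rh y *\<^sub>Re rh x +\<^sub>Re rh {x, y}\<^sub>C"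
  "rh (x *\<^sub>C y) = rm y *\<^sub>Re rh x +\<^sub>Re rm x *\<^sub>Re rh y"
  "rh x *\<^sub>Re rm y = rm y *\<^sub>Re rh x +\<^sub>Re rm {x, y}\<^sub>C" "rm x *\<^sub>Re rm y = rm y *\<^sub>Re rm x"
proof -
 note e = env_repD(4-7)[OF env_m_h_rep[OF R] assms, unfolded R_eq]
 show "rm (x *\<^sub>C y) = rm x *\<^sub>Re rm y" "rh x *\<^sub>Re rh y = rh y *\<^sub>Re rh x +\<^sub>Re rh {x, y}\<^sub>C"
  "rh (x *\<^sub>C y) = rm y *\<^sub>Re rh x +\<^sub>Re rm x *\<^sub>Re rh y"
  "rh x *\<^sub>Re rm y = rm y *\<^sub>Re rh x +\<^sub>Re rm {x, y}\<^sub>C" by (rule e)+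
 show "rm x *\<^sub>Re rm y = rm y *\<^sub>Re rm x"
  using e(1) env_repD(4)[OF env_m_h_rep[OF R] assms(2,1), unfolded R_eq] pa_comm[OF C RC[OF assms(1)] RC[OF assms(2)]] by simp
qed

lemma r_lin:
 "x\<in>|R| ==> y\<in>|R| ==> rm (x +\<^sub>C y) = rm x +\<^sub>Re rm y"
 "x\<in>|R| ==> y\<in>|R| ==> rh (x +\<^sub>C y) = rh x +\<^sub>Re rh y"
 using lin_add[OF env_m_lin[OF R]] lin_add[OF env_h_lin[OF R]] by (simp_all add: R_eq)

lemma r_zero: "rm 0\<^sub>C = 0\<^sub>Re" "rh 0\<^sub>C = 0\<^sub>Re" "rm 1\<^sub>C = 1\<^sub>Re"
proof -
 have Rm: "vs R" using R by simp
 show "rm 0\<^sub>C = 0\<^sub>Re" "rh 0\<^sub>C = 0\<^sub>Re"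
  using lin_zero[OF env_m_lin[OF R] Rm] lin_zero[OF env_h_lin[OF R] Rm] by (simp_all add: R_eq)
 show "rm 1\<^sub>C = 1\<^sub>Re" using env_m_one[OF R] by (simp add: R_eq)
qed

lemma rm_neg_bracket: "x\<in>|R| ==> y\<in>|R| ==> rm {x, y}\<^sub>C +\<^sub>Re rm {y, x}\<^sub>C = 0\<^sub>Re"
proof -
 assume xy: "x\<in>|R|" "y\<in>|R|"
 have b: "{x, y}\<^sub>C\<in>|C|" "{y, x}\<^sub>C\<in>|C|" using RC[OF R_closed(3)[OF xy]] RC[OF R_closed(3)[OF xy(2,1)]] .
 have "{x, y}\<^sub>C +\<^sub>C {y, x}\<^sub>C = 0\<^sub>C" using pa_anti[OF C RC[OF xy(1)] RC[OF xy(2)]] b by simp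
 thus ?thesis using r_lin(1)[OF R_closed(3)[OF xy] R_closed(3)[OF xy(2,1)]] r_zero by simp
qed

subsection \<open>The automorphisms and derivations of \<open>R\<^sup>e\<close>\<close>

text \<open>Conjugation by m_g inside C^e, restricted to R^e. It is defined on generators because
  injectivity of R^e \<rightarrow> C^e is not yet known.\<close>

definition sig :: "'c => (('c + 'c) list => 'k) set => (('c + 'c) list => 'k) set"
 where "sig g = env_lift K Re rm (%y. rh y +\<^sub>Re rm (dd g y))"

text \<open>The commutator with m_{g^-1} h_g inside C^e, restricted to R^e. The universal property
  produces algebra maps, not derivations; hence the detour through the dual numbers.\<close>

definition der :: "'c => (('c + 'c) list => 'k) set => (('c + 'c) list => 'k) set"
 where "der g x = snd (env_lift K (dual Re) (%y. (rm y, rm (dd g y))) (%y. (rh y, rh (dd g y))) x)"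

context
 fixes g assumes g: "g\<in>G"
begin

lemma sig_rep: "env_rep R Re rm (%y. rh y +\<^sub>Re rm (dd g y))"
 unfolding env_rep_def
proof (intro conjI ballI)
 note d = dd_R[OF g]
 note T = env_algs(1,4)
 show "lin R Re rm" by (rule env_m_lin[OF R])
 show "lin R Re (%y. rh y +\<^sub>Re rm (dd g y))"
  by (rule lin_plus[OF T(2) env_h_lin[OF R] lin_comp[OF dd_lin_R[OF g] env_m_lin[OF R]]])
 show "rm 1\<^sub>R = 1\<^sub>Re" by (rule env_m_one[OF R])
 fix x y assume x: "x\<in>|R|" and y: "y\<in>|R|"
 note c = x y d[OF x] d[OF y]
 note c3 = R_closed(3)[OF x y] R_closed(3)[OF d[OF x] y] R_closed(3)[OF x d[OF y]] R_closed(3)[OF y d[OF x]]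
 show "rm (x *\<^sub>R y) = rm x *\<^sub>Re rm y" unfolding R_eq by (rule r_rel(1)[OF x y])
 \<comment> \<open>The mixed relation read from right to left, the bracket changing sides by
   antisymmetry.\<close>
 have pb: "rm (dd g x) *\<^sub>Re rh y = rh y *\<^sub>Re rm (dd g x) +\<^sub>Re rm {dd g x, y}\<^sub>C"
  unfolding r_rel(4)[OF y d[OF x]] using c c3 rm_neg_bracket[OF y d[OF x]] by (simp add: v_assoc)
 have e: "dd g {x, y}\<^sub>C = {dd g x, y}\<^sub>C +\<^sub>C {x, dd g y}\<^sub>C" by (rule dd_bracket[OF g RC[OF x] RC[OF y]])
 have "(rh x +\<^sub>Re rm (dd g x)) *\<^sub>Re (rh y +\<^sub>Re rm (dd g y)) =
  (rh x *\<^sub>Re rh y +\<^sub>Re rh x *\<^sub>Re rm (dd g y)) +\<^sub>Re (rm (dd g x) *\<^sub>Re rh y +\<^sub>Re rm (dd g x) *\<^sub>Re rm (dd g y))"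
  using c by (simp add: alg_ldistr alg_rdistr v_assoc v_lcomm)
 also have "... = (rh y +\<^sub>Re rm (dd g y)) *\<^sub>Re (rh x +\<^sub>Re rm (dd g x)) +\<^sub>Re (rh {x, y}\<^sub>C +\<^sub>Re rm (dd g {x, y}\<^sub>C))"
  unfolding pb r_rel(2)[OF x y] r_rel(4)[OF x d[OF y]] r_rel(5)[OF d[OF x] d[OF y]] e r_lin(1)[OF c3(2,3)]
  using c c3 by (simp add: alg_ldistr[OF T(1)] alg_rdistr[OF T(1)] v_assoc[OF T(2)] v_lcomm[OF T(2)] v_comm[OF T(2)])
 finally show "(rh x +\<^sub>Re rm (dd g x)) *\<^sub>Re (rh y +\<^sub>Re rm (dd g y)) =
  (rh y +\<^sub>Re rm (dd g y)) *\<^sub>Re (rh x +\<^sub>Re rm (dd g x)) +\<^sub>Re (rh {x, y}\<^sub>R +\<^sub>Re rm (dd g {x, y}\<^sub>R))" unfolding R_eq .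
 have p: "dd g (x *\<^sub>C y) = dd g x *\<^sub>C y +\<^sub>C x *\<^sub>C dd g y" by (rule dd_prod[OF g RC[OF x] RC[OF y]])
 show "rh (x *\<^sub>R y) +\<^sub>Re rm (dd g (x *\<^sub>R y)) =
  rm y *\<^sub>Re (rh x +\<^sub>Re rm (dd g x)) +\<^sub>Re rm x *\<^sub>Re (rh y +\<^sub>Re rm (dd g y))"
  unfolding R_eq p r_rel(3)[OF x y] r_lin(1)[OF R_closed(1)[OF d[OF x] y] R_closed(1)[OF x d[OF y]]] r_rel(1)[OF d[OF x] y] r_rel(1)[OF x d[OF y]]
   r_rel(5)[OF d[OF x] y]
  using c by (simp add: alg_rdistr[OF T(1)] v_assoc[OF T(2)] v_lcomm[OF T(2)])
 show "(rh x +\<^sub>Re rm (dd g x)) *\<^sub>Re rm y = rm y *\<^sub>Re (rh x +\<^sub>Re rm (dd g x)) +\<^sub>Re rm {x, y}\<^sub>R"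
  using c c3 r_rel(4)[OF x y] r_rel(5)[OF d[OF x] y] unfolding R_eq
  by (simp add: alg_rdistr[OF T(1)] alg_ldistr[OF T(1)] v_assoc[OF T(2)] v_comm[OF T(2)] v_lcomm[OF T(2)])
qed

lemma sig_hom: "alg_hom Re Re (sig g)"
 and sig_m: "y\<in>|R| ==> sig g (rm y) = rm y"
 and sig_h: "y\<in>|R| ==> sig g (rh y) = rh y +\<^sub>Re rm (dd g y)"
 unfolding sig_def using env_lift_hom[OF R env_algs(1) sig_rep] by auto

lemmas sig_closed [simp] = hom_closed[OF sig_hom]

lemma der_rep: "env_rep R (dual Re) (%y. (rm y, rm (dd g y))) (%y. (rh y, rh (dd g y)))"
 unfolding env_rep_def
proof (intro conjI ballI)
 note d = dd_R[OF g]
 note T = env_algs(1,4)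
 note ml = env_m_lin[OF R] and hl = env_h_lin[OF R] and dl = dd_lin_R[OF g]
 show "lin R (dual Re) (%y. (rm y, rm (dd g y)))"
  by (rule k_linearI) (use d in "auto simp: lin_add[OF ml] lin_smult[OF ml] lin_add[OF lin_comp[OF dl ml]] lin_smult[OF lin_comp[OF dl ml]]")
 show "lin R (dual Re) (%y. (rh y, rh (dd g y)))"
  by (rule k_linearI) (use d in "auto simp: lin_add[OF hl] lin_smult[OF hl] lin_add[OF lin_comp[OF dl hl]] lin_smult[OF lin_comp[OF dl hl]]")
 show "(rm 1\<^sub>R, rm (dd g 1\<^sub>R)) = 1\<^sub>(dual Re)" using dd_one[OF g] r_zero by (simp add: R_eq)
 fix x y assume x: "x\<in>|R|" and y: "y\<in>|R|"
 note c = x y d[OF x] d[OF y]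
 note c3 = R_closed(3)[OF x y] R_closed(3)[OF d[OF x] y] R_closed(3)[OF x d[OF y]]
 note c1 = R_closed(1)[OF d[OF x] y] R_closed(1)[OF x d[OF y]]
 have e: "dd g {x, y}\<^sub>C = {dd g x, y}\<^sub>C +\<^sub>C {x, dd g y}\<^sub>C" by (rule dd_bracket[OF g RC[OF x] RC[OF y]])
 have p: "dd g (x *\<^sub>C y) = dd g x *\<^sub>C y +\<^sub>C x *\<^sub>C dd g y" by (rule dd_prod[OF g RC[OF x] RC[OF y]])
 note sm = alg_rdistr[OF T(1)] alg_ldistr[OF T(1)] v_assoc[OF T(2)] v_lcomm[OF T(2)] v_comm[OF T(2)]
 show "(rm (x *\<^sub>R y), rm (dd g (x *\<^sub>R y))) = (rm x, rm (dd g x)) *\<^sub>(dual Re) (rm y, rm (dd g y))"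
  unfolding R_eq p r_lin(1)[OF c1] r_rel(1)[OF x y] r_rel(1)[OF d[OF x] y] r_rel(1)[OF x d[OF y]] using c by (simp add: sm)
 show "(rh x, rh (dd g x)) *\<^sub>(dual Re) (rh y, rh (dd g y)) =
  (rh y, rh (dd g y)) *\<^sub>(dual Re) (rh x, rh (dd g x)) +\<^sub>(dual Re) (rh {x, y}\<^sub>R, rh (dd g {x, y}\<^sub>R))"
  unfolding R_eq e r_lin(2)[OF c3(2,3)] dual_simps fst_conv snd_conv r_rel(2)[OF x y] r_rel(2)[OF d[OF x] y] r_rel(2)[OF x d[OF y]] using c c3 by (simp add: sm)
 show "(rh (x *\<^sub>R y), rh (dd g (x *\<^sub>R y))) =
  (rm y, rm (dd g y)) *\<^sub>(dual Re) (rh x, rh (dd g x)) +\<^sub>(dual Re) (rm x, rm (dd g x)) *\<^sub>(dual Re) (rh y, rh (dd g y))"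
  unfolding R_eq p r_lin(2)[OF c1] dual_simps fst_conv snd_conv r_rel(3)[OF x y] r_rel(3)[OF d[OF x] y] r_rel(3)[OF x d[OF y]] using c by (simp add: sm)
 show "(rh x, rh (dd g x)) *\<^sub>(dual Re) (rm y, rm (dd g y)) =
  (rm y, rm (dd g y)) *\<^sub>(dual Re) (rh x, rh (dd g x)) +\<^sub>(dual Re) (rm {x, y}\<^sub>R, rm (dd g {x, y}\<^sub>R))"
  unfolding R_eq e r_lin(1)[OF c3(2,3)] dual_simps fst_conv snd_conv r_rel(4)[OF x y] r_rel(4)[OF d[OF x] y] r_rel(4)[OF x d[OF y]] using c c3 by (simp add: sm)
qed

private lemmas dhom = env_lift_hom[OF R dual_algebra[OF env_algs(1)] der_rep]

text \<open>The first component is an algebra map fixing the generators. That it is the identity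
  makes the second component a derivation.\<close>

private lemma der_fst:
 assumes "x\<in>|Re|"
 shows "fst (env_lift K (dual Re) (%y. (rm y, rm (dd g y))) (%y. (rh y, rh (dd g y))) x) = x"
proof (rule env_hom_eq[OF R env_algs(1) _ _ _ _ assms])
 have "alg_hom (dual Re) Re fst" unfolding alg_hom_def k_linear_def by auto
 thus "alg_hom Re Re (%x. fst (env_lift K (dual Re) (%y. (rm y, rm (dd g y))) (%y. (rh y, rh (dd g y))) x))"
  by (rule hom_comp[OF dhom(1)])
 show "alg_hom Re Re (%x. x)" unfolding alg_hom_def k_linear_def by auto
qed (simp_all add: dhom(2,3))

lemma der_lin: "lin Re Re (der g)"
proof -
 have "lin (dual Re) Re snd" unfolding k_linear_def by auto
 thus ?thesis unfolding der_def[abs_def] by (rule lin_comp[OF hom_lin[OF dhom(1)]])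
qed

lemmas der_closed [simp] = lin_closed[OF der_lin]

lemma der_mult: "x\<in>|Re| ==> y\<in>|Re| ==> der g (x *\<^sub>Re y) = x *\<^sub>Re der g y +\<^sub>Re der g x *\<^sub>Re y"
 unfolding der_def by (simp add: hom_mult[OF dhom(1)] der_fst)
lemma der_m: "y\<in>|R| ==> der g (rm y) = rm (dd g y)"
 unfolding der_def by (simp add: dhom(2))
lemma der_h: "y\<in>|R| ==> der g (rh y) = rh (dd g y)"
 unfolding der_def by (simp add: dhom(3))
lemma der_one: "der g 1\<^sub>Re = 0\<^sub>Re"
 unfolding der_def by (simp add: hom_one[OF dhom(1)])

end

lemma sig_one: "x\<in>|Re| ==> sig 1\<^sub>C x = x"
proof (rule env_hom_eq[OF R env_algs(1) sig_hom[OF G_one]])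
 show "alg_hom Re Re (%x. x)" unfolding alg_hom_def k_linear_def by auto
qed (simp_all add: sig_m[OF G_one] sig_h[OF G_one] dd_unit[OF RC] r_zero)

lemma sig_mult: "g\<in>G ==> t\<in>G ==> x\<in>|Re| ==> sig (g *\<^sub>C t) x = sig g (sig t x)"
 by (rule env_hom_eq[OF R env_algs(1) sig_hom[OF G_mult] hom_comp[OF sig_hom sig_hom]])
  (simp_all add: sig_m sig_h G_mult dd_R dd_mult[OF _ _ RC] r_lin hom_add[OF sig_hom] v_assoc)

lemma der_add: "g\<in>G ==> t\<in>G ==> x\<in>|Re| ==> der (g *\<^sub>C t) x = der g x +\<^sub>Re der t x"
proof -
 assume g: "g\<in>G" and t: "t\<in>G"
 note sm = alg_rdistr[OF env_algs(1)] alg_ldistr[OF env_algs(1)] v_assoc[OF env_algs(4)] v_lcomm[OF env_algs(4)]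
 note gt = G_mult[OF g t]
 assume "x\<in>|Re|"
 thus ?thesis
  by (induction rule: env_induct[OF R, consumes 1, case_names one add smult m h])
   (simp_all add: g t gt der_one der_mult der_m der_h lin_add[OF der_lin] lin_smult[OF der_lin] v_smult_rdistr
    dd_mult[OF g t RC] r_lin dd_R sm)
qed

text \<open>Induction on words: on generators the two orders agree because \<open>dd g\<close> and
  \<open>dd t\<close> commute, and the Leibniz rule carries this to products.\<close>

lemma der_sig: "g\<in>G ==> t\<in>G ==> x\<in>|Re| ==> der g (sig t x) = sig t (der g x)"
proof -
 assume g: "g\<in>G" and t: "t\<in>G"
 note sm = alg_rdistr[OF env_algs(1)] alg_ldistr[OF env_algs(1)] v_assoc[OF env_algs(4)] v_lcomm[OF env_algs(4)]
 note h = sig_hom[OF t]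
 have z: "sig t 0\<^sub>Re = 0\<^sub>Re" by (rule lin_zero[OF hom_lin[OF h] env_algs(4,4)])
 assume "x\<in>|Re|"
 thus ?thesis
  by (induction rule: env_induct[OF R, consumes 1, case_names one add smult m h])
   (simp_all add: g t z der_one der_mult der_m der_h lin_add[OF der_lin] lin_smult[OF der_lin]
    hom_one[OF h] hom_add[OF h] hom_smult[OF h] hom_mult[OF h] sig_m sig_h dd_comm[OF g t RC] dd_R)
qed

lemma der_comm: "g\<in>G ==> t\<in>G ==> x\<in>|Re| ==> der g (der t x) = der t (der g x)"
proof -
 assume g: "g\<in>G" and t: "t\<in>G"
 note sm = v_assoc[OF env_algs(4)] v_lcomm[OF env_algs(4)] v_comm[OF env_algs(4)]
 have z: "der u 0\<^sub>Re = 0\<^sub>Re" if "u\<in>G" for u by (rule lin_zero[OF der_lin[OF that] env_algs(4,4)])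
 assume "x\<in>|Re|"
 thus ?thesis
  by (induction rule: env_induct[OF R, consumes 1, case_names one add smult m h])
   (simp_all add: g t z der_one der_mult der_m der_h lin_add[OF der_lin] lin_smult[OF der_lin] dd_comm[OF g t RC] dd_R sm)
qed

definition eY :: "'c => (('c + 'c) list => 'k) set => (('c + 'c) list => 'k) set" where "eY y = lmul Re (rm y)"
definition eB :: "'c => (('c + 'c) list => 'k) set => (('c + 'c) list => 'k) set" where "eB y = lmul Re (rh y)"
definition eG :: "'c => (('c + 'c) list => 'k) set => (('c + 'c) list => 'k) set" where "eG g = restrict (sig g) (carrier Re)"
definition eX :: "'c => (('c + 'c) list => 'k) set => (('c + 'c) list => 'k) set" where "eX g = restrict (der g) (carrier Re)"

text \<open>R^e acts on itself by left multiplication, m_g acts by an automorphism and m_{g^-1} h_g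
  by a derivation; the mixed conditions are multiplicativity of \<open>sig g\<close> and the Leibniz
  rule of \<open>der g\<close>. Through \<open>universal\<close>, R^e thus becomes a module over
  C^e.\<close>

lemma end_datum: "U_datum (end_alg Re) eY eB eG eX"
proof -
 let ?E = "end_alg Re"
 have E: "k_algebra K ?E" by (rule end_algebra[OF env_algs(4)])
 have rep: "env_rep R ?E eY eB"
  using env_rep_post[OF env_m_h_rep[OF R] lmul_hom[OF env_algs(1)] R env_algs(1)] by (simp add: eY_def[abs_def] eB_def[abs_def])
 have cG: "eG g\<in>|?E|" "eX g\<in>|?E|" if "g\<in>G" for g
  unfolding eG_def eX_def by (rule end_restrict[OF env_algs(4) hom_lin[OF sig_hom[OF that]]], rule end_restrict[OF env_algs(4) der_lin[OF that]])
 have cY: "eY y\<in>|?E|" "eB y\<in>|?E|" if "y\<in>|R|" for y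
  using lin_closed[OF env_repD(1)[OF rep] that] lin_closed[OF env_repD(2)[OF rep] that] .
 note ev = eY_def eB_def eG_def eX_def end_simps lmul_def
 have cm: "f *\<^sub>?E h\<in>|?E|" "f +\<^sub>?E h\<in>|?E|" if "f\<in>|?E|" "h\<in>|?E|" for f h using E that by auto
 have eq: "f = h" if "f\<in>|?E|" "h\<in>|?E|" "!!x. x\<in>|Re| ==> f x = h x" for f h by (rule end_eqI[OF that])
 note hm = hom_add[OF sig_hom] hom_mult[OF sig_hom] lin_add[OF der_lin] der_mult
 show ?thesis unfolding U_datum_def
 proof (intro conjI ballI E rep)
  show "eG 1\<^sub>C = 1\<^sub>?E" by (rule eq) (use cG[OF G_one] E in \<open>simp_all add: ev sig_one\<close>, simp add: end_simps(2)[symmetric])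
  fix g assume g: "g\<in>G"
  show "eG g\<in>|?E|" "eX g\<in>|?E|" by (rule cG[OF g])+
  { fix t assume t: "t\<in>G"
   show "eG (g *\<^sub>C t) = eG g *\<^sub>?E eG t"
    by (rule eq[OF cG(1)[OF G_mult[OF g t]] cm(1)[OF cG(1)[OF g] cG(1)[OF t]]]) (use g t in "simp add: ev sig_mult")
   show "eX (g *\<^sub>C t) = eX g +\<^sub>?E eX t"
    by (rule eq[OF cG(2)[OF G_mult[OF g t]] cm(2)[OF cG(2)[OF g] cG(2)[OF t]]]) (use g t in "simp add: ev der_add")
   show "eX g *\<^sub>?E eG t = eG t *\<^sub>?E eX g"
    by (rule eq[OF cm(1)[OF cG(2)[OF g] cG(1)[OF t]] cm(1)[OF cG(1)[OF t] cG(2)[OF g]]]) (use g t in "simp add: ev der_sig")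
   show "eX g *\<^sub>?E eX t = eX t *\<^sub>?E eX g"
    by (rule eq[OF cm(1)[OF cG(2)[OF g] cG(2)[OF t]] cm(1)[OF cG(2)[OF t] cG(2)[OF g]]]) (simp add: ev g t der_comm[OF g t]) }
  { fix y assume y: "y\<in>|R|"
   note cc = cG[OF g] cY[OF y] cY[OF dd_R[OF g y]]
   show "eG g *\<^sub>?E eY y = eY y *\<^sub>?E eG g"
    by (rule eq) (intro cm cc, intro cm cc, use g y in \<open>simp add: ev hm sig_m\<close>)
   show "eG g *\<^sub>?E eB y = (eB y +\<^sub>?E eY (dd g y)) *\<^sub>?E eG g"
    by (rule eq) (intro cm cc, intro cm cc, use g y in \<open>simp add: ev hm sig_h alg_ldistr dd_R\<close>)
   show "eX g *\<^sub>?E eY y = eY y *\<^sub>?E eX g +\<^sub>?E eY (dd g y)"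
    by (rule eq) (intro cm cc, intro cm cc, use g y in \<open>simp add: ev hm der_m dd_R\<close>)
   show "eX g *\<^sub>?E eB y = eB y *\<^sub>?E eX g +\<^sub>?E eB (dd g y)"
    by (rule eq) (intro cm cc, intro cm cc, use g y in \<open>simp add: ev hm der_h dd_R\<close>) }
 qed
qed

subsection \<open>The enveloping algebra of the group algebra\<close>

lemma bil_eq_H:
 assumes f: "bil H H T f" and h: "bil H H T h" and T: "vs T"
  and e: "!!g t. g\<in>G ==> t\<in>G ==> f g t = h g t" and c: "c\<in>|H|" "d\<in>|H|"
 shows "f c d = h c d"
proof -
 have Hm: "vs H" using H by simp
 \<comment> \<open>Submodules of the record of kG are also submodules of C, so the span of G is the
   same in both.\<close>
 have sp: "|H| = span H G"
 proof
  have "sub N C" if "sub N H" for N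
   by (rule submodule_crit[OF Ca(2)]) (use sub_carrier[OF Hm that] HC sub_add[OF Hm that] sub_smult[OF Hm that] sub_zero[OF Hm that] in "auto simp: H_eq")
  thus "|H|\<subseteq>span H G" unfolding H_carrier k_span_def by blast
  have "G\<subseteq>|H|" using GH by auto
  thus "span H G\<subseteq>|H|" by (rule span_least[OF sub_full[OF Hm]])
 qed
 have S: "G\<subseteq>|H|" using GH by auto
 note c' = c[unfolded sp]
 have 1: "f g d = h g d" if g: "g\<in>G" for g
  by (rule lin_eq_span[OF bil_right[OF f GH[OF g]] bil_right[OF h GH[OF g]] Hm T S e[OF g] c'(2)])
 show ?thesis
  by (rule lin_eq_span[OF bil_left[OF f c(2)] bil_left[OF h c(2)] Hm T S 1 c'(1)])
qed

text \<open>On kG the bracket is zero and all relations are bilinear, so only commutation and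
  product rules for group elements remain.\<close>

lemma env_rep_H:
 assumes T: "k_algebra K T" and \<mu>: "lin H T \<mu>" and \<eta>: "lin H T \<eta>" and one: "\<mu> 1\<^sub>C = 1\<^sub>T"
  and e: "!!g t. g\<in>G ==> t\<in>G ==> \<mu> (g *\<^sub>C t) = \<mu> g *\<^sub>T \<mu> t"
   "!!g t. g\<in>G ==> t\<in>G ==> \<eta> (g *\<^sub>C t) = \<mu> t *\<^sub>T \<eta> g +\<^sub>T \<mu> g *\<^sub>T \<eta> t"
   "!!g t. g\<in>G ==> t\<in>G ==> \<eta> g *\<^sub>T \<eta> t = \<eta> t *\<^sub>T \<eta> g"
   "!!g t. g\<in>G ==> t\<in>G ==> \<eta> g *\<^sub>T \<mu> t = \<mu> t *\<^sub>T \<eta> g"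
 shows "env_rep H T \<mu> \<eta>"
proof -
 have Hm: "vs H" and Hal: "k_algebra K H" using H by simp_all
 note Tm = alg_module[OF T] and mb = alg_bilinear[OF T] and hb = alg_bilinear[OF Hal, unfolded H_eq]
 note cl = lin_closed[OF \<mu>] lin_closed[OF \<eta>]
 have z: "\<mu> 0\<^sub>C = 0\<^sub>T" "\<eta> 0\<^sub>C = 0\<^sub>T" using lin_zero[OF \<mu> Hm Tm] lin_zero[OF \<eta> Hm Tm] by (simp_all add: H_eq)
 note bl = lin_plus[OF Tm] lin_comp[OF \<mu> bil_left[OF mb]] lin_comp[OF \<eta> bil_right[OF mb]]
    lin_comp[OF \<mu> bil_right[OF mb]] lin_comp[OF \<eta> bil_left[OF mb]]
 show ?thesis unfolding env_rep_def H_eq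
 proof (intro conjI ballI \<mu> \<eta> one)
  fix x y assume xy: "x\<in>|H|" "y\<in>|H|"
  show "\<mu> (x *\<^sub>C y) = \<mu> x *\<^sub>T \<mu> y"
   by (rule bil_eq_H[OF bil_post[OF hb \<mu>] bil_comp[OF mb \<mu> \<mu>] Tm e(1) xy])
  show "\<eta> (x *\<^sub>C y) = \<mu> y *\<^sub>T \<eta> x +\<^sub>T \<mu> x *\<^sub>T \<eta> y"
  proof (rule bil_eq_H[OF bil_post[OF hb \<eta>] _ Tm e(2) xy])
   show "bil H H T (%x y. \<mu> y *\<^sub>T \<eta> x +\<^sub>T \<mu> x *\<^sub>T \<eta> y)"
    unfolding k_bilinear_def by (intro conjI ballI bl cl)
  qed
  have "\<eta> x *\<^sub>T \<eta> y = \<eta> y *\<^sub>T \<eta> x"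
  proof (rule bil_eq_H[OF bil_comp[OF mb \<eta> \<eta>] _ Tm e(3) xy])
   show "bil H H T (%x y. \<eta> y *\<^sub>T \<eta> x)" unfolding k_bilinear_def by (intro conjI ballI bl cl)
  qed
  thus "\<eta> x *\<^sub>T \<eta> y = \<eta> y *\<^sub>T \<eta> x +\<^sub>T \<eta> {x, y}\<^sub>C" using cl xy T Tm by (simp add: H_bracket z)
  have "\<eta> x *\<^sub>T \<mu> y = \<mu> y *\<^sub>T \<eta> x"
  proof (rule bil_eq_H[OF bil_comp[OF mb \<eta> \<mu>] _ Tm e(4) xy])
   show "bil H H T (%x y. \<mu> y *\<^sub>T \<eta> x)" unfolding k_bilinear_def by (intro conjI ballI bl cl)
  qed
  thus "\<eta> x *\<^sub>T \<mu> y = \<mu> y *\<^sub>T \<eta> x +\<^sub>T \<mu> {x, y}\<^sub>C" using cl xy T Tm by (simp add: H_bracket z)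
 qed
qed

lemma g_rel:
 assumes "x\<in>|H|" "y\<in>|H|"
 shows "gm (x *\<^sub>C y) = gm x *\<^sub>He gm y" "gh x *\<^sub>He gh y = gh y *\<^sub>He gh x"
  "gh (x *\<^sub>C y) = gm y *\<^sub>He gh x +\<^sub>He gm x *\<^sub>He gh y"
  "gh x *\<^sub>He gm y = gm y *\<^sub>He gh x" "gm x *\<^sub>He gm y = gm y *\<^sub>He gm x"
proof -
 have Hm: "vs H" using H by simp
 have z: "gm 0\<^sub>C = 0\<^sub>He" "gh 0\<^sub>C = 0\<^sub>He"
  using lin_zero[OF env_m_lin[OF H] Hm] lin_zero[OF env_h_lin[OF H] Hm] by (simp_all add: H_eq)
 note e = env_repD(4-7)[OF env_m_h_rep[OF H] assms, unfolded H_eq H_bracket[OF assms] z]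
 show "gm (x *\<^sub>C y) = gm x *\<^sub>He gm y" "gh (x *\<^sub>C y) = gm y *\<^sub>He gh x +\<^sub>He gm x *\<^sub>He gh y" by (rule e)+
 show "gh x *\<^sub>He gh y = gh y *\<^sub>He gh x" "gh x *\<^sub>He gm y = gm y *\<^sub>He gh x"
  unfolding e(2) e(4) using assms by simp_all
 show "gm x *\<^sub>He gm y = gm y *\<^sub>He gm x"
  using e(1) env_repD(4)[OF env_m_h_rep[OF H] assms(2,1), unfolded H_eq] pa_comm[OF C HC[OF assms(1)] HC[OF assms(2)]] by simp
qed

lemma gm_one: "gm 1\<^sub>C = 1\<^sub>He"
 using env_m_one[OF H] by (simp add: H_eq)

text \<open>m_a and h_a are linear in a and G spans kG, so words in the m_g and h_g with g in G
  suffice.\<close>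

lemma He_induct [consumes 1, case_names one add smult m h]:
 assumes "x\<in>|He|" and one: "P 1\<^sub>He"
  and add: "!!x y. x\<in>|He| ==> y\<in>|He| ==> P x ==> P y ==> P (x +\<^sub>He y)"
  and smult: "!!k x. k\<in>|K| ==> x\<in>|He| ==> P x ==> P (k \<odot>\<^sub>He x)"
  and m: "!!g x. g\<in>G ==> x\<in>|He| ==> P x ==> P (gm g *\<^sub>He x)"
  and h: "!!g x. g\<in>G ==> x\<in>|He| ==> P x ==> P (gh g *\<^sub>He x)"
 shows "P x"
proof -
 have Hm: "vs H" using H by simp
 have z: "P 0\<^sub>He" using smult[OF K.zero_closed _ one] by simp
 have zz: "gm 0\<^sub>C = 0\<^sub>He" "gh 0\<^sub>C = 0\<^sub>He"
  using lin_zero[OF env_m_lin[OF H] Hm] lin_zero[OF env_h_lin[OF H] Hm] by (simp_all add: H_eq)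
 note l = lin_add[OF env_m_lin[OF H]] lin_add[OF env_h_lin[OF H]] lin_smult[OF env_m_lin[OF H]] lin_smult[OF env_h_lin[OF H]]
 have gen: "P (gm a *\<^sub>He x) & P (gh a *\<^sub>He x)" if a: "a\<in>|H|" and x: "x\<in>|He|" "P x" for a x
  using a[unfolded H_carrier] Ca(2) G_sub
 proof (induction rule: span_induct)
  case zero
  show ?case using x z by (simp add: zz)
 next
  case (base s)
  thus ?case using m h x by auto
 next
  case (add a b)
  have ab: "a\<in>|H|" "b\<in>|H|" using add H_carrier by auto
  thus ?case using add(3,4) assms(3) x l ab by (simp add: H_eq alg_ldistr)
 next
  case (smult k a)
  have ab: "a\<in>|H|" using smult H_carrier by auto
  thus ?case using smult(1,3) assms(4) x l ab by (simp add: H_eq alg_smult)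
 qed
 show ?thesis using assms(1)
  by (induction rule: env_induct[OF H, consumes 1, case_names one add smult m h]) (use one add smult gen in auto)
qed

lemma gr_tensor_alg: "k_algebra K (tensor_alg K He He)"
 by (rule tensor_alg_algebra) simp_all

lemma He_bil:
 assumes f: "lin H He f" and h: "lin H He h"
 shows "bil H H (tensor_alg K He He) (%a b. ts He He (f a) (h b))"
 unfolding bil_tensor_alg by (rule tensor_map_bil[OF env_algs(5,5) f h])

text \<open>m_g is group-like and h_g is (g, g)-primitive. Multiplicativity comes from the universal
  property, whose relations hold in the tensor square because the m_g and h_g commute with each
  other.\<close>

lemma env_comult_hom:
 shows "alg_hom He (tensor_alg K He He) (env_comult K H)"
  "g\<in>G ==> env_comult K H (gm g) = ts He He (gm g) (gm g)"
  "g\<in>G ==> env_comult K H (gh g) = ts He He (gm g) (gh g) +\<^sub>(TS He He) ts He He (gh g) (gm g)"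
proof -
 let ?EE = "tensor_alg K He He" and ?T = "TS He He"
 have Hm: "vs H" using H by simp
 note EE = gr_tensor_alg
 note EEm = alg_module[OF EE]
 note ml = env_m_lin[OF H] and hl = env_h_lin[OF H]
 define f where "f = (%a1 a2. ts He He (gm a1) (gm a2))"
 define h where "h = (%a1 a2. ts He He (gm a1) (gh a2) +\<^sub>?EE ts He He (gh a1) (gm a2))"
 have fb: "bil H H ?EE f" unfolding f_def by (rule He_bil[OF ml ml])
 have hb: "bil H H ?EE h" unfolding h_def
  by (rule bil_plus[OF EEm He_bil[OF ml hl] He_bil[OF hl ml]])
 let ?\<mu> = "%a. tlift ?EE f (comult H a)" and ?\<eta> = "%a. tlift ?EE h (comult H a)"
 have \<mu>: "lin H ?EE ?\<mu>" by (rule lin_comp[OF H_comult_lin tensor_lift_lin[OF Hm Hm EEm fb]])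
 have \<eta>: "lin H ?EE ?\<eta>" by (rule lin_comp[OF H_comult_lin tensor_lift_lin[OF Hm Hm EEm hb]])
 have v: "?\<mu> g = ts He He (gm g) (gm g)" "?\<eta> g = ts He He (gm g) (gh g) +\<^sub>?T ts He He (gh g) (gm g)" if "g\<in>G" for g
  unfolding H_comult[OF that] tensor_lift_tens[OF Hm Hm EEm fb GH[OF that] GH[OF that]] tensor_lift_tens[OF Hm Hm EEm hb GH[OF that] GH[OF that]]
  by (simp_all add: f_def h_def)
 note t = tensor_mult_tens[OF env_algs(2,2)] and tb = tensor_mult_bil[OF env_algs(2,2)]
 note tc = tens_closed[OF env_algs(5,5)] and T = tensor_module[OF env_algs(5,5)]
 note tl = tens_add_l[OF env_algs(5,5)] tens_add_r[OF env_algs(5,5)]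
 have rep: "env_rep H ?EE ?\<mu> ?\<eta>"
 proof (rule env_rep_H[OF EE \<mu> \<eta>])
  show "?\<mu> 1\<^sub>C = 1\<^sub>?EE" using v[OF G_one] by (simp add: gm_one)
  fix g u assume g: "g\<in>G" and u: "u\<in>G"
  note c = GH[OF g] GH[OF u] and gu = G_mult[OF g u]
  show "?\<mu> (g *\<^sub>C u) = ?\<mu> g *\<^sub>?EE ?\<mu> u" unfolding v[OF g] v[OF u] v[OF gu] using c by (simp add: t g_rel)
  show "?\<eta> (g *\<^sub>C u) = ?\<mu> u *\<^sub>?EE ?\<eta> g +\<^sub>?EE ?\<mu> g *\<^sub>?EE ?\<eta> u"
   unfolding v[OF g] v[OF u] v[OF gu] using c g_rel(5)[OF c]
   by (simp add: t g_rel(1,3) bil_add_r[OF tb] tc tl T v_assoc v_lcomm)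
  show "?\<eta> g *\<^sub>?EE ?\<mu> u = ?\<mu> u *\<^sub>?EE ?\<eta> g"
   unfolding v[OF g] v[OF u] using c g_rel(4,5)[OF c] by (simp add: t bil_add_r[OF tb] bil_add_l[OF tb] tc)
  show "?\<eta> g *\<^sub>?EE ?\<eta> u = ?\<eta> u *\<^sub>?EE ?\<eta> g"
   unfolding v[OF g] v[OF u] using c g_rel(2,4,5)[OF c] g_rel(4)[OF c(2,1)]
   by (simp add: t bil_add_r[OF tb] bil_add_l[OF tb] tc T v_assoc v_lcomm v_comm)
 qed
 have d: "env_comult K H = env_lift K ?EE ?\<mu> ?\<eta>" unfolding env_comult_def Let_def f_def h_def ..
 note l = env_lift_hom[OF H EE rep]
 show "alg_hom He ?EE (env_comult K H)" unfolding d by (rule l(1))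
 show "g\<in>G ==> env_comult K H (gm g) = ts He He (gm g) (gm g)" unfolding d using l(2) v(1) GH by simp
 show "g\<in>G ==> env_comult K H (gh g) = ts He He (gm g) (gh g) +\<^sub>?T ts He He (gh g) (gm g)"
  unfolding d using l(3) v(2) GH by simp
qed

lemma base_k_algebra: "k_algebra K (base_algebra K)"
 by (rule k_algebraI[OF base_module]) (auto simp: K.m_assoc K.l_distr K.r_distr K.m_lcomm intro!: k_bilinearI)

lemma env_counit_hom:
 shows "alg_hom He (base_algebra K) (env_counit K H)"
  "g\<in>G ==> env_counit K H (gm g) = \<one>" "g\<in>G ==> env_counit K H (gh g) = \<zero>"
proof -
 have rep: "env_rep H (base_algebra K) (counit H) (%_. \<zero>)"
  by (rule env_rep_H[OF base_k_algebra H_counit_lin])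
   (use lin_null[OF base_module, of H] H_counit G_mult G_one in auto)
 note l = env_lift_hom[OF H base_k_algebra rep]
 show "alg_hom He (base_algebra K) (env_counit K H)" unfolding env_counit_def by (rule l(1))
 show "g\<in>G ==> env_counit K H (gm g) = \<one>" "g\<in>G ==> env_counit K H (gh g) = \<zero>"
  unfolding env_counit_def using l(2,3) GH H_counit by auto
qed

end

context base
begin

text \<open>The axioms are equations, and an injective linear map compatible with products reflects
  them. This gives associativity of the smash product without a computation with coproducts.\<close>

lemma k_algebra_transport:
 assumes S: "vs S" and A: "k_algebra K A" and f: "lin S A f" and inj: "inj_on f (carrier S)"
  and c: "!!x y. x\<in>|S| ==> y\<in>|S| ==> x *\<^sub>S y\<in>|S|" "1\<^sub>S\<in>|S|"
  and m: "!!x y. x\<in>|S| ==> y\<in>|S| ==> f (x *\<^sub>S y) = f x *\<^sub>A f y" "f 1\<^sub>S = 1\<^sub>A"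
 shows "k_algebra K S"
proof -
 have eq: "x = y" if "f x = f y" "x\<in>|S|" "y\<in>|S|" for x y using inj that by (auto simp: inj_on_def)
 note fc = lin_closed[OF f] and fl = lin_add[OF f] lin_smult[OF f]
 show ?thesis
 proof (rule k_algebraI[OF S c])
  show "(x *\<^sub>S y) *\<^sub>S z = x *\<^sub>S (y *\<^sub>S z)" if "x\<in>|S|" "y\<in>|S|" "z\<in>|S|" for x y z
   by (rule eq) (use that c m fc A in "simp_all add: alg_assoc")
  show "1\<^sub>S *\<^sub>S x = x" "x *\<^sub>S 1\<^sub>S = x" if "x\<in>|S|" for x
   by (rule eq; use that c m fc A in simp)+
  show "bil S S S (%x y. x *\<^sub>S y)"
  proof (rule k_bilinearI)
   show "(x +\<^sub>S x') *\<^sub>S y = x *\<^sub>S y +\<^sub>S x' *\<^sub>S y" "y *\<^sub>S (x +\<^sub>S x') = y *\<^sub>S x +\<^sub>S y *\<^sub>S x'"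
    if "x\<in>|S|" "x'\<in>|S|" "y\<in>|S|" for x x' y
    by (rule eq; use that c m fc A S in \<open>simp add: fl alg_ldistr alg_rdistr\<close>)+
   show "(k \<odot>\<^sub>S x) *\<^sub>S y = k \<odot>\<^sub>S (x *\<^sub>S y)" "x *\<^sub>S (k \<odot>\<^sub>S y) = k \<odot>\<^sub>S (x *\<^sub>S y)"
    if "k\<in>|K|" "x\<in>|S|" "y\<in>|S|" for k x y
    by (rule eq; use that c m fc A S in \<open>simp add: fl alg_smult\<close>)+
  qed (rule c)
 qed
qed

end

section \<open>The action of (kG)^e on R^e\<close>

context graded_pa
begin

text \<open>\<open>env_map\<close> depends on the target and the map but not on the source, so this
  one function is \<Psi> on R^e and \<iota>^e on (kG)^e.\<close>

abbreviation "inR \<equiv> env_map K C (%y. y) :: (('c + 'c) list => 'k) set => (('c + 'c) list => 'k) set"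

lemma inc_R: "poisson_hom R C (%y. y)"
 unfolding poisson_hom_def alg_hom_def k_linear_def using RC by (auto simp: R_eq)

lemma inc_H: "poisson_hom H C (%y. y)"
 unfolding poisson_hom_def alg_hom_def k_linear_def using HC by (auto simp: H_eq)

lemmas inR_hom = env_map_hom[OF R C inc_R]
lemmas inH_hom = env_map_hom[OF H C inc_H]

abbreviation "cm \<equiv> env_m K C"
abbreviation "ch \<equiv> env_h K C"

lemma cc [simp]: "y\<in>|C| ==> cm y\<in>|Ce|" "y\<in>|C| ==> ch y\<in>|Ce|"
 by (rule env_m_closed[OF C], assumption, rule env_h_closed[OF C])

lemmas c_rel = env_repD(4-7)[OF env_m_h_rep[OF C]]

text \<open>\<open>gr_env_action\<close> in the present setting, with the double bracket replaced by
  the square of \<open>dd g\<close>.\<close>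

definition good_act :: "((('c + 'c) list => 'k) set => (('c + 'c) list => 'k) set => (('c + 'c) list => 'k) set) => bool"
 where "good_act act \<longleftrightarrow> module_algebra K He (env_comult K H) (env_counit K H) Re act &
  (\<forall>g\<in>G. \<forall>y\<in>carrier R. act (gm g) (rm y) = rm y & act (gm g) (rh y) = rh y +\<^sub>Re rm (dd g y) &
   act (gh g) (rm y) = rm (dd g y) & act (gh g) (rh y) = rh (dd g y) +\<^sub>Re rm (dd g (dd g y)))"

text \<open>The action of C^e on R^e is restricted along \<iota>^e. Then m_g acts by
  \<open>sig g\<close> and h_g, being m_g times m_{g^-1} h_g, by \<open>sig g\<close> after
  \<open>der g\<close>. The first is multiplicative and the second obeys a twisted Leibniz rule,
  which is the module algebra law on generators.\<close>

theorem act_exists: "\<exists>act. good_act act"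
proof -
 let ?E = "end_alg Re" and ?EE = "tensor_alg K He He" and ?T = "TS He He"
 have E: "k_algebra K ?E" by (rule end_algebra[OF env_algs(4)])
 obtain \<mu> \<eta> where rep: "env_rep C ?E \<mu> \<eta>" and vR: "!!y. y\<in>|R| ==> \<mu> y = eY y" "!!y. y\<in>|R| ==> \<eta> y = eB y"
  and vG: "!!g. g\<in>G ==> \<mu> g = eG g" "!!g. g\<in>G ==> \<eta> g = eG g *\<^sub>?E eX g"
  using universal[OF end_datum] by blast
 define \<rho> where "\<rho> b = env_lift K ?E \<mu> \<eta> (inR b)" for b
 note rh1 = env_lift_hom[OF C E rep]
 have rho: "alg_hom He ?E \<rho>" unfolding \<rho>_def[abs_def] by (rule hom_comp[OF inH_hom(1) rh1(1)])
 have rg: "\<rho> (gm g) = eG g" "\<rho> (gh g) = eG g *\<^sub>?E eX g" if "g\<in>G" for g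
  using that by (simp_all add: \<rho>_def inH_hom(2,3) GH rh1(2,3) GC vG)
 define act where "act b a = \<rho> b a" for b a
 have lb: "lin Re Re (act b)" if "b\<in>|He|" for b
  using hom_closed[OF rho that] unfolding end_carrier act_def[abs_def] by simp
 have bil: "bil He Re Re act"
 proof (rule k_bilinearI)
  fix x x' y assume a: "x\<in>|He|" "x'\<in>|He|" "y\<in>|Re|"
  thus "act (x +\<^sub>He x') y = act x y +\<^sub>Re act x' y" by (simp add: act_def hom_add[OF rho] end_simps)
 next
  fix k x y assume a: "k\<in>|K|" "x\<in>|He|" "y\<in>|Re|"
  thus "act (k \<odot>\<^sub>He x) y = k \<odot>\<^sub>Re act x y" by (simp add: act_def hom_smult[OF rho] end_simps)
 qed (simp_all add: lin_closed[OF lb] lin_add[OF lb] lin_smult[OF lb])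
 have ac: "act b a\<in>|Re|" if "b\<in>|He|" "a\<in>|Re|" for a b by (rule bil_closed[OF bil that])
 have aone: "act 1\<^sub>He a = a" if "a\<in>|Re|" for a using that by (simp add: act_def hom_one[OF rho] end_simps)
 have comp: "act (x *\<^sub>He y) a = act x (act y a)" if "x\<in>|He|" "y\<in>|He|" "a\<in>|Re|" for x y a
  using that by (simp add: act_def hom_mult[OF rho] end_simps)
 have g1: "act (gm g) a = sig g a" "act (gh g) a = sig g (der g a)" if "g\<in>G" "a\<in>|Re|" for g a
  using that by (simp_all add: act_def rg end_simps eG_def eX_def)
 have ag: "act (gm g *\<^sub>He x) a = sig g (act x a)" "act (gh g *\<^sub>He x) a = sig g (der g (act x a))"
  if "g\<in>G" "x\<in>|He|" "a\<in>|Re|" for g x a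
  using that GH ac by (simp_all add: comp g1)
 note eps = env_counit_hom and del = env_comult_hom
 have unit: "act x 1\<^sub>Re = env_counit K H x \<odot>\<^sub>Re 1\<^sub>Re" if "x\<in>|He|" for x
  using that
 proof (induction rule: He_induct)
  case one
  thus ?case using hom_one[OF eps(1)] aone[of "1\<^sub>Re"] by simp
 next
  case (add x y)
  thus ?case using hom_add[OF eps(1)] hom_closed[OF eps(1)] by (simp add: bil_add_l[OF bil] v_smult_ldistr)
 next
  case (smult k x)
  thus ?case using hom_smult[OF eps(1)] hom_closed[OF eps(1)] by (simp add: bil_smult_l[OF bil] v_smult_assoc)
 next
  case (m g x)
  thus ?case using hom_mult[OF eps(1)] hom_closed[OF eps(1)] GH
   by (simp add: ag eps(2) hom_smult[OF sig_hom] hom_one[OF sig_hom])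
 next
  case (h g x)
  have z: "sig g 0\<^sub>Re = 0\<^sub>Re" by (rule lin_zero[OF hom_lin[OF sig_hom[OF h(1)]] env_algs(4,4)])
  show ?case using h hom_mult[OF eps(1)] hom_closed[OF eps(1)] GH z
   by (simp add: ag eps(3) lin_smult[OF der_lin] der_one)
 qed
 have prod: "act x (a *\<^sub>Re b) = tlift Re (%x1 x2. act x1 a *\<^sub>Re act x2 b) (env_comult K H x)"
  if x: "x\<in>|He|" and a: "a\<in>|Re|" and b: "b\<in>|Re|" for x a b
 proof -
  note ab = bil_comp[OF alg_bilinear[OF env_algs(1)] bil_left[OF bil a] bil_left[OF bil b]]
  let ?\<Theta> = "tlift Re (%x1 x2. act x1 a *\<^sub>Re act x2 b)"
  have \<Theta>l: "lin ?T Re ?\<Theta>" by (rule tensor_lift_lin[OF env_algs(5,5,4) ab])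
  have \<Theta>t: "?\<Theta> (ts He He u v) = act u a *\<^sub>Re act v b" if "u\<in>|He|" "v\<in>|He|" for u v
   by (rule tensor_lift_tens[OF env_algs(5,5,4) ab that])
  note t = tensor_mult_tens[OF env_algs(2,2)] and tb = tensor_mult_bil[OF env_algs(2,2)]
  note tc = tens_closed[OF env_algs(5,5)]
  have dc: "env_comult K H x\<in>|?T|" if "x\<in>|He|" for x using hom_closed[OF del(1) that] by simp
  \<comment> \<open>Under \<Theta>, left multiplication by \<Delta> m_g corresponds to
    \<open>sig g\<close>, and below left multiplication by \<Delta> h_g to \<open>sig g\<close>
    after \<open>der g\<close>. As \<Delta> is multiplicative, the law passes from x to m_g x and
    h_g x.\<close>
  have 1: "?\<Theta> (ts He He (gm g) (gm g) *\<^sub>?EE u) = sig g (?\<Theta> u)" if g: "g\<in>G" and u: "u\<in>|?T|" for g u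
  proof (rule lin_eq_tensor[OF env_algs(5,5) lin_comp[OF bil_right[OF tb] \<Theta>l] lin_comp[OF \<Theta>l hom_lin[OF sig_hom[OF g]]] _ u])
   show "ts He He (gm g) (gm g)\<in>|?T|" using g GH tc by simp
  qed (use g GH ac in "simp add: t \<Theta>t ag a b hom_mult[OF sig_hom]")
  have 2: "?\<Theta> ((ts He He (gm g) (gh g) +\<^sub>?T ts He He (gh g) (gm g)) *\<^sub>?EE u) = sig g (der g (?\<Theta> u))" if g: "g\<in>G" and u: "u\<in>|?T|" for g u
  proof (rule lin_eq_tensor[OF env_algs(5,5) lin_comp[OF bil_right[OF tb] \<Theta>l] lin_comp[OF lin_comp[OF \<Theta>l der_lin[OF g]] hom_lin[OF sig_hom[OF g]]] _ u])
   show "ts He He (gm g) (gh g) +\<^sub>?T ts He He (gh g) (gm g)\<in>|?T|" using g GH tc tensor_module[OF env_algs(5,5)] by simp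
  qed (use g GH ac tc in "simp add: t bil_add_l[OF tb] lin_add[OF \<Theta>l] \<Theta>t ag a b der_mult hom_mult[OF sig_hom] hom_add[OF sig_hom]")
  show ?thesis using x
  proof (induction rule: He_induct)
   case one
   thus ?case using hom_one[OF del(1)] aone a b by (simp add: \<Theta>t)
  next
   case (add x y)
   thus ?case using hom_add[OF del(1)] dc a b by (simp add: bil_add_l[OF bil] lin_add[OF \<Theta>l])
  next
   case (smult k x)
   thus ?case using hom_smult[OF del(1)] dc a b by (simp add: bil_smult_l[OF bil] lin_smult[OF \<Theta>l])
  next
   case (m g x)
   thus ?case using hom_mult[OF del(1)] dc a b GH by (simp add: ag del(2) 1)
  next
   case (h g x)
   thus ?case using hom_mult[OF del(1)] dc a b GH by (simp add: ag del(3) 2)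
  qed
 qed
 have "good_act act"
  unfolding good_act_def module_algebra_def using bil aone comp unit prod
  by (auto simp: g1 sig_m sig_h der_m der_h dd_R)
 thus ?thesis by blast
qed

section \<open>Commuting (kG)^e past R^e inside C^e\<close>

context
 fixes act assumes act: "good_act act"
begin

private lemma act_bil: "bil He Re Re act"
 and act_one: "a\<in>|Re| ==> act 1\<^sub>He a = a"
 and act_comp: "x\<in>|He| ==> y\<in>|He| ==> a\<in>|Re| ==> act (x *\<^sub>He y) a = act x (act y a)"
 and act_unit: "x\<in>|He| ==> act x 1\<^sub>Re = env_counit K H x \<odot>\<^sub>Re 1\<^sub>Re"
 and act_prod: "x\<in>|He| ==> a\<in>|Re| ==> b\<in>|Re| ==>
  act x (a *\<^sub>Re b) = tlift Re (%x1 x2. act x1 a *\<^sub>Re act x2 b) (env_comult K H x)"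
 using act unfolding good_act_def module_algebra_def by blast+

private lemma act_gen:
 assumes "g\<in>G" "y\<in>|R|"
 shows "act (gm g) (rm y) = rm y" "act (gm g) (rh y) = rh y +\<^sub>Re rm (dd g y)"
  "act (gh g) (rm y) = rm (dd g y)" "act (gh g) (rh y) = rh (dd g y) +\<^sub>Re rm (dd g (dd g y))"
 using act assms unfolding good_act_def by blast+

private lemmas act_closed = bil_closed[OF act_bil]

private lemma act_g_mult:
 assumes g: "g\<in>G" and a: "a\<in>|Re|" and b: "b\<in>|Re|"
 shows "act (gm g) (a *\<^sub>Re b) = act (gm g) a *\<^sub>Re act (gm g) b"
  "act (gh g) (a *\<^sub>Re b) = act (gm g) a *\<^sub>Re act (gh g) b +\<^sub>Re act (gh g) a *\<^sub>Re act (gm g) b"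
proof -
 note ab = bil_comp[OF alg_bilinear[OF env_algs(1)] bil_left[OF act_bil a] bil_left[OF act_bil b]]
 note l = tensor_lift_lin[OF env_algs(5,5,4) ab] and t = tensor_lift_tens[OF env_algs(5,5,4) ab]
 note h = gc(1)[OF GH[OF g]] gc(2)[OF GH[OF g]]
 show "act (gm g) (a *\<^sub>Re b) = act (gm g) a *\<^sub>Re act (gm g) b"
  unfolding act_prod[OF h(1) a b] env_comult_hom(2)[OF g] by (rule t[OF h(1) h(1)])
 show "act (gh g) (a *\<^sub>Re b) = act (gm g) a *\<^sub>Re act (gh g) b +\<^sub>Re act (gh g) a *\<^sub>Re act (gm g) b"
  unfolding act_prod[OF h(2) a b] env_comult_hom(3)[OF g]
  using h by (simp add: lin_add[OF l] tens_closed[OF env_algs(5,5)] t)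
qed

private lemma inR_m: "y\<in>|R| ==> inR (rm y) = cm y" and inR_h: "y\<in>|R| ==> inR (rh y) = ch y"
 and inH_m: "y\<in>|H| ==> inR (gm y) = cm y" and inH_h: "y\<in>|H| ==> inR (gh y) = ch y"
 by (simp_all add: inR_hom inH_hom)

text \<open>These follow from the defining relations with {g, y} written as (dd g y) g. In the last
  one, h of that product contributes m_g h_{dd g y}, which the second rule, applied to
  \<open>dd g y\<close>, puts into normal order.\<close>

private lemma gen_comm:
 assumes g: "g\<in>G" and y: "y\<in>|R|"
 shows "cm g *\<^sub>Ce cm y = cm y *\<^sub>Ce cm g" "cm g *\<^sub>Ce ch y = (ch y +\<^sub>Ce cm (dd g y)) *\<^sub>Ce cm g"
  "ch g *\<^sub>Ce cm y = cm y *\<^sub>Ce ch g +\<^sub>Ce cm (dd g y) *\<^sub>Ce cm g"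
  "ch g *\<^sub>Ce ch y = (ch y +\<^sub>Ce cm (dd g y)) *\<^sub>Ce ch g +\<^sub>Ce (ch (dd g y) +\<^sub>Ce cm (dd g (dd g y))) *\<^sub>Ce cm g"
proof -
 have all: "cm g *\<^sub>Ce cm y = cm y *\<^sub>Ce cm g & cm g *\<^sub>Ce ch y = (ch y +\<^sub>Ce cm (dd g y)) *\<^sub>Ce cm g &
  ch g *\<^sub>Ce cm y = cm y *\<^sub>Ce ch g +\<^sub>Ce cm (dd g y) *\<^sub>Ce cm g" if "y\<in>|R|" for y
 proof -
  note c = GC[OF g] RC[OF that] RC[OF dd_R[OF g that]]
  have m: "cm (dd g y *\<^sub>C g) = cm (dd g y) *\<^sub>Ce cm g" by (rule c_rel(1)[OF c(3,1)])
  have b: "{y, g}\<^sub>C = \<ominus>\<^sub>C (dd g y *\<^sub>C g)" unfolding pa_anti[OF C c(2,1)] bracket_dd[OF g c(2)] ..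
  have mb: "cm {y, g}\<^sub>C = \<ominus>\<^sub>Ce (cm (dd g y) *\<^sub>Ce cm g)"
   unfolding b m[symmetric] using c by (intro lin_neg[OF env_m_lin[OF C]]) auto
  have 1: "cm g *\<^sub>Ce cm y = cm y *\<^sub>Ce cm g" using c_rel(1)[OF c(1,2)] c_rel(1)[OF c(2,1)] pa_comm[OF C c(1,2)] by simp
  have 2: "ch y *\<^sub>Ce cm g = cm g *\<^sub>Ce ch y +\<^sub>Ce \<ominus>\<^sub>Ce (cm (dd g y) *\<^sub>Ce cm g)" using c_rel(4)[OF c(2,1)] mb by simp
  have 3: "(ch y +\<^sub>Ce cm (dd g y)) *\<^sub>Ce cm g = cm g *\<^sub>Ce ch y" using c 2 by (simp add: alg_ldistr v_assoc)
  have 4: "ch g *\<^sub>Ce cm y = cm y *\<^sub>Ce ch g +\<^sub>Ce cm (dd g y) *\<^sub>Ce cm g" using c_rel(4)[OF c(1,2)] m bracket_dd[OF g c(2)] by simp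
  show ?thesis using 1 3 4 by simp
 qed
 note a = all[OF y] and d = all[OF dd_R[OF g y]]
 show "cm g *\<^sub>Ce cm y = cm y *\<^sub>Ce cm g" "cm g *\<^sub>Ce ch y = (ch y +\<^sub>Ce cm (dd g y)) *\<^sub>Ce cm g"
  "ch g *\<^sub>Ce cm y = cm y *\<^sub>Ce ch g +\<^sub>Ce cm (dd g y) *\<^sub>Ce cm g" using a by blast+
 note c = GC[OF g] RC[OF y] RC[OF dd_R[OF g y]] RC[OF dd_R[OF g dd_R[OF g y]]]
 have e1: "ch g *\<^sub>Ce ch y = ch y *\<^sub>Ce ch g +\<^sub>Ce (cm g *\<^sub>Ce ch (dd g y) +\<^sub>Ce cm (dd g y) *\<^sub>Ce ch g)"
  unfolding c_rel(2)[OF c(1,2)] bracket_dd[OF g c(2)] c_rel(3)[OF c(3,1)] ..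
 show "ch g *\<^sub>Ce ch y = (ch y +\<^sub>Ce cm (dd g y)) *\<^sub>Ce ch g +\<^sub>Ce (ch (dd g y) +\<^sub>Ce cm (dd g (dd g y))) *\<^sub>Ce cm g"
  unfolding e1 conjunct1[OF conjunct2[OF d]] using c
  by (simp add: alg_ldistr v_assoc v_lcomm v_comm[OF env_algs(6), of _ "cm (dd g y) *\<^sub>Ce ch g"])
qed

private lemmas Rh = inR_hom(1)
private lemmas Rhc = hom_closed[OF Rh]

text \<open>Moving a generator past z and then past x reproduces the coproducts of m_g and h_g, and
  these govern the action on products.\<close>

private lemma gen_act_mult:
 assumes g: "g\<in>G" and z: "z\<in>|Re|" and x: "x\<in>|Re|"
  and z1: "cm g *\<^sub>Ce inR z = inR (act (gm g) z) *\<^sub>Ce cm g"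
  and z2: "ch g *\<^sub>Ce inR z = inR (act (gm g) z) *\<^sub>Ce ch g +\<^sub>Ce inR (act (gh g) z) *\<^sub>Ce cm g"
  and x1: "cm g *\<^sub>Ce inR x = inR (act (gm g) x) *\<^sub>Ce cm g"
  and x2: "ch g *\<^sub>Ce inR x = inR (act (gm g) x) *\<^sub>Ce ch g +\<^sub>Ce inR (act (gh g) x) *\<^sub>Ce cm g"
 shows "cm g *\<^sub>Ce inR (z *\<^sub>Re x) = inR (act (gm g) (z *\<^sub>Re x)) *\<^sub>Ce cm g &
   ch g *\<^sub>Ce inR (z *\<^sub>Re x) = inR (act (gm g) (z *\<^sub>Re x)) *\<^sub>Ce ch g +\<^sub>Ce inR (act (gh g) (z *\<^sub>Re x)) *\<^sub>Ce cm g"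
proof -
   note gg = gc(1)[OF GH[OF g]] gc(2)[OF GH[OF g]] and ggc = cc(1)[OF GC[OF g]] cc(2)[OF GC[OF g]]
   note k = Rhc[OF z] Rhc[OF x] Rhc[OF act_closed[OF gg(1) z]] Rhc[OF act_closed[OF gg(1) x]] Rhc[OF act_closed[OF gg(2) z]] Rhc[OF act_closed[OF gg(2) x]]
    ggc
   note k' = act_closed[OF gg(1) z] act_closed[OF gg(1) x] act_closed[OF gg(2) z] act_closed[OF gg(2) x]
   have 1: "cm g *\<^sub>Ce inR (z *\<^sub>Re x) = inR (act (gm g) z) *\<^sub>Ce (inR (act (gm g) x) *\<^sub>Ce cm g)"
   proof -
    have "cm g *\<^sub>Ce inR (z *\<^sub>Re x) = (cm g *\<^sub>Ce inR z) *\<^sub>Ce inR x" using k z x by (simp add: hom_mult[OF Rh] alg_assoc)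
    also have "... = inR (act (gm g) z) *\<^sub>Ce (cm g *\<^sub>Ce inR x)" unfolding z1 using k by (simp add: alg_assoc)
    finally show ?thesis unfolding x1 .
   qed
   have 2: "ch g *\<^sub>Ce inR (z *\<^sub>Re x) = inR (act (gm g) z) *\<^sub>Ce (inR (act (gm g) x) *\<^sub>Ce ch g +\<^sub>Ce inR (act (gh g) x) *\<^sub>Ce cm g) \<oplus>\<^sub>Ce
    inR (act (gh g) z) *\<^sub>Ce (inR (act (gm g) x) *\<^sub>Ce cm g)"
   proof -
    have "ch g *\<^sub>Ce inR (z *\<^sub>Re x) = (ch g *\<^sub>Ce inR z) *\<^sub>Ce inR x" using k z x by (simp add: hom_mult[OF Rh] alg_assoc)
    also have "... = inR (act (gm g) z) *\<^sub>Ce (ch g *\<^sub>Ce inR x) +\<^sub>Ce inR (act (gh g) z) *\<^sub>Ce (cm g *\<^sub>Ce inR x)"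
     unfolding z2 using k by (simp add: alg_assoc alg_ldistr)
    finally show ?thesis unfolding x1 x2 .
   qed
   show ?thesis unfolding 1 2 act_g_mult[OF g z x] using k k'
    by (simp add: hom_add[OF Rh] hom_mult[OF Rh] alg_assoc alg_ldistr alg_rdistr v_assoc)
qed

private lemma gen_act:
 assumes g: "g\<in>G" and a: "a\<in>|Re|"
 shows "cm g *\<^sub>Ce inR a = inR (act (gm g) a) *\<^sub>Ce cm g &
  ch g *\<^sub>Ce inR a = inR (act (gm g) a) *\<^sub>Ce ch g +\<^sub>Ce inR (act (gh g) a) *\<^sub>Ce cm g"
proof -
 note gg = gc(1)[OF GH[OF g]] gc(2)[OF GH[OF g]] and ggc = cc(1)[OF GC[OF g]] cc(2)[OF GC[OF g]]
 show ?thesis using a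
 proof (induction rule: env_induct[OF R, consumes 1, case_names one add smult m h])
  case one
  have "env_counit K H (gm g) = \<one>" "env_counit K H (gh g) = \<zero>" using env_counit_hom(2,3)[OF g] .
  thus ?case using gg ggc act_unit lin_zero[OF hom_lin[OF Rh] env_algs(4,6)] by (simp add: hom_one[OF Rh])
 next
  case (add x y)
  thus ?case using gg ggc Rhc
   by (simp add: bil_add_r[OF act_bil] hom_add[OF Rh] act_closed alg_ldistr alg_rdistr v_assoc v_lcomm)
 next
  case (smult k x)
  thus ?case using gg ggc Rhc
   by (simp add: bil_smult_r[OF act_bil] hom_smult[OF Rh] act_closed alg_smult v_smult_rdistr)
 next
  case (m y x)
  show ?case by (rule gen_act_mult[OF g])
   (use m gen_comm[OF g m(1)] act_gen[OF g m(1)] dd_R[OF g m(1)] in "simp_all add: inR_m")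
 next
  case (h y x)
  have c: "cm (dd g y)\<in>|Ce|" "cm (dd g (dd g y))\<in>|Ce|" "ch y\<in>|Ce|" "ch (dd g y)\<in>|Ce|"
   using RC h dd_R[OF g] by auto
  show ?case by (rule gen_act_mult[OF g])
   (use h c gen_comm[OF g h(1)] act_gen[OF g h(1)] dd_R[OF g h(1)] dd_R[OF g dd_R[OF g h(1)]]
    in \<open>simp_all add: inR_m inR_h hom_add[OF Rh]\<close>)
 qed
qed

text \<open>This straightening rule is what makes \<Phi> multiplicative. It passes from b to m_g b
  and h_g b, because left multiplication by the coproducts of the generators matches left
  multiplication by m_g and h_g in C^e.\<close>

private lemma comm_act:
 assumes b: "b\<in>|He|" and c: "c\<in>|Re|"
 shows "inR b *\<^sub>Ce inR c = tlift Ce (%b1 b2. inR (act b1 c) *\<^sub>Ce inR b2) (env_comult K H b)"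
proof -
 let ?EE = "tensor_alg K He He" and ?T = "TS He He"
 note Rl = hom_lin[OF inR_hom(1)] and Hl = hom_lin[OF inH_hom(1)] and Hh = inH_hom(1)
 note Rc = lin_closed[OF Rl] and Hc = lin_closed[OF Hl]
 note f = bil_comp[OF alg_bilinear[OF env_algs(3)] lin_comp[OF bil_left[OF act_bil c] Rl] Hl]
 let ?\<Theta> = "tlift Ce (%b1 b2. inR (act b1 c) *\<^sub>Ce inR b2)"
 have \<Theta>l: "lin ?T Ce ?\<Theta>" by (rule tensor_lift_lin[OF env_algs(5,5,6) f])
 have \<Theta>t: "?\<Theta> (ts He He u v) = inR (act u c) *\<^sub>Ce inR v" if "u\<in>|He|" "v\<in>|He|" for u v
  by (rule tensor_lift_tens[OF env_algs(5,5,6) f that])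
 note t = tensor_mult_tens[OF env_algs(2,2)] and tb = tensor_mult_bil[OF env_algs(2,2)]
 note tc = tens_closed[OF env_algs(5,5)] and del = env_comult_hom
 have dc: "env_comult K H x\<in>|?T|" if "x\<in>|He|" for x using hom_closed[OF del(1) that] by simp
 note cb = alg_bilinear[OF env_algs(3)]
 have 1: "?\<Theta> (ts He He (gm g) (gm g) *\<^sub>?EE u) = cm g *\<^sub>Ce ?\<Theta> u" if g: "g\<in>G" and u: "u\<in>|?T|" for g u
 proof (rule lin_eq_tensor[OF env_algs(5,5) lin_comp[OF bil_right[OF tb] \<Theta>l] lin_comp[OF \<Theta>l bil_right[OF cb]] _ u])
  show "ts He He (gm g) (gm g)\<in>|?T|" "cm g\<in>|Ce|" using g GH GC tc by simp_all
  fix x y assume xy: "x\<in>|He|" "y\<in>|He|"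
  note k = gc(1)[OF GH[OF g]] act_closed[OF xy(1) c] Rc[OF act_closed[OF xy(1) c]] Hc[OF xy(2)] cc(1)[OF GC[OF g]]
   Rc[OF act_closed[OF gc(1)[OF GH[OF g]] act_closed[OF xy(1) c]]]
  show "?\<Theta> (ts He He (gm g) (gm g) *\<^sub>?EE ts He He x y) = cm g *\<^sub>Ce ?\<Theta> (ts He He x y)"
   using k xy conjunct1[OF gen_act[OF g k(2)]] GH[OF g]
   by (simp add: t \<Theta>t act_comp c hom_mult[OF Hh] inH_m alg_assoc[OF env_algs(3), symmetric])
 qed
 have 2: "?\<Theta> ((ts He He (gm g) (gh g) +\<^sub>?T ts He He (gh g) (gm g)) *\<^sub>?EE u) = ch g *\<^sub>Ce ?\<Theta> u" if g: "g\<in>G" and u: "u\<in>|?T|" for g u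
 proof (rule lin_eq_tensor[OF env_algs(5,5) lin_comp[OF bil_right[OF tb] \<Theta>l] lin_comp[OF \<Theta>l bil_right[OF cb]] _ u])
  show "ts He He (gm g) (gh g) +\<^sub>?T ts He He (gh g) (gm g)\<in>|?T|" "ch g\<in>|Ce|"
   using g GH GC tc tensor_module[OF env_algs(5,5)] by simp_all
  fix x y assume xy: "x\<in>|He|" "y\<in>|He|"
  note k = gc(1)[OF GH[OF g]] act_closed[OF xy(1) c] Rc[OF act_closed[OF xy(1) c]] Hc[OF xy(2)] cc(1)[OF GC[OF g]]
   Rc[OF act_closed[OF gc(1)[OF GH[OF g]] act_closed[OF xy(1) c]]] gc(2)[OF GH[OF g]] cc(2)[OF GC[OF g]]
   Rc[OF act_closed[OF gc(2)[OF GH[OF g]] act_closed[OF xy(1) c]]]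
  show "?\<Theta> ((ts He He (gm g) (gh g) +\<^sub>?T ts He He (gh g) (gm g)) *\<^sub>?EE ts He He x y) = ch g *\<^sub>Ce ?\<Theta> (ts He He x y)"
   using k xy conjunct2[OF gen_act[OF g k(2)]] GH[OF g]
   by (simp add: t tc bil_add_l[OF tb] lin_add[OF \<Theta>l] \<Theta>t act_comp c hom_mult[OF Hh] inH_m inH_h alg_assoc[OF env_algs(3), symmetric] alg_ldistr)
 qed
 show ?thesis using b
 proof (induction rule: He_induct)
  case one
  show ?case using hom_one[OF del(1)] c Rc[OF c] by (simp add: \<Theta>t act_one hom_one[OF Hh])
 next
  case (add x y)
  thus ?case using hom_add[OF del(1)] dc Rc[OF c] Hc by (simp add: lin_add[OF \<Theta>l] hom_add[OF Hh] alg_ldistr)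
 next
  case (smult k x)
  thus ?case using hom_smult[OF del(1)] dc Rc[OF c] Hc by (simp add: lin_smult[OF \<Theta>l] hom_smult[OF Hh] alg_smult)
 next
  case (m g x)
  thus ?case using hom_mult[OF del(1)] dc Rc[OF c] Hc GH GC by (simp add: del(2) 1 hom_mult[OF Hh] alg_assoc inH_m)
 next
  case (h g x)
  thus ?case using hom_mult[OF del(1)] dc Rc[OF c] Hc GH GC by (simp add: del(3) 2 hom_mult[OF Hh] alg_assoc inH_h)
 qed
qed

section \<open>The map \<Phi> and its bijectivity\<close>

definition smash_map :: "(((('c + 'c) list => 'k) set \<times> (('c + 'c) list => 'k) set) => 'k) set => (('c + 'c) list => 'k) set"
 where "smash_map = tlift Ce (%a b. inR a *\<^sub>Ce inR b)"

private lemma smash_bil: "bil Re He Ce (%a b. inR a *\<^sub>Ce inR b)"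
 by (rule bil_comp[OF alg_bilinear[OF env_algs(3)] hom_lin[OF inR_hom(1)] hom_lin[OF inH_hom(1)]])

private lemma smash_lin: "lin (TS Re He) Ce smash_map"
 unfolding smash_map_def by (rule tensor_lift_lin[OF env_algs(4,5,6) smash_bil])

private lemma smash_tens: "a\<in>|Re| ==> b\<in>|He| ==> smash_map (ts Re He a b) = inR a *\<^sub>Ce inR b"
 unfolding smash_map_def by (rule tensor_lift_tens[OF env_algs(4,5,6) smash_bil])

text \<open>\<open>C\<^sup>e\<close> maps to \<open>End(R\<^sup>e) \<otimes> (kG)\<^sup>e\<close>; evaluating the first factor at \<open>1\<close> inverts \<open>smash_map\<close>.\<close>

private lemma smash_left_inverse:
 obtains \<Lambda> where "!!u. u\<in>|TS Re He| ==> \<Lambda> (smash_map u) = u"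
proof -
 let ?E = "end_alg Re"
 let ?A = "tensor_alg K ?E He" and ?T = "TS ?E He" and ?S = "TS Re He"
 have E: "k_algebra K ?E" by (rule end_algebra[OF env_algs(4)])
 have Em: "vs ?E" using E by simp
 have A: "k_algebra K ?A" by (rule tensor_alg_algebra[OF E env_algs(2)])
 have Tm: "vs ?T" by (rule tensor_module[OF Em env_algs(5)])
 note t = tensor_mult_tens[OF E env_algs(2)] and tb = tensor_mult_bil[OF E env_algs(2)]
 note tc = tens_closed[OF Em env_algs(5)] and tl = tens_add_l[OF Em env_algs(5)] tens_add_r[OF Em env_algs(5)]
 note D = end_datum[unfolded U_datum_def]
 have rep: "env_rep R ?E eY eB" using D by blast
 have eG: "eG g\<in>|?E|" "eX g\<in>|?E|" if "g\<in>G" for g using D that by blast+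
 have eG1: "eG 1\<^sub>C = 1\<^sub>?E" using D by blast
 have eGG: "eG (g *\<^sub>C u) = eG g *\<^sub>?E eG u" "eX (g *\<^sub>C u) = eX g +\<^sub>?E eX u" "eX g *\<^sub>?E eG u = eG u *\<^sub>?E eX g"
  "eX g *\<^sub>?E eX u = eX u *\<^sub>?E eX g" if "g\<in>G" "u\<in>G" for g u using D that by blast+
 have eGY: "eG g *\<^sub>?E eY y = eY y *\<^sub>?E eG g" "eG g *\<^sub>?E eB y = (eB y +\<^sub>?E eY (dd g y)) *\<^sub>?E eG g"
  "eX g *\<^sub>?E eY y = eY y *\<^sub>?E eX g +\<^sub>?E eY (dd g y)"
  "eX g *\<^sub>?E eB y = eB y *\<^sub>?E eX g +\<^sub>?E eB (dd g y)" if "g\<in>G" "y\<in>|R|" for g y using D that by blast+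
 note yc = lin_closed[OF env_repD(1)[OF rep]] lin_closed[OF env_repD(2)[OF rep]]
 \<comment> \<open>\<open>gx g\<close> stands for g^-1 h_g, which is primitive in (kG)^e and, unlike
   h_g, additive in g.\<close>
 define gx where "gx g = gm (gi g) *\<^sub>He gh g" for g
 have gxc: "gx g\<in>|He|" if "g\<in>G" for g using that GH gi_G by (simp add: gx_def)
 note Ha = env_algs(2)
 have lc: "x *\<^sub>He (y *\<^sub>He z) = y *\<^sub>He (x *\<^sub>He z)" if "x *\<^sub>He y = y *\<^sub>He x" "x\<in>|He|" "y\<in>|He|" "z\<in>|He|" for x y z
  using that by (simp add: alg_assoc[OF Ha, symmetric])
 have gg2: "gm (gi g) *\<^sub>He gm g = 1\<^sub>He" "gm g *\<^sub>He gm (gi g) = 1\<^sub>He" if "g\<in>G" for g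
  using GH[OF that] GH[OF gi_G[OF that]] by (simp_all add: g_rel(1)[symmetric] gi_inv[OF that] gi_inv'[OF that] gm_one)
 have gg: "gm g *\<^sub>He gx g = gh g" "gm (gi g) *\<^sub>He gm g = 1\<^sub>He" if "g\<in>G" for g
  using GH[OF that] GH[OF gi_G[OF that]] gg2[OF that]
  by (simp_all add: gx_def alg_assoc[OF Ha, symmetric])
 have gxm: "gx g *\<^sub>He gm u = gm u *\<^sub>He gx g" if "g\<in>G" "u\<in>G" for g u
 proof -
  note c = GH[OF that(1)] GH[OF that(2)] GH[OF gi_G[OF that(1)]]
  show ?thesis unfolding gx_def using c by (simp add: alg_assoc[OF Ha] g_rel(4)[OF c(1,2)] lc[OF g_rel(5)[OF c(3,2)]])
 qed
 have gxh: "gx g *\<^sub>He gh u = gh u *\<^sub>He gx g" if "g\<in>G" "u\<in>G" for g u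
 proof -
  note c = GH[OF that(1)] GH[OF that(2)] GH[OF gi_G[OF that(1)]]
  show ?thesis unfolding gx_def using c by (simp add: alg_assoc[OF Ha] g_rel(2)[OF c(1,2)] lc[OF g_rel(4)[OF c(2,3)]])
 qed
 have gxx: "gx g *\<^sub>He gx u = gx u *\<^sub>He gx g" if "g\<in>G" "u\<in>G" for g u
 proof -
  note c = GH[OF that(2)] GH[OF gi_G[OF that(2)]] gxc[OF that(1)]
  show ?thesis unfolding gx_def[of u] using c by (simp add: alg_assoc[OF Ha] gxh[OF that, symmetric] lc[OF gxm[OF that(1) gi_G[OF that(2)]]])
 qed
 have gxa: "gx (g *\<^sub>C u) = gx g +\<^sub>He gx u" if "g\<in>G" "u\<in>G" for g u
 proof -
  note c = GH[OF that(1)] GH[OF that(2)] GH[OF gi_G[OF that(1)]] GH[OF gi_G[OF that(2)]]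
  have l: "gm g *\<^sub>He (gm (gi g) *\<^sub>He x) = x" "gm u *\<^sub>He (gm (gi u) *\<^sub>He x) = x"
   "gm (gi g) *\<^sub>He (gm g *\<^sub>He x) = x" "gm (gi u) *\<^sub>He (gm u *\<^sub>He x) = x" if "x\<in>|He|" for x
   using that c gg(2) \<open>g\<in>G\<close> \<open>u\<in>G\<close> g_rel(5)[OF c(1,3)] g_rel(5)[OF c(2,4)] by (simp_all add: alg_assoc[OF Ha, symmetric])
  have s: "gm (gi u) *\<^sub>He (gm g *\<^sub>He x) = gm g *\<^sub>He (gm (gi u) *\<^sub>He x)" if "x\<in>|He|" for x
   using that c by (intro lc g_rel(5)) auto
  show ?thesis unfolding gx_def gi_mult[OF that] g_rel(3)[OF c(1,2)] g_rel(1)[OF c(3,4)]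
   using c by (simp add: alg_assoc[OF Ha] alg_rdistr[OF Ha] l s)
 qed
 note e1 = alg_one_closed[OF E] and h1 = alg_one_closed[OF Ha]
 \<comment> \<open>The operators of \<open>end_datum\<close> combined with (kG)^e along its
   coproduct: m_g is group-like and g^-1 h_g primitive, so they go to \<open>eG g\<close> \<otimes>
   m_g and \<open>eX g\<close> \<otimes> 1 + 1 \<otimes> \<open>gx g\<close>.\<close>
 define dY where "dY y = ts ?E He (eY y) 1\<^sub>He" for y
 define dB where "dB y = ts ?E He (eB y) 1\<^sub>He" for y
 define dG where "dG g = ts ?E He (eG g) (gm g)" for g
 define dX where "dX g = ts ?E He (eX g) 1\<^sub>He +\<^sub>?T ts ?E He 1\<^sub>?E (gx g)" for g
 note dd' = dY_def dB_def dG_def dX_def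
 have drep: "env_rep R ?A dY dB"
 proof -
  have "alg_hom ?E ?A (%x. ts ?E He x 1\<^sub>He)"
   unfolding alg_hom_def lin_tensor_alg using tens_lin_l[OF Em env_algs(5) h1] e1 h1 Ha by (simp add: t)
  thus ?thesis unfolding dY_def[abs_def] dB_def[abs_def] by (rule env_rep_post[OF rep _ R E])
 qed
 have datum: "U_datum ?A dY dB dG dX"
  unfolding U_datum_def
 proof (intro conjI ballI A drep)
  note st = t tc tl bil_add_l[OF tb] bil_add_r[OF tb]
  show "dG 1\<^sub>C = 1\<^sub>?A" by (simp add: dG_def eG1 gm_one)
  fix g assume g: "g\<in>G"
  note cg = eG[OF g] gc(1)[OF GH[OF g]] gxc[OF g] e1 h1
  show "dG g\<in>|?A|" "dX g\<in>|?A|" using cg tc Tm by (simp_all add: dd')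
  { fix u assume u: "u\<in>G"
   note cu = cg eG[OF u] gc(1)[OF GH[OF u]] gxc[OF u]
   show "dG (g *\<^sub>C u) = dG g *\<^sub>?A dG u" using cu g u GH by (simp add: dd' st eGG g_rel)
   show "dX (g *\<^sub>C u) = dX g +\<^sub>?A dX u" using cu g u Tm by (simp add: dd' st eGG gxa v_assoc v_lcomm)
   show "dX g *\<^sub>?A dG u = dG u *\<^sub>?A dX g" using cu E Ha by (simp add: dd' st eGG(3)[OF g u] gxm[OF g u])
   show "dX g *\<^sub>?A dX u = dX u *\<^sub>?A dX g" using cu E Ha Tm by (simp add: dd' st eGG(4)[OF g u] gxx[OF g u] v_assoc v_lcomm v_comm) }
  { fix y assume y: "y\<in>|R|"
   note cy = cg yc[OF y] yc[OF dd_R[OF g y]]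
   show "dG g *\<^sub>?A dY y = dY y *\<^sub>?A dG g" using cy E Ha by (simp add: dd' st eGY(1)[OF g y])
   show "dG g *\<^sub>?A dB y = (dB y +\<^sub>?A dY (dd g y)) *\<^sub>?A dG g" using cy E Em Ha by (simp add: dd' st eGY(2)[OF g y] alg_ldistr[OF E])
   show "dX g *\<^sub>?A dY y = dY y *\<^sub>?A dX g +\<^sub>?A dY (dd g y)"
    using cy E Em Ha Tm by (simp add: dd' st eGY(3)[OF g y] v_assoc v_lcomm v_comm)
   show "dX g *\<^sub>?A dB y = dB y *\<^sub>?A dX g +\<^sub>?A dB (dd g y)"
    using cy E Em Ha Tm by (simp add: dd' st eGY(4)[OF g y] v_assoc v_lcomm v_comm) }
 qed
 obtain \<mu> \<eta> where m: "env_rep C ?A \<mu> \<eta>" and vR: "!!y. y\<in>|R| ==> \<mu> y = dY y" "!!y. y\<in>|R| ==> \<eta> y = dB y"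
  and vG: "!!g. g\<in>G ==> \<mu> g = dG g" "!!g. g\<in>G ==> \<eta> g = dG g *\<^sub>?A dX g"
  using universal[OF datum] by blast
 define L where "L = env_lift K ?A \<mu> \<eta>"
 note Lh = env_lift_hom[OF C A m, folded L_def]
 define ev where "ev = tmap Re He (%f. f 1\<^sub>Re) (%b. b)"
 have evl1: "lin ?E Re (%f. f 1\<^sub>Re)"
  by (rule k_linearI) (auto simp: end_simps end_carrier lin_closed)
 have idl: "lin He He (%b. b)" by (rule lin_id) auto
 have evl: "lin ?T ?S ev" unfolding ev_def by (rule tensor_map_lin[OF Em env_algs(5,4,5) evl1 idl])
 have evt: "ev (ts ?E He f b) = ts Re He (f 1\<^sub>Re) b" if "f\<in>|?E|" "b\<in>|He|" for f b
  unfolding ev_def by (rule tensor_map_tens[OF Em env_algs(5,4,5) evl1 idl that])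
 have fl: "lin Re Re f" if "f\<in>|?E|" for f using that by (simp add: end_carrier)
 \<comment> \<open>Evaluation at 1 is not multiplicative, but it turns left multiplication by f
   \<otimes> b into f on the first leg and left multiplication by b on the second.\<close>
 have evm: "ev (ts ?E He f b *\<^sub>?A u) = tmap Re He f (%x. b *\<^sub>He x) (ev u)"
  if f: "f\<in>|?E|" and b: "b\<in>|He|" and u: "u\<in>|?T|" for f b u
 proof -
  note bl = bil_right[OF alg_bilinear[OF Ha] b]
  show ?thesis
  proof (rule lin_eq_tensor[OF Em env_algs(5) lin_comp[OF bil_right[OF tb tc[OF f b]] evl]
    lin_comp[OF evl tensor_map_lin[OF env_algs(4,5,4,5) fl[OF f] bl]] _ u])
   fix x y assume xy: "x\<in>|?E|" "y\<in>|He|"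
   show "ev (ts ?E He f b *\<^sub>?A ts ?E He x y) = tmap Re He f (%x. b *\<^sub>He x) (ev (ts ?E He x y))"
    unfolding t[OF f b xy] evt[OF xy] evt[OF alg_mult_closed[OF E f xy(1)] alg_mult_closed[OF Ha b xy(2)]]
     tensor_map_tens[OF env_algs(4,5,4,5) fl[OF f] bl lin_closed[OF evl1 xy(1)] xy(2)]
    by (simp add: end_simps)
  qed
 qed
 have tmt: "tmap Re He f (%x. b *\<^sub>He x) (ts Re He a c) = ts Re He (f a) (b *\<^sub>He c)"
  if "f\<in>|?E|" "b\<in>|He|" "a\<in>|Re|" "c\<in>|He|" for f b a c
  by (rule tensor_map_tens[OF env_algs(4,5,4,5) fl[OF that(1)] bil_right[OF alg_bilinear[OF Ha] that(2)] that(3,4)])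
 have LR: "L (inR a) = ts ?E He (lmul Re a) 1\<^sub>He" if "a\<in>|Re|" for a
 proof (rule env_hom_eq[OF R A hom_comp[OF inR_hom(1) Lh(1)] _ _ _ that])
  have 1: "alg_hom ?E ?A (%x. ts ?E He x 1\<^sub>He)"
   unfolding alg_hom_def lin_tensor_alg using tens_lin_l[OF Em env_algs(5) h1] e1 h1 Ha by (simp add: t)
  show "alg_hom Re ?A (%a. ts ?E He (lmul Re a) 1\<^sub>He)" by (rule hom_comp[OF lmul_hom[OF env_algs(1)] 1])
 qed (simp_all add: inR_m inR_h Lh(2,3) RC vR dY_def dB_def eY_def eB_def)
 have lm: "lmul Re a\<in>|?E|" if "a\<in>|Re|" for a by (rule hom_closed[OF lmul_hom[OF env_algs(1)] that])
 have Lc: "L x\<in>|?T|" if "x\<in>|Ce|" for x using hom_closed[OF Lh(1) that] by simp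
 note Hc = hom_closed[OF inH_hom(1)]
 \<comment> \<open>On the image of (kG)^e the first leg consists of automorphisms, which fix 1, and
   derivations, which kill 1; only 1 \<otimes> b remains.\<close>
 have LH: "ev (L (inR b)) = ts Re He 1\<^sub>Re b" if "b\<in>|He|" for b
  using that
 proof (induction rule: He_induct)
  case one
  show ?case using e1 h1 by (simp add: hom_one[OF inH_hom(1)] hom_one[OF Lh(1)] evt) (simp add: end_simps)
 next
  case (add x y)
  thus ?case using Hc Lc by (simp add: hom_add[OF inH_hom(1)] hom_add[OF Lh(1)] lin_add[OF evl] tens_add_r[OF env_algs(4,5)])
 next
  case (smult k x)
  thus ?case using Hc Lc by (simp add: hom_smult[OF inH_hom(1)] hom_smult[OF Lh(1)] lin_smult[OF evl] tens_smult_r[OF env_algs(4,5)])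
 next
  case (m g x)
  note c = gc(1)[OF GH[OF m(1)]] eG[OF m(1)] Hc[OF m(2)]
  have "L (inR (gm g *\<^sub>He x)) = ts ?E He (eG g) (gm g) *\<^sub>?A L (inR x)"
   using c m GH GC by (simp add: hom_mult[OF inH_hom(1)] inH_m hom_mult[OF Lh(1)] Lh(2) vG dG_def)
  thus ?case using evm[OF c(2,1) Lc[OF c(4)]] m c by (simp add: tmt) (simp add: eG_def hom_one[OF sig_hom])
 next
  case (h g x)
  note c = gc[OF GH[OF h(1)]] eG[OF h(1)] Hc[OF h(2)]
  have "dG g *\<^sub>?A dX g = ts ?E He (eG g *\<^sub>?E eX g) (gm g) +\<^sub>?T ts ?E He (eG g) (gh g)"
   using c gxc[OF h(1)] e1 h1 E Ha by (simp add: dd' t tc bil_add_r[OF tb] gg(1)[OF h(1)])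
  hence 1: "L (inR (gh g *\<^sub>He x)) = (ts ?E He (eG g *\<^sub>?E eX g) (gm g) +\<^sub>?T ts ?E He (eG g) (gh g)) *\<^sub>?A L (inR x)"
   using c h GH GC by (simp add: hom_mult[OF inH_hom(1)] inH_h hom_mult[OF Lh(1)] Lh(3) vG)
  have gx: "eG g *\<^sub>?E eX g\<in>|?E|" using c E by simp
  have z: "(eG g *\<^sub>?E eX g) 1\<^sub>Re = 0\<^sub>Re"
   using lin_zero[OF hom_lin[OF sig_hom[OF h(1)]] env_algs(4,4)] by (simp add: end_simps eG_def eX_def der_one[OF h(1)])
  have o: "eG g 1\<^sub>Re = 1\<^sub>Re" by (simp add: eG_def hom_one[OF sig_hom[OF h(1)]])
  have cl: "ts ?E He (eG g *\<^sub>?E eX g) (gm g) *\<^sub>?A L (inR x)\<in>|?T|" "ts ?E He (eG g) (gh g) *\<^sub>?A L (inR x)\<in>|?T|"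
   by (rule bil_closed[OF tb tc[OF gx c(1)] Lc[OF c(5)]], rule bil_closed[OF tb tc[OF c(3,2)] Lc[OF c(5)]])
  have "ev (L (inR (gh g *\<^sub>He x))) = ts Re He 0\<^sub>Re (gm g *\<^sub>He x) +\<^sub>?S ts Re He 1\<^sub>Re (gh g *\<^sub>He x)"
   unfolding 1 bil_add_l[OF tb tc[OF gx c(1)] tc[OF c(3,2)] Lc[OF c(5)]] lin_add[OF evl cl] evm[OF gx c(1) Lc[OF c(5)]] evm[OF c(3,2) Lc[OF c(5)]]
    h(3) using h c gx by (simp add: tmt z o)
  thus ?case using c h tensor_module[OF env_algs(4,5)] tens_closed[OF env_algs(4,5)] by (simp add: tens_zero_l[OF env_algs(4,5)])
 qed
 have "ev (L (smash_map u)) = u" if u: "u\<in>|?S|" for u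
 proof (rule lin_eq_tensor[OF env_algs(4,5) lin_comp[OF lin_comp[OF smash_lin hom_lin[OF Lh(1), unfolded lin_tensor_alg]] evl] lin_id _ u])
  fix a b assume ab: "a\<in>|Re|" "b\<in>|He|"
  note c = hom_closed[OF inR_hom(1) ab(1)] Hc[OF ab(2)]
  have "L (smash_map (ts Re He a b)) = ts ?E He (lmul Re a) 1\<^sub>He *\<^sub>?A L (inR b)"
   using c ab by (simp add: smash_tens hom_mult[OF Lh(1)] LR)
  thus "ev (L (smash_map (ts Re He a b))) = ts Re He a b"
   using evm[OF lm[OF ab(1)] h1 Lc[OF c(2)]] LH[OF ab(2)] tmt[OF lm[OF ab(1)] h1 alg_one_closed[OF env_algs(1)] ab(2)] ab by (simp add: lmul_def)
 qed auto
 thus ?thesis using that[of "%x. ev (L x)"] by blast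
qed

text \<open>Multiplicativity is the straightening rule, injectivity the left inverse, and the image
  is a subalgebra containing m_c and h_c for all c in C. That the smash product is an algebra is
  itself a consequence, obtained by pulling the axioms back along the injective map.\<close>

theorem smash_iso:
 "k_algebra_iso K (smash K Re He (env_comult K H) act) Ce smash_map &
  (\<forall>a\<in>carrier Re. \<forall>b\<in>carrier He. smash_map (ts Re He a b) = inR a *\<^sub>Ce inR b)"
proof -
 let ?S = "smash K Re He (env_comult K H) act" and ?T = "TS Re He"
 note Tm = tensor_module[OF env_algs(4,5)]
 have Ss: "|?S| = |?T|" "zero ?S = zero ?T" "add ?S = add ?T" "smult ?S = smult ?T" "one ?S = ts Re He 1\<^sub>Re 1\<^sub>He"
  by (simp_all add: smash_def Let_def)
 \<comment> \<open>The product of the pure tensors a # b and a' # b'. Its bilinearity in each pair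
   is what lets it extend to all tensors.\<close>
 define W where "W a b a' b' = tlift ?T (%b1 b2. ts Re He (a *\<^sub>Re act b1 a') (b2 *\<^sub>He b')) (env_comult K H b)" for a b a' b'
 have Sm: "u *\<^sub>?S v = tensor_lift2 ?T W u v" for u v
  by (simp add: smash_def Let_def tensor_lift2_def W_def)
 have dl: "lin He (TS He He) (env_comult K H)"
  using hom_lin[OF env_comult_hom(1)] unfolding lin_tensor_alg .
 note tb = tens_bilinear[OF env_algs(4,5)] and rb = alg_bilinear[OF env_algs(1)] and hb = alg_bilinear[OF env_algs(2)]
 have w1: "bil He He ?T (%b1 b2. ts Re He (a *\<^sub>Re act b1 a') (b2 *\<^sub>He b'))"
  if "a\<in>|Re|" "a'\<in>|Re|" "b'\<in>|He|" for a a' b'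
  by (rule bil_comp[OF tb lin_comp[OF bil_left[OF act_bil that(2)] bil_right[OF rb that(1)]] bil_left[OF hb that(3)]])
 have Wc: "W a b a' b'\<in>|?T|" if "a\<in>|Re|" "b\<in>|He|" "a'\<in>|Re|" "b'\<in>|He|" for a b a' b'
  unfolding W_def by (rule tensor_lift_closed[OF env_algs(5,5) Tm w1[OF that(1,3,4)] lin_closed[OF dl that(2)]])
 have f1: "bil Re He ?T (W a b)" if "a\<in>|Re|" "b\<in>|He|" for a b
  unfolding W_def[abs_def]
 proof (rule tensor_lift2_bil_aux[OF env_algs(4,5,5,5) Tm w1[OF that(1)] _ lin_closed[OF dl that(2)]])
  show "bil Re He ?T (%a' b'. ts Re He (a *\<^sub>Re act c a') (d *\<^sub>He b'))" if "c\<in>|He|" "d\<in>|He|" for c d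
   by (rule bil_comp[OF tb lin_comp[OF bil_right[OF act_bil that(1)] bil_right[OF rb \<open>a\<in>|Re|\<close>]] bil_right[OF hb that(2)]])
 qed
 have f2: "bil Re He ?T (%a b. W a b a' b')" if "a'\<in>|Re|" "b'\<in>|He|" for a' b'
  unfolding k_bilinear_def
 proof (intro conjI ballI)
  show "lin He ?T (%b. W a b a' b')" if "a\<in>|Re|" for a
   unfolding W_def by (rule lin_comp[OF dl tensor_lift_lin[OF env_algs(5,5) Tm w1[OF that \<open>a'\<in>|Re|\<close> \<open>b'\<in>|He|\<close>]]])
  fix b assume b: "b\<in>|He|"
  have "bil Re He ?T (%a b'. W a b a' b')" unfolding W_def[abs_def]
  proof (rule tensor_lift2_bil_aux[OF env_algs(4,5,5,5) Tm w1[OF _ that(1)] _ lin_closed[OF dl b]])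
   show "bil Re He ?T (%a b'. ts Re He (a *\<^sub>Re act c a') (d *\<^sub>He b'))" if "c\<in>|He|" "d\<in>|He|" for c d
    by (rule bil_comp[OF tb bil_left[OF rb act_closed[OF that(1) \<open>a'\<in>|Re|\<close>]] bil_right[OF hb that(2)]])
  qed
  thus "lin Re ?T (%a. W a b a' b')" by (rule bil_left[OF _ that(2)])
 qed
 have Wb: "bil ?T ?T ?T (tensor_lift2 ?T W)"
  by (rule tensor_lift2_bil[OF env_algs(4,5,4,5) Tm f1 f2])
 have Wt: "tensor_lift2 ?T W (ts Re He a b) (ts Re He a' b') = W a b a' b'"
  if "a\<in>|Re|" "b\<in>|He|" "a'\<in>|Re|" "b'\<in>|He|" for a b a' b'
  by (rule tensor_lift2_tens[OF env_algs(4,5,4,5) Tm f1 f2 that])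
 note cb = alg_bilinear[OF env_algs(3)]
 have pure: "smash_map (W a b a' b') = (inR a *\<^sub>Ce inR b) *\<^sub>Ce (inR a' *\<^sub>Ce inR b')"
  if c: "a\<in>|Re|" "b\<in>|He|" "a'\<in>|Re|" "b'\<in>|He|" for a b a' b'
 proof -
  note k = hom_closed[OF inR_hom(1) c(1)] hom_closed[OF inH_hom(1) c(2)] hom_closed[OF inR_hom(1) c(3)] hom_closed[OF inH_hom(1) c(4)]
  have dc: "env_comult K H b\<in>|TS He He|" by (rule lin_closed[OF dl c(2)])
  note l = lin_comp[OF bil_right[OF cb k(1)] bil_left[OF cb k(4)]]
  note fb = bil_comp[OF cb lin_comp[OF bil_left[OF act_bil c(3)] hom_lin[OF inR_hom(1)]] hom_lin[OF inH_hom(1)]]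
  have "smash_map (W a b a' b') = tlift Ce (%b1 b2. smash_map (ts Re He (a *\<^sub>Re act b1 a') (b2 *\<^sub>He b'))) (env_comult K H b)"
   unfolding W_def by (rule lin_tensor_lift[OF env_algs(5,5) Tm env_algs(6) w1[OF c(1,3,4)] smash_lin dc])
  also have "... = tlift Ce (%b1 b2. (inR a *\<^sub>Ce (inR (act b1 a') *\<^sub>Ce inR b2)) *\<^sub>Ce inR b') (env_comult K H b)"
  proof (rule tensor_lift_cong[OF env_algs(5,5,6) bil_post[OF w1[OF c(1,3,4)] smash_lin] bil_post[OF fb l] _ dc])
   fix x y assume xy: "x\<in>|He|" "y\<in>|He|"
   note m = act_closed[OF xy(1) c(3)]
   show "smash_map (ts Re He (a *\<^sub>Re act x a') (y *\<^sub>He b')) = (inR a *\<^sub>Ce (inR (act x a') *\<^sub>Ce inR y)) *\<^sub>Ce inR b'"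
    using c xy m k hom_closed[OF inR_hom(1) m] hom_closed[OF inH_hom(1) xy(2)]
    by (simp add: smash_tens hom_mult[OF inR_hom(1)] hom_mult[OF inH_hom(1)] alg_assoc[OF env_algs(3)])
  qed
  also have "... = (inR a *\<^sub>Ce tlift Ce (%b1 b2. inR (act b1 a') *\<^sub>Ce inR b2) (env_comult K H b)) *\<^sub>Ce inR b'"
   by (rule lin_tensor_lift[OF env_algs(5,5,6,6) fb l dc, symmetric])
  also have "... = (inR a *\<^sub>Ce inR b) *\<^sub>Ce (inR a' *\<^sub>Ce inR b')"
   unfolding comm_act[OF c(2,3), symmetric] using k by (simp add: alg_assoc[OF env_algs(3)])
  finally show ?thesis .
 qed
 have mult: "smash_map (u *\<^sub>?S v) = smash_map u *\<^sub>Ce smash_map v" if u: "u\<in>|?T|" and v: "v\<in>|?T|" for u v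
  unfolding Sm
 proof (rule lin_eq_tensor[OF env_algs(4,5) lin_comp[OF bil_left[OF Wb v] smash_lin] lin_comp[OF smash_lin bil_left[OF cb lin_closed[OF smash_lin v]]] _ u])
  fix a b assume ab: "a\<in>|Re|" "b\<in>|He|"
  note tab = tens_closed[OF env_algs(4,5) ab]
  show "smash_map (tensor_lift2 ?T W (ts Re He a b) v) = smash_map (ts Re He a b) *\<^sub>Ce smash_map v"
   by (rule lin_eq_tensor[OF env_algs(4,5) lin_comp[OF bil_right[OF Wb tab] smash_lin] lin_comp[OF smash_lin bil_right[OF cb lin_closed[OF smash_lin tab]]] _ v])
    (use ab in "simp add: Wt pure smash_tens")
 qed
 obtain \<Lambda> where \<Lambda>: "!!u. u\<in>|?T| ==> \<Lambda> (smash_map u) = u" using smash_left_inverse by blast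
 have inj: "inj_on smash_map (carrier ?S)" unfolding Ss by (rule inj_on_inverseI[of _ \<Lambda>]) (rule \<Lambda>)
 have oneT: "1\<^sub>?S\<in>|?T|" "smash_map 1\<^sub>?S = 1\<^sub>Ce"
  by (simp_all add: Ss tens_closed[OF env_algs(4,5)] smash_tens hom_one[OF inR_hom(1)] hom_one[OF inH_hom(1)])
 have mc: "u *\<^sub>?S v\<in>|?T|" if "u\<in>|?T|" "v\<in>|?T|" for u v unfolding Sm by (rule bil_closed[OF Wb that])
 have lin: "lin ?S Ce smash_map" using smash_lin unfolding k_linear_def Ss .
 have Smod: "vs ?S" by (rule module_cong[OF Tm Ss(1-4)])
 have alg: "k_algebra K ?S"
  by (rule k_algebra_transport[OF Smod env_algs(3) lin inj]) (use mc oneT mult in "auto simp: Ss(1)")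
 let ?I = "smash_map ` |?T|"
 have I: "submodule ?I K Ce" by (rule sub_image[OF smash_lin Tm env_algs(6) sub_full[OF Tm]])
 have Im: "x *\<^sub>Ce y\<in>?I" if "x\<in>?I" "y\<in>?I" for x y
  using that mult mc by (auto simp: image_iff) metis
 have IR: "inR a\<in>?I" if "a\<in>|Re|" for a
  using smash_tens[OF that alg_one_closed[OF env_algs(2)]] hom_one[OF inH_hom(1)] hom_closed[OF inR_hom(1) that] tens_closed[OF env_algs(4,5) that alg_one_closed[OF env_algs(2)]]
  by (intro image_eqI[of _ _ "ts Re He a 1\<^sub>He"]) simp_all
 have IH: "inR b\<in>?I" if "b\<in>|He|" for b
  using smash_tens[OF alg_one_closed[OF env_algs(1)] that] hom_one[OF inR_hom(1)] hom_closed[OF inH_hom(1) that] tens_closed[OF env_algs(4,5) alg_one_closed[OF env_algs(1)] that]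
  by (intro image_eqI[of _ _ "ts Re He 1\<^sub>Re b"]) simp_all
 \<comment> \<open>C is spanned by products y g, and h_{yg} = m_g h_y + m_y h_g.\<close>
 have gens: "cm c\<in>?I & ch c\<in>?I" if c: "c\<in>|C|" for c
 proof -
  have S: "{y *\<^sub>C g | y g. y\<in>|R| & g\<in>G}\<subseteq>|C|" using RC GC by auto
  have i: "cm y\<in>?I" "ch y\<in>?I" if "y\<in>|R|" for y using IR[of "rm y"] IR[of "rh y"] that by (simp_all add: inR_m inR_h)
  have j: "cm g\<in>?I" "ch g\<in>?I" if "g\<in>G" for g using IH[of "gm g"] IH[of "gh g"] GH[OF that] by (simp_all add: inH_m inH_h)
  have "span C {y *\<^sub>C g | y g. y\<in>|R| & g\<in>G}\<subseteq>{c\<in>carrier C. cm c\<in>?I}"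
   by (rule span_least[OF sub_preimage[OF env_m_lin[OF C] Ca(2) env_algs(6) I]]) (use RC GC i j Im c_rel(1) in auto)
  moreover have "span C {y *\<^sub>C g | y g. y\<in>|R| & g\<in>G}\<subseteq>{c\<in>carrier C. ch c\<in>?I}"
  proof (rule span_least[OF sub_preimage[OF env_h_lin[OF C] Ca(2) env_algs(6) I]], safe)
   fix y g assume y: "y\<in>|R|" and g: "g\<in>G"
   show "y *\<^sub>C g\<in>|C|" using RC[OF y] GC[OF g] by simp
   show "ch (y *\<^sub>C g)\<in>?I" unfolding c_rel(3)[OF RC[OF y] GC[OF g]]
    by (intro sub_add[OF env_algs(6) I] Im i j y g)
  qed
  ultimately show ?thesis using C_span[OF c] by blast
 qed
 have surj: "x\<in>?I" if "x\<in>|Ce|" for x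
  using that
 proof (induction rule: env_induct[OF C, consumes 1, case_names one add smult m h])
  case one
  thus ?case using IR[of "1\<^sub>Re"] hom_one[OF inR_hom(1)] by simp
 qed (use gens Im sub_add[OF env_algs(6) I] sub_smult[OF env_algs(6) I] in auto)
 have "bij_betw smash_map (carrier ?S) (carrier Ce)"
  unfolding bij_betw_def using inj surj lin_closed[OF smash_lin] by (auto simp: Ss(1))
 moreover have "smash_map\<in>ring_hom ?S Ce"
  using mult oneT lin_closed[OF smash_lin] lin_add[OF smash_lin] by (auto simp: ring_hom_def Ss(1,3))
 ultimately show ?thesis unfolding k_algebra_iso_def using alg lin smash_tens by simp
qed

end
end

section \<open>Contractions of iterated coproducts\<close>

context base
begin

lemma lsl_map:
 assumes m: "vs M" "vs N" "vs M'" "vs N'" and f: "lin M M' f" and g: "lin N N' g"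
  and \<phi>: "fnl M' \<phi>" and u: "u\<in>|TS M N|"
 shows "lsl N' \<phi> (tmap M' N' f g u) = g (lsl N (%x. \<phi> (f x)) u)"
proof (rule lin_eq_tensor[OF m(1,2) lin_comp[OF tensor_map_lin[OF m f g] lsl_lin[OF m(3,4) \<phi>]]
   lin_comp[OF lsl_lin[OF m(1,2) lin_comp[OF f \<phi>]] g] _ u])
 fix x y assume xy: "x\<in>|M|" "y\<in>|N|"
 thus "lsl N' \<phi> (tmap M' N' f g (ts M N x y)) = g (lsl N (%x. \<phi> (f x)) (ts M N x y))"
  by (simp add: tensor_map_tens[OF m f g] lsl_tens[OF m(3,4) \<phi>] lsl_tens[OF m(1,2) lin_comp[OF f \<phi>]]
   lin_closed[OF f] lin_closed[OF g] lin_smult[OF g] fnl_closed[OF \<phi>])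
qed

lemma rsl_map:
 assumes m: "vs M" "vs N" "vs M'" "vs N'" and f: "lin M M' f" and g: "lin N N' g"
  and \<psi>: "fnl N' \<psi>" and u: "u\<in>|TS M N|"
 shows "rsl M' \<psi> (tmap M' N' f g u) = f (rsl M (%x. \<psi> (g x)) u)"
proof (rule lin_eq_tensor[OF m(1,2) lin_comp[OF tensor_map_lin[OF m f g] rsl_lin[OF m(3,4) \<psi>]]
   lin_comp[OF rsl_lin[OF m(1,2) lin_comp[OF g \<psi>]] f] _ u])
 fix x y assume xy: "x\<in>|M|" "y\<in>|N|"
 thus "rsl M' \<psi> (tmap M' N' f g (ts M N x y)) = f (rsl M (%x. \<psi> (g x)) (ts M N x y))"
  by (simp add: tensor_map_tens[OF m f g] rsl_tens[OF m(3,4) \<psi>] rsl_tens[OF m(1,2) lin_comp[OF g \<psi>]]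
   lin_closed[OF f] lin_closed[OF g] lin_smult[OF f] fnl_closed[OF \<psi>])
qed

lemma lin_ident: "lin M M (%x. x)"
 by (rule lin_id) auto

lemma set_add_comm:
 assumes "vs M" "H\<subseteq>|M|" "H'\<subseteq>|M|"
 shows "H <+>\<^sub>M H' = H' <+>\<^sub>M H"
proof -
 have c: "a +\<^sub>M b = b +\<^sub>M a" if "a\<in>H" "b\<in>H'" for a b using assms that by (intro v_comm) auto
 thus ?thesis unfolding set_eq_iff set_add_iff by metis
qed

lemma bil_span:
 assumes b: "bil M N P f" and M: "vs M" "S\<subseteq>|M|" and N: "vs N" "T\<subseteq>|N|"
  and P: "vs P" "sub H P" and c: "!!s t. s\<in>S ==> t\<in>T ==> f s t\<in>H"
  and u: "u\<in>span M S" and v: "v\<in>span N T"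
 shows "f u v\<in>H"
proof -
 have 1: "f s v\<in>H" if s: "s\<in>S" for s
  using span_least[OF sub_preimage[OF bil_right[OF b] N(1) P], of s T] c[OF s] N(2) M(2) s v by blast
 show ?thesis
  using span_least[OF sub_preimage[OF bil_left[OF b sub_carrier[OF N(1) span_sub[OF N] v]] M(1) P], of S] 1 M(2) u by blast
qed

text \<open>After reassociation the first of the three legs is the first leg of \<Delta> x, where x
  runs over the first legs of u; contracting it replaces \<Delta> x by its slice.\<close>

lemma tensor_triple_aux:
 assumes C: "vs C" and D: "lin C (TS C C) \<Delta>" and \<phi>: "fnl C \<phi>"
  and u: "u\<in>|TS C C|"
 shows "tensor_assoc K C (tmap (TS C C) C \<Delta> (%b. b) u)\<in>|TS C (TS C C)|"
  "lsl (TS C C) \<phi> (tensor_assoc K C (tmap (TS C C) C \<Delta> (%b. b) u)) =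
   tmap C C (%x. lsl C \<phi> (\<Delta> x)) (%b. b) u"
proof -
 let ?T = "TS C C" and ?U = "TS C (TS C C)"
 note T = tensor_module[OF C C] and U = tensor_module[OF C tensor_module[OF C C]]
 have b1: "bil C C ?U (%x y. ts C ?T x (ts C C y z))" if "z\<in>|C|" for z
  by (rule bil_comp[OF tens_bilinear[OF C T] lin_ident tens_lin_l[OF C C that]])
 have b2: "lin C ?U (%z. ts C ?T x (ts C C y z))" if "x\<in>|C|" "y\<in>|C|" for x y
  by (rule lin_comp[OF tens_lin_r[OF C C that(2)] tens_lin_r[OF C T that(1)]])
 define A where "A u z = tlift ?U (%x y. ts C ?T x (ts C C y z)) u" for u z
 have At: "A (ts C C x y) z = ts C ?T x (ts C C y z)" if "x\<in>|C|" "y\<in>|C|" "z\<in>|C|" for x y z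
  unfolding A_def by (rule tensor_lift_tens[OF C C U b1[OF that(3)] that(1,2)])
 have Al: "lin ?T ?U (%u. A u z)" if "z\<in>|C|" for z
  unfolding A_def by (rule tensor_lift_lin[OF C C U b1[OF that]])
 have Ar: "lin C ?U (A u)" if "u\<in>|?T|" for u
  using that
 proof (induction rule: tensor_induct[OF C C, consumes 1, case_names tens add])
  case (tens x y)
  show ?case by (rule lin_cong[OF b2[OF tens] C]) (use tens At in auto)
 next
  case (add u v)
  show ?case by (rule lin_cong[OF lin_plus[OF U add(3,4)] C]) (use add(1,2) in "simp add: lin_add[OF Al]")
 qed
 have Ab: "bil ?T C ?U A" unfolding k_bilinear_def using Al Ar by auto
 have as: "tensor_assoc K C = tlift ?U A" unfolding tensor_assoc_def Let_def A_def[abs_def] ..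
 note asl = tensor_lift_lin[OF T C U Ab, folded as] and ast = tensor_lift_tens[OF T C U Ab, folded as]
 note tm = tensor_map_lin[OF C C T C D lin_ident]
 show "tensor_assoc K C (tmap ?T C \<Delta> (%b. b) u)\<in>|?U|"
  by (rule lin_closed[OF asl lin_closed[OF tm u]])
 have l2: "lin C C (%x. lsl C \<phi> (\<Delta> x))" by (rule lin_comp[OF D lsl_lin[OF C C \<phi>]])
 show "lsl ?T \<phi> (tensor_assoc K C (tmap ?T C \<Delta> (%b. b) u)) = tmap C C (%x. lsl C \<phi> (\<Delta> x)) (%b. b) u"
 proof (rule lin_eq_tensor[OF C C lin_comp[OF lin_comp[OF tm asl] lsl_lin[OF C T \<phi>]] tensor_map_lin[OF C C C C l2 lin_ident] _ u])
  fix x y assume xy: "x\<in>|C|" "y\<in>|C|"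
  have dx: "\<Delta> x\<in>|?T|" by (rule lin_closed[OF D xy(1)])
  have "lsl ?T \<phi> (A w y) = ts C C (lsl C \<phi> w) y" if "w\<in>|?T|" for w
  proof (rule lin_eq_tensor[OF C C lin_comp[OF Al[OF xy(2)] lsl_lin[OF C T \<phi>]] lin_comp[OF lsl_lin[OF C C \<phi>] tens_lin_l[OF C C xy(2)]] _ that])
   fix a b assume ab: "a\<in>|C|" "b\<in>|C|"
   thus "lsl ?T \<phi> (A (ts C C a b) y) = ts C C (lsl C \<phi> (ts C C a b)) y"
    using xy by (simp add: At lsl_tens[OF C T \<phi>] lsl_tens[OF C C \<phi>] tens_closed[OF C C] tens_smult_l[OF C C] fnl_closed[OF \<phi>])
  qed
  thus "lsl ?T \<phi> (tensor_assoc K C (tmap ?T C \<Delta> (%b. b) (ts C C x y))) = tmap C C (%x. lsl C \<phi> (\<Delta> x)) (%b. b) (ts C C x y)"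
   using xy dx by (simp add: tensor_map_tens[OF C C T C D lin_ident] ast tensor_map_tens[OF C C C C l2 lin_ident])
 qed
qed

text \<open>A tensor with three legs is determined by its contractions with \<phi>, \<psi> and
  \<chi>. Coassociativity thus becomes an identity of scalars, the form in which it is verified for
  gr B.\<close>

lemma coassocI:
 assumes C: "vs C" and D: "lin C (TS C C) \<Delta>"
  and a: "!!\<phi> \<psi> \<chi> x. fnl C \<phi> ==> fnl C \<psi> ==> fnl C \<chi> ==> x\<in>|C| ==>
   \<chi> (lsl C \<psi> (\<Delta> (lsl C \<phi> (\<Delta> x)))) = \<chi> (lsl C (%y. \<psi> (lsl C \<phi> (\<Delta> y))) (\<Delta> x))"
  and x: "x\<in>|C|"
 shows "tmap C (TS C C) (%a. a) \<Delta> (\<Delta> x) = tensor_assoc K C (tmap (TS C C) C \<Delta> (%b. b) (\<Delta> x))"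
proof -
 let ?T = "TS C C" and ?U = "TS C (TS C C)"
 note T = tensor_module[OF C C]
 have dx: "\<Delta> x\<in>|?T|" by (rule lin_closed[OF D x])
 note tm = tensor_map_lin[OF C C C T lin_ident D]
 show ?thesis
 proof (rule tensor_eqI2[OF C T lin_closed[OF tm dx] tensor_triple_aux(1)[OF C D lin_null[OF base_module] dx]])
  fix \<phi> \<omega> assume \<phi>: "fnl C \<phi>" and \<omega>: "fnl ?T \<omega>"
  have l2: "lin C C (%x. lsl C \<phi> (\<Delta> x))" by (rule lin_comp[OF D lsl_lin[OF C C \<phi>]])
  have lx: "lsl C \<phi> (\<Delta> x)\<in>|C|" by (rule lin_closed[OF l2 x])
  have "\<Delta> (lsl C \<phi> (\<Delta> x)) = tmap C C (%x. lsl C \<phi> (\<Delta> x)) (%b. b) (\<Delta> x)"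
  proof (rule tensor_eqI2[OF C C lin_closed[OF D lx] lin_closed[OF tensor_map_lin[OF C C C C l2 lin_ident] dx]])
   fix \<psi> \<chi> assume f: "fnl C \<psi>" "fnl C \<chi>"
   show "\<chi> (lsl C \<psi> (\<Delta> (lsl C \<phi> (\<Delta> x)))) = \<chi> (lsl C \<psi> (tmap C C (%x. lsl C \<phi> (\<Delta> x)) (%b. b) (\<Delta> x)))"
    unfolding lsl_map[OF C C C C l2 lin_ident f(1) dx] by (rule a[OF \<phi> f x])
  qed
  thus "\<omega> (lsl ?T \<phi> (tmap C ?T (%a. a) \<Delta> (\<Delta> x))) = \<omega> (lsl ?T \<phi> (tensor_assoc K C (tmap ?T C \<Delta> (%b. b) (\<Delta> x))))"
   unfolding lsl_map[OF C C C T lin_ident D \<phi> dx] tensor_triple_aux(2)[OF C D \<phi> dx] by simp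
 qed
qed

subsection \<open>Slices of the comultiplication\<close>

end

locale coalg = base K + coalgebra K C \<Delta> \<epsilon> for K :: "('k, 'r) ring_scheme" (structure) and C :: "('k, 'c, 'z) module_scheme" and \<Delta> \<epsilon>
begin

lemma Cm: "vs C" by unfold_locales
lemmas CT = tensor_module[OF Cm Cm]
lemma D_closed: "x\<in>|C| ==> \<Delta> x\<in>|TS C C|"
 by (rule lin_closed[OF comult_linear])

text \<open>\<open>ls\<close> and \<open>rs\<close> are the hit actions of the dual algebra on C,
  from the right and from the left.\<close>

definition ls :: "('c => 'k) => 'c => 'c" where "ls \<phi> x = lsl C \<phi> (\<Delta> x)"
definition rs :: "('c => 'k) => 'c => 'c" where "rs \<phi> x = rsl C \<phi> (\<Delta> x)"

lemma ls_lin: "fnl C \<phi> ==> lin C C (ls \<phi>)"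
 unfolding ls_def by (rule lin_comp[OF comult_linear lsl_lin[OF Cm Cm]])
lemma rs_lin: "fnl C \<phi> ==> lin C C (rs \<phi>)"
 unfolding rs_def by (rule lin_comp[OF comult_linear rsl_lin[OF Cm Cm]])
lemmas ls_closed = lin_closed[OF ls_lin] and rs_closed = lin_closed[OF rs_lin]

lemma ls_counit: "x\<in>|C| ==> ls \<epsilon> x = x"
 unfolding ls_def lsl_def by (rule counit_left)
lemma rs_counit: "x\<in>|C| ==> rs \<epsilon> x = x"
 unfolding rs_def rsl_def by (rule counit_right)

lemma ls_rs: "fnl C \<phi> ==> fnl C \<psi> ==> x\<in>|C| ==> \<psi> (ls \<phi> x) = \<phi> (rs \<psi> x)"
 unfolding ls_def rs_def by (rule lsl_rsl[OF Cm Cm _ _ D_closed])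

text \<open>Coassociativity contracted by \<phi> in the first of three legs.\<close>

lemma comult_ls:
 assumes \<phi>: "fnl C \<phi>" and x: "x\<in>|C|"
 shows "\<Delta> (ls \<phi> x) = tmap C C (ls \<phi>) (%b. b) (\<Delta> x)"
 using coassoc[OF x] lsl_map[OF Cm Cm Cm CT lin_ident comult_linear \<phi> D_closed[OF x]]
  tensor_triple_aux(2)[OF Cm comult_linear \<phi> D_closed[OF x]]
 unfolding ls_def[abs_def] by simp

lemma conv_fnl: "fnl C \<phi> ==> fnl C \<psi> ==> fnl C (%y. \<psi> (ls \<phi> y))"
 by (rule lin_comp[OF ls_lin])

lemma ls_ls: "fnl C \<phi> ==> fnl C \<psi> ==> x\<in>|C| ==> ls \<psi> (ls \<phi> x) = ls (%y. \<psi> (ls \<phi> y)) x"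
 unfolding ls_def[of \<psi> "ls \<phi> x"] ls_def[of "%y. \<psi> (ls \<phi> y)"]
 by (simp add: comult_ls lsl_map[OF Cm Cm Cm Cm ls_lin lin_ident] D_closed)

text \<open>Coassociativity once more: the two actions contract different legs. Most later
  inductions use it in this form.\<close>

lemma ls_rs_comm: "fnl C \<phi> ==> fnl C \<psi> ==> x\<in>|C| ==> rs \<psi> (ls \<phi> x) = ls \<phi> (rs \<psi> x)"
 unfolding rs_def
 by (simp add: comult_ls rsl_map[OF Cm Cm Cm Cm ls_lin lin_ident] D_closed)

lemma comult_rs:
 assumes \<psi>: "fnl C \<psi>" and x: "x\<in>|C|"
 shows "\<Delta> (rs \<psi> x) = tmap C C (%a. a) (rs \<psi>) (\<Delta> x)"
proof (rule tensor_eqI2[OF Cm Cm D_closed[OF rs_closed[OF \<psi> x]] lin_closed[OF tensor_map_lin[OF Cm Cm Cm Cm lin_ident rs_lin[OF \<psi>]] D_closed[OF x]]])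
 fix \<phi> \<chi> assume f: "fnl C \<phi>" "fnl C \<chi>"
 show "\<chi> (lsl C \<phi> (\<Delta> (rs \<psi> x))) = \<chi> (lsl C \<phi> (tmap C C (%a. a) (rs \<psi>) (\<Delta> x)))"
  using ls_rs_comm[OF f(1) \<psi> x] unfolding lsl_map[OF Cm Cm Cm Cm lin_ident rs_lin[OF \<psi>] f(1) D_closed[OF x]]
  unfolding ls_def by simp
qed

subsection \<open>The coradical filtration\<close>

abbreviation "F \<equiv> corad_filt K C \<Delta>"
abbreviation (input) "ann \<phi> X \<equiv> \<forall>x\<in>X. \<phi> x = \<zero>"

lemma simple_carrier: "\<Union>{D. simple_subcoalgebra K C \<Delta> D}\<subseteq>|C|"
 unfolding simple_subcoalgebra_def subcoalgebra_def using sub_carrier[OF Cm] by blast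

lemma F0_sub: "sub (F 0) C"
 by (simp add: span_sub[OF Cm simple_carrier])

lemma F0_comult:
 assumes "x\<in>F 0"
 shows "\<Delta> x\<in>tsub C C (F 0) (F 0)"
proof -
 have "\<Delta> x\<in>tsub C C (F 0) (F 0)" if D: "simple_subcoalgebra K C \<Delta> D" and x: "x\<in>D" for x D
 proof -
  have "\<Delta> x\<in>tsub C C D D" using D x unfolding simple_subcoalgebra_def subcoalgebra_def by blast
  moreover have "D\<subseteq>F 0" using D by (auto intro: span_incl)
  ultimately show ?thesis using tensor_sub_mono[OF Cm Cm, of D "F 0" D "F 0"] by blast
 qed
 hence "F 0\<subseteq>{x\<in>carrier C. \<Delta> x\<in>tsub C C (F 0) (F 0)}"
  unfolding corad_filt.simps(1)[of K C \<Delta>]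
  by (intro span_least sub_preimage[OF comult_linear Cm CT] tensor_sub_sub[OF Cm Cm] span_sub[OF Cm simple_carrier])
   (use simple_carrier in auto)
 thus ?thesis using assms by blast
qed

text \<open>\<open>tensor_criterion\<close> and its converse for X = F 0 and Y = F n, after swapping
  the two summands of the definition. That F n is a subspace is assumed because it is proved by
  induction through this very characterisation.\<close>

lemma F_Suc:
 assumes Fn: "sub (F n) C"
 shows "x\<in>F (Suc n) \<longleftrightarrow> x\<in>|C| & (\<forall>\<phi>. fnl C \<phi> --> ann \<phi> (F 0) --> ls \<phi> x\<in>F n)"
proof -
 let ?A = "tsub C C (carrier C) (F n)" and ?B = "tsub C C (F 0) (carrier C)"
 have c: "?A <+>\<^sub>(TS C C) ?B = ?B <+>\<^sub>(TS C C) ?A"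
  by (rule set_add_comm[OF CT]; rule sub_subset[OF CT tensor_sub_sub[OF Cm Cm]]) (rule sub_full[OF Cm] Fn F0_sub)+
 show ?thesis unfolding corad_filt.simps(2) c
  using tensor_criterion[OF Cm Cm sub_full[OF Cm] sub_full[OF Cm] F0_sub sub_subset[OF Cm F0_sub] Fn, of "\<Delta> x"]
   tensor_criterion_rev[OF Cm Cm F0_sub Fn, of "\<Delta> x"] D_closed[of x]
  unfolding tensor_sub_full[OF Cm Cm] ls_def by blast
qed

lemma F_sub: "sub (F n) C"
proof (induction n)
 case 0
 show ?case by (rule F0_sub)
next
 case (Suc n)
 note l = ls_lin
 show ?case
  by (rule submodule_crit[OF Cm])
   (auto simp: F_Suc[OF Suc] Cm lin_zero[OF ls_lin Cm Cm] lin_add[OF ls_lin] lin_smult[OF ls_lin]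
    intro: sub_zero[OF Cm Suc] sub_add[OF Cm Suc] sub_smult[OF Cm Suc] simp del: corad_filt.simps)
qed

lemmas FC = sub_carrier[OF Cm F_sub]
lemmas F_Suc_iff = F_Suc[OF F_sub]
declare corad_filt.simps [simp del]

lemma F0_slices:
 assumes "x\<in>F 0" "fnl C \<phi>"
 shows "ls \<phi> x\<in>F 0" "rs \<phi> x\<in>F 0" "ann \<phi> (F 0) ==> ls \<phi> x = 0\<^sub>C"
proof -
 note sl = F0_sub F0_sub F0_comult[OF assms(1)]
 note c = fnl_closed[OF assms(2) FC]
 show "ls \<phi> x\<in>F 0" unfolding ls_def by (rule lsl_sub[OF Cm Cm assms(2) sl F0_sub]) (auto intro!: sub_smult[OF Cm F0_sub] c)
 show "rs \<phi> x\<in>F 0" unfolding rs_def by (rule rsl_sub[OF Cm Cm assms(2) sl F0_sub]) (auto intro!: sub_smult[OF Cm F0_sub] c)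
 assume "ann \<phi> (F 0)"
 hence "ls \<phi> x\<in>{0\<^sub>C}" unfolding ls_def
  by (intro lsl_sub[OF Cm Cm assms(2) sl sub_null[OF Cm]]) (auto simp: Cm FC)
 thus "ls \<phi> x = 0\<^sub>C" by simp
qed

text \<open>In the step, \<psi> composed with \<open>ls \<phi>\<close> again vanishes on F 0,
  because F 0 is stable under slices; for the other side \<open>rs \<phi>\<close> commutes with
  \<open>ls \<psi>\<close>.\<close>

lemma F_slices:
 assumes "x\<in>F n" "fnl C \<phi>"
 shows "ls \<phi> x\<in>F n & rs \<phi> x\<in>F n"
 using assms(1)
proof (induction n arbitrary: x)
 case 0
 thus ?case using F0_slices[OF _ assms(2)] by blast
next
 case (Suc n)
 note x = Suc.prems[unfolded F_Suc_iff]
 have "ls \<psi> (ls \<phi> x)\<in>F n & ls \<psi> (rs \<phi> x)\<in>F n" if p: "fnl C \<psi>" "ann \<psi> (F 0)" for \<psi>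
 proof
  have "ann (%y. \<psi> (ls \<phi> y)) (F 0)" using F0_slices(1)[OF _ assms(2)] p(2) by blast
  thus "ls \<psi> (ls \<phi> x)\<in>F n" using x conv_fnl[OF assms(2) p(1)] by (simp add: ls_ls[OF assms(2) p(1)])
  show "ls \<psi> (rs \<phi> x)\<in>F n" using Suc.IH x p by (simp add: ls_rs_comm[OF p(1) assms(2), symmetric])
 qed
 thus ?case using x ls_closed[OF assms(2)] rs_closed[OF assms(2)] by (auto simp: F_Suc_iff)
qed

lemma F_Suc_mono: "F n\<subseteq>F (Suc n)"
proof (induction n)
 case 0
 show ?case using F0_slices(3) FC[of _ 0] sub_zero[OF Cm F0_sub] by (auto simp: F_Suc_iff)
next
 case (Suc n)
 thus ?case unfolding subset_iff F_Suc_iff[of _ "Suc n"] F_Suc_iff[of _ n] by blast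
qed

lemma F_mono: "i \<le> j ==> F i\<subseteq>F j"
 by (rule lift_Suc_mono_le[of F, OF F_Suc_mono])

text \<open>In slice form, F (i + j + 1) lies in the wedge of F i and F j. For i = 0, test by a
  \<chi> killing F 0: \<chi> (rs \<psi> x) = \<psi> (ls \<chi> x), and \<open>ls \<chi> x\<close>
  lies in F j. For larger i, slice once more by such a \<chi> and commute the two actions.\<close>

lemma F_wedge_r:
 assumes \<psi>: "fnl C \<psi>" "ann \<psi> (F j)" and x: "x\<in>F (Suc (i + j))"
 shows "rs \<psi> x\<in>F i"
 using x
proof (induction i arbitrary: x)
 case 0
 show ?case
 proof (rule fnl_memI[OF Cm F_sub])
  show "rs \<psi> x\<in>|C|" by (rule rs_closed[OF \<psi>(1) FC[OF 0]])
  fix \<chi> assume "fnl C \<chi>" "!!x. x\<in>F 0 ==> \<chi> x = \<zero>"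
  thus "\<chi> (rs \<psi> x) = \<zero>" using 0 \<psi> by (simp add: F_Suc_iff ls_rs[symmetric])
 qed
next
 case (Suc i)
 note x = Suc.prems[unfolded add_Suc, unfolded F_Suc_iff[of _ "Suc (i + j)"]]
 have "ls \<chi> (rs \<psi> x)\<in>F i" if "fnl C \<chi>" "ann \<chi> (F 0)" for \<chi>
  using Suc.IH x that by (simp add: ls_rs_comm[OF that(1) \<psi>(1), symmetric])
 thus ?case using x rs_closed[OF \<psi>(1)] by (auto simp: F_Suc_iff)
qed

text \<open>Testing by a \<psi> that kills F j trades \<open>ls \<phi>\<close> for
  \<open>rs \<psi>\<close>, to which the previous fact applies.\<close>

lemma F_wedge_l:
 assumes \<phi>: "fnl C \<phi>" "ann \<phi> (F i)" and x: "x\<in>F (Suc (i + j))"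
 shows "ls \<phi> x\<in>F j"
 using F_wedge_r[OF _ _ x] \<phi> FC[OF x] ls_closed[OF \<phi>(1)]
 by (intro fnl_memI[OF Cm F_sub]) (auto simp: ls_rs)

lemma F_ann_l:
 assumes \<phi>: "fnl C \<phi>" "ann \<phi> (F n)" and x: "x\<in>F n"
 shows "ls \<phi> x = 0\<^sub>C"
 using F_slices[OF x] \<phi> FC[OF x] ls_closed[OF \<phi>(1)]
 by (intro fnl_zeroI[OF Cm]) (auto simp: ls_rs)

text \<open>Pure tensors that span the sum of all F i \<otimes> F (n - i), so that bilinear
  arguments can be run on them directly.\<close>

definition W :: "nat => ('c \<times> 'c => 'k) set set"
 where "W n = {ts C C a b | a b. \<exists>i\<le>n. a\<in>F i & b\<in>F (n - i)}"

lemma W_carrier: "W n\<subseteq>|TS C C|"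
 unfolding W_def using FC tens_closed[OF Cm Cm] by blast

lemma W_span: "span (TS C C) (\<Union>i\<le>n. tsub C C (F i) (F (n - i))) = span (TS C C) (W n)"
  (is "?l = ?r")
proof
 have "tsub C C (F i) (F (n - i))\<subseteq>?r" if "i \<le> n" for i
  unfolding tensor_sub_def by (rule span_mono) (use that in "auto simp: W_def")
 thus "?l\<subseteq>?r" by (intro span_least[OF span_sub[OF CT W_carrier]]) blast
 have "(\<Union>i\<le>n. tsub C C (F i) (F (n - i)))\<subseteq>|TS C C|"
  using tensor_sub_carrier[OF Cm Cm F_sub F_sub] by blast
 thus "?r\<subseteq>?l"
  by (intro span_least[OF span_sub[OF CT]]) (auto simp: W_def intro!: span_incl bexI[rotated] tensor_sub_tens[OF Cm Cm])
qed

text \<open>The wedge facts are the slice hypotheses of \<open>tensor_filtration\<close>. Before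
  that, the criterion with X = 0 places the second leg in F n.\<close>

lemma F_comult:
 assumes x: "x\<in>F n"
 shows "\<Delta> x\<in>span (TS C C) (W n)"
proof -
 have "\<Delta> x\<in>tsub C C {0\<^sub>C} (carrier C) <+>\<^sub>(TS C C) tsub C C (carrier C) (F n)"
  by (rule tensor_criterion[OF Cm Cm sub_full[OF Cm] sub_full[OF Cm] sub_null[OF Cm] _ F_sub])
   (use D_closed[OF FC[OF x]] F_slices[OF x] in "auto simp: tensor_sub_full[OF Cm Cm] ls_def Cm")
 hence 1: "\<Delta> x\<in>tsub C C (carrier C) (F n)"
  using sub_carrier[OF CT tensor_sub_sub[OF Cm Cm sub_full[OF Cm] F_sub]]
  by (auto simp: tensor_sub_null_l[OF Cm Cm sub_full[OF Cm]] set_add_iff CT)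
 show ?thesis unfolding W_span[symmetric]
 proof (rule tensor_filtration[where F = F and G = F and n = n, OF Cm Cm F_sub F_mono F_sub F_mono 1])
  show "lsl C \<phi> (\<Delta> x)\<in>F (n - Suc i)" if "i < n" "fnl C \<phi>" "!!x. x\<in>F i ==> \<phi> x = \<zero>" for i \<phi>
   using F_wedge_l[OF that(2), of i x "n - Suc i"] that x unfolding ls_def by simp
  show "lsl C \<phi> (\<Delta> x) = 0\<^sub>C" if "fnl C \<phi>" "!!x. x\<in>F n ==> \<phi> x = \<zero>" for \<phi>
   using F_ann_l[OF that(1) _ x] that(2) unfolding ls_def by simp
 qed
qed

subsection \<open>Group-likes\<close>

abbreviation "GL \<equiv> grouplikes K C \<Delta> \<epsilon>"

lemma GL_D: "g\<in>GL ==> g\<in>|C|" "g\<in>GL ==> \<Delta> g = ts C C g g" "g\<in>GL ==> \<epsilon> g = \<one>"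
 by (auto simp: grouplikes_def)

lemma GL_slices: "g\<in>GL ==> fnl C \<phi> ==> ls \<phi> g = \<phi> g \<odot>\<^sub>C g" "g\<in>GL ==> fnl C \<phi> ==> rs \<phi> g = \<phi> g \<odot>\<^sub>C g"
 by (simp_all add: ls_def rs_def GL_D lsl_tens[OF Cm Cm] rsl_tens[OF Cm Cm])

lemma GL_nonzero: "g\<in>GL ==> g ~= 0\<^sub>C"
 using GL_D(3)[of g] fnl_zero[OF counit_linear Cm] by auto

text \<open>Induction on a finite set of group-likes whose span contains a multiple of g. To remove
  s, choose \<phi> with \<phi> g = 0 and \<phi> s = 1: then id - \<open>ls \<phi>\<close> kills s,
  rescales the other members and fixes multiples of g, so the multiple already lies in the span
  without s.\<close>

lemma GL_indep:
 assumes S: "S\<subseteq>GL" and g: "g\<in>GL" "g \<notin> S"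
 shows "g \<notin> span C S"
proof -
 have SC: "S\<subseteq>|C|" using S GL_D by blast
 have "x = 0\<^sub>C" if "finite X" "X\<subseteq>S" "x\<in>span C X" "x\<in>line C g" for X x
  using that
 proof (induction X arbitrary: x rule: finite_induct)
  case empty
  thus ?case using span_least[OF sub_null[OF Cm], of "{}"] by auto
 next
  case (insert s X)
  have s: "s\<in>GL" and XC: "X\<subseteq>|C|" "insert s X\<subseteq>|C|" and sC: "s\<in>|C|"
   using insert.prems S SC by auto
  have gC: "g\<in>|C|" using GL_D(1)[OF g(1)] .
  obtain k where k: "k\<in>|K|" "x = k \<odot>\<^sub>C g" using insert.prems(3) unfolding line_def by blast
  \<comment> \<open>The counit is 1 on s and on g, so s could only be g itself.\<close>
  have "s \<notin> line C g"
  proof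
   assume "s\<in>line C g"
   then obtain l where l: "l\<in>|K|" "s = l \<odot>\<^sub>C g" unfolding line_def by blast
   hence "l = \<one>" using GL_D(3)[OF s] GL_D(3)[OF g(1)] fnl_smult[OF counit_linear l(1) gC] by simp
   thus False using l gC g(2) insert.prems(1) by (auto simp: Cm)
  qed
  then obtain \<phi> where \<phi>: "fnl C \<phi>" "!!x. x\<in>line C g ==> \<phi> x = \<zero>" "\<phi> s = \<one>"
   using separation[OF Cm sub_line[OF Cm gC] sC] by blast
  let ?N = "{y\<in>carrier C. y -\<^sub>C ls \<phi> y\<in>span C X}"
  have Ns: "submodule ?N K C"
   by (rule sub_preimage[OF lin_diff[OF Cm lin_ident ls_lin[OF \<phi>(1)]] Cm Cm span_sub[OF Cm XC(1)]])
  have "t\<in>?N" if t: "t\<in>insert s X" for t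
  proof -
   have tG: "t\<in>GL" "t\<in>|C|" using t insert.prems(1) S SC by auto
   show ?thesis
   proof (cases "t = s")
    case True
    thus ?thesis using GL_slices(1)[OF s \<phi>(1)] \<phi>(3) sC sub_zero[OF Cm span_sub[OF Cm XC(1)]] by (simp add: Cm)
   next
    case False
    hence "t\<in>span C X" using t by (auto intro: span_incl)
    thus ?thesis using tG fnl_closed[OF \<phi>(1) tG(2)]
     by (auto simp: GL_slices(1)[OF tG(1) \<phi>(1)] intro!: sub_minus[OF Cm span_sub[OF Cm XC(1)]] sub_smult[OF Cm span_sub[OF Cm XC(1)]])
   qed
  qed
  hence "x -\<^sub>C ls \<phi> x\<in>span C X" using span_least[OF Ns, of "insert s X"] insert.prems(2) by blast
  moreover have "ls \<phi> x = 0\<^sub>C"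
   using \<phi>(2)[OF line_incl[OF Cm gC]] k gC by (simp add: lin_smult[OF ls_lin[OF \<phi>(1)]] GL_slices(1)[OF g(1) \<phi>(1)] Cm)
  ultimately have "x\<in>span C X" using k gC by (simp add: Cm)
  thus ?case using insert.IH insert.prems by blast
 qed
 note fin = this
 have "\<exists>X. finite X & X\<subseteq>S & x\<in>span C X" if "x\<in>span C S" for x
  using that Cm SC
 proof (induction rule: span_induct)
  case zero
  show ?case using sub_zero[OF Cm span_sub[OF Cm, of "{}"]] by (intro exI[of _ "{}"]) auto
 next
  case (base s)
  thus ?case by (intro exI[of _ "{s}"]) (auto intro: span_incl)
 next
  case (add x y)
  then obtain X Y where "finite X" "X\<subseteq>S" "x\<in>span C X" "finite Y" "Y\<subseteq>S" "y\<in>span C Y" by blast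
  thus ?case using span_mono[of X "X \<union> Y" C] span_mono[of Y "X \<union> Y" C] SC
   by (intro exI[of _ "X \<union> Y"]) (auto intro!: sub_add[OF Cm span_sub[OF Cm]])
 next
  case (smult k x)
  then obtain X where "finite X" "X\<subseteq>S" "x\<in>span C X" by blast
  thus ?case using SC smult(1) by (intro exI[of _ X]) (auto intro!: sub_smult[OF Cm span_sub[OF Cm]])
 qed
 thus ?thesis using fin line_incl[OF Cm GL_D(1)[OF g(1)]] GL_nonzero[OF g(1)] by blast
qed

lemma GL_dual:
 assumes g: "g\<in>GL"
 obtains \<phi> where "fnl C \<phi>" "\<phi> g = \<one>" "!!h. h\<in>GL ==> h ~= g ==> \<phi> h = \<zero>"
proof -
 have s: "GL - {g}\<subseteq>|C|" using GL_D by blast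
 obtain \<phi> where "fnl C \<phi>" "!!x. x\<in>span C (GL - {g}) ==> \<phi> x = \<zero>" "\<phi> g = \<one>"
  using separation[OF Cm span_sub[OF Cm s] GL_D(1)[OF g] GL_indep[OF _ g]] by blast
 thus ?thesis using that by (meson DiffI span_incl singletonD)
qed

text \<open>A simple subcoalgebra is a line spanned by some x, and \<Delta> x must be a multiple of
  x \<otimes> x; a suitable rescaling of x is group-like. Conversely the line of a group-like is a
  simple subcoalgebra.\<close>

lemma pointed_F0:
 assumes p: "pointed K C \<Delta>"
 shows "F 0 = span C GL"
proof
 have GC: "GL\<subseteq>|C|" using GL_D by blast
 have "D\<subseteq>span C GL" if D: "simple_subcoalgebra K C \<Delta> D" for D
 proof -
  obtain x where x: "x\<in>|C|" "x ~= 0\<^sub>C" "D = line C x" using p D unfolding pointed_def line_def by blast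
  have "\<Delta> x\<in>tsub C C (line C x) (line C x)"
   using D line_incl[OF Cm x(1)] unfolding x(3) simple_subcoalgebra_def subcoalgebra_def by blast
  moreover have "tsub C C (line C x) (line C x)\<subseteq>line (TS C C) (ts C C x x)"
  proof (rule tensor_sub_least[OF Cm Cm sub_line[OF CT tens_closed[OF Cm Cm x(1) x(1)]]])
   fix a b assume "a\<in>line C x" "b\<in>line C x"
   then obtain k l where kl: "k\<in>|K|" "l\<in>|K|" "a = k \<odot>\<^sub>C x" "b = l \<odot>\<^sub>C x" unfolding line_def by blast
   hence "ts C C a b = (k \<otimes> l) \<odot>\<^sub>(TS C C) ts C C x x"
    using x by (simp add: tens_smult_l[OF Cm Cm] tens_smult_r[OF Cm Cm] v_smult_assoc[OF CT, symmetric] K.m_comm tens_closed[OF Cm Cm] Cm)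
   thus "ts C C a b\<in>line (TS C C) (ts C C x x)" unfolding line_def using kl by blast
  qed
  ultimately obtain k where k: "k\<in>|K|" "\<Delta> x = k \<odot>\<^sub>(TS C C) ts C C x x" unfolding line_def by blast
  \<comment> \<open>The factor k of \<Delta> x = k x \<otimes> x makes \<Delta> g = g \<otimes> g.
    The counit axiom gives x = \<epsilon> (x) g, from which \<epsilon> (g) = 1.\<close>
  define g where "g = k \<odot>\<^sub>C x"
  have gC: "g\<in>|C|" using k x by (simp add: g_def Cm)
  have e: "\<epsilon> x\<in>|K|" using fnl_closed[OF counit_linear x(1)] .
  have "x = ls \<epsilon> x" by (simp add: ls_counit x)
  also have "... = k \<odot>\<^sub>C (\<epsilon> x \<odot>\<^sub>C x)"
   unfolding ls_def k(2) using x k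
   by (simp add: lin_smult[OF lsl_lin[OF Cm Cm counit_linear]] lsl_tens[OF Cm Cm counit_linear] tens_closed[OF Cm Cm])
  finally have xe: "x = \<epsilon> x \<odot>\<^sub>C g" using k x e unfolding g_def by (simp add: v_smult_assoc[OF Cm, symmetric] K.m_comm)
  have eg: "\<epsilon> g = \<one>"
  proof -
   have "\<epsilon> x = \<epsilon> x \<otimes> \<epsilon> g" using arg_cong[OF xe, of \<epsilon>] fnl_smult[OF counit_linear e gC] by simp
   moreover have "\<epsilon> x ~= \<zero>" using xe x gC by (auto simp: Cm)
   ultimately show ?thesis using e fnl_closed[OF counit_linear gC] K.m_lcancel[of "\<epsilon> x" "\<epsilon> g" "\<one>"] by simp
  qed
  have "\<Delta> g = ts C C g g"
   using x k by (simp add: g_def lin_smult[OF comult_linear] k(2) tens_smult_l[OF Cm Cm] tens_smult_r[OF Cm Cm] Cm)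
  hence gG: "g\<in>GL" using gC eg by (simp add: grouplikes_def)
  have "x\<in>span C GL" by (subst xe) (rule sub_smult[OF Cm span_sub[OF Cm GC] e span_incl[OF gG]])
  thus ?thesis unfolding x(3) line_def using sub_smult[OF Cm span_sub[OF Cm GC]] by blast
 qed
 thus "F 0\<subseteq>span C GL" unfolding corad_filt.simps(1) by (intro span_least[OF span_sub[OF Cm GC]]) blast
 have "g\<in>F 0" if g: "g\<in>GL" for g
 proof -
  have gC: "g\<in>|C|" using GL_D(1)[OF g] .
  have "simple_subcoalgebra K C \<Delta> (line C g)"
   unfolding simple_subcoalgebra_def subcoalgebra_def
  proof (intro conjI allI impI)
   show "sub (line C g) C" by (rule sub_line[OF Cm gC])
   show "\<Delta> ` line C g\<subseteq>tsub C C (line C g) (line C g)"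
   proof (intro image_subsetI)
    fix y assume "y\<in>line C g"
    then obtain k where k: "k\<in>|K|" "y = k \<odot>\<^sub>C g" unfolding line_def by blast
    hence "\<Delta> y = ts C C y g"
     using gC GL_D(2)[OF g] by (simp add: lin_smult[OF comult_linear] tens_smult_l[OF Cm Cm])
    thus "\<Delta> y\<in>tsub C C (line C g) (line C g)"
     using \<open>y\<in>line C g\<close> line_incl[OF Cm gC] by (simp add: tensor_sub_tens[OF Cm Cm])
   qed
   show "line C g ~= {0\<^sub>C}" using line_incl[OF Cm gC] GL_nonzero[OF g] by blast
   fix D' assume D': "(submodule D' K C & \<Delta> ` D'\<subseteq>tsub C C D' D') & D'\<subseteq>line C g"
   show "D' = {0\<^sub>C} \<or> D' = line C g"
   proof (cases "D'\<subseteq>{0\<^sub>C}")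
    case True
    thus ?thesis using sub_zero[OF Cm conjunct1[OF conjunct1[OF D']]] by blast
   next
    case False
    then obtain k where k: "k\<in>|K|" "k \<odot>\<^sub>C g\<in>D'" "k \<odot>\<^sub>C g ~= 0\<^sub>C" using D' unfolding line_def by blast
    hence "k ~= \<zero>" using gC by (auto simp: Cm)
    hence "g\<in>D'" using smult_cancel[OF Cm k(1) gC _ k(2)] D' by blast
    thus ?thesis using D' sub_smult[OF Cm, of D'] unfolding line_def by blast
   qed
  qed
  thus ?thesis unfolding corad_filt.simps(1) using line_incl[OF Cm gC] by (blast intro: span_incl)
 qed
 thus "span C GL\<subseteq>F 0" by (intro span_least[OF F_sub]) blast
qed

end

context base
begin

lemma tensor_bracket_eq: "tensor_bracket K A = tensor_lift2 (TS A A)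
  (%a b c d. ts A A (a *\<^sub>A c) {b, d}\<^sub>A +\<^sub>(TS A A) ts A A {a, c}\<^sub>A (b *\<^sub>A d))"
 by (simp add: fun_eq_iff tensor_bracket_def tensor_lift2_def Let_def)

lemma bracket_tens_bil:
 assumes A: "poisson_algebra K A"
 shows "bil (TS A A) (TS A A) (TS A A) (tensor_bracket K A)"
  "\<lbrakk>a\<in>|A|; b\<in>|A|; c\<in>|A|; d\<in>|A|\<rbrakk> \<Longrightarrow> tensor_bracket K A (ts A A a b) (ts A A c d) =
   ts A A (a *\<^sub>A c) {b, d}\<^sub>A +\<^sub>(TS A A) ts A A {a, c}\<^sub>A (b *\<^sub>A d)"
proof -
 have M: "vs A" using A by simp
 note T = tensor_module[OF M M] and m = alg_bilinear[OF pa_algebra[OF A]] and b = pa_bilinear[OF A]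
 let ?f = "%a b c d. ts A A (a *\<^sub>A c) {b, d}\<^sub>A +\<^sub>(TS A A) ts A A {a, c}\<^sub>A (b *\<^sub>A d)"
 have 1: "bil A A (TS A A) (?f a b)" if "a\<in>|A|" "b\<in>|A|" for a b
  by (rule bil_plus[OF T]; rule tensor_map_bil[OF M M]) (rule bil_right[OF m] bil_right[OF b] that)+
 have 2: "bil A A (TS A A) (%a b. ?f a b c d)" if "c\<in>|A|" "d\<in>|A|" for c d
  by (rule bil_plus[OF T]; rule tensor_map_bil[OF M M]) (rule bil_left[OF m] bil_left[OF b] that)+
 show "bil (TS A A) (TS A A) (TS A A) (tensor_bracket K A)"
  unfolding tensor_bracket_eq by (rule tensor_lift2_bil[OF M M M M T 1 2])
 show "tensor_bracket K A (ts A A a b) (ts A A c d) = ?f a b c d"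
  if "a\<in>|A|" "b\<in>|A|" "c\<in>|A|" "d\<in>|A|"
  unfolding tensor_bracket_eq by (rule tensor_lift2_tens[OF M M M M T 1 2 that])
qed

end

subsection \<open>The coradical filtration of a pointed Poisson Hopf algebra\<close>

locale pointed_pha = base K for K :: "('k, 'r) ring_scheme" (structure) +
 fixes B :: "('k, 'b, 'z) poisson_hopf_scheme"
 assumes PH: "poisson_hopf_algebra K B" and pointed: "pointed K B (comult B)"
  and comm: "!!g t. \<lbrakk>g\<in>grouplikes K B (comult B) (counit B); t\<in>grouplikes K B (comult B) (counit B)\<rbrakk> \<Longrightarrow> {g, t}\<^sub>B = 0\<^sub>B"
begin

lemma PA: "poisson_algebra K B" using PH by (simp add: poisson_hopf_algebra_def)
lemmas BA = pa_algebra[OF PA]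

sublocale B: coalg K B "comult B" "counit B"
 using PH base_axioms by (simp add: coalg_def poisson_hopf_algebra_def)

lemmas Bm = B.Cm and BT = B.CT
abbreviation "BB \<equiv> TS B B"
abbreviation "F \<equiv> Bfilt K B"
abbreviation "GL \<equiv> grouplikes K B (comult B) (counit B)"

lemma comult_mult: "x\<in>|B| ==> y\<in>|B| ==> comult B (x *\<^sub>B y) = comult B x *\<^sub>(tensor_alg K B B) comult B y"
 by (rule ring_hom_mult[OF poisson_hopf_algebra.comult_hom[OF PH]])
lemma comult_one: "comult B 1\<^sub>B = ts B B 1\<^sub>B 1\<^sub>B"
 using ring_hom_one[OF poisson_hopf_algebra.comult_hom[OF PH]] by simp
lemma counit_mult: "x\<in>|B| ==> y\<in>|B| ==> counit B (x *\<^sub>B y) = counit B x \<otimes> counit B y"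
 by (rule ring_hom_mult[OF poisson_hopf_algebra.counit_hom[OF PH]])
lemma counit_one: "counit B 1\<^sub>B = \<one>"
 by (rule ring_hom_one[OF poisson_hopf_algebra.counit_hom[OF PH]])
lemmas S_lin = poisson_hopf_algebra.antipode_linear[OF PH]
lemmas S_closed = lin_closed[OF S_lin]

lemma S_bil: "bil B B B (%a b. antipode B a *\<^sub>B b)"
 by (rule bil_comp[OF alg_bilinear[OF BA] S_lin lin_ident])
abbreviation "SL \<equiv> tlift B (%a b. antipode B a *\<^sub>B b)"
lemmas SL_lin = tensor_lift_lin[OF Bm Bm Bm S_bil] and SL_tens = tensor_lift_tens[OF Bm Bm Bm S_bil]

lemma GL_one: "1\<^sub>B\<in>GL"
 by (simp add: grouplikes_def comult_one counit_one BA)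
lemma GL_mult: "g\<in>GL ==> t\<in>GL ==> g *\<^sub>B t\<in>GL"
 by (simp add: grouplikes_def comult_mult counit_mult tensor_mult_tens[OF BA BA] BA)

text \<open>\<Delta> (S g) is inverse to \<Delta> g = g \<otimes> g in the tensor algebra, hence
  equals S g \<otimes> S g.\<close>

lemma GL_S:
 assumes g: "g\<in>GL"
 shows "antipode B g *\<^sub>B g = 1\<^sub>B" "antipode B g\<in>GL"
proof -
 have c: "g\<in>|B|" "antipode B g\<in>|B|" using S_closed B.GL_D(1)[OF g] by auto
 show 1: "antipode B g *\<^sub>B g = 1\<^sub>B"
  using poisson_hopf_algebra.antipode_left[OF PH c(1)] c B.GL_D[OF g] by (simp add: SL_tens Bm BA)
 have 2: "g *\<^sub>B antipode B g = 1\<^sub>B" using 1 pa_comm[OF PA c] by simp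
 let ?E = "tensor_alg K B B"
 have E: "k_algebra K ?E" by (rule tensor_alg_algebra[OF BA BA])
 have t: "ts B B a b\<in>|?E|" if "a\<in>|B|" "b\<in>|B|" for a b
  using tens_closed[OF Bm Bm that] by simp
 have d: "comult B (antipode B g)\<in>|?E|" using B.D_closed[OF c(2)] by simp
 have "comult B (antipode B g) = comult B (antipode B g) *\<^sub>?E (ts B B g g *\<^sub>?E ts B B (antipode B g) (antipode B g))"
  using c d alg_one(2)[OF E d] by (simp add: tensor_mult_tens[OF BA BA] 2)
 also have "... = comult B (antipode B g *\<^sub>B g) *\<^sub>?E ts B B (antipode B g) (antipode B g)"
  by (simp add: comult_mult c B.GL_D(2)[OF g] alg_assoc[OF E d t t])
 also have "... = ts B B (antipode B g) (antipode B g)"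
  using alg_one(1)[OF E t[OF c(2) c(2)]] by (simp add: 1 comult_one)
 finally have "comult B (antipode B g) = ts B B (antipode B g) (antipode B g)" .
 moreover have "counit B (antipode B g) = \<one>"
  using counit_mult[OF c(2,1)] fnl_closed[OF B.counit_linear c(2)] by (simp add: 1 counit_one B.GL_D(3)[OF g])
 ultimately show "antipode B g\<in>GL" using c by (simp add: grouplikes_def)
qed

lemmas F0 = B.pointed_F0[OF pointed]
lemma GL_carrier: "GL\<subseteq>|B|" using B.GL_D(1) by blast

text \<open>One induction on i + j for both product and bracket. The slices of \<Delta> (f x y) = OP
  (\<Delta> x) (\<Delta> y) are, by bilinearity, controlled by pairs of pure tensors of total degree
  i + j, and \<open>step\<close> is all that depends on the operation there.\<close>

lemma F_op:
 assumes OP: "bil BB BB BB OP" and D: "!!x y. x\<in>|B| ==> y\<in>|B| ==> comult B (f x y) = OP (comult B x) (comult B y)"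
  and f: "bil B B B f" and f0: "!!g t. g\<in>GL ==> t\<in>GL ==> f g t\<in>F 0"
  and step: "!!n \<phi> p q r s a b c d. fnl B \<phi> ==> \<forall>x\<in>F 0. \<phi> x = \<zero> ==> a\<in>F p ==> b\<in>F q ==> c\<in>F r ==> d\<in>F s ==>
    p + q + r + s = Suc n ==> (!!i j x y. x\<in>F i ==> y\<in>F j ==> i + j \<le> n ==> f x y\<in>F (i + j)) ==>
    lsl B \<phi> (OP (ts B B a b) (ts B B c d))\<in>F n"
  and xy: "x\<in>F i" "y\<in>F j"
 shows "f x y\<in>F (i + j)"
proof -
 have "\<forall>i j x y. i + j = n --> x\<in>F i --> y\<in>F j --> f x y\<in>F n" for n
 proof (induction n rule: less_induct)
  case (less n)
  show ?case
  proof (intro allI impI)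
   fix i j x y assume ij: "i + j = n" and xy: "x\<in>F i" "y\<in>F j"
   show "f x y\<in>F n"
   proof (cases n)
    case 0
    thus ?thesis using ij xy bil_span[OF f Bm GL_carrier Bm GL_carrier Bm B.F_sub f0, of x y] F0 by simp
   next
    case (Suc m)
    have IH: "f x y\<in>F (i + j)" if "x\<in>F i" "y\<in>F j" "i + j \<le> m" for i j x y
     using less that Suc by simp
    have "lsl B \<phi> (OP (comult B x) (comult B y))\<in>F m" if p: "fnl B \<phi>" "\<forall>x\<in>F 0. \<phi> x = \<zero>" for \<phi>
    proof (rule bil_span[OF bil_post[OF OP lsl_lin[OF Bm Bm p(1)]] BT B.W_carrier BT B.W_carrier Bm B.F_sub _ B.F_comult[OF xy(1)] B.F_comult[OF xy(2)]])
     fix s t assume "s\<in>B.W i" "t\<in>B.W j"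
     then obtain a b c d p' q' where w: "s = ts B B a b" "t = ts B B c d" "p' \<le> i" "q' \<le> j" "a\<in>F p'" "b\<in>F (i - p')" "c\<in>F q'" "d\<in>F (j - q')"
      unfolding B.W_def by blast
     show "lsl B \<phi> (OP s t)\<in>F m" unfolding w(1,2)
      by (rule step[OF p w(5-8)]) (use w(3,4) ij Suc IH in auto)
    qed
    hence "f x y\<in>F (Suc m)" using bil_closed[OF f B.FC[OF xy(1)] B.FC[OF xy(2)]]
     by (simp add: B.F_Suc_iff B.ls_def D B.FC[OF xy(1)] B.FC[OF xy(2)])
    thus ?thesis using Suc by simp
   qed
  qed
 qed
 thus ?thesis using xy by blast
qed

lemma F_mult:
 assumes "x\<in>F i" "y\<in>F j"
 shows "x *\<^sub>B y\<in>F (i + j)"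
proof (rule F_op[OF tensor_mult_bil[OF BA BA] comult_mult alg_bilinear[OF BA] _ _ assms])
 show g: "g *\<^sub>B t\<in>F 0" if "g\<in>GL" "t\<in>GL" for g t
  unfolding F0 using GL_mult[OF that] by (rule span_incl)
 fix n \<phi> p q r s a b c d
 assume h: "fnl B \<phi>" "\<forall>x\<in>F 0. \<phi> x = \<zero>" "a\<in>F p" "b\<in>F q" "c\<in>F r" "d\<in>F s" "p + q + r + s = Suc n"
  and IH: "!!i j x y. x\<in>F i ==> y\<in>F j ==> i + j \<le> n ==> x *\<^sub>B y\<in>F (i + j)"
 note c = h(3-6)[THEN B.FC]
 \<comment> \<open>If a and c both have degree 0, their product is killed by \<phi>; otherwise b and
   d have total degree at most n and the induction hypothesis applies.\<close>
 have "\<phi> (a *\<^sub>B c) \<odot>\<^sub>B (b *\<^sub>B d)\<in>F n"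
 proof (cases "p = 0 & r = 0")
  case True
  hence "a *\<^sub>B c\<in>F 0" using bil_span[OF alg_bilinear[OF BA] Bm GL_carrier Bm GL_carrier Bm B.F_sub g, of a c] h F0 by simp
  thus ?thesis using h(2) c sub_zero[OF Bm B.F_sub] by (simp add: Bm BA)
 next
  case False
  hence l: "q + s \<le> n" using h(7) by linarith
  show ?thesis using IH[OF h(4,6) l] B.F_mono[OF l] c fnl_closed[OF h(1)]
   by (intro sub_smult[OF Bm B.F_sub]) (auto simp: BA)
 qed
 thus "lsl B \<phi> (ts B B a b *\<^sub>(tensor_alg K B B) ts B B c d)\<in>F n"
  using c by (simp add: tensor_mult_tens[OF BA BA] lsl_tens[OF Bm Bm h(1)] BA)
qed

text \<open>As for the product. The vanishing of brackets of group-likes starts the induction, and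
  it also puts {a, c} into F 0, where \<phi> vanishes, when a and c have degree 0.\<close>

lemma F_bracket:
 assumes "x\<in>F i" "y\<in>F j"
 shows "{x, y}\<^sub>B\<in>F (i + j)"
proof (rule F_op[OF bracket_tens_bil(1)[OF PA] poisson_hopf_algebra.comult_bracket[OF PH] pa_bilinear[OF PA] _ _ assms])
 show g: "{g, t}\<^sub>B\<in>F 0" if "g\<in>GL" "t\<in>GL" for g t
  using comm[OF that] sub_zero[OF Bm B.F_sub] by simp
 fix n \<phi> p q r s a b c d
 assume h: "fnl B \<phi>" "\<forall>x\<in>F 0. \<phi> x = \<zero>" "a\<in>F p" "b\<in>F q" "c\<in>F r" "d\<in>F s" "p + q + r + s = Suc n"
  and IH: "!!i j x y. x\<in>F i ==> y\<in>F j ==> i + j \<le> n ==> {x, y}\<^sub>B\<in>F (i + j)"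
 note c = h(3-6)[THEN B.FC]
 have "\<phi> (a *\<^sub>B c) \<odot>\<^sub>B {b, d}\<^sub>B\<in>F n & \<phi> {a, c}\<^sub>B \<odot>\<^sub>B (b *\<^sub>B d)\<in>F n"
 proof (cases "p = 0 & r = 0")
  case True
  hence "a *\<^sub>B c\<in>F 0" "{a, c}\<^sub>B\<in>F 0" using F_mult[of a 0 c 0] bil_span[OF pa_bilinear[OF PA] Bm GL_carrier Bm GL_carrier Bm B.F_sub g, of a c] h F0 by simp_all
  thus ?thesis using h(2) c sub_zero[OF Bm B.F_sub] by (simp add: Bm BA PA)
 next
  case False
  hence l: "q + s \<le> n" using h(7) by linarith
  show ?thesis using IH[OF h(4,6) l] F_mult[OF h(4,6)] B.F_mono[OF l] c fnl_closed[OF h(1)]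
   by (intro conjI sub_smult[OF Bm B.F_sub]) (auto simp: BA PA)
 qed
 thus "lsl B \<phi> (tensor_bracket K B (ts B B a b) (ts B B c d))\<in>F n"
  using c by (simp add: bracket_tens_bil(2)[OF PA] lin_add[OF lsl_lin[OF Bm Bm h(1)]] tens_closed[OF Bm Bm]
    lsl_tens[OF Bm Bm h(1)] BA PA sub_add[OF Bm B.F_sub])
qed

text \<open>S has not been shown to reverse coproducts, so \<Delta> (S x) cannot be sliced. Instead
  write \<Delta> x as a sum of c_h \<otimes> h over group-likes h plus some w in the F i \<otimes> F
  (n - i) with i < n. The antipode axiom, for a slice of x isolating one c_g, expresses S(c_g) g by
  terms in S(F i) F (n - i) with i < n and a multiple of 1. Finally x and the sum of the c_h differ
  by an element of F (n - 1).\<close>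

lemma F_antipode: "x\<in>F n ==> antipode B x\<in>F n"
proof (induction n arbitrary: x rule: less_induct)
 case (less n)
 have S0: "antipode B x\<in>F 0" if "x\<in>F 0" for x
  using span_least[OF sub_preimage[OF S_lin Bm Bm B.F_sub], of GL 0] that GL_S(2) GL_carrier unfolding F0 by (auto intro: span_incl)
 show ?case
 proof (cases "n = 0")
  case True
  thus ?thesis using S0 less.prems by simp
 next
  case False
  define Q where "Q = {ts B B a b | a b. \<exists>i<n. a\<in>F i & b\<in>F (n - i)}"
  have QC: "Q\<subseteq>|BB|" unfolding Q_def using B.FC tens_closed[OF Bm Bm] by blast
  note Qs = span_sub[OF BT QC]
  note Ps = tensor_sub_sub[OF Bm Bm B.F_sub[of n] B.F_sub[of 0]]
  have xC: "x\<in>|B|" by (rule B.FC[OF less.prems])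
  have "B.W n\<subseteq>tsub B B (F n) (F 0) <+>\<^sub>BB span BB Q"
  proof
   fix u assume "u\<in>B.W n"
   then obtain a b i where u: "u = ts B B a b" "i \<le> n" "a\<in>F i" "b\<in>F (n - i)" unfolding B.W_def by blast
   show "u\<in>tsub B B (F n) (F 0) <+>\<^sub>BB span BB Q"
   proof (cases "i = n")
    case True
    thus ?thesis unfolding u(1) using u(3,4) by (intro set_add_left[OF BT Ps Qs] tensor_sub_tens[OF Bm Bm]) auto
   next
    case False
    hence "i < n" using u(2) by simp
    hence "u\<in>Q" using u(1,3,4) unfolding Q_def by blast
    thus ?thesis by (intro set_add_right[OF BT Ps Qs] span_incl)
   qed
  qed
  hence "comult B x\<in>tsub B B (F n) (F 0) <+>\<^sub>BB span BB Q"
   using span_least[OF sub_sum[OF BT Ps Qs]] B.F_comult[OF less.prems] by blast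
  then obtain v w where vw: "v\<in>tsub B B (F n) (F 0)" "w\<in>span BB Q" "comult B x = v +\<^sub>BB w"
   unfolding set_add_iff by blast
  obtain H c where H: "finite H" "H\<subseteq>GL" "!!h. c h\<in>F n" "v = (\<Oplus>\<^sub>BB h\<in>H. ts B B (c h) h)"
   using tensor_normal_form[OF Bm Bm GL_carrier B.F_sub vw(1)[unfolded F0]] by blast
  have HC: "h\<in>|B|" if "h\<in>H" for h using H(2) GL_carrier that by blast
  have cC: "c h\<in>|B|" for h by (rule B.FC[OF H(3)])
  have tC: "ts B B (c h) h\<in>|BB|" if "h\<in>H" for h by (rule tens_closed[OF Bm Bm cC HC[OF that]])
  have vC: "v\<in>|BB|" unfolding H(4) using tC by (rule v_finsum_closed[OF BT])
  have wC: "w\<in>|BB|" by (rule sub_carrier[OF BT Qs vw(2)])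
  have Sc: "antipode B (c g)\<in>F n" if g: "g\<in>H" for g
  proof -
   have gG: "g\<in>GL" "g\<in>|B|" using H(2) g HC by auto
   \<comment> \<open>\<phi> selects g among the group-likes, so id \<otimes>
     \<open>rs \<phi>\<close> keeps c_g \<otimes> g and removes the other c_h \<otimes> h.\<close>
   obtain \<phi> where \<phi>: "fnl B \<phi>" "\<phi> g = \<one>" "!!h. h\<in>GL ==> h ~= g ==> \<phi> h = \<zero>" using B.GL_dual[OF gG(1)] by blast
   note rl = B.rs_lin[OF \<phi>(1)]
   let ?M = "tmap B B (%a. a) (B.rs \<phi>)"
   note Ml = tensor_map_lin[OF Bm Bm Bm Bm lin_ident rl] and Mt = tensor_map_tens[OF Bm Bm Bm Bm lin_ident rl]
   have rx: "B.rs \<phi> x\<in>|B|" by (rule lin_closed[OF rl xC])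
   have "?M v = (\<Oplus>\<^sub>BB h\<in>H. ?M (ts B B (c h) h))" unfolding H(4) by (rule lin_finsum[OF Ml BT BT H(1) tC])
   also have "... = ?M (ts B B (c g) g)"
   proof (rule v_finsum_single[OF BT H(1) g])
    show "?M (ts B B (c g) g)\<in>|BB|" by (rule lin_closed[OF Ml tC[OF g]])
    fix h assume h: "h\<in>H" "h ~= g"
    thus "?M (ts B B (c h) h) = 0\<^sub>BB" using \<phi>(3)[of h] H(2) HC[OF h(1)]
     by (simp add: Mt cC B.GL_slices(2)[OF _ \<phi>(1)] subsetD Bm tens_zero_r[OF Bm Bm])
   qed
   also have "... = ts B B (c g) g" using gG by (simp add: Mt cC B.GL_slices(2)[OF _ \<phi>(1)] \<phi>(2) Bm)
   finally have "comult B (B.rs \<phi> x) = ts B B (c g) g +\<^sub>BB ?M w"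
    unfolding B.comult_rs[OF \<phi>(1) xC] vw(3) by (simp add: lin_add[OF Ml vC wC])
   hence "SL (comult B (B.rs \<phi> x)) = antipode B (c g) *\<^sub>B g +\<^sub>B SL (?M w)"
    using lin_closed[OF Ml wC] tC[OF g] by (simp add: lin_add[OF SL_lin] SL_tens cC gG)
   moreover have "SL (comult B (B.rs \<phi> x))\<in>F n"
    unfolding poisson_hopf_algebra.antipode_left[OF PH rx]
    using B.F_mono[of 0 n] span_incl[OF GL_one] fnl_closed[OF B.counit_linear rx] by (intro sub_smult[OF Bm B.F_sub]) (auto simp: F0)
   moreover have "SL (?M w)\<in>F n"
   proof -
    have "Q\<subseteq>{w\<in>carrier BB. SL (?M w)\<in>F n}"
    proof
     fix u assume u: "u\<in>Q"
     then obtain a b i where ab: "u = ts B B a b" "i < n" "a\<in>F i" "b\<in>F (n - i)" unfolding Q_def by blast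
     have "antipode B a *\<^sub>B B.rs \<phi> b\<in>F (i + (n - i))"
      using less.IH[OF ab(2,3)] B.F_slices[OF ab(4) \<phi>(1)] by (intro F_mult) auto
     thus "u\<in>{w\<in>carrier BB. SL (?M w)\<in>F n}"
      using u QC ab(2) unfolding ab(1) by (auto simp: Mt SL_tens ab(3,4)[THEN B.FC] lin_closed[OF rl])
    qed
    thus ?thesis using span_least[OF sub_preimage[OF lin_comp[OF Ml SL_lin] BT Bm B.F_sub]] vw(2) by blast
   qed
   ultimately have "antipode B (c g) *\<^sub>B g\<in>F n"
    using sub_cancel[OF Bm B.F_sub, of _ "SL (?M w)"] S_closed[OF cC] gG by (simp add: BA)
   \<comment> \<open>Multiplication by S g, the inverse of g and again of degree 0, frees
     S(c_g).\<close>
   hence "(antipode B (c g) *\<^sub>B g) *\<^sub>B antipode B g\<in>F (n + 0)"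
    using GL_S(2)[OF gG(1)] by (intro F_mult) (auto simp: F0 intro: span_incl)
   thus ?thesis using GL_S(1)[OF gG(1)] pa_comm[OF PA gG(2) S_closed[OF gG(2)]] S_closed[OF cC] S_closed[OF gG(2)] gG(2)
    by (simp add: alg_assoc[OF BA] BA)
  qed
  \<comment> \<open>Counit on the second leg: v gives the sum of the c_h, and w lands in F (n - 1),
    because its first legs have degree below n.\<close>
  have "x = rsl B (counit B) v +\<^sub>B rsl B (counit B) w"
   using B.rs_counit[OF xC] unfolding B.rs_def vw(3) by (simp add: lin_add[OF rsl_lin[OF Bm Bm B.counit_linear] vC wC])
  moreover have "rsl B (counit B) v = (\<Oplus>\<^sub>B h\<in>H. c h)"
   unfolding H(4) by (subst lin_finsum[OF rsl_lin[OF Bm Bm B.counit_linear] BT Bm H(1)], rule tC, assumption, rule v_finsum_cong[OF Bm cC]) (use H(2) in "auto simp: rsl_tens[OF Bm Bm B.counit_linear cC HC] B.GL_D(3) subsetD Bm cC")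
  moreover have "antipode B (\<Oplus>\<^sub>B h\<in>H. c h)\<in>F n"
   by (subst lin_finsum[OF S_lin Bm Bm H(1) cC], rule sub_finsum[OF Bm B.F_sub Sc])
  moreover have "antipode B (rsl B (counit B) w)\<in>F n"
  proof -
   have "rsl B (counit B) u\<in>F (n - 1)" if "u\<in>Q" for u
   proof -
    from that obtain a b i where ab: "u = ts B B a b" "i < n" "a\<in>F i" "b\<in>F (n - i)" unfolding Q_def by blast
    have "i \<le> n - 1" using ab(2) by simp
    hence "a\<in>F (n - 1)" using B.F_mono ab(3) by blast
    thus ?thesis using fnl_closed[OF B.counit_linear B.FC[OF ab(4)]]
     unfolding ab(1) rsl_tens[OF Bm Bm B.counit_linear B.FC[OF ab(3)] B.FC[OF ab(4)]] by (intro sub_smult[OF Bm B.F_sub]) auto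
   qed
   hence "rsl B (counit B) w\<in>F (n - 1)"
    using span_least[OF sub_preimage[OF rsl_lin[OF Bm Bm B.counit_linear] BT Bm B.F_sub], of Q "n - 1"] QC vw(2) by blast
   thus ?thesis using less.IH[of "n - 1"] False B.F_mono[of "n - 1" n] by auto
  qed
  ultimately show ?thesis
   using lin_closed[OF rsl_lin[OF Bm Bm B.counit_linear] wC] cC
   by (metis lin_add[OF S_lin] sub_add[OF Bm B.F_sub] v_finsum_closed[OF Bm])
 qed
qed

end

subsection \<open>The associated graded Poisson algebra\<close>

context pointed_pha
begin

abbreviation "Bp \<equiv> Bprev K B"
abbreviation "Q \<equiv> gr_quot K B"
abbreviation "A \<equiv> gr_alg K B"
abbreviation "C \<equiv> gr K B"
abbreviation "cl \<equiv> gr_class K B"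
abbreviation "Fm n \<equiv> B\<lparr>carrier := F n\<rparr>"

lemma Bp_sub: "sub (Bp n) B"
 by (cases n) (simp_all add: Bprev_def sub_null[OF Bm] B.F_sub)
lemma Bp_Suc: "Bp (Suc n) = F n" by (simp add: Bprev_def)
lemma Bp_0: "x\<in>Bp 0 \<longleftrightarrow> x = 0\<^sub>B" by (simp add: Bprev_def)
lemma Bp_F: "x\<in>Bp n ==> x\<in>F n"
 using B.F_Suc_mono[of "n - 1"] sub_zero[OF Bm B.F_sub] by (cases n) (auto simp: Bprev_def)
lemma F_Bp: "x\<in>F m ==> m < n ==> x\<in>Bp n"
 using B.F_mono[of m "n - 1"] by (cases n) (auto simp: Bprev_def)
lemmas FC = B.FC
lemmas F_add = sub_add[OF Bm B.F_sub] and F_smult = sub_smult[OF Bm B.F_sub] and F_zero = sub_zero[OF Bm B.F_sub]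
lemma Fmod: "vs (Fm n)" by (rule sub_module[OF Bm B.F_sub])
lemma Bp_subF: "sub (Bp n) (Fm n)"
 by (rule sub_restrict[OF Bm B.F_sub Bp_sub]) (auto intro: Bp_F)
lemma coset_F: "H +>\<^sub>(Fm n) x = H +>\<^sub>B x"
 by (simp add: a_r_coset_def r_coset_def)

abbreviation q :: "nat => 'b => 'b set" where "q n x \<equiv> Bp n +>\<^sub>B x"

lemma Qm: "vs (Q n)" unfolding gr_quot_def by (rule quot_module[OF Fmod Bp_subF])
lemma Q_carrier: "|Q n| = q n ` F n" unfolding gr_quot_def quot_carrier by (simp add: coset_F)
lemma Q_zero: "0\<^sub>(Q n) = Bp n" by (simp add: gr_quot_def quot_simps)
lemma q_lin: "lin (Fm n) (Q n) (q n)"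
 using quot_cls_lin[OF Fmod Bp_subF, of n] unfolding gr_quot_def by (simp add: coset_F)
lemma q_add: "x\<in>F n ==> y\<in>F n ==> q n (x +\<^sub>B y) = q n x +\<^sub>(Q n) q n y" using lin_add[OF q_lin, of x n y] by simp
lemma q_smult: "k\<in>|K| ==> x\<in>F n ==> q n (k \<odot>\<^sub>B x) = k \<odot>\<^sub>(Q n) q n x" using lin_smult[OF q_lin, of k x n] by simp
lemma q_closed: "x\<in>F n ==> q n x\<in>|Q n|" by (simp add: Q_carrier)
lemma q_zero: "x\<in>|B| ==> q n x = Bp n \<longleftrightarrow> x\<in>Bp n" by (rule coset_eq_sub[OF Bm Bp_sub])
lemma q_eq: "x\<in>|B| ==> y\<in>|B| ==> q n x = q n y \<longleftrightarrow> x -\<^sub>B y\<in>Bp n" by (rule coset_eq[OF Bm Bp_sub])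
text \<open>Bp n is contained in F n, so all representatives of a class in degree n stay in F n and
  may be fed into filtered operations.\<close>

lemma q_mem: "x\<in>F n ==> y\<in>q n x \<longleftrightarrow> y\<in>F n & q n y = q n x"
 using q_eq[of y x n] coset_mem[OF Bm Bp_sub, of x y n] FC[of x n] FC[of y n] Bp_F[of "y -\<^sub>B x" n]
  F_add[of "y -\<^sub>B x" n x] v_diff_add[OF Bm, of y x] by auto

lemma A_carrier: "u\<in>|A| \<longleftrightarrow> (\<forall>n. u n\<in>carrier (Q n)) & finite {n. u n ~= Bp n}"
 by (simp add: gr_alg_def)
lemma A_simps: "zero A = (%n. Bp n)" "u +\<^sub>A v = (%n. u n +\<^sub>(Q n) v n)" "k \<odot>\<^sub>A u = (%n. k \<odot>\<^sub>(Q n) u n)"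
 "mult A = gr_op K B (mult B)" "one A = cl 0 1\<^sub>B"
 by (simp_all add: gr_alg_def)
lemma C_simps: "|C| = |A|" "zero C = zero A" "add C = add A" "smult C = smult A" "mult C = mult A" "one C = one A"
 "bracket C = gr_op K B (bracket B)"
 by (simp_all add: gr_def module.extend_def)

lemma Am: "vs A"
proof (rule moduleI)
 have s: "finite {n. f (u n) (v n) n ~= Bp n}" if "u\<in>|A|" "v\<in>|A|" "!!n. f (Bp n) (Bp n) n = Bp n" for u v and f :: "'b set => 'b set => nat => 'b set"
 proof (rule finite_subset)
  show "{n. f (u n) (v n) n ~= Bp n}\<subseteq>{n. u n ~= Bp n} \<union> {n. v n ~= Bp n}" using that(3) by auto
 qed (use that A_carrier in auto)
 have Z: "Bp n\<in>|Q n|" for n using v_zero_closed[OF Qm] Q_zero by metis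
 have Zn [simp]: "Bp n +\<^sub>(Q n) Bp n = Bp n" "k\<in>|K| ==> k \<odot>\<^sub>(Q n) Bp n = Bp n" "\<ominus>\<^sub>(Q n) Bp n = Bp n" for n k
  using v_zero(1)[OF Qm, of "0\<^sub>(Q n)" n] v_smult_zero(2)[OF Qm, of k n] v_neg_zero[OF Qm] v_zero_closed[OF Qm] by (auto simp: Q_zero)
 have a: "u +\<^sub>A v\<in>|A|" if "u\<in>|A|" "v\<in>|A|" for u v
  using s[OF that, of "%a b n. a +\<^sub>(Q n) b"] that by (simp add: A_carrier A_simps Qm)
 have m: "k \<odot>\<^sub>A u\<in>|A|" if "k\<in>|K|" "u\<in>|A|" for k u
  using s[OF that(2,2), of "%a b n. k \<odot>\<^sub>(Q n) a"] that by (simp add: A_carrier A_simps Qm)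
 show "abelian_group A"
 proof (rule abelian_groupI)
  fix u assume u: "u\<in>|A|"
  hence "(%n. \<ominus>\<^sub>(Q n) u n)\<in>|A|"
   using s[OF u u, of "%a b n. \<ominus>\<^sub>(Q n) a"] by (simp add: A_carrier Qm)
  thus "\<exists>v\<in>carrier A. v +\<^sub>A u = 0\<^sub>A"
   using u by (intro bexI[of _ "%n. \<ominus>\<^sub>(Q n) u n"]) (auto simp: A_simps A_carrier Qm Q_zero)
  have "Bp n +\<^sub>(Q n) u n = u n" for n using u v_zero(1)[OF Qm, of "u n" n] by (simp add: A_carrier Q_zero)
  thus "0\<^sub>A +\<^sub>A u = u" by (simp add: A_simps)
  fix v assume v: "v\<in>|A|"
  show "u +\<^sub>A v = v +\<^sub>A u" using u v v_comm[OF Qm] by (simp add: A_simps A_carrier)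
  fix w assume "w\<in>|A|"
  thus "u +\<^sub>A v +\<^sub>A w = u +\<^sub>A (v +\<^sub>A w)" using u v v_assoc[OF Qm] by (simp add: A_simps A_carrier)
 qed (rule a, auto simp: A_carrier A_simps Z)
 show "k \<odot>\<^sub>A u\<in>|A|" if "k\<in>|K|" "u\<in>|A|" for k u by (rule m[OF that])
next
 fix k l u assume k: "k\<in>|K|" "l\<in>|K|" and u: "u\<in>|A|"
 hence u': "u n\<in>|Q n|" for n by (simp add: A_carrier)
 show "(k \<oplus> l) \<odot>\<^sub>A u = k \<odot>\<^sub>A u +\<^sub>A l \<odot>\<^sub>A u" "(k \<otimes> l) \<odot>\<^sub>A u = k \<odot>\<^sub>A (l \<odot>\<^sub>A u)"
  using k u' by (simp_all add: A_simps v_smult_ldistr[OF Qm] v_smult_assoc[OF Qm])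
next
 fix k u v assume k: "k\<in>|K|" and "u\<in>|A|" "v\<in>|A|"
 hence "u n\<in>|Q n|" "v n\<in>|Q n|" for n by (simp_all add: A_carrier)
 thus "k \<odot>\<^sub>A (u +\<^sub>A v) = k \<odot>\<^sub>A u +\<^sub>A k \<odot>\<^sub>A v"
  using k by (simp add: A_simps v_smult_rdistr[OF Qm])
next
 fix u assume "u\<in>|A|"
 thus "\<one> \<odot>\<^sub>A u = u" by (simp add: A_simps A_carrier Qm)
qed (rule cring_K)

lemma Cm: "vs C" by (rule module_cong[OF Am]) (simp_all add: C_simps)
lemmas CA = C_simps(1) and CT = tensor_module[OF Cm Cm]

lemma comp_lin: "lin C (Q n) (%u. u n)"
 by (rule k_linearI) (auto simp: C_simps A_simps A_carrier)
lemma comp_closed: "u\<in>|C| ==> u n\<in>|Q n|" by (rule lin_closed[OF comp_lin])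

lemma cl_closed: "x\<in>F n ==> cl n x\<in>|C|"
 using v_zero_closed[OF Qm] finite_subset[of "{m. cl n x m ~= Bp m}" "{n}"]
 by (auto simp: CA A_carrier gr_class_def q_closed Q_zero)
lemma cl_lin: "lin (Fm n) C (cl n)"
proof (rule k_linearI)
 have z: "Bp m +\<^sub>(Q m) Bp m = Bp m" "k\<in>|K| ==> k \<odot>\<^sub>(Q m) Bp m = Bp m" for m k
  using v_zero(1)[OF Qm v_zero_closed[OF Qm]] v_smult_zero(2)[OF Qm] by (auto simp: Q_zero)
 show "cl n (x +\<^sub>(Fm n) y) = cl n x +\<^sub>C cl n y" if "x\<in>|Fm n|" "y\<in>|Fm n|" for x y
  using that by (intro ext) (simp add: gr_class_def C_simps A_simps q_add z)
 show "cl n (k \<odot>\<^sub>(Fm n) x) = k \<odot>\<^sub>C cl n x" if "k\<in>|K|" "x\<in>|Fm n|" for k x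
  using that by (intro ext) (simp add: gr_class_def C_simps A_simps q_smult z)
qed (simp add: cl_closed)
lemma cl_add: "x\<in>F n ==> y\<in>F n ==> cl n (x +\<^sub>B y) = cl n x +\<^sub>C cl n y" using lin_add[OF cl_lin, of x n y] by simp
lemma cl_smult: "k\<in>|K| ==> x\<in>F n ==> cl n (k \<odot>\<^sub>B x) = k \<odot>\<^sub>C cl n x" using lin_smult[OF cl_lin, of k x n] by simp
lemma cl_zero_iff: "x\<in>F n ==> cl n x = 0\<^sub>C \<longleftrightarrow> x\<in>Bp n"
 unfolding C_simps A_simps gr_class_def fun_eq_iff[of "%m. if m = n then q n x else Bp m"] by (simp add: q_zero FC)
lemma cl_zero: "x\<in>Bp n ==> cl n x = 0\<^sub>C" using cl_zero_iff[OF Bp_F] by simp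
lemma cl_0: "cl n 0\<^sub>B = 0\<^sub>C" by (rule cl_zero[OF sub_zero[OF Bm Bp_sub]])
definition part :: "nat => (nat => 'b set) => (nat => 'b set)" where "part n u = (%m. if m = n then u m else Bp m)"

lemma part_cl: "u\<in>|C| ==> \<exists>x\<in>F n. u n = q n x & part n u = cl n x"
proof -
 assume "u\<in>|C|"
 then obtain x where x: "x\<in>F n" "u n = q n x" using comp_closed[of u n] by (auto simp: Q_carrier)
 hence "part n u = cl n x" by (intro ext) (simp add: part_def gr_class_def)
 thus ?thesis using x by blast
qed
lemma part_closed: "u\<in>|C| ==> part n u\<in>|C|"
 using part_cl[of u n] cl_closed by auto
lemma part_zero: "part n u = 0\<^sub>C \<longleftrightarrow> u n = Bp n"
 unfolding part_def C_simps A_simps fun_eq_iff[of "%m. if m = n then u m else Bp m"] by simp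

lemma finsum_comp:
 assumes "finite I" "!!i. i\<in>I ==> f i\<in>|C|"
 shows "(\<Oplus>\<^sub>C i\<in>I. f i) m = (\<Oplus>\<^sub>(Q m) i\<in>I. f i m)"
 by (rule lin_finsum[OF comp_lin Cm Qm assms])

lemma part_finsum:
 assumes f: "finite I" "!!i. i\<in>I ==> f i\<in>|C|" "!!i m. i\<in>I ==> m ~= i ==> f i m = Bp m"
 shows "(\<Oplus>\<^sub>C i\<in>I. f i) m = (if m\<in>I then f m m else Bp m)"
proof (cases "m\<in>I")
 case True
 have "(\<Oplus>\<^sub>(Q m) i\<in>I. f i m) = f m m"
  by (rule v_finsum_single[OF Qm f(1) True]) (use f True comp_closed in "auto simp: Q_zero")
 thus ?thesis using finsum_comp[OF f(1,2), where m = m] True by simp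
next
 case False
 have "f i m = 0\<^sub>(Q m)" if "i\<in>I" for i using f(3)[OF that, of m] that False by (metis Q_zero)
 hence "(\<Oplus>\<^sub>(Q m) i\<in>I. f i m) = 0\<^sub>(Q m)" by (rule v_finsum_zero[OF Qm])
 thus ?thesis using finsum_comp[OF f(1,2), where m = m] False by (simp add: Q_zero)
qed

lemma part_sum:
 assumes u: "u\<in>|C|" and I: "finite I" "{n. u n ~= Bp n}\<subseteq>I"
 shows "u = (\<Oplus>\<^sub>C n\<in>I. part n u)"
proof
 fix m
 have "(\<Oplus>\<^sub>C n\<in>I. part n u) m = (if m\<in>I then part m u m else Bp m)"
  by (rule part_finsum[OF I(1) part_closed[OF u]]) (auto simp: part_def)
 thus "u m = (\<Oplus>\<^sub>C n\<in>I. part n u) m" using I(2) by (auto simp: part_def)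
qed

lemma supp_finite: "u\<in>|C| ==> finite {n. u n ~= Bp n}" by (simp add: CA A_carrier)

text \<open>Every element is the finite sum of its components, and each component is the class of
  some x in F n.\<close>

lemma gr_induct [consumes 1, case_names cl add]:
 assumes u: "u\<in>|C|" and c: "!!n x. x\<in>F n ==> P (cl n x)"
  and a: "!!u v. u\<in>|C| ==> v\<in>|C| ==> P u ==> P v ==> P (u +\<^sub>C v)"
 shows "P u"
proof -
 have "P (\<Oplus>\<^sub>C n\<in>I. part n u)" if "finite I" for I
  using that
 proof (induction I rule: finite_induct)
  case empty
  thus ?case using c[of "0\<^sub>B" 0] F_zero by (simp add: Cm cl_0)
 next
  case (insert i I)
  thus ?case using part_cl[OF u, of i] c a[OF part_closed[OF u, of i] v_finsum_closed[OF Cm part_closed[OF u]]] part_closed[OF u]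
   by (auto simp: v_finsum_insert[OF Cm])
 qed
 thus ?thesis using part_sum[OF u supp_finite[OF u] subset_refl] supp_finite[OF u] by metis
qed

lemma gr_lin_eq:
 assumes "lin C P f" "lin C P g" "!!n x. x\<in>F n ==> f (cl n x) = g (cl n x)" "u\<in>|C|"
 shows "f u = g u"
 using assms(4) by (induction rule: gr_induct) (simp_all add: assms(3) lin_add[OF assms(1)] lin_add[OF assms(2)])

lemma gr_bil_eq:
 assumes "bil C C P f" "bil C C P g"
  "!!m n x y. x\<in>F m ==> y\<in>F n ==> f (cl m x) (cl n y) = g (cl m x) (cl n y)" "u\<in>|C|" "v\<in>|C|"
 shows "f u v = g u v"
proof (rule gr_lin_eq[OF bil_left[OF assms(1,5)] bil_left[OF assms(2,5)] _ assms(4)])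
 fix n x assume x: "x\<in>F n"
 show "f (cl n x) v = g (cl n x) v"
  by (rule gr_lin_eq[OF bil_right[OF assms(1) cl_closed[OF x]] bil_right[OF assms(2) cl_closed[OF x]] assms(3)[OF x] assms(5)])
qed

lemma gr_tri_eq:
 assumes f: "!!u. u\<in>|C| ==> bil C C P (f u)" "!!v w. v\<in>|C| ==> w\<in>|C| ==> lin C P (%u. f u v w)"
  and g: "!!u. u\<in>|C| ==> bil C C P (g u)" "!!v w. v\<in>|C| ==> w\<in>|C| ==> lin C P (%u. g u v w)"
  and e: "!!l m n x y z. x\<in>F l ==> y\<in>F m ==> z\<in>F n ==> f (cl l x) (cl m y) (cl n z) = g (cl l x) (cl m y) (cl n z)"
  and c: "u\<in>|C|" "v\<in>|C|" "w\<in>|C|"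
 shows "f u v w = g u v w"
proof (rule gr_lin_eq[OF f(2)[OF c(2,3)] g(2)[OF c(2,3)] _ c(1)])
 fix n x assume x: "x\<in>F n"
 show "f (cl n x) v w = g (cl n x) v w"
  by (rule gr_bil_eq[OF f(1)[OF cl_closed[OF x]] g(1)[OF cl_closed[OF x]] e[OF x] c(2,3)])
qed

definition filtered :: "('b => 'b => 'b) => bool"
 where "filtered f \<longleftrightarrow> bil B B B f & (\<forall>i j. \<forall>x\<in>F i. \<forall>y\<in>F j. f x y\<in>F (i + j))"

context
 fixes f assumes f: "filtered f"
begin

lemma f_bil: "bil B B B f" and f_F: "x\<in>F i ==> y\<in>F j ==> f x y\<in>F (i + j)"
 using f by (auto simp: filtered_def)

text \<open>Lowering the degree of one argument lowers that of the result; in degree 0 the lower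
  step is the zero space. This is what makes the operation well defined on classes.\<close>

lemma f_Bp: "x\<in>Bp i ==> y\<in>F j ==> f x y\<in>Bp (i + j)" "x\<in>F i ==> y\<in>Bp j ==> f x y\<in>Bp (i + j)"
proof -
 have z: "f 0\<^sub>B y = 0\<^sub>B" "f y 0\<^sub>B = 0\<^sub>B" if "y\<in>|B|" for y
  using lin_zero[OF bil_left[OF f_bil that] Bm Bm] lin_zero[OF bil_right[OF f_bil that] Bm Bm] .
 show "f x y\<in>Bp (i + j)" if "x\<in>Bp i" "y\<in>F j"
  using that f_F[of x _ y j] by (cases i) (auto simp: Bprev_def Bp_0 z FC intro: sub_zero[OF Bm Bp_sub, unfolded Bprev_def] F_zero split: nat.split)
 show "f x y\<in>Bp (i + j)" if "x\<in>F i" "y\<in>Bp j"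
  using that f_F[of x i y] by (cases j) (auto simp: Bprev_def Bp_0 z FC intro: F_zero split: nat.split)
qed

definition qop :: "nat => 'b set => 'b set => 'b set" where "qop n S T = (\<Union>x\<in>S. \<Union>y\<in>T. q n (f x y))"

lemma qop_q:
 assumes xy: "x\<in>F i" "y\<in>F j"
 shows "qop (i + j) (q i x) (q j y) = q (i + j) (f x y)"
proof -
 have e: "q (i + j) (f x' y') = q (i + j) (f x y)" if "x'\<in>q i x" "y'\<in>q j y" for x' y'
 proof -
  have F: "x'\<in>F i" "y'\<in>F j" and d: "x' -\<^sub>B x\<in>Bp i" "y' -\<^sub>B y\<in>Bp j"
   using that q_mem[OF xy(1)] q_mem[OF xy(2)] q_eq FC xy by auto
  note c = F[THEN FC] xy[THEN FC]
  have "q (i + j) (f x' y') = q (i + j) (f x y')"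
   using f_Bp(1)[OF d(1) F(2)] c bil_closed[OF f_bil] lin_minus[OF bil_left[OF f_bil c(2)] Bm Bm c(1,3)] by (simp add: q_eq)
  also have "... = q (i + j) (f x y)"
   using f_Bp(2)[OF xy(1) d(2)] c bil_closed[OF f_bil] lin_minus[OF bil_right[OF f_bil c(3)] Bm Bm c(2,4)] by (simp add: q_eq)
  finally show ?thesis .
 qed
 have s: "x\<in>q i x" "y\<in>q j y" using q_mem xy by auto
 show ?thesis unfolding qop_def by (rule UN_const[OF UN_const[OF e s(2)] s(1)])
qed

lemma qop_bil: "bil (Q i) (Q j) (Q (i + j)) (qop (i + j))"
 by (rule k_bilinearI)
  (auto simp: Q_carrier qop_q f_F q_add[symmetric] q_smult[symmetric] F_add F_smult bil_add_l[OF f_bil] bil_add_r[OF f_bil]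
   bil_smult_l[OF f_bil] bil_smult_r[OF f_bil] FC)

lemma gr_op_eq: "gr_op K B f u v n = (\<Oplus>\<^sub>(Q n) i\<in>{..n}. qop n (u i) (v (n - i)))"
 by (simp add: gr_op_def qop_def)

lemma qop_bil': "i \<le> n ==> bil C C (Q n) (%u v. qop n (u i) (v (n - i)))"
 using bil_comp[OF qop_bil comp_lin comp_lin, of i "n - i"] by simp

lemma gr_op_closed:
 assumes u: "u\<in>|C|" and v: "v\<in>|C|"
 shows "gr_op K B f u v\<in>|C|"
proof -
 have 1: "gr_op K B f u v n\<in>|Q n|" for n
  unfolding gr_op_eq using bil_closed[OF qop_bil' u v] by (intro v_finsum_closed[OF Qm]) auto
 \<comment> \<open>A nonzero component in degree n needs nonzero components of u and v in some
   degrees i and n - i, so the support lies in the sumset of two finite sets.\<close>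
 have "{n. gr_op K B f u v n ~= Bp n}\<subseteq>(%(i, j). i + j) ` ({n. u n ~= Bp n} \<times> {n. v n ~= Bp n})"
 proof
  fix n assume n: "n\<in>{n. gr_op K B f u v n ~= Bp n}"
  have "\<exists>i\<le>n. u i ~= Bp i & v (n - i) ~= Bp (n - i)"
  proof (rule ccontr)
   assume a: "\<not> ?thesis"
   have "qop n (u i) (v (n - i)) = 0\<^sub>(Q n)" if i: "i \<le> n" for i
    using a i lin_zero[OF bil_left[OF qop_bil[of i "n - i"] comp_closed[OF v]] Qm Qm]
     lin_zero[OF bil_right[OF qop_bil[of i "n - i"] comp_closed[OF u]] Qm Qm] by (cases "u i = Bp i") (auto simp: Q_zero)
   hence "gr_op K B f u v n = 0\<^sub>(Q n)" unfolding gr_op_eq by (intro v_finsum_zero[OF Qm]) auto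
   thus False using n by (simp add: Q_zero)
  qed
  then obtain i where "i \<le> n" "u i ~= Bp i" "v (n - i) ~= Bp (n - i)" by blast
  thus "n\<in>(%(i, j). i + j) ` ({n. u n ~= Bp n} \<times> {n. v n ~= Bp n})" by (intro image_eqI[of _ _ "(i, n - i)"]) auto
 qed
 hence "finite {n. gr_op K B f u v n ~= Bp n}" using supp_finite[OF u] supp_finite[OF v] finite_subset by blast
 thus ?thesis using 1 by (simp add: CA A_carrier)
qed

lemma gr_op_bil: "bil C C C (gr_op K B f)"
proof -
 have eqC: "w = w'" if "!!n. w n = w' n" for w w' :: "nat => 'b set" using that by blast
 have l: "lin C (Q n) (%u. gr_op K B f u v n)" if v: "v\<in>|C|" for v n
  unfolding gr_op_eq by (rule lin_sum[OF Qm Cm finite_atMost bil_left[OF qop_bil' v]]) simp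
 have r: "lin C (Q n) (%v. gr_op K B f u v n)" if u: "u\<in>|C|" for u n
  unfolding gr_op_eq by (rule lin_sum[OF Qm Cm finite_atMost bil_right[OF qop_bil' u]]) simp
 show ?thesis
 proof (rule k_bilinearI[OF gr_op_closed]; (rule eqC)?)
  have add: "(a +\<^sub>C b) n = a n +\<^sub>(Q n) b n" "(k \<odot>\<^sub>C a) n = k \<odot>\<^sub>(Q n) a n" for a b n k by (simp_all add: C_simps A_simps)
  fix u u' v n assume h: "u\<in>|C|" "u'\<in>|C|" "v\<in>|C|"
  show "gr_op K B f (u +\<^sub>C u') v n = (gr_op K B f u v +\<^sub>C gr_op K B f u' v) n" by (rule trans[OF lin_add[OF l[OF h(3)] h(1,2)] add(1)[symmetric]])
 next
  have add: "(a +\<^sub>C b) n = a n +\<^sub>(Q n) b n" "(k \<odot>\<^sub>C a) n = k \<odot>\<^sub>(Q n) a n" for a b n k by (simp_all add: C_simps A_simps)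
  fix u v v' n assume h: "u\<in>|C|" "v\<in>|C|" "v'\<in>|C|"
  show "gr_op K B f u (v +\<^sub>C v') n = (gr_op K B f u v +\<^sub>C gr_op K B f u v') n" by (rule trans[OF lin_add[OF r[OF h(1)] h(2,3)] add(1)[symmetric]])
 next
  have add: "(k \<odot>\<^sub>C a) n = k \<odot>\<^sub>(Q n) a n" for a n k by (simp add: C_simps A_simps)
  fix k u v n assume h: "k\<in>|K|" "u\<in>|C|" "v\<in>|C|"
  show "gr_op K B f (k \<odot>\<^sub>C u) v n = (k \<odot>\<^sub>C gr_op K B f u v) n" by (rule trans[OF lin_smult[OF l[OF h(3)] h(1,2)] add[symmetric]])
  show "gr_op K B f u (k \<odot>\<^sub>C v) n = (k \<odot>\<^sub>C gr_op K B f u v) n" by (rule trans[OF lin_smult[OF r[OF h(2)] h(1,3)] add[symmetric]])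
 qed
qed

lemma gr_op_cl:
 assumes x: "x\<in>F i" and y: "y\<in>F j"
 shows "gr_op K B f (cl i x) (cl j y) = cl (i + j) (f x y)"
proof
 fix n
 have z: "qop n (cl i x p) (cl j y (n - p)) = 0\<^sub>(Q n)" if p: "p \<le> n" "p ~= i \<or> n - p ~= j" for p
 proof -
  have n: "p + (n - p) = n" using p(1) by simp
  note b = qop_bil[of p "n - p", unfolded n]
  show ?thesis
  proof (cases "p = i")
   case True
   hence "cl j y (n - p) = 0\<^sub>(Q (n - p))" using p by (simp add: gr_class_def Q_zero)
   thus ?thesis using lin_zero[OF bil_right[OF b comp_closed[OF cl_closed[OF x]]] Qm Qm] by simp
  next
   case False
   hence "cl i x p = 0\<^sub>(Q p)" by (simp add: gr_class_def Q_zero)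
   thus ?thesis using lin_zero[OF bil_left[OF b comp_closed[OF cl_closed[OF y]]] Qm Qm] by simp
  qed
 qed
 show "gr_op K B f (cl i x) (cl j y) n = cl (i + j) (f x y) n"
 proof (cases "n = i + j")
  case True
  have "(\<Oplus>\<^sub>(Q n) p\<in>{..n}. qop n (cl i x p) (cl j y (n - p))) = qop n (cl i x i) (cl j y (n - i))"
   by (rule v_finsum_single[OF Qm]) (use True z bil_closed[OF qop_bil'[of i n] cl_closed[OF x] cl_closed[OF y]] in auto)
  thus ?thesis using True qop_q[OF x y] by (simp add: gr_op_eq gr_class_def)
 next
  case False
  hence "(\<Oplus>\<^sub>(Q n) p\<in>{..n}. qop n (cl i x p) (cl j y (n - p))) = 0\<^sub>(Q n)"
   by (intro v_finsum_zero[OF Qm] z) auto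
  thus ?thesis using False by (simp add: gr_op_eq gr_class_def Q_zero)
 qed
qed

end

lemma mult_filtered: "filtered (mult B)"
 unfolding filtered_def using alg_bilinear[OF BA] F_mult by auto
lemma bracket_filtered: "filtered (bracket B)"
 unfolding filtered_def using pa_bilinear[OF PA] F_bracket by auto

lemma C_mult_bil: "bil C C C (mult C)"
 using gr_op_bil[OF mult_filtered] by (simp add: C_simps A_simps)
lemma C_bracket_bil: "bil C C C (bracket C)"
 using gr_op_bil[OF bracket_filtered] by (simp add: C_simps)
lemma cl_mult: "x\<in>F i ==> y\<in>F j ==> cl i x *\<^sub>C cl j y = cl (i + j) (x *\<^sub>B y)"
 using gr_op_cl[OF mult_filtered] by (simp add: C_simps A_simps)
lemma cl_bracket: "x\<in>F i ==> y\<in>F j ==> {cl i x, cl j y}\<^sub>C = cl (i + j) {x, y}\<^sub>B"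
 using gr_op_cl[OF bracket_filtered] by (simp add: C_simps)
lemma C_one: "1\<^sub>C = cl 0 1\<^sub>B" by (simp add: C_simps A_simps)
lemma one_F0: "1\<^sub>B\<in>F 0" unfolding F0 using GL_one by (rule span_incl)

lemma C_mult_lin: "u\<in>|C| ==> lin C C (%v. u *\<^sub>C v)" "u\<in>|C| ==> lin C C (%v. v *\<^sub>C u)"
 "u\<in>|C| ==> lin C C (%v. {u, v}\<^sub>C)" "u\<in>|C| ==> lin C C (%v. {v, u}\<^sub>C)"
 by (rule bil_right[OF C_mult_bil] bil_left[OF C_mult_bil] bil_right[OF C_bracket_bil] bil_left[OF C_bracket_bil]; assumption)+

text \<open>The axioms are multilinear, so it suffices to test them on classes of homogeneous
  elements, where they are the axioms of B.\<close>

lemma C_algebra: "k_algebra K C"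
proof (rule k_algebraI[OF Cm bil_closed[OF C_mult_bil] _ _ _ _ C_mult_bil])
 show "1\<^sub>C\<in>|C|" by (simp add: C_one cl_closed one_F0)
 show "x *\<^sub>C y *\<^sub>C z = x *\<^sub>C (y *\<^sub>C z)" if "x\<in>|C|" "y\<in>|C|" "z\<in>|C|" for x y z
 proof (rule gr_tri_eq[OF _ _ _ _ _ that])
  note l = C_mult_lin(1,2) lin_comp[OF C_mult_lin(1) C_mult_lin(1)] lin_comp[OF C_mult_lin(1) C_mult_lin(2)]
   lin_comp[OF C_mult_lin(2) C_mult_lin(1)] lin_comp[OF C_mult_lin(2) C_mult_lin(2)]
  show "bil C C C (%v w. u *\<^sub>C v *\<^sub>C w)" "bil C C C (%v w. u *\<^sub>C (v *\<^sub>C w))" if "u\<in>|C|" for u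
   unfolding k_bilinear_def using that by (auto intro!: l bil_closed[OF C_mult_bil])
  show "lin C C (%u. u *\<^sub>C v *\<^sub>C w)" "lin C C (%u. u *\<^sub>C (v *\<^sub>C w))" if "v\<in>|C|" "w\<in>|C|" for v w
   using that by (auto intro!: l bil_closed[OF C_mult_bil])
  fix i j k x y z assume h: "x\<in>F i" "y\<in>F j" "z\<in>F k"
  thus "cl i x *\<^sub>C cl j y *\<^sub>C cl k z = cl i x *\<^sub>C (cl j y *\<^sub>C cl k z)"
   using F_mult[OF h(1,2)] F_mult[OF h(2,3)] by (simp add: cl_mult FC alg_assoc[OF BA] add.assoc)
 qed
 show "1\<^sub>C *\<^sub>C x = x" if "x\<in>|C|" for x
  by (rule gr_lin_eq[OF C_mult_lin(1) lin_ident _ that]) (use one_F0 in "auto simp: C_one cl_closed cl_mult BA FC")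
 show "x *\<^sub>C 1\<^sub>C = x" if "x\<in>|C|" for x
  by (rule gr_lin_eq[OF C_mult_lin(2) lin_ident _ that]) (use one_F0 in "auto simp: C_one cl_closed cl_mult BA FC")
qed

lemma C_comm: "x\<in>|C| ==> y\<in>|C| ==> x *\<^sub>C y = y *\<^sub>C x"
proof (rule gr_bil_eq[OF C_mult_bil])
 show "bil C C C (%x y. y *\<^sub>C x)" using C_mult_bil unfolding k_bilinear_def by auto
 show "cl m x *\<^sub>C cl n y = cl n y *\<^sub>C cl m x" if "x\<in>F m" "y\<in>F n" for m n x y
  using that pa_comm[OF PA, of x y] by (simp add: cl_mult FC add.commute)
qed

lemma C_anti: "x\<in>|C| ==> y\<in>|C| ==> {x, y}\<^sub>C +\<^sub>C {y, x}\<^sub>C = 0\<^sub>C"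
proof (rule gr_bil_eq[where f = "%x y. {x, y}\<^sub>C +\<^sub>C {y, x}\<^sub>C" and g = "%x y. 0\<^sub>C" and P = C])
 show "bil C C C (%x y. {x, y}\<^sub>C +\<^sub>C {y, x}\<^sub>C)"
  by (rule bil_plus[OF Cm C_bracket_bil]) (use C_bracket_bil in "auto simp: k_bilinear_def")
 show "bil C C C (%x y. 0\<^sub>C)" by (simp add: k_bilinear_def lin_null[OF Cm])
 show "{cl m x, cl n y}\<^sub>C +\<^sub>C {cl n y, cl m x}\<^sub>C = 0\<^sub>C" if xy: "x\<in>F m" "y\<in>F n" for m n x y
 proof -
  have "{x, y}\<^sub>B +\<^sub>B {y, x}\<^sub>B = 0\<^sub>B" using pa_anti[OF PA FC[OF xy(1)] FC[OF xy(2)]] xy FC by (simp add: Bm PA)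
  thus ?thesis using cl_add[OF F_bracket[OF xy] F_bracket[OF xy(2,1), unfolded add.commute[of n]]] xy
   by (simp add: cl_bracket add.commute[of n] cl_0)
 qed
qed

lemma C_poisson: "poisson_algebra K C"
proof -
 have bc: "{x, y}\<^sub>C\<in>|C|" if "x\<in>|C|" "y\<in>|C|" for x y using bil_closed[OF C_bracket_bil that] .
 have "algebra K C"
 proof (rule algebraI)
  show "cring C"
   by (rule cringI[OF mod_agrp[OF Cm] comm_monoidI])
    (auto simp: C_algebra alg_ldistr[OF C_algebra] alg_assoc[OF C_algebra] intro: C_comm)
 qed (auto simp: Cm alg_smult[OF C_algebra] v_smult_ldistr[OF Cm] v_smult_rdistr[OF Cm] v_smult_assoc[OF Cm])
 moreover have "{a, a}\<^sub>C = 0\<^sub>C" if "a\<in>|C|" for a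
  using that
 proof (induction rule: gr_induct)
  case (cl n x)
  thus ?case by (simp add: cl_bracket pa_self[OF PA] FC cl_0)
 next
  case (add u v)
  thus ?case using C_anti[OF add(2,1)] bc
   by (simp add: bil_add_l[OF C_bracket_bil] bil_add_r[OF C_bracket_bil] Cm)
 qed
 moreover have "{a, {b, c}\<^sub>C}\<^sub>C +\<^sub>C {b, {c, a}\<^sub>C}\<^sub>C +\<^sub>C {c, {a, b}\<^sub>C}\<^sub>C = 0\<^sub>C"
  if abc: "a\<in>|C|" "b\<in>|C|" "c\<in>|C|" for a b c
 proof (rule gr_tri_eq[where g = "%a b c. 0\<^sub>C", OF _ _ _ _ _ abc])
  note l = C_mult_lin(3,4) lin_comp[OF C_mult_lin(3) C_mult_lin(3)] lin_comp[OF C_mult_lin(3) C_mult_lin(4)]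
   lin_comp[OF C_mult_lin(4) C_mult_lin(3)] lin_comp[OF C_mult_lin(4) C_mult_lin(4)]
  show "bil C C C (%b c. {u, {b, c}\<^sub>C}\<^sub>C +\<^sub>C {b, {c, u}\<^sub>C}\<^sub>C +\<^sub>C {c, {u, b}\<^sub>C}\<^sub>C)" if "u\<in>|C|" for u
   unfolding k_bilinear_def using that by (auto intro!: lin_plus[OF Cm] l bc)
  show "lin C C (%u. {u, {v, w}\<^sub>C}\<^sub>C +\<^sub>C {v, {w, u}\<^sub>C}\<^sub>C +\<^sub>C {w, {u, v}\<^sub>C}\<^sub>C)" if "v\<in>|C|" "w\<in>|C|" for v w
   using that by (auto intro!: lin_plus[OF Cm] l bc)
  fix i j k x y z assume h: "x\<in>F i" "y\<in>F j" "z\<in>F k"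
  have e: "j + (k + i) = i + (j + k)" "k + (i + j) = i + (j + k)" by auto
  note b = F_bracket[OF h(1) F_bracket[OF h(2,3)]] F_bracket[OF h(2) F_bracket[OF h(3,1)], unfolded e] F_bracket[OF h(3) F_bracket[OF h(1,2)], unfolded e]
  have "{x, {y, z}\<^sub>B}\<^sub>B +\<^sub>B {y, {z, x}\<^sub>B}\<^sub>B +\<^sub>B {z, {x, y}\<^sub>B}\<^sub>B = 0\<^sub>B"
   by (rule poisson_algebra.jacobi[OF PA h(1)[THEN FC] h(2)[THEN FC] h(3)[THEN FC]])
  thus "{cl i x, {cl j y, cl k z}\<^sub>C}\<^sub>C +\<^sub>C {cl j y, {cl k z, cl i x}\<^sub>C}\<^sub>C +\<^sub>C {cl k z, {cl i x, cl j y}\<^sub>C}\<^sub>C = 0\<^sub>C"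
   using h b by (simp add: cl_bracket F_bracket e cl_add[symmetric] F_add cl_0)
 qed (auto simp: k_bilinear_def lin_null[OF Cm])
 moreover have "{a, b *\<^sub>C c}\<^sub>C = {a, b}\<^sub>C *\<^sub>C c +\<^sub>C b *\<^sub>C {a, c}\<^sub>C"
  if abc: "a\<in>|C|" "b\<in>|C|" "c\<in>|C|" for a b c
 proof (rule gr_tri_eq[OF _ _ _ _ _ abc])
  note l = C_mult_lin lin_comp[OF C_mult_lin(1) C_mult_lin(3)] lin_comp[OF C_mult_lin(2) C_mult_lin(3)]
   lin_comp[OF C_mult_lin(3) C_mult_lin(2)] lin_comp[OF C_mult_lin(3) C_mult_lin(1)] lin_comp[OF C_mult_lin(4) C_mult_lin(2)] lin_comp[OF C_mult_lin(4) C_mult_lin(1)]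
  show "bil C C C (%b c. {u, b *\<^sub>C c}\<^sub>C)" "bil C C C (%b c. {u, b}\<^sub>C *\<^sub>C c +\<^sub>C b *\<^sub>C {u, c}\<^sub>C)" if "u\<in>|C|" for u
   unfolding k_bilinear_def using that by (auto intro!: lin_plus[OF Cm] l bc)
  show "lin C C (%a. {a, v *\<^sub>C w}\<^sub>C)" "lin C C (%a. {a, v}\<^sub>C *\<^sub>C w +\<^sub>C v *\<^sub>C {a, w}\<^sub>C)" if "v\<in>|C|" "w\<in>|C|" for v w
   using that by (auto intro!: lin_plus[OF Cm] l bc bil_closed[OF C_mult_bil])
  fix i j k x y z assume h: "x\<in>F i" "y\<in>F j" "z\<in>F k"
  have e: "i + j + k = i + (j + k)" "j + (i + k) = i + (j + k)" by auto
  note b = F_mult[OF F_bracket[OF h(1,2)] h(3), unfolded e] F_mult[OF h(2) F_bracket[OF h(1,3)], unfolded e]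
  show "{cl i x, cl j y *\<^sub>C cl k z}\<^sub>C = {cl i x, cl j y}\<^sub>C *\<^sub>C cl k z +\<^sub>C cl j y *\<^sub>C {cl i x, cl k z}\<^sub>C"
   using h b FC pa_leibniz_r[OF PA h(1)[THEN FC] h(2)[THEN FC] h(3)[THEN FC]] by (simp add: cl_bracket cl_mult F_bracket F_mult e cl_add[symmetric])
 qed
 ultimately show ?thesis
  by (intro poisson_algebra.intro K.field_axioms poisson_algebra_axioms.intro C_bracket_bil)
qed

end

subsection \<open>The comultiplication of the associated graded algebra\<close>

context pointed_pha
begin

abbreviation "CC \<equiv> TS C C"
abbreviation "tB \<equiv> ts B B"
abbreviation "tC \<equiv> ts C C"

lemma gr_tensor_eq: "TS A A = CC" "ts A A = tC"
 by (rule tensor_space_cong; simp add: C_simps)+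

text \<open>\<open>gr_tensor_class\<close> speaks of a finite family of pure tensors; building the
  family one summand at a time provides an induction rule.\<close>

inductive GT :: "nat => ('b \<times> 'b => 'k) set => ((nat => 'b set) \<times> (nat => 'b set) => 'k) set => bool" for n where
 zero: "GT n 0\<^sub>BB 0\<^sub>CC"
| step: "GT n t s ==> d \<le> n ==> a\<in>F d ==> b\<in>F (n - d) ==> GT n (tB a b +\<^sub>BB t) (tC (cl d a) (cl (n - d) b) +\<^sub>CC s)"

lemma tB_closed: "a\<in>F i ==> b\<in>F j ==> tB a b\<in>|BB|" by (rule tens_closed[OF Bm Bm FC FC])
lemma tC_closed: "a\<in>F i ==> b\<in>F j ==> tC (cl i a) (cl j b)\<in>|CC|" by (rule tens_closed[OF Cm Cm cl_closed cl_closed])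

lemma GT_closed: "GT n t s ==> t\<in>|BB| & s\<in>|CC|"
 by (induction rule: GT.induct) (auto simp: BT CT tB_closed tC_closed)

lemma GT_eq: "gr_tensor_class K B n t s \<longleftrightarrow> GT n t s"
proof
 assume "gr_tensor_class K B n t s"
 then obtain N :: nat and d a b where h: "\<forall>j<N. d j \<le> n & a j\<in>F (d j) & b j\<in>F (n - d j)"
  "t = (\<Oplus>\<^sub>BB j\<in>{..<N}. tB (a j) (b j))" "s = (\<Oplus>\<^sub>CC j\<in>{..<N}. tC (cl (d j) (a j)) (cl (n - d j) (b j)))"
  unfolding gr_tensor_class_def gr_tensor_eq by blast
 show "GT n t s" unfolding h(2,3) using h(1)
 proof (induction N)
  case 0
  thus ?case by (simp add: GT.zero BT CT)
 next
  case (Suc N)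
  have c: "tB (a j) (b j)\<in>|BB|" "tC (cl (d j) (a j)) (cl (n - d j) (b j))\<in>|CC|" if "j\<in>insert N {..<N}" for j
   using Suc.prems that tB_closed[of "a j" "d j" "b j" "n - d j"] tC_closed[of "a j" "d j" "b j" "n - d j"] by auto
  have 1: "(\<Oplus>\<^sub>BB j\<in>{..<Suc N}. tB (a j) (b j)) = tB (a N) (b N) +\<^sub>BB (\<Oplus>\<^sub>BB j\<in>{..<N}. tB (a j) (b j))"
   unfolding lessThan_Suc by (rule v_finsum_insert[OF BT]) (use c in auto)
  have 2: "(\<Oplus>\<^sub>CC j\<in>{..<Suc N}. tC (cl (d j) (a j)) (cl (n - d j) (b j))) =
    tC (cl (d N) (a N)) (cl (n - d N) (b N)) +\<^sub>CC (\<Oplus>\<^sub>CC j\<in>{..<N}. tC (cl (d j) (a j)) (cl (n - d j) (b j)))"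
   unfolding lessThan_Suc by (rule v_finsum_insert[OF CT]) (use c in auto)
  show ?case unfolding 1 2 by (rule GT.step[OF Suc.IH]) (use Suc.prems in auto)
 qed
next
 assume "GT n t s"
 thus "gr_tensor_class K B n t s"
 proof (induction rule: GT.induct)
  case zero
  show ?case unfolding gr_tensor_class_def gr_tensor_eq
   by (intro exI[of _ 0] exI[of _ "%_. 0"] exI[of _ "%_. 0\<^sub>B"]) (simp add: BT CT)
 next
  case (step t s d' a' b')
  then obtain N :: nat and d a b where h: "!!j. j < N ==> d j \<le> n & a j\<in>F (d j) & b j\<in>F (n - d j)"
   "t = (\<Oplus>\<^sub>BB j\<in>{..<N}. tB (a j) (b j))" "s = (\<Oplus>\<^sub>CC j\<in>{..<N}. tC (cl (d j) (a j)) (cl (n - d j) (b j)))"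
   unfolding gr_tensor_class_def gr_tensor_eq by blast
  let ?d = "d(N := d')" and ?a = "a(N := a')" and ?b = "b(N := b')"
  have c: "tB (?a j) (?b j)\<in>|BB|" "tC (cl (?d j) (?a j)) (cl (n - ?d j) (?b j))\<in>|CC|" if "j\<in>insert N {..<N}" for j
   using h(1) step(3,4) that by (auto intro!: tB_closed tC_closed)
  have "(\<Oplus>\<^sub>BB j\<in>{..<Suc N}. tB (?a j) (?b j)) = tB a' b' +\<^sub>BB (\<Oplus>\<^sub>BB j\<in>{..<N}. tB (?a j) (?b j))"
   unfolding lessThan_Suc by (subst v_finsum_insert[OF BT]) (use c in auto)
  also have "(\<Oplus>\<^sub>BB j\<in>{..<N}. tB (?a j) (?b j)) = t" unfolding h(2) by (rule v_finsum_cong[OF BT]) (use h(1) in "auto intro!: tB_closed")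
  finally have 1: "tB a' b' +\<^sub>BB t = (\<Oplus>\<^sub>BB j\<in>{..<Suc N}. tB (?a j) (?b j))" ..
  have "(\<Oplus>\<^sub>CC j\<in>{..<Suc N}. tC (cl (?d j) (?a j)) (cl (n - ?d j) (?b j))) =
    tC (cl d' a') (cl (n - d') b') +\<^sub>CC (\<Oplus>\<^sub>CC j\<in>{..<N}. tC (cl (?d j) (?a j)) (cl (n - ?d j) (?b j)))"
   unfolding lessThan_Suc by (subst v_finsum_insert[OF CT]) (use c in auto)
  also have "(\<Oplus>\<^sub>CC j\<in>{..<N}. tC (cl (?d j) (?a j)) (cl (n - ?d j) (?b j))) = s"
   unfolding h(3) by (rule v_finsum_cong[OF CT]) (use h(1) in "auto intro!: tC_closed")
  finally have 2: "tC (cl d' a') (cl (n - d') b') +\<^sub>CC s = (\<Oplus>\<^sub>CC j\<in>{..<Suc N}. tC (cl (?d j) (?a j)) (cl (n - ?d j) (?b j)))" ..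
  show ?case unfolding gr_tensor_class_def gr_tensor_eq 1 2
   by (rule exI[of _ "Suc N"], rule exI[of _ ?d], rule exI[of _ ?a], rule exI[of _ ?b])
    (use h(1) step(2-4) less_Suc_eq in auto)
 qed
qed

lemma GT_tens: "d \<le> n ==> a\<in>F d ==> b\<in>F (n - d) ==> GT n (tB a b) (tC (cl d a) (cl (n - d) b))"
 using GT.step[OF GT.zero, of d n a b] tB_closed[of a d b "n - d"] tC_closed[of a d b "n - d"] by (simp add: BT CT)

lemma GT_add: "GT n t s ==> GT n t' s' ==> GT n (t +\<^sub>BB t') (s +\<^sub>CC s')"
proof (induction rule: GT.induct)
 case zero
 thus ?case using GT_closed[of n t' s'] by (simp add: BT CT)
next
 case (step t s d a b)
 note c = GT_closed[OF step(1)] GT_closed[OF step(6)] tB_closed[OF step(3,4)] tC_closed[OF step(3,4)]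
 show ?case using GT.step[OF step(5)[OF step(6)] step(2-4)] c by (simp add: v_assoc[OF BT] v_assoc[OF CT])
qed

lemma GT_smult:
 assumes k: "k\<in>|K|"
 shows "GT n t s ==> GT n (k \<odot>\<^sub>BB t) (k \<odot>\<^sub>CC s)"
proof (induction rule: GT.induct)
 case zero
 thus ?case using GT.zero k by (simp add: BT CT)
next
 case (step t s d a b)
 note c = GT_closed[OF step(1)] tB_closed[OF step(3,4)] tC_closed[OF step(3,4)]
 show ?case using GT.step[OF step(5,2) F_smult[OF k step(3)] step(4)] c k step(3,4)
  by (simp add: v_smult_rdistr[OF BT] v_smult_rdistr[OF CT] cl_smult tens_smult_l[OF Bm Bm] tens_smult_l[OF Cm Cm] FC cl_closed)
qed

lemma GT_exists:
 assumes "t\<in>span BB (B.W n)"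
 shows "\<exists>s. GT n t s"
 using assms BT B.W_carrier
proof (induction rule: span_induct)
 case (base t)
 thus ?case unfolding B.W_def using GT_tens by blast
qed (use GT.zero GT_add GT_smult in blast)+

text \<open>A functional on \<open>gr B\<close> restricts to \<open>B\<^sub>p/B\<^bsub>p-1\<^esub>\<close> and extends from there to \<open>B\<close>. Such extensions turn
  statements about \<open>gr B \<otimes> gr B\<close> into statements about slices of \<open>B \<otimes> B\<close>.\<close>

definition ex :: "((nat => 'b set) => 'k) => nat => 'b => 'k"
 where "ex \<phi> p = (SOME g. fnl B g & (\<forall>x\<in>F p. g x = \<phi> (cl p x)))"

lemma ex:
 assumes "fnl C \<phi>"
 shows "fnl B (ex \<phi> p)" "x\<in>F p ==> ex \<phi> p x = \<phi> (cl p x)" "x\<in>Bp p ==> ex \<phi> p x = \<zero>"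
proof -
 obtain g where g: "fnl B g" "!!x. x\<in>F p ==> g x = \<phi> (cl p x)"
  by (rule lin_extension[OF Bm base_module B.F_sub lin_comp[OF cl_lin assms]]) (rule that)
 have *: "fnl B (ex \<phi> p) & (\<forall>x\<in>F p. ex \<phi> p x = \<phi> (cl p x))" unfolding ex_def by (rule someI[of _ g]) (use g in blast)
 thus "fnl B (ex \<phi> p)" and 2: "!!x. x\<in>F p ==> ex \<phi> p x = \<phi> (cl p x)" by auto
 show "x\<in>Bp p ==> ex \<phi> p x = \<zero>" using 2[OF Bp_F] fnl_zero[OF assms Cm] by (simp add: cl_zero)
qed

abbreviation "bK \<equiv> base_algebra K"

text \<open>The value of \<phi> \<otimes> \<psi> on the degree n class of t, computed in B \<otimes>
  B: the summand for p = m - c uses lifts of \<phi> in degree p and of \<psi> in degree n - p. The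
  shift c only relabels the summation index; with it, both iterated coproducts are summed over the
  same range in the proof of coassociativity.\<close>

definition PP :: "nat => nat => ((nat => 'b set) => 'k) => ((nat => 'b set) => 'k) => ('b \<times> 'b => 'k) set => 'k"
 where "PP c n \<phi> \<psi> t = (\<Oplus>\<^sub>bK m\<in>{..n + c}. if c \<le> m then ex \<psi> (n + c - m) (lsl B (ex \<phi> (m - c)) t) else \<zero>)"

lemma PP_lin:
 assumes f: "fnl C \<phi>" "fnl C \<psi>"
 shows "fnl BB (PP c n \<phi> \<psi>)"
proof -
 have "fnl BB (%t. if c \<le> m then ex \<psi> (n + c - m) (lsl B (ex \<phi> (m - c)) t) else \<zero>)" for m
  using lin_comp[OF lsl_lin[OF Bm Bm ex(1)[OF f(1), of "m - c"]] ex(1)[OF f(2), of "n + c - m"]] lin_null[OF base_module] by (cases "c \<le> m") auto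
 thus ?thesis unfolding PP_def[abs_def] by (intro lin_sum[OF base_module BT]) auto
qed

text \<open>A lift in degree p kills \<open>Bp p\<close>, so for a and b of degrees d and e all
  summands vanish except the one with p = d, and that one too when d + e < n.\<close>

lemma PP_tens:
 assumes f: "fnl C \<phi>" "fnl C \<psi>" and ab: "a\<in>F d" "b\<in>F e" and l: "d + e \<le> n"
 shows "PP c n \<phi> \<psi> (tB a b) = (if d + e = n then \<phi> (cl d a) \<otimes> \<psi> (cl e b) else \<zero>)"
proof -
 define h where "h m = (if c \<le> m then ex \<psi> (n + c - m) (lsl B (ex \<phi> (m - c)) (tB a b)) else \<zero>)" for m
 have h: "h m = ex \<phi> (m - c) a \<otimes> ex \<psi> (n + c - m) b" if "c \<le> m" for m
  using that fnl_smult[OF ex(1)[OF f(2)] fnl_closed[OF ex(1)[OF f(1)] FC[OF ab(1)]] FC[OF ab(2)]]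
  by (simp add: h_def lsl_tens[OF Bm Bm ex(1)[OF f(1)] FC[OF ab(1)] FC[OF ab(2)]])
 note c = fnl_closed[OF ex(1)[OF f(1)] FC[OF ab(1)]] fnl_closed[OF ex(1)[OF f(2)] FC[OF ab(2)]]
 have z: "h m = \<zero>" if m: "m ~= d + c \<or> d + e ~= n" "m \<le> n + c" for m
 proof (cases "c \<le> m")
  case True
  have "d < m - c \<or> e < n + c - m" using m l True by linarith
  thus ?thesis using F_Bp[OF ab(1)] F_Bp[OF ab(2)] c True by (auto simp: h ex(3)[OF f(1)] ex(3)[OF f(2)])
 qed (simp add: h_def)
 show ?thesis
 proof (cases "d + e = n")
  case True
  hence e: "n + c - (d + c) = e" by simp
  have hd: "h (d + c) = \<phi> (cl d a) \<otimes> \<psi> (cl e b)" using h[of "d + c"] unfolding e by (simp add: ex(2)[OF f(1) ab(1)] ex(2)[OF f(2) ab(2)])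
  have "(\<Oplus>\<^sub>bK m\<in>{..n + c}. h m) = h (d + c)"
   by (rule v_finsum_single[OF base_module]) (use True z hd fnl_closed[OF f(1) cl_closed[OF ab(1)]] fnl_closed[OF f(2) cl_closed[OF ab(2)]] in auto)
  thus ?thesis using True hd unfolding PP_def h_def by simp
 next
  case False
  hence "(\<Oplus>\<^sub>bK m\<in>{..n + c}. h m) = \<zero>" using v_finsum_zero[OF base_module, of "{..n + c}" h] z by auto
  thus ?thesis using False unfolding PP_def h_def by simp
 qed
qed

lemma GT_PP:
 assumes "GT n t s" and f: "fnl C \<phi>" "fnl C \<psi>"
 shows "\<psi> (lsl C \<phi> s) = PP c n \<phi> \<psi> t"
 using assms(1)
proof (induction rule: GT.induct)
 case zero
 thus ?case using fnl_zero[OF PP_lin[OF f] BT] fnl_zero[OF lin_comp[OF lsl_lin[OF Cm Cm f(1)] f(2)] CT] by simp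
next
 case (step t s d a b)
 note c = conjunct1[OF GT_closed[OF step(1)]] conjunct2[OF GT_closed[OF step(1)]] tB_closed[OF step(3,4)] tC_closed[OF step(3,4)]
 have "\<psi> (lsl C \<phi> (tC (cl d a) (cl (n - d) b))) = PP c n \<phi> \<psi> (tB a b)"
  using step(2) fnl_closed[OF f(1) cl_closed[OF step(3)]]
  by (simp add: PP_tens[OF f step(3,4)] lsl_tens[OF Cm Cm f(1) cl_closed[OF step(3)] cl_closed[OF step(4)]] fnl_smult[OF f(2)] cl_closed[OF step(4)])
 thus ?case using step(5) fnl_add[OF lin_comp[OF lsl_lin[OF Cm Cm f(1)] f(2)] c(4,2)] fnl_add[OF PP_lin[OF f] c(3,1)] by simp
qed

text \<open>By \<open>GT_PP\<close> the contractions of a class depend on t alone, and contractions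
  separate the points of C \<otimes> C.\<close>

lemma GT_unique:
 assumes "GT n t s" "GT n t' s'" "!!\<phi> \<psi>. fnl C \<phi> ==> fnl C \<psi> ==> PP 0 n \<phi> \<psi> t = PP 0 n \<phi> \<psi> t'"
 shows "s = s'"
 by (rule tensor_eqI2[OF Cm Cm]) (use assms GT_closed GT_PP[of n _ _ _ _ 0] in auto)

text \<open>If x has filtration degree n - 1, then \<Delta> x is spanned by pure tensors of total
  degree n - 1, which are invisible in degree n. This makes the coproduct of gr B independent of
  representatives.\<close>

lemma PP_Bp:
 assumes f: "fnl C \<phi>" "fnl C \<psi>" and x: "x\<in>Bp n"
 shows "PP 0 n \<phi> \<psi> (comult B x) = \<zero>"
proof (cases n)
 case 0
 thus ?thesis using x lin_zero[OF lin_comp[OF B.comult_linear PP_lin[OF f]] Bm base_module] by (simp add: Bp_0)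
next
 case (Suc m)
 hence "comult B x\<in>span BB (B.W m)" using x B.F_comult by (simp add: Bp_Suc)
 moreover have "t\<in>{t\<in>carrier BB. PP 0 n \<phi> \<psi> t\<in>{0\<^sub>bK}}" if t: "t\<in>B.W m" for t
 proof -
  obtain a b i where ab: "t = tB a b" "i \<le> m" "a\<in>F i" "b\<in>F (m - i)" using t unfolding B.W_def by blast
  show ?thesis using PP_tens[OF f ab(3,4), of n 0] ab(2) Suc tB_closed[OF ab(3,4)] unfolding ab(1) by simp
 qed
 ultimately show ?thesis
  using span_least[OF sub_preimage[OF PP_lin[OF f] BT base_module sub_null[OF base_module]], of "B.W m" 0 n] by auto
qed

definition Dq :: "nat => 'b set => ((nat => 'b set) \<times> (nat => 'b set) => 'k) set"
 where "Dq n S = (THE s. \<exists>x\<in>S. gr_tensor_class K B n (comult B x) s)"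

text \<open>Uniqueness has to cover both another representative of the coset and another
  decomposition of its coproduct; \<open>GT_unique\<close> and \<open>PP_Bp\<close> treat the two at
  once.\<close>

lemma Dq_eq:
 assumes x: "x\<in>F n" and s: "GT n (comult B x) s"
 shows "Dq n (q n x) = s"
 unfolding Dq_def GT_eq
proof (rule the_equality)
 show "\<exists>y\<in>q n x. GT n (comult B y) s" using s q_mem[OF x] x by blast
 fix s' assume "\<exists>y\<in>q n x. GT n (comult B y) s'"
 then obtain y where y: "y\<in>F n" "q n y = q n x" "GT n (comult B y) s'" using q_mem[OF x] by blast
 hence d: "y -\<^sub>B x\<in>Bp n" using q_eq[of y x n] FC x by blast
 show "s' = s"
 proof (rule GT_unique[OF y(3) s])
  fix \<phi> \<psi> assume f: "fnl C \<phi>" "fnl C \<psi>"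
  note l = lin_comp[OF B.comult_linear PP_lin[OF f, of 0 n]]
  show "PP 0 n \<phi> \<psi> (comult B y) = PP 0 n \<phi> \<psi> (comult B x)"
   using PP_Bp[OF f d] lin_minus[OF l Bm base_module FC[OF y(1)] FC[OF x]] fnl_closed[OF l FC[OF x]] fnl_closed[OF l FC[OF y(1)]]
    v_eq_diff[OF base_module, of "PP 0 n \<phi> \<psi> (comult B y)" "PP 0 n \<phi> \<psi> (comult B x)"] by simp
 qed
qed

lemma Dq_GT: "x\<in>F n ==> GT n (comult B x) (Dq n (q n x))"
 using GT_exists[OF B.F_comult] Dq_eq by metis

lemma Dq_lin: "lin (Q n) CC (Dq n)"
proof (rule k_linearI)
 fix S assume "S\<in>|Q n|"
 thus "Dq n S\<in>|CC|" using GT_closed[OF Dq_GT] by (auto simp: Q_carrier)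
 fix T assume "T\<in>|Q n|"
 then obtain x y where xy: "x\<in>F n" "y\<in>F n" "S = q n x" "T = q n y" using \<open>S\<in>|Q n|\<close> by (auto simp: Q_carrier)
 show "Dq n (S +\<^sub>(Q n) T) = Dq n S +\<^sub>CC Dq n T"
  unfolding xy q_add[OF xy(1,2), symmetric]
  by (rule Dq_eq[OF F_add[OF xy(1,2)]]) (simp add: lin_add[OF B.comult_linear FC[OF xy(1)] FC[OF xy(2)]] GT_add Dq_GT xy)
next
 fix k S assume k: "k\<in>|K|" and "S\<in>|Q n|"
 then obtain x where x: "x\<in>F n" "S = q n x" by (auto simp: Q_carrier)
 show "Dq n (k \<odot>\<^sub>(Q n) S) = k \<odot>\<^sub>CC Dq n S"
  unfolding x q_smult[OF k x(1), symmetric]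
  by (rule Dq_eq[OF F_smult[OF k x(1)]]) (simp add: lin_smult[OF B.comult_linear k FC[OF x(1)]] GT_smult Dq_GT k x)
qed

abbreviation "\<Delta> \<equiv> comult C"
abbreviation "\<epsilon> \<equiv> counit C"

lemma comult_C_eq: "\<Delta> u = (\<Oplus>\<^sub>CC n\<in>{n. u n ~= Bp n}. Dq n (u n))"
proof -
 have "\<Delta> u = (\<Oplus>\<^sub>(TS A A) n\<in>{n. u n ~= Bp n}. THE s. \<exists>x\<in>u n. gr_tensor_class K B n (comult B x) s)"
  by (simp add: gr_def module.extend_def)
 thus ?thesis unfolding gr_tensor_eq Dq_def .
qed

lemma comult_C_superset:
 assumes u: "u\<in>|C|" and I: "finite I" "{n. u n ~= Bp n}\<subseteq>I"
 shows "\<Delta> u = (\<Oplus>\<^sub>CC n\<in>I. Dq n (u n))"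
proof -
 have "Dq n (u n) = 0\<^sub>CC" if "n\<in>I - {n. u n ~= Bp n}" for n
  using that lin_zero[OF Dq_lin Qm CT, of n] by (simp add: Q_zero)
 thus ?thesis unfolding comult_C_eq
  by (intro v_finsum_mono[OF CT I, symmetric] lin_closed[OF Dq_lin comp_closed[OF u]])
qed

lemma comult_C_lin: "lin C CC \<Delta>"
proof (rule k_linearI)
 note l = lin_comp[OF comp_lin Dq_lin]
 fix u v assume uv: "u\<in>|C|" "v\<in>|C|"
 show "\<Delta> u\<in>|CC|" unfolding comult_C_eq using lin_closed[OF l uv(1)] by (rule v_finsum_closed[OF CT])
 let ?I = "{n. u n ~= Bp n} \<union> {n. v n ~= Bp n} \<union> {n. (u +\<^sub>C v) n ~= Bp n}"
 have I: "finite ?I" using supp_finite uv by (auto simp: Cm)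
 have "\<Delta> (u +\<^sub>C v) = (\<Oplus>\<^sub>CC n\<in>?I. Dq n ((u +\<^sub>C v) n))" by (rule comult_C_superset[OF v_add_closed[OF Cm uv] I]) auto
 also have "... = (\<Oplus>\<^sub>CC n\<in>?I. Dq n (u n) +\<^sub>CC Dq n (v n))"
  by (rule v_finsum_cong[OF CT v_add_closed[OF CT lin_closed[OF l uv(1)] lin_closed[OF l uv(2)]] lin_add[OF l uv]])
 also have "... = (\<Oplus>\<^sub>CC n\<in>?I. Dq n (u n)) +\<^sub>CC (\<Oplus>\<^sub>CC n\<in>?I. Dq n (v n))"
  by (rule v_finsum_add[OF CT lin_closed[OF l uv(1)] lin_closed[OF l uv(2)]])
 also have "... = \<Delta> u +\<^sub>CC \<Delta> v"
  by (subst (1 2) comult_C_superset[OF _ I]) (use uv in auto)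
 finally show "\<Delta> (u +\<^sub>C v) = \<Delta> u +\<^sub>CC \<Delta> v" .
next
 note l = lin_comp[OF comp_lin Dq_lin]
 fix k u assume k: "k\<in>|K|" and u: "u\<in>|C|"
 let ?I = "{n. u n ~= Bp n} \<union> {n. (k \<odot>\<^sub>C u) n ~= Bp n}"
 have I: "finite ?I" using supp_finite k u by (auto simp: Cm)
 have "\<Delta> (k \<odot>\<^sub>C u) = (\<Oplus>\<^sub>CC n\<in>?I. Dq n ((k \<odot>\<^sub>C u) n))" by (rule comult_C_superset[OF v_smult_closed[OF Cm k u] I]) auto
 also have "... = (\<Oplus>\<^sub>CC n\<in>?I. k \<odot>\<^sub>CC Dq n (u n))"
  by (rule v_finsum_cong[OF CT v_smult_closed[OF CT k lin_closed[OF l u]] lin_smult[OF l k u]])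
 also have "... = k \<odot>\<^sub>CC \<Delta> u"
  unfolding v_finsum_smult[OF CT I k lin_closed[OF l u], symmetric] using comult_C_superset[OF u I] by simp
 finally show "\<Delta> (k \<odot>\<^sub>C u) = k \<odot>\<^sub>CC \<Delta> u" .
qed

lemma \<Delta>_closed: "u\<in>|C| ==> \<Delta> u\<in>|CC|" by (rule lin_closed[OF comult_C_lin])

lemma comult_cl:
 assumes x: "x\<in>F n"
 shows "GT n (comult B x) (\<Delta> (cl n x))"
proof -
 have "\<Delta> (cl n x) = (\<Oplus>\<^sub>CC m\<in>{n}. Dq m (cl n x m))"
  by (rule comult_C_superset[OF cl_closed[OF x]]) (auto simp: gr_class_def)
 also have "... = Dq n (q n x)"
  using GT_closed[OF Dq_GT[OF x]] by (subst v_finsum_insert[OF CT]) (auto simp: gr_class_def CT)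
 finally show ?thesis using Dq_GT[OF x] by simp
qed

lemma counit_C: "x\<in>F 0 ==> u 0 = q 0 x ==> \<epsilon> u = counit B x"
proof -
 assume x: "x\<in>F 0" "u 0 = q 0 x"
 have "q 0 x = {x}" using coset_mem[OF Bm Bp_sub FC[OF x(1)], of _ 0] v_eq_diff[OF Bm _ FC[OF x(1)]] FC[OF x(1)] by (auto simp: Bp_0)
 thus ?thesis using x(2) by (simp add: gr_def module.extend_def)
qed
lemma counit_C_lin: "fnl C \<epsilon>"
proof -
 have q: "\<exists>x\<in>F 0. u 0 = q 0 x" if "u\<in>|C|" for u using comp_closed[OF that, of 0] by (auto simp: Q_carrier)
 have c: "counit B x\<in>|K|" if "x\<in>F 0" for x using fnl_closed[OF B.counit_linear FC[OF that]] .
 show ?thesis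
 proof (rule k_linearI)
  fix u v assume uv: "u\<in>|C|" "v\<in>|C|"
  obtain x y where xy: "x\<in>F 0" "u 0 = q 0 x" "y\<in>F 0" "v 0 = q 0 y" using q[OF uv(1)] q[OF uv(2)] by blast
  show "\<epsilon> u\<in>|bK|" using counit_C[OF xy(1), of u] xy(2) c[OF xy(1)] by simp
  have "(u +\<^sub>C v) 0 = q 0 (x +\<^sub>B y)" using lin_add[OF comp_lin uv] xy by (simp add: q_add)
  thus "\<epsilon> (u +\<^sub>C v) = \<epsilon> u +\<^sub>bK \<epsilon> v"
   using counit_C[OF F_add[OF xy(1,3)], of "u +\<^sub>C v"] counit_C[OF xy(1), of u] counit_C[OF xy(3), of v] xy by (simp add: fnl_add[OF B.counit_linear] FC)
 next
  fix k u assume k: "k\<in>|K|" and u: "u\<in>|C|"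
  obtain x where x: "x\<in>F 0" "u 0 = q 0 x" using q[OF u] by blast
  have "(k \<odot>\<^sub>C u) 0 = q 0 (k \<odot>\<^sub>B x)" using lin_smult[OF comp_lin k u] x k by (simp add: q_smult)
  thus "\<epsilon> (k \<odot>\<^sub>C u) = k \<odot>\<^sub>bK \<epsilon> u"
   using counit_C[OF F_smult[OF k x(1)], of "k \<odot>\<^sub>C u"] counit_C[OF x(1), of u] x k by (simp add: fnl_smult[OF B.counit_linear] FC)
 qed
qed
lemma counit_cl: "x\<in>F n ==> \<epsilon> (cl n x) = (if n = 0 then counit B x else \<zero>)"
 using counit_C[of x "cl n x"] counit_C[of "0\<^sub>B" "cl n x"] F_zero fnl_zero[OF B.counit_linear Bm]
 by (auto simp: gr_class_def coset_zero[OF Bm Bp_sub])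

abbreviation "S \<equiv> antipode C"
lemma antipode_q:
 assumes x: "x\<in>F n"
 shows "(\<Union>y\<in>q n x. q n (antipode B y)) = q n (antipode B x)"
proof (rule UN_const)
 show "x\<in>q n x" using q_mem[OF x] x by blast
 fix y assume "y\<in>q n x"
 hence y: "y\<in>F n" "y -\<^sub>B x\<in>Bp n" using q_mem[OF x] q_eq FC x by auto
 have "antipode B (y -\<^sub>B x)\<in>Bp n" using y(2) F_antipode lin_zero[OF S_lin Bm Bm] by (cases n) (auto simp: Bprev_def)
 thus "q n (antipode B y) = q n (antipode B x)"
  using FC x y(1) S_closed by (simp add: q_eq lin_minus[OF S_lin Bm Bm])
qed
lemma antipode_comp: "x\<in>F n ==> u n = q n x ==> S u n = q n (antipode B x)"
 using antipode_q[of x n] by (simp add: gr_def module.extend_def)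
lemma antipode_Bp: "u n = Bp n ==> S u n = Bp n"
 using antipode_comp[OF F_zero, of u n] lin_zero[OF S_lin Bm Bm] by (simp add: coset_zero[OF Bm Bp_sub])
lemma antipode_cl: "x\<in>F n ==> S (cl n x) = cl n (antipode B x)"
proof
 fix m assume "x\<in>F n"
 thus "S (cl n x) m = cl n (antipode B x) m"
  using antipode_comp[of x n "cl n x"] antipode_Bp[of "cl n x" m] by (cases "m = n") (simp_all add: gr_class_def)
qed
lemma antipode_C_lin: "lin C C S"
proof -
 have q: "\<exists>x\<in>F n. u n = q n x" if "u\<in>|C|" for u n using comp_closed[OF that, of n] by (auto simp: Q_carrier)
 have add: "(a +\<^sub>C b) n = a n +\<^sub>(Q n) b n" "(k \<odot>\<^sub>C a) n = k \<odot>\<^sub>(Q n) a n" for a b n k by (simp_all add: C_simps A_simps)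
 show ?thesis
 proof (rule k_linearI)
  fix u v assume uv: "u\<in>|C|" "v\<in>|C|"
  have "S u n\<in>|Q n|" for n using q[OF uv(1), of n] antipode_comp F_antipode by (auto simp: q_closed)
  moreover have "finite {n. S u n ~= Bp n}" by (rule finite_subset[OF _ supp_finite[OF uv(1)]]) (use antipode_Bp in auto)
  ultimately show "S u\<in>|C|" by (simp add: CA A_carrier)
  show "S (u +\<^sub>C v) = S u +\<^sub>C S v"
  proof
   fix n
   obtain x y where xy: "x\<in>F n" "u n = q n x" "y\<in>F n" "v n = q n y" using q[OF uv(1)] q[OF uv(2)] by blast
   have "(u +\<^sub>C v) n = q n (x +\<^sub>B y)" using xy by (simp add: q_add lin_add[OF comp_lin uv])
   hence "S (u +\<^sub>C v) n = q n (antipode B (x +\<^sub>B y))" by (rule antipode_comp[OF F_add[OF xy(1,3)]])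
   also have "... = S u n +\<^sub>(Q n) S v n" using xy by (simp add: lin_add[OF S_lin] FC q_add F_antipode antipode_comp)
   finally show "S (u +\<^sub>C v) n = (S u +\<^sub>C S v) n" using add(1)[of "S u" "S v" n] by (rule trans[OF _ sym])
  qed
 next
  fix k u assume k: "k\<in>|K|" and u: "u\<in>|C|"
  show "S (k \<odot>\<^sub>C u) = k \<odot>\<^sub>C S u"
  proof
   fix n
   obtain x where x: "x\<in>F n" "u n = q n x" using q[OF u] by blast
   have "(k \<odot>\<^sub>C u) n = q n (k \<odot>\<^sub>B x)" using x k by (simp add: q_smult lin_smult[OF comp_lin k u])
   hence "S (k \<odot>\<^sub>C u) n = q n (antipode B (k \<odot>\<^sub>B x))" by (rule antipode_comp[OF F_smult[OF k x(1)]])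
   also have "... = k \<odot>\<^sub>(Q n) S u n" using x k by (simp add: lin_smult[OF S_lin] FC q_smult F_antipode antipode_comp)
   finally show "S (k \<odot>\<^sub>C u) n = (k \<odot>\<^sub>C S u) n" using add(2)[of k "S u" n] by (rule trans[OF _ sym])
  qed
 qed
qed

lemma GT_lift:
 assumes f: "bil B B B f" and g: "bil C C C g"
  and fg: "!!i j a b. a\<in>F i ==> b\<in>F j ==> f a b\<in>F (i + j) & g (cl i a) (cl j b) = cl (i + j) (f a b)"
  and "GT n t s"
 shows "tlift B f t\<in>F n & tlift C g s = cl n (tlift B f t)"
 using assms(4)
proof (induction rule: GT.induct)
 note l = tensor_lift_lin[OF Bm Bm Bm f] tensor_lift_lin[OF Cm Cm Cm g]
 {
  case zero
  thus ?case using lin_zero[OF l(1) BT Bm] lin_zero[OF l(2) CT Cm] by (simp add: F_zero cl_0)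
 next
  case (step t s d a b)
  note c = conjunct1[OF GT_closed[OF step(1)]] conjunct2[OF GT_closed[OF step(1)]] tB_closed[OF step(3,4)] tC_closed[OF step(3,4)]
  have "tlift B f (tB a b)\<in>F n & tlift C g (tC (cl d a) (cl (n - d) b)) = cl n (tlift B f (tB a b))"
   using fg[OF step(3,4)] step(2-4) by (simp add: tensor_lift_tens[OF Bm Bm Bm f] tensor_lift_tens[OF Cm Cm Cm g] FC cl_closed)
  thus ?case using step(5) lin_add[OF l(1) c(3,1)] lin_add[OF l(2) c(4,2)] by (simp add: F_add cl_add)
 }
qed

text \<open>The counit and antipode axioms say that the linear extension of a bilinear operation,
  applied to \<Delta> u, is a known linear map. Each descends from B by a check on homogeneous pure
  tensors.\<close>

lemma \<Delta>_lift:
 assumes f: "bil B B B f" and g: "bil C C C g"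
  and fg: "!!i j a b. a\<in>F i ==> b\<in>F j ==> f a b\<in>F (i + j) & g (cl i a) (cl j b) = cl (i + j) (f a b)"
  and h: "lin C C h" "!!n x. x\<in>F n ==> cl n (tlift B f (comult B x)) = h (cl n x)" and u: "u\<in>|C|"
 shows "tlift C g (\<Delta> u) = h u"
 by (rule gr_lin_eq[OF lin_comp[OF comult_C_lin tensor_lift_lin[OF Cm Cm Cm g]] h(1) _ u])
  (use GT_lift[OF f g fg comult_cl] h(2) in simp)

lemma \<Delta>_PP: "x\<in>F n ==> fnl C \<phi> ==> fnl C \<psi> ==> \<psi> (lsl C \<phi> (\<Delta> (cl n x))) =
  (\<Oplus>\<^sub>bK m\<in>{..n + c}. if c \<le> m then ex \<psi> (n + c - m) (B.ls (ex \<phi> (m - c)) x) else \<zero>)"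
 using GT_PP[OF comult_cl, of x n \<phi> \<psi> c] unfolding PP_def B.ls_def by simp

text \<open>For p > 0 the lift vanishes on F (p - 1), so by the wedge facts slicing by it lowers the
  degree by p; for p = 0 this is stability of F n under slices.\<close>

lemma ls_ex:
 assumes f: "fnl C \<phi>" and x: "x\<in>F n" and p: "p \<le> n"
 shows "B.ls (ex \<phi> p) x\<in>F (n - p)" "B.rs (ex \<phi> p) x\<in>F (n - p)"
proof -
 note e = ex(1)[OF f, of p]
 have "B.ls (ex \<phi> p) x\<in>F (n - p) & B.rs (ex \<phi> p) x\<in>F (n - p)"
 proof (cases p)
  case 0
  thus ?thesis using B.F_slices[OF x e] by simp
 next
  case (Suc m)
  hence "\<forall>y\<in>F m. ex \<phi> p y = \<zero>" using ex(3)[OF f, of _ p] by (simp add: Bp_Suc)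
  moreover have e1: "Suc (m + (n - p)) = n" and e2: "Suc (n - p + m) = n" using p Suc by auto
  have "x\<in>F (Suc (m + (n - p)))" "x\<in>F (Suc (n - p + m))" unfolding e1 e2 by (rule x)+
  ultimately show ?thesis using B.F_wedge_l[OF e] B.F_wedge_r[OF e] by blast
 qed
 thus "B.ls (ex \<phi> p) x\<in>F (n - p)" "B.rs (ex \<phi> p) x\<in>F (n - p)" by auto
qed

text \<open>Contracted with \<phi>, \<psi>, \<chi>, both sides become one double sum over degrees p
  \<le> m \<le> n of contractions of the iterated coproduct of x in B, with lifts in degrees p, m -
  p and n - m. Coassociativity of B enters by commuting left and right slices.\<close>

lemma C_coassoc:
 assumes u: "u\<in>|C|"
 shows "tmap C CC (%a. a) \<Delta> (\<Delta> u) = tensor_assoc K C (tmap CC C \<Delta> (%b. b) (\<Delta> u))"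
proof (rule coassocI[OF Cm comult_C_lin _ u])
 fix \<phi> \<psi> \<chi> u assume f: "fnl C \<phi>" "fnl C \<psi>" "fnl C \<chi>" and u: "u\<in>|C|"
 have L: "lin C C (%y. lsl C \<alpha> (\<Delta> y))" if "fnl C \<alpha>" for \<alpha> by (rule lin_comp[OF comult_C_lin lsl_lin[OF Cm Cm that]])
 define \<omega> where "\<omega> = (%y. \<psi> (lsl C \<phi> (\<Delta> y)))"
 define \<theta> where "\<theta> = (%y. \<chi> (lsl C \<psi> (\<Delta> y)))"
 have \<omega>: "fnl C \<omega>" and \<theta>: "fnl C \<theta>" unfolding \<omega>_def \<theta>_def by (rule lin_comp[OF L[OF f(1)] f(2)], rule lin_comp[OF L[OF f(2)] f(3)])
 have "\<theta> (lsl C \<phi> (\<Delta> u)) = \<chi> (lsl C \<omega> (\<Delta> u))"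
 proof (rule gr_lin_eq[OF lin_comp[OF L[OF f(1)] \<theta>] lin_comp[OF L[OF \<omega>] f(3)] _ u])
  fix n x assume x: "x\<in>F n"
  define g where "g p m = (if p \<le> m then ex \<chi> (n - m) (B.ls (ex \<psi> (m - p)) (B.ls (ex \<phi> p) x)) else \<zero>)" for p m
  have gc: "g p m\<in>|bK|" for p m
   unfolding g_def using fnl_closed[OF ex(1)[OF f(3)] B.ls_closed[OF ex(1)[OF f(2)] B.ls_closed[OF ex(1)[OF f(1)] FC[OF x]]]] by simp
  have 1: "ex \<theta> (n - p) (B.ls (ex \<phi> p) x) = (\<Oplus>\<^sub>bK m\<in>{..n}. g p m)" if p: "p \<le> n" for p
   unfolding ex(2)[OF \<theta> ls_ex(1)[OF f(1) x p]] unfolding \<theta>_def g_def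
   by (rule \<Delta>_PP[OF ls_ex(1)[OF f(1) x p] f(2,3), of p, unfolded le_add_diff_inverse2[OF p]])
  have 2: "ex \<chi> (n - m) (B.ls (ex \<omega> m) x) = (\<Oplus>\<^sub>bK p\<in>{..n}. g p m)" if m: "m \<le> n" for m
  proof -
   \<comment> \<open>To expand the functional \<omega>, the slice by the lift of \<chi> is moved to
     the other side, so that \<omega> gets evaluated at an element of known degree m.\<close>
   define y where "y = B.rs (ex \<chi> (n - m)) x"
   have y: "y\<in>F m" using ls_ex(2)[OF f(3) x, of "n - m"] m by (simp add: y_def)
   have "ex \<chi> (n - m) (B.ls (ex \<omega> m) x) = ex \<omega> m y" unfolding y_def by (rule B.ls_rs[OF ex(1)[OF \<omega>] ex(1)[OF f(3)] FC[OF x]])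
   also have "... = \<psi> (lsl C \<phi> (\<Delta> (cl m y)))" using ex(2)[OF \<omega> y] unfolding \<omega>_def .
   also have "... = (\<Oplus>\<^sub>bK p\<in>{..m}. ex \<psi> (m - p) (B.ls (ex \<phi> p) y))" using \<Delta>_PP[OF y f(1,2), of 0] by simp
   also have "... = (\<Oplus>\<^sub>bK p\<in>{..m}. g p m)"
   proof (rule v_finsum_cong[OF base_module gc])
    fix p assume "p\<in>{..m}"
    have "B.ls (ex \<phi> p) y = B.rs (ex \<chi> (n - m)) (B.ls (ex \<phi> p) x)" unfolding y_def
     by (rule B.ls_rs_comm[OF ex(1)[OF f(1)] ex(1)[OF f(3)] FC[OF x], symmetric])
    thus "ex \<psi> (m - p) (B.ls (ex \<phi> p) y) = g p m"
     using \<open>p\<in>{..m}\<close> B.ls_rs[OF ex(1)[OF f(2)] ex(1)[OF f(3)] B.ls_closed[OF ex(1)[OF f(1)] FC[OF x]]] by (simp add: g_def)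
   qed
   also have "... = (\<Oplus>\<^sub>bK p\<in>{..n}. g p m)"
    by (rule v_finsum_mono[OF base_module _ _ _ gc, symmetric]) (use m in "auto simp: g_def")
   finally show ?thesis .
  qed
  have "\<theta> (lsl C \<phi> (\<Delta> (cl n x))) = (\<Oplus>\<^sub>bK p\<in>{..n}. ex \<theta> (n - p) (B.ls (ex \<phi> p) x))" using \<Delta>_PP[OF x f(1) \<theta>, of 0] by simp
  also have "... = (\<Oplus>\<^sub>bK p\<in>{..n}. \<Oplus>\<^sub>bK m\<in>{..n}. g p m)"
   by (rule v_finsum_cong[OF base_module v_finsum_closed[OF base_module gc] 1]) simp
  also have "... = (\<Oplus>\<^sub>bK m\<in>{..n}. \<Oplus>\<^sub>bK p\<in>{..n}. g p m)" by (rule v_finsum_swap[OF base_module finite_atMost finite_atMost gc])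
  also have "... = (\<Oplus>\<^sub>bK m\<in>{..n}. ex \<chi> (n - m) (B.ls (ex \<omega> m) x))"
   by (rule v_finsum_cong[OF base_module, symmetric], use fnl_closed[OF ex(1)[OF f(3)] B.ls_closed[OF ex(1)[OF \<omega>] FC[OF x]]] 2 v_finsum_closed[OF base_module gc] in auto)
  also have "... = \<chi> (lsl C \<omega> (\<Delta> (cl n x)))" using \<Delta>_PP[OF x \<omega> f(3), of 0] by simp
  finally show "\<theta> (lsl C \<phi> (\<Delta> (cl n x))) = \<chi> (lsl C \<omega> (\<Delta> (cl n x)))" .
 qed
 thus "\<chi> (lsl C \<psi> (\<Delta> (lsl C \<phi> (\<Delta> u)))) = \<chi> (lsl C (%y. \<psi> (lsl C \<phi> (\<Delta> y))) (\<Delta> u))" unfolding \<omega>_def \<theta>_def .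
qed

lemma C_coalgebra: "coalgebra K C \<Delta> \<epsilon>"
proof (intro coalgebra.intro coalgebra_axioms.intro K.field_axioms Cm comult_C_lin counit_C_lin C_coassoc)
 have e: "counit B x\<in>|K|" if "x\<in>F i" for x i using fnl_closed[OF B.counit_linear FC[OF that]] .
 fix u assume u: "u\<in>|C|"
 show "tlift C (%a b. \<epsilon> a \<odot>\<^sub>C b) (\<Delta> u) = u"
 proof (rule \<Delta>_lift[OF lsl_bil[OF Bm Bm B.counit_linear] lsl_bil[OF Cm Cm counit_C_lin] _ lin_ident _ u])
  show "cl n (tlift B (%a b. counit B a \<odot>\<^sub>B b) (comult B x)) = cl n x" if "x\<in>F n" for n x
   using B.counit_left[OF FC[OF that]] by simp
  fix i j a b assume h: "a\<in>F i" "b\<in>F j"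
  have "counit B a \<odot>\<^sub>B b\<in>F j" by (rule F_smult[OF e[OF h(1)] h(2)])
  thus "counit B a \<odot>\<^sub>B b\<in>F (i + j) & \<epsilon> (cl i a) \<odot>\<^sub>C cl j b = cl (i + j) (counit B a \<odot>\<^sub>B b)"
   using h e[OF h(1)] F_Bp[of "counit B a \<odot>\<^sub>B b" j "i + j"] B.F_mono[of j "i + j"] by (auto simp: counit_cl cl_smult cl_closed Cm cl_zero)
 qed
 show "tlift C (%a b. \<epsilon> b \<odot>\<^sub>C a) (\<Delta> u) = u"
 proof (rule \<Delta>_lift[OF rsl_bil[OF Bm Bm B.counit_linear] rsl_bil[OF Cm Cm counit_C_lin] _ lin_ident _ u])
  show "cl n (tlift B (%a b. counit B b \<odot>\<^sub>B a) (comult B x)) = cl n x" if "x\<in>F n" for n x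
   using B.counit_right[OF FC[OF that]] by simp
  fix i j a b assume h: "a\<in>F i" "b\<in>F j"
  have "counit B b \<odot>\<^sub>B a\<in>F i" by (rule F_smult[OF e[OF h(2)] h(1)])
  thus "counit B b \<odot>\<^sub>B a\<in>F (i + j) & \<epsilon> (cl j b) \<odot>\<^sub>C cl i a = cl (i + j) (counit B b \<odot>\<^sub>B a)"
   using h e[OF h(2)] F_Bp[of "counit B b \<odot>\<^sub>B a" i "i + j"] B.F_mono[of i "i + j"] by (auto simp: counit_cl cl_smult cl_closed Cm cl_zero)
 qed
qed

lemma GT_op:
 assumes OB: "bil BB BB BB OB" and OC: "bil CC CC CC OC"
  and p: "!!p q p' q' a b c d. a\<in>F p ==> b\<in>F q ==> c\<in>F p' ==> d\<in>F q' ==>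
   GT (p + q + (p' + q')) (OB (tB a b) (tB c d)) (OC (tC (cl p a) (cl q b)) (tC (cl p' c) (cl q' d)))"
  and t: "GT i t s" "GT j t' s'"
 shows "GT (i + j) (OB t t') (OC s s')"
 using t(1)
proof (induction rule: GT.induct)
 case zero
 note c = GT_closed[OF t(2)]
 thus ?case using lin_zero[OF bil_left[OF OB] BT BT] lin_zero[OF bil_left[OF OC] CT CT] GT.zero by simp
next
 case (step t s d a b)
 have "GT (i + j) (OB (tB a b) t') (OC (tC (cl d a) (cl (i - d) b)) s')"
  using t(2)
 proof (induction rule: GT.induct)
  case zero
  show ?case using lin_zero[OF bil_right[OF OB tB_closed[OF step(3,4)]] BT BT] lin_zero[OF bil_right[OF OC tC_closed[OF step(3,4)]] CT CT] GT.zero by simp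
 next
  case (step t' s' d' a' b')
  note c = GT_closed[OF step(1)] tB_closed[OF step(3,4)] tC_closed[OF step(3,4)]
  show ?case using GT_add[OF p[OF \<open>a\<in>F d\<close> \<open>b\<in>F (i - d)\<close> step(3,4)], of "OB (tB a b) t'" "OC (tC (cl d a) (cl (i - d) b)) s'"] step(2,5) \<open>d \<le> i\<close> c
   by (simp add: bil_add_r[OF OB tB_closed[OF \<open>a\<in>F d\<close> \<open>b\<in>F (i - d)\<close>]] bil_add_r[OF OC tC_closed[OF \<open>a\<in>F d\<close> \<open>b\<in>F (i - d)\<close>]])
 qed
 thus ?case using GT_add[OF _ step(5)] GT_closed[OF step(1)] GT_closed[OF t(2)] tB_closed[OF step(3,4)] tC_closed[OF step(3,4)]
  by (simp add: bil_add_l[OF OB] bil_add_l[OF OC])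
qed

lemma GT_tens': "a\<in>F i ==> b\<in>F j ==> n = i + j ==> GT n (tB a b) (tC (cl i a) (cl j b))"
 using GT_tens[of i n a b] by simp

text \<open>The common reason why \<Delta> respects product and bracket on gr B: it does so on B,
  and on pure tensors the tensor operation commutes with passing to classes.\<close>

lemma \<Delta>_op:
 assumes f: "filtered f" and OB: "bil BB BB BB OB" and OC: "bil CC CC CC OC"
  and D: "!!x y. x\<in>|B| ==> y\<in>|B| ==> comult B (f x y) = OB (comult B x) (comult B y)"
  and p: "!!p q p' q' a b c d. a\<in>F p ==> b\<in>F q ==> c\<in>F p' ==> d\<in>F q' ==>
   GT (p + q + (p' + q')) (OB (tB a b) (tB c d)) (OC (tC (cl p a) (cl q b)) (tC (cl p' c) (cl q' d)))"
  and uv: "u\<in>|C|" "v\<in>|C|"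
 shows "\<Delta> (gr_op K B f u v) = OC (\<Delta> u) (\<Delta> v)"
proof (rule gr_bil_eq[OF bil_post[OF gr_op_bil[OF f] comult_C_lin] bil_comp[OF OC comult_C_lin comult_C_lin] _ uv])
 fix i j x y assume xy: "x\<in>F i" "y\<in>F j"
 have d: "comult B (f x y) = OB (comult B x) (comult B y)" by (rule D[OF FC[OF xy(1)] FC[OF xy(2)]])
 show "\<Delta> (gr_op K B f (cl i x) (cl j y)) = OC (\<Delta> (cl i x)) (\<Delta> (cl j y))"
  unfolding gr_op_cl[OF f xy]
  by (rule GT_unique[OF comult_cl[OF f_F[OF f xy]] GT_op[OF OB OC p comult_cl[OF xy(1)] comult_cl[OF xy(2)]]])
   (assumption+, unfold d, rule refl)
qed

lemma C_hopf: "poisson_hopf_algebra K C"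
proof (intro poisson_hopf_algebra.intro C_poisson C_coalgebra poisson_hopf_algebra_axioms.intro antipode_C_lin)
 have m: "mult C = gr_op K B (mult B)" and b: "bracket C = gr_op K B (bracket B)" by (simp_all add: C_simps A_simps)
 show "\<Delta>\<in>ring_hom C (tensor_alg K C C)"
 proof (rule ring_hom_memI)
  show "\<Delta> (u *\<^sub>C v) = \<Delta> u *\<^sub>(tensor_alg K C C) \<Delta> v" if "u\<in>|C|" "v\<in>|C|" for u v
   unfolding m
   by (rule \<Delta>_op[OF mult_filtered tensor_mult_bil[OF BA BA] tensor_mult_bil[OF C_algebra C_algebra] comult_mult _ that])
    (auto simp: tensor_mult_tens[OF BA BA] tensor_mult_tens[OF C_algebra C_algebra] FC cl_closed cl_mult intro!: GT_tens' F_mult)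
  have "GT 0 (comult B 1\<^sub>B) (tC (cl 0 1\<^sub>B) (cl 0 1\<^sub>B))" unfolding comult_one by (rule GT_tens'[OF one_F0 one_F0]) simp
  thus "\<Delta> 1\<^sub>C = 1\<^sub>(tensor_alg K C C)" using GT_unique[OF comult_cl[OF one_F0]] by (simp add: C_one)
 qed (use \<Delta>_closed lin_add[OF comult_C_lin] in auto)
 show "\<epsilon>\<in>ring_hom C K"
 proof (rule ring_hom_memI)
  show "\<epsilon> (u *\<^sub>C v) = \<epsilon> u \<otimes> \<epsilon> v" if "u\<in>|C|" "v\<in>|C|" for u v
  proof (rule gr_bil_eq[OF bil_post[OF C_mult_bil counit_C_lin] _ _ that])
   show "bil C C bK (%u v. \<epsilon> u \<otimes> \<epsilon> v)"
    using fnl_closed[OF counit_C_lin] by (intro k_bilinearI) (auto simp: fnl_add[OF counit_C_lin] fnl_smult[OF counit_C_lin] K.l_distr K.r_distr K.m_ac)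
   show "\<epsilon> (cl i x *\<^sub>C cl j y) = \<epsilon> (cl i x) \<otimes> \<epsilon> (cl j y)" if "x\<in>F i" "y\<in>F j" for i j x y
    using that F_mult[OF that] fnl_closed[OF B.counit_linear] by (auto simp: cl_mult counit_cl counit_mult FC)
  qed
  show "\<epsilon> 1\<^sub>C = \<one>" by (simp add: C_one counit_cl one_F0 counit_one)
 qed (use fnl_closed[OF counit_C_lin] fnl_add[OF counit_C_lin] in auto)
 show "\<Delta> {u, v}\<^sub>C = tensor_bracket K C (\<Delta> u) (\<Delta> v)" if "u\<in>|C|" "v\<in>|C|" for u v
  unfolding b
 proof (rule \<Delta>_op[OF bracket_filtered bracket_tens_bil(1)[OF PA] bracket_tens_bil(1)[OF C_poisson] poisson_hopf_algebra.comult_bracket[OF PH] _ that])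
  fix p q p' q' a b c d assume h: "a\<in>F p" "b\<in>F q" "c\<in>F p'" "d\<in>F q'"
  show "GT (p + q + (p' + q')) (tensor_bracket K B (tB a b) (tB c d)) (tensor_bracket K C (tC (cl p a) (cl q b)) (tC (cl p' c) (cl q' d)))"
   using h by (auto simp: bracket_tens_bil(2)[OF PA] bracket_tens_bil(2)[OF C_poisson] FC cl_closed cl_mult cl_bracket intro!: GT_add GT_tens' F_mult F_bracket)
 qed
 fix u assume u: "u\<in>|C|"
 have h: "lin C C (%u. \<epsilon> u \<odot>\<^sub>C 1\<^sub>C)"
  by (rule bil_left[OF lsl_bil[OF Cm Cm counit_C_lin]]) (simp add: C_algebra)
 \<comment> \<open>In positive degree both sides vanish: a multiple of 1 lies in F 0 and has zero
   class there.\<close>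
 have e: "cl n (counit B x \<odot>\<^sub>B 1\<^sub>B) = \<epsilon> (cl n x) \<odot>\<^sub>C 1\<^sub>C" if x: "x\<in>F n" for n x
 proof -
  note k = fnl_closed[OF B.counit_linear FC[OF x]]
  show ?thesis using x k F_smult[OF k one_F0] F_Bp[OF F_smult[OF k one_F0], of n] cl_closed[OF one_F0]
   by (cases "n = 0") (simp_all add: counit_cl C_one cl_smult one_F0 cl_zero Cm)
 qed
 show "tlift C (%a b. S a *\<^sub>C b) (\<Delta> u) = \<epsilon> u \<odot>\<^sub>C 1\<^sub>C"
  by (rule \<Delta>_lift[OF S_bil bil_comp[OF C_mult_bil antipode_C_lin lin_ident] _ h _ u])
   (simp_all add: antipode_cl cl_mult F_mult F_antipode poisson_hopf_algebra.antipode_left[OF PH] FC e)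
 show "tlift C (%a b. a *\<^sub>C S b) (\<Delta> u) = \<epsilon> u \<odot>\<^sub>C 1\<^sub>C"
  by (rule \<Delta>_lift[OF bil_comp[OF alg_bilinear[OF BA] lin_ident S_lin] bil_comp[OF C_mult_bil lin_ident antipode_C_lin] _ h _ u])
   (simp_all add: antipode_cl cl_mult F_mult F_antipode poisson_hopf_algebra.antipode_right[OF PH] FC e)
qed

lemma gr_part_eq: "gr_part K B n = cl n ` F n"
proof
 show "gr_part K B n\<subseteq>cl n ` F n"
 proof
  fix u assume u: "u\<in>gr_part K B n"
  hence "part n u = u" by (intro ext) (auto simp: gr_part_def part_def)
  thus "u\<in>cl n ` F n" using part_cl[of u n] u by (auto simp: gr_part_def)
 qed
 show "cl n ` F n\<subseteq>gr_part K B n" by (auto simp: gr_part_def cl_closed) (auto simp: gr_class_def)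
qed

theorem gr_graded: "graded_poisson_hopf_algebra K C (gr_part K B)"
proof (intro graded_poisson_hopf_algebra.intro C_hopf graded_poisson_hopf_algebra_axioms.intro)
 fix u assume u: "u\<in>|C|"
 have uniq: "f = (%n. part n u)" if f: "\<forall>n. f n\<in>gr_part K B n" "finite {n. f n ~= 0\<^sub>C}" "u = (\<Oplus>\<^sub>C n\<in>{n. f n ~= 0\<^sub>C}. f n)" for f
 proof (intro ext)
  fix n m
  have fc: "f n\<in>|C|" "m ~= n ==> f n m = Bp m" for n m using f(1) by (auto simp: gr_part_def)
  have "u n = (if n\<in>{n. f n ~= 0\<^sub>C} then f n n else Bp n)"
   by (subst f(3), rule part_finsum[OF f(2)]) (use fc in auto)
  hence "u n = f n n" by (auto simp: C_simps A_simps split: if_splits)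
  thus "f n m = part n u m" using fc(2)[of m n] by (cases "m = n") (simp_all add: part_def)
 qed
 have p: "part n u\<in>gr_part K B n" for n using part_closed[OF u] by (auto simp: gr_part_def part_def)
 show "\<exists>!f. (\<forall>n. f n\<in>gr_part K B n) & finite {n. f n ~= 0\<^sub>C} & u = (\<Oplus>\<^sub>C n\<in>{n. f n ~= 0\<^sub>C}. f n)"
 proof (rule ex1I[of _ "%n. part n u"])
  have e: "{n. part n u ~= 0\<^sub>C} = {n. u n ~= Bp n}" by (simp only: part_zero)
  show "(\<forall>n. part n u\<in>gr_part K B n) & finite {n. part n u ~= 0\<^sub>C} & u = (\<Oplus>\<^sub>C n\<in>{n. part n u ~= 0\<^sub>C}. part n u)"
   unfolding e using p supp_finite[OF u] part_sum[OF u supp_finite[OF u] subset_refl] by blast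
 qed (use uniq in blast)
next
 fix n u assume u: "u\<in>gr_part K B n"
 then obtain x where x: "x\<in>F n" "u = cl n x" by (auto simp: gr_part_eq)
 have "s\<in>span CC (\<Union>i\<le>n. tsub C C (gr_part K B i) (gr_part K B (n - i)))" if "GT n t s" for t s
 proof -
  have sc: "(\<Union>i\<le>n. tsub C C (gr_part K B i) (gr_part K B (n - i)))\<subseteq>|CC|"
   unfolding gr_part_eq using tensor_sub_carrier[OF Cm Cm] sub_image[OF cl_lin Fmod Cm sub_full[OF Fmod]] by fastforce
  show ?thesis using that
  proof (induction rule: GT.induct)
   case zero
   show ?case by (rule sub_zero[OF CT span_sub[OF CT sc]])
  next
   case (step t s d a b)
   have "tC (cl d a) (cl (n - d) b)\<in>tsub C C (gr_part K B d) (gr_part K B (n - d))"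
    by (rule tensor_sub_tens[OF Cm Cm]) (use step in "auto simp: gr_part_eq")
   thus ?case using step(2) by (intro sub_add[OF CT span_sub[OF CT sc] _ step(5)] span_incl) blast
  qed
 qed
 thus "\<Delta> u\<in>span CC (\<Union>i\<le>n. tsub C C (gr_part K B i) (gr_part K B (n - i)))"
  using comult_cl[OF x(1)] x(2) by blast
qed (auto simp: gr_part_eq sub_image[OF cl_lin Fmod Cm sub_full[OF Fmod], simplified] C_one one_F0 cl_mult F_mult cl_bracket F_bracket
  counit_cl antipode_cl F_antipode)

end

context base
begin

text \<open>Functionals on subspaces extend to the whole spaces, so a tensor over U and V is
  determined by its image. Thus the comultiplication of \<open>hopf_restrict\<close>, defined by a
  unique preimage, is determined.\<close>

lemma tensor_sub_inj:
 assumes M: "vs M" "sub U M" and N: "vs N" "sub V N"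
  and u: "u\<in>|TS (M\<lparr>carrier := U\<rparr>) (N\<lparr>carrier := V\<rparr>)|" "v\<in>|TS (M\<lparr>carrier := U\<rparr>) (N\<lparr>carrier := V\<rparr>)|"
  and e: "tmap M N (%a. a) (%b. b) u = tmap M N (%a. a) (%b. b) v"
 shows "u = v"
proof -
 let ?M = "M\<lparr>carrier := U\<rparr>" and ?N = "N\<lparr>carrier := V\<rparr>"
 note m = sub_module[OF M] sub_module[OF N]
 have l: "lin ?M M (%a. a)" "lin ?N N (%b. b)"
  by (rule lin_id; use sub_subset[OF M] sub_subset[OF N] in simp)+
 show ?thesis
 proof (rule tensor_eqI2[OF m u])
  fix \<phi> \<psi> assume f: "fnl ?M \<phi>" "fnl ?N \<psi>"
  obtain \<phi>' where \<phi>': "fnl M \<phi>'" "!!x. x\<in>U ==> \<phi>' x = \<phi> x" by (rule lin_extension[OF M(1) base_module M(2) f(1)]) (rule that)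
  obtain \<psi>' where \<psi>': "fnl N \<psi>'" "!!x. x\<in>V ==> \<psi>' x = \<psi> x" by (rule lin_extension[OF N(1) base_module N(2) f(2)]) (rule that)
  have "\<psi> (lsl ?N \<phi> w) = \<psi>' (lsl N \<phi>' (tmap M N (%a. a) (%b. b) w))" if "w\<in>|TS ?M ?N|" for w
  proof (rule lin_eq_tensor[OF m lin_comp[OF lsl_lin[OF m f(1)] f(2)]
     lin_comp[OF tensor_map_lin[OF m M(1) N(1) l] lin_comp[OF lsl_lin[OF M(1) N(1) \<phi>'(1)] \<psi>'(1)]] _ that])
   fix x y assume xy: "x\<in>|?M|" "y\<in>|?N|"
   hence c: "x\<in>|M|" "y\<in>|N|" using sub_subset[OF M] sub_subset[OF N] by auto
   show "\<psi> (lsl ?N \<phi> (ts ?M ?N x y)) = \<psi>' (lsl N \<phi>' (tmap M N (%a. a) (%b. b) (ts ?M ?N x y)))"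
    using xy fnl_smult[OF f(2) fnl_closed[OF f(1) xy(1)] xy(2)] fnl_closed[OF f(1) xy(1)] c
    by (simp add: lsl_tens[OF m f(1)] tensor_map_tens[OF m M(1) N(1) l] lsl_tens[OF M(1) N(1) \<phi>'(1)] fnl_smult[OF \<psi>'(1)] \<phi>'(2) \<psi>'(2))
  qed
  thus "\<psi> (lsl ?N \<phi> u) = \<psi> (lsl ?N \<phi> v)" using u e by simp
 qed
qed

end

subsection \<open>The pieces of the associated graded algebra\<close>

context pointed_pha
begin

sublocale Cc: coalg K C \<Delta> \<epsilon>
 using C_coalgebra base_axioms by (simp add: coalg_def)

abbreviation "G \<equiv> gr_group K B"
abbreviation "H \<equiv> gr_kG K B"
abbreviation "R \<equiv> gr_R K B"
abbreviation "HC \<equiv> span C G"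
abbreviation "E \<equiv> C\<lparr>carrier := HC\<rparr>"
abbreviation "\<pi> \<equiv> gr_proj K B"

lemma GL_F0: "g\<in>GL ==> g\<in>F 0" unfolding F0 by (rule span_incl)
lemma G_C: "g\<in>G ==> g\<in>|C|" unfolding gr_group_def using cl_closed[OF GL_F0] by auto
lemma G_sub: "G\<subseteq>|C|" using G_C by auto
lemmas HC_sub = span_sub[OF Cm G_sub]
lemma HC_C: "x\<in>HC ==> x\<in>|C|" by (rule sub_carrier[OF Cm HC_sub])
lemma G_HC: "g\<in>G ==> g\<in>HC" by (rule span_incl)

lemma G_GL: "g\<in>G ==> g\<in>Cc.GL"
proof -
 assume "g\<in>G"
 then obtain t where t: "t\<in>GL" "g = cl 0 t" unfolding gr_group_def by blast
 have "GT 0 (comult B t) (tC g g)" unfolding t(2) B.GL_D(2)[OF t(1)] by (rule GT_tens'[OF GL_F0[OF t(1)] GL_F0[OF t(1)]]) simp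
 hence "\<Delta> g = tC g g" unfolding t(2) using GT_unique[OF comult_cl[OF GL_F0[OF t(1)]]] by simp
 thus ?thesis using t GL_F0[OF t(1)] by (simp add: grouplikes_def cl_closed counit_cl)
qed

lemma G_one: "1\<^sub>C\<in>G" unfolding C_one gr_group_def using GL_one by blast
lemma G_mult: "g\<in>G ==> t\<in>G ==> g *\<^sub>C t\<in>G"
 unfolding gr_group_def using GL_mult GL_F0 by (auto simp: cl_mult)
lemma G_bracket: "g\<in>G ==> t\<in>G ==> {g, t}\<^sub>C = 0\<^sub>C"
 unfolding gr_group_def using GL_F0 comm by (auto simp: cl_bracket cl_0)
lemma G_inv:
 assumes "g\<in>G"
 shows "inv\<^bsub>C\<^esub> g\<in>G" "g *\<^sub>C inv\<^bsub>C\<^esub> g = 1\<^sub>C"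
proof -
 interpret C: ring C by (rule alg_ring[OF C_algebra])
 obtain t where t: "t\<in>GL" "g = cl 0 t" using assms unfolding gr_group_def by blast
 note s = GL_S[OF t(1)]
 have 1: "cl 0 (antipode B t) *\<^sub>C g = 1\<^sub>C" using t s GL_F0 by (simp add: cl_mult C_one)
 note c = cl_closed[OF GL_F0[OF s(2)]] G_C[OF assms]
 have 2: "g *\<^sub>C cl 0 (antipode B t) = 1\<^sub>C" using 1 C_comm[OF c] by simp
 have "inv\<^bsub>C\<^esub> g = cl 0 (antipode B t)" by (rule C.inv_char[OF c(2,1) 2 1])
 thus "inv\<^bsub>C\<^esub> g\<in>G" "g *\<^sub>C inv\<^bsub>C\<^esub> g = 1\<^sub>C" using 2 s(2) unfolding gr_group_def by auto
qed

lemma \<pi>_eq: "\<pi> u = part 0 u" by (intro ext) (simp add: gr_proj_def part_def)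
lemma cl0_HC:
 assumes "x\<in>F 0"
 shows "cl 0 x\<in>HC"
 using assms[unfolded F0] Bm GL_carrier
proof (induction rule: span_induct)
 case zero
 show ?case using sub_zero[OF Cm HC_sub] by (simp add: cl_0)
next
 case (base g)
 thus ?case by (intro G_HC) (simp add: gr_group_def)
next
 case (add x y)
 thus ?case using sub_add[OF Cm HC_sub] by (simp add: cl_add F0)
next
 case (smult k x)
 thus ?case using sub_smult[OF Cm HC_sub] by (simp add: cl_smult F0)
qed
lemma \<pi>_lin: "lin C C \<pi>"
proof (rule k_linearI)
 have z: "Bp m +\<^sub>(Q m) Bp m = Bp m" "k\<in>|K| ==> k \<odot>\<^sub>(Q m) Bp m = Bp m" for m k
  using v_zero(1)[OF Qm v_zero_closed[OF Qm]] v_smult_zero(2)[OF Qm] by (auto simp: Q_zero)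
 show "\<pi> u\<in>|C|" if "u\<in>|C|" for u unfolding \<pi>_eq by (rule part_closed[OF that])
 show "\<pi> (u +\<^sub>C v) = \<pi> u +\<^sub>C \<pi> v" for u v by (intro ext) (simp add: gr_proj_def C_simps A_simps z)
 show "\<pi> (k \<odot>\<^sub>C u) = k \<odot>\<^sub>C \<pi> u" if "k\<in>|K|" for k u using that by (intro ext) (simp add: gr_proj_def C_simps A_simps z)
qed
lemmas \<pi>_closed = lin_closed[OF \<pi>_lin]
lemma \<pi>_cl: "x\<in>F n ==> \<pi> (cl n x) = (if n = 0 then cl n x else 0\<^sub>C)"
 by (intro ext) (simp add: gr_proj_def gr_class_def C_simps A_simps)
lemma \<pi>_HC: "u\<in>|C| ==> \<pi> u\<in>HC"
 using part_cl[of u 0] cl0_HC unfolding \<pi>_eq by auto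
lemma \<pi>_id: "u\<in>HC ==> \<pi> u = u"
 by (rule lin_eq_span[OF \<pi>_lin lin_ident Cm Cm G_sub]) (auto simp: gr_group_def \<pi>_cl GL_F0)
lemma \<pi>_mult:
 assumes "u\<in>|C|" "v\<in>|C|"
 shows "\<pi> (u *\<^sub>C v) = \<pi> u *\<^sub>C \<pi> v"
 by (rule gr_bil_eq[OF bil_post[OF C_mult_bil \<pi>_lin] bil_comp[OF C_mult_bil \<pi>_lin \<pi>_lin] _ assms])
  (auto simp: cl_mult \<pi>_cl F_mult cl_closed C_algebra)
text \<open>The degree 0 part of a bracket comes from degree 0 alone, and F 0, spanned by
  group-likes, has zero bracket. So \<pi> is a Poisson map onto kG.\<close>

lemma \<pi>_bracket:
 assumes "u\<in>|C|" "v\<in>|C|"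
 shows "\<pi> {u, v}\<^sub>C = 0\<^sub>C"
proof -
 have 0: "{x, y}\<^sub>B = 0\<^sub>B" if "x\<in>F 0" "y\<in>F 0" for x y
  using bil_span[OF pa_bilinear[OF PA] Bm GL_carrier Bm GL_carrier Bm sub_null[OF Bm], of x y] that comm unfolding F0 by simp
 show ?thesis
  by (rule gr_bil_eq[OF bil_post[OF C_bracket_bil \<pi>_lin], where g = "%u v. 0\<^sub>C", OF _ _ assms])
   (use 0 in "auto simp: k_bilinear_def lin_null[OF Cm] cl_bracket \<pi>_cl F_bracket cl_0")
qed

lemma counit_\<pi>: "u\<in>|C| ==> \<epsilon> (\<pi> u) = \<epsilon> u"
 by (rule gr_lin_eq[OF lin_comp[OF \<pi>_lin counit_C_lin] counit_C_lin])
  (auto simp: \<pi>_cl counit_cl fnl_zero[OF counit_C_lin Cm])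

section \<open>The grading of C by G\<close>

abbreviation "mp \<equiv> tmap C C (%a. a) \<pi>"
lemmas mp_lin = tensor_map_lin[OF Cm Cm Cm Cm lin_ident \<pi>_lin] and mp_tens = tensor_map_tens[OF Cm Cm Cm Cm lin_ident \<pi>_lin]

text \<open>The right kG-coaction on C, written in C \<otimes> C so that no change of record is
  involved. A coaction of a group algebra amounts to a grading by the group.\<close>

definition \<rho> :: "(nat => 'b set) => ((nat => 'b set) \<times> (nat => 'b set) => 'k) set" where "\<rho> x = mp (\<Delta> x)"
lemma \<rho>_lin: "lin C CC \<rho>" unfolding \<rho>_def by (rule lin_comp[OF comult_C_lin mp_lin])

text \<open>The component of degree g for the coaction; degree 1 is R, and degree g is R g.\<close>

definition Cg :: "(nat => 'b set) => (nat => 'b set) set" where "Cg g = {x\<in>carrier C. \<rho> x = tC x g}"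

lemma CgD: "x\<in>Cg g ==> x\<in>|C|" "x\<in>Cg g ==> \<rho> x = tC x g" by (auto simp: Cg_def)

text \<open>OP and OP' may differ: \<pi> kills brackets, so id \<otimes> \<pi> turns the bracket of
  C \<otimes> C into {-, -} on the first leg and the product on the second.\<close>

lemma mp_op:
 assumes OP: "bil CC CC CC OP" and OP': "bil CC CC CC OP'"
  and p: "!!a b c d. \<lbrakk>a\<in>|C|; b\<in>|C|; c\<in>|C|; d\<in>|C|\<rbrakk> \<Longrightarrow> mp (OP (tC a b) (tC c d)) = OP' (tC a (\<pi> b)) (tC c (\<pi> d))"
  and uv: "u\<in>|CC|" "v\<in>|CC|"
 shows "mp (OP u v) = OP' (mp u) (mp v)"
proof -
 note b = bil_post[OF OP mp_lin] and b' = bil_comp[OF OP' mp_lin mp_lin] and t = tens_closed[OF Cm Cm]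
 have "mp (OP (tC a b) v) = OP' (mp (tC a b)) (mp v)" if "a\<in>|C|" "b\<in>|C|" for a b
  by (rule lin_eq_tensor[OF Cm Cm bil_right[OF \<open>bil CC CC CC (%x y. mp (OP x y))\<close>] bil_right[OF b'] _ uv(2)])
   (use b that in "auto simp: p mp_tens t")
 thus ?thesis
  by (rule lin_eq_tensor[OF Cm Cm bil_left[OF b uv(2)] bil_left[OF b' uv(2)] _ uv(1)])
qed

lemma Cg_mult: "x\<in>Cg g ==> y\<in>Cg t ==> g\<in>G ==> t\<in>G ==> x *\<^sub>C y\<in>Cg (g *\<^sub>C t)"
proof -
 assume h: "x\<in>Cg g" "y\<in>Cg t" "g\<in>G" "t\<in>G"
 note c = CgD(1)[OF h(1)] CgD(1)[OF h(2)] G_C[OF h(3)] G_C[OF h(4)]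
 note tm = tensor_mult_tens[OF C_algebra C_algebra] and tb = tensor_mult_bil[OF C_algebra C_algebra]
 have "\<rho> (x *\<^sub>C y) = mp (\<Delta> x *\<^sub>(tensor_alg K C C) \<Delta> y)"
  unfolding \<rho>_def ring_hom_mult[OF poisson_hopf_algebra.comult_hom[OF C_hopf] c(1,2)] ..
 also have "... = \<rho> x *\<^sub>(tensor_alg K C C) \<rho> y"
  unfolding \<rho>_def by (rule mp_op[OF tb tb _ \<Delta>_closed[OF c(1)] \<Delta>_closed[OF c(2)]]) (simp add: tm mp_tens \<pi>_mult \<pi>_closed C_algebra)
 also have "... = tC (x *\<^sub>C y) (g *\<^sub>C t)" using c by (simp add: CgD(2)[OF h(1)] CgD(2)[OF h(2)] tm)
 finally show ?thesis using c by (simp add: Cg_def C_algebra)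
qed

lemma Cg_bracket: "x\<in>Cg g ==> y\<in>Cg t ==> g\<in>G ==> t\<in>G ==> {x, y}\<^sub>C\<in>Cg (g *\<^sub>C t)"
proof -
 assume h: "x\<in>Cg g" "y\<in>Cg t" "g\<in>G" "t\<in>G"
 note c = CgD(1)[OF h(1)] CgD(1)[OF h(2)] G_C[OF h(3)] G_C[OF h(4)]
 let ?O = "tensor_lift2 CC (%a b c d. tC {a, c}\<^sub>C (b *\<^sub>C d))"
 note ob = tensor_op_bil[OF C_algebra C_algebra C_bracket_bil C_mult_bil]
 note bt = bracket_tens_bil[OF C_poisson]
 have "\<rho> {x, y}\<^sub>C = mp (tensor_bracket K C (\<Delta> x) (\<Delta> y))"
  unfolding \<rho>_def poisson_hopf_algebra.comult_bracket[OF C_hopf c(1,2)] ..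
 also have "... = ?O (\<rho> x) (\<rho> y)"
  unfolding \<rho>_def
 proof (rule mp_op[OF bt(1) ob(1) _ \<Delta>_closed[OF c(1)] \<Delta>_closed[OF c(2)]])
  fix a b c d assume a: "a\<in>|C|" "b\<in>|C|" "c\<in>|C|" "d\<in>|C|"
  hence "mp (tensor_bracket K C (tC a b) (tC c d)) = tC (a *\<^sub>C c) (\<pi> {b, d}\<^sub>C) +\<^sub>CC tC {a, c}\<^sub>C (\<pi> (b *\<^sub>C d))"
   by (simp add: bt(2) lin_add[OF mp_lin] mp_tens tens_closed[OF Cm Cm] C_algebra C_poisson)
  also have "... = tC {a, c}\<^sub>C (\<pi> b *\<^sub>C \<pi> d)"
   using a by (simp add: \<pi>_bracket \<pi>_mult tens_zero_r[OF Cm Cm] tens_closed[OF Cm Cm] CT C_algebra C_poisson \<pi>_closed)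
  also have "... = ?O (tC a (\<pi> b)) (tC c (\<pi> d))" by (rule ob(2)[symmetric]) (use a \<pi>_closed in auto)
  finally show "mp (tensor_bracket K C (tC a b) (tC c d)) = ?O (tC a (\<pi> b)) (tC c (\<pi> d))" .
 qed
 also have "... = tC {x, y}\<^sub>C (g *\<^sub>C t)" unfolding CgD(2)[OF h(1)] CgD(2)[OF h(2)] by (rule ob(2)[OF c(1,3,2,4)])
 finally show ?thesis using c by (simp add: Cg_def C_poisson)
qed

lemma Cg_G: "g\<in>G ==> g\<in>Cg g"
 using Cc.GL_D(2)[OF G_GL] by (simp add: Cg_def \<rho>_def G_C mp_tens \<pi>_id G_HC)

definition de :: "(nat => 'b set) => (nat => 'b set) => 'k"
 where "de g = (SOME \<phi>. fnl C \<phi> & \<phi> g = \<one> & (\<forall>h\<in>Cc.GL. h ~= g --> \<phi> h = \<zero>))"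
lemma de:
 assumes g: "g\<in>G"
 shows "fnl C (de g)" "t\<in>G ==> de g t = (if t = g then \<one> else \<zero>)"
proof -
 obtain \<phi> where \<phi>: "fnl C \<phi>" "\<phi> g = \<one>" "!!h. h\<in>Cc.GL ==> h ~= g ==> \<phi> h = \<zero>" by (rule Cc.GL_dual[OF G_GL[OF g]]) (rule that)
 have *: "fnl C (de g) & de g g = \<one> & (\<forall>h\<in>Cc.GL. h ~= g --> de g h = \<zero>)" unfolding de_def by (rule someI[of _ \<phi>]) (use \<phi> in blast)
 thus "fnl C (de g)" by blast
 show "t\<in>G ==> de g t = (if t = g then \<one> else \<zero>)" using * G_GL by auto
qed

text \<open>The coefficient of g in \<rho> c, extracted by a functional dual to g among the
  group-likes.\<close>

definition pr :: "(nat => 'b set) => (nat => 'b set) => (nat => 'b set)" where "pr g c = rsl C (de g) (\<rho> c)"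

lemma pr_lin: "g\<in>G ==> lin C C (pr g)"
 unfolding pr_def by (rule lin_comp[OF \<rho>_lin rsl_lin[OF Cm Cm de(1)]])
lemma pr_Cg: "g\<in>G ==> t\<in>G ==> x\<in>Cg g ==> pr t x = (if t = g then x else 0\<^sub>C)"
 using de(2)[of t g] by (auto simp: pr_def CgD rsl_tens[OF Cm Cm de(1)] G_C Cm)
lemma pr_rs: "g\<in>G ==> c\<in>|C| ==> pr g c = Cc.rs (%x. de g (\<pi> x)) c"
 unfolding pr_def \<rho>_def Cc.rs_def by (rule rsl_map[OF Cm Cm Cm Cm lin_ident \<pi>_lin de(1) \<Delta>_closed])

text \<open>The identity (\<pi> \<otimes> \<pi>) \<Delta> = \<Delta> \<pi> contracted in the second
  leg. In degree n > 0 every pure tensor of the coproduct has a leg of positive degree, which \<pi>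
  kills.\<close>

lemma \<pi>_slice:
 assumes \<psi>: "fnl C \<psi>" and u: "u\<in>|C|"
 shows "\<pi> (Cc.rs (%x. \<psi> (\<pi> x)) u) = Cc.rs \<psi> (\<pi> u)"
proof -
 note \<psi>' = lin_comp[OF \<pi>_lin \<psi>]
 note r = lin_comp[OF rsl_lin[OF Cm Cm \<psi>'] \<pi>_lin]
 have 1: "\<pi> (rsl C (%x. \<psi> (\<pi> x)) s) = (if n = 0 then rsl C \<psi> s else 0\<^sub>C)" if "GT n t s" for n t s
  using that
 proof (induction rule: GT.induct)
  case zero
  thus ?case using lin_zero[OF r CT Cm] lin_zero[OF rsl_lin[OF Cm Cm \<psi>] CT Cm] by simp
 next
  case (step t s d a b)
  note c = conjunct2[OF GT_closed[OF step(1)]] tC_closed[OF step(3,4)] cl_closed[OF step(3)] cl_closed[OF step(4)]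
  note k = fnl_closed[OF \<psi> c(4)]
  have "\<pi> (rsl C (%x. \<psi> (\<pi> x)) (tC (cl d a) (cl (n - d) b))) = \<psi> (\<pi> (cl (n - d) b)) \<odot>\<^sub>C \<pi> (cl d a)"
   using fnl_closed[OF \<psi>' c(4)] c by (simp add: rsl_tens[OF Cm Cm \<psi>'] lin_smult[OF \<pi>_lin])
  also have "... = (if n = 0 then rsl C \<psi> (tC (cl d a) (cl (n - d) b)) else 0\<^sub>C)"
   using step(2-4) c k fnl_zero[OF \<psi> Cm] by (auto simp: \<pi>_cl rsl_tens[OF Cm Cm \<psi>] Cm)
  finally show ?case using step(5) lin_add[OF r c(2,1)] lin_add[OF rsl_lin[OF Cm Cm \<psi>] c(2,1)] by (cases "n = 0") (simp_all del: diff_0_eq_0 add: Cm)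
 qed
 show ?thesis
  by (rule gr_lin_eq[OF lin_comp[OF Cc.rs_lin[OF \<psi>'] \<pi>_lin] lin_comp[OF \<pi>_lin Cc.rs_lin[OF \<psi>]] _ u])
   (use 1[OF comult_cl] in "simp add: Cc.rs_def \<pi>_cl lin_zero[OF comult_C_lin Cm CT] lin_zero[OF rsl_lin[OF Cm Cm \<psi>] CT Cm]")
qed

lemma rs_HC:
 assumes g: "g\<in>G" and z: "z\<in>HC"
 shows "Cc.rs (de g) z = de g z \<odot>\<^sub>C g"
proof (rule lin_eq_span[OF Cc.rs_lin[OF de(1)[OF g]] bil_left[OF lsl_bil[OF Cm Cm de(1)[OF g]] G_C[OF g]] Cm Cm G_sub _ z])
 show "Cc.rs (de g) s = de g s \<odot>\<^sub>C g" if "s\<in>G" for s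
  using that g by (simp add: Cc.GL_slices(2)[OF G_GL de(1)] de(2) G_C Cm)
qed

text \<open>By \<open>comult_rs\<close> the coproduct of a slice is sliced in its second leg. There
  \<open>\<pi>_slice\<close> brings the slice into kG, where \<open>rs_HC\<close> leaves only a
  multiple of g.\<close>

lemma pr_closed: "g\<in>G ==> c\<in>|C| ==> pr g c\<in>Cg g"
proof -
 assume g: "g\<in>G" and c: "c\<in>|C|"
 note e = lin_comp[OF \<pi>_lin de(1)[OF g]]
 note p = lin_closed[OF pr_lin[OF g] c]
 have "\<rho> (pr g c) = tmap C C (%a. a) (%y. \<pi> (Cc.rs (%x. de g (\<pi> x)) y)) (\<Delta> c)"
  unfolding \<rho>_def pr_rs[OF g c] Cc.comult_rs[OF e c]
  by (rule lin_eq_tensor[OF Cm Cm lin_comp[OF tensor_map_lin[OF Cm Cm Cm Cm lin_ident Cc.rs_lin[OF e]] mp_lin]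
     tensor_map_lin[OF Cm Cm Cm Cm lin_ident lin_comp[OF Cc.rs_lin[OF e] \<pi>_lin]] _ \<Delta>_closed[OF c]])
   (simp add: tensor_map_tens[OF Cm Cm Cm Cm lin_ident Cc.rs_lin[OF e]] mp_tens Cc.rs_closed[OF e] tensor_map_tens[OF Cm Cm Cm Cm lin_ident lin_comp[OF Cc.rs_lin[OF e] \<pi>_lin]])
 also have "... = tC (rsl C (%x. de g (\<pi> x)) (\<Delta> c)) g"
 proof (rule lin_eq_tensor[OF Cm Cm tensor_map_lin[OF Cm Cm Cm Cm lin_ident lin_comp[OF Cc.rs_lin[OF e] \<pi>_lin]]
     lin_comp[OF rsl_lin[OF Cm Cm e] tens_lin_l[OF Cm Cm G_C[OF g]]] _ \<Delta>_closed[OF c]])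
  fix x y assume xy: "x\<in>|C|" "y\<in>|C|"
  thus "tmap C C (%a. a) (%y. \<pi> (Cc.rs (%x. de g (\<pi> x)) y)) (tC x y) = tC (rsl C (%x. de g (\<pi> x)) (tC x y)) g"
   using fnl_closed[OF e xy(2)] G_C[OF g]
   by (simp add: tensor_map_tens[OF Cm Cm Cm Cm lin_ident lin_comp[OF Cc.rs_lin[OF e] \<pi>_lin]] \<pi>_slice[OF de(1)[OF g]]
     rs_HC[OF g] \<pi>_HC rsl_tens[OF Cm Cm e] tens_smult_l[OF Cm Cm] tens_smult_r[OF Cm Cm])
 qed
 also have "... = tC (pr g c) g" unfolding pr_rs[OF g c] Cc.rs_def ..
 finally show ?thesis using p by (simp add: Cg_def)
qed

text \<open>\<rho> c lies in C \<otimes> kG and is a finite sum of terms d_h \<otimes> h. Dual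
  functionals identify d_h with \<open>pr h c\<close>, and the counit on the second leg returns c,
  since \<epsilon> \<pi> = \<epsilon>.\<close>

lemma pr_decomp:
 assumes c: "c\<in>|C|"
 shows "finite {g\<in>G. pr g c ~= 0\<^sub>C}" "c = (\<Oplus>\<^sub>C g\<in>{g\<in>G. pr g c ~= 0\<^sub>C}. pr g c)"
proof -
 have t: "\<rho> c\<in>tsub C C (carrier C) HC"
 proof -
  have "mp u\<in>tsub C C (carrier C) HC" if "u\<in>|CC|" for u
   using that
  proof (induction rule: tensor_induct[OF Cm Cm, consumes 1, case_names tens add])
   case (tens x y)
   thus ?case using \<pi>_HC by (simp add: mp_tens tensor_sub_tens[OF Cm Cm])
  next
   case (add u v)
   thus ?case using sub_add[OF CT tensor_sub_sub[OF Cm Cm sub_full[OF Cm] HC_sub]] by (simp add: lin_add[OF mp_lin])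
  qed
  thus ?thesis unfolding \<rho>_def using \<Delta>_closed[OF c] by blast
 qed
 obtain X d where X': "finite X & X\<subseteq>G & (\<forall>h. d h\<in>carrier C) & \<rho> c = (\<Oplus>\<^sub>CC h\<in>X. tC (d h) h)"
  using tensor_normal_form[OF Cm Cm G_sub sub_full[OF Cm] t] by (elim exE)
 hence X: "finite X" "X\<subseteq>G" "!!h. d h\<in>|C|" "\<rho> c = (\<Oplus>\<^sub>CC h\<in>X. tC (d h) h)" by auto
 have XC: "h\<in>|C|" if "h\<in>X" for h using that X(2) G_C by auto
 have tc: "tC (d h) h\<in>|CC|" if "h\<in>X" for h using tens_closed[OF Cm Cm X(3) XC[OF that]] .
 have r: "rsl C \<phi> (\<rho> c) = (\<Oplus>\<^sub>C h\<in>X. \<phi> h \<odot>\<^sub>C d h)" if \<phi>: "fnl C \<phi>" for \<phi>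
 proof -
  have "rsl C \<phi> (\<rho> c) = (\<Oplus>\<^sub>C h\<in>X. rsl C \<phi> (tC (d h) h))" unfolding X(4) by (rule lin_finsum[OF rsl_lin[OF Cm Cm \<phi>] CT Cm X(1) tc])
  also have "... = (\<Oplus>\<^sub>C h\<in>X. \<phi> h \<odot>\<^sub>C d h)"
   by (rule v_finsum_cong[OF Cm v_smult_closed[OF Cm fnl_closed[OF \<phi> XC] X(3)]]) (simp_all add: rsl_tens[OF Cm Cm \<phi> X(3) XC])
  finally show ?thesis .
 qed
 have pX: "pr g c = (if g\<in>X then d g else 0\<^sub>C)" if g: "g\<in>G" for g
 proof (cases "g\<in>X")
  case True
  have "(\<Oplus>\<^sub>C h\<in>X. de g h \<odot>\<^sub>C d h) = de g g \<odot>\<^sub>C d g"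
  proof (rule v_finsum_single[OF Cm X(1) True])
   show "de g h \<odot>\<^sub>C d h = 0\<^sub>C" if "h\<in>X" "h ~= g" for h using de(2)[OF g, of h] that X(2,3) by (auto simp: Cm)
   show "de g g \<odot>\<^sub>C d g\<in>|C|" using de(2)[OF g g] X(3) by (simp add: Cm)
  qed
  thus ?thesis using True r[OF de(1)[OF g]] de(2)[OF g g] X(3) by (simp add: pr_def Cm)
 next
  case False
  have "de g h \<odot>\<^sub>C d h = 0\<^sub>C" if "h\<in>X" for h using de(2)[OF g, of h] that False X(2,3) by (auto simp: Cm)
  hence "(\<Oplus>\<^sub>C h\<in>X. de g h \<odot>\<^sub>C d h) = 0\<^sub>C" by (rule v_finsum_zero[OF Cm])
  thus ?thesis using False r[OF de(1)[OF g]] by (simp add: pr_def)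
 qed
 have s: "{g\<in>G. pr g c ~= 0\<^sub>C}\<subseteq>X" using pX by auto
 show f: "finite {g\<in>G. pr g c ~= 0\<^sub>C}" by (rule finite_subset[OF s X(1)])
 have "c = Cc.rs \<epsilon> c" by (simp add: Cc.rs_counit c)
 also have "... = rsl C (%x. \<epsilon> (\<pi> x)) (\<Delta> c)" unfolding Cc.rs_def rsl_def
  by (rule tensor_lift_cong[OF Cm Cm Cm rsl_bil[OF Cm Cm counit_C_lin] rsl_bil[OF Cm Cm lin_comp[OF \<pi>_lin counit_C_lin]] _ \<Delta>_closed[OF c]]) (simp add: counit_\<pi>)
 also have "... = rsl C \<epsilon> (\<rho> c)" unfolding \<rho>_def by (rule rsl_map[OF Cm Cm Cm Cm lin_ident \<pi>_lin counit_C_lin \<Delta>_closed[OF c], symmetric])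
 also have "... = (\<Oplus>\<^sub>C h\<in>X. pr h c)" unfolding r[OF counit_C_lin]
  by (rule v_finsum_cong[OF Cm]) (use X pX Cc.GL_D(3)[OF G_GL] in "auto simp: subset_iff Cm")
 also have "... = (\<Oplus>\<^sub>C g\<in>{g\<in>G. pr g c ~= 0\<^sub>C}. pr g c)"
  by (rule v_finsum_mono[OF Cm X(1) s]) (use X(2) pX in "auto simp: X(3) Cm")
 finally show "c = (\<Oplus>\<^sub>C g\<in>{g\<in>G. pr g c ~= 0\<^sub>C}. pr g c)" .
qed

section \<open>The records of kG and R as parts of C\<close>

lemma H_simps: "|H| = HC" "mult H = mult C" "one H = one C" "zero H = zero C" "add H = add C" "smult H = smult C"
 "bracket H = bracket C" "counit H = counit C"
 by (simp_all add: gr_kG_def hopf_restrict_def Let_def)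

lemma Em: "vs E" by (rule sub_module[OF Cm HC_sub])
lemma HE: "TS H H = TS E E" "ts H H = ts E E" "TS C H = TS C E" "ts C H = ts C E"
 by (rule tensor_space_cong; simp add: H_simps)+
lemma incl: "lin E C (%a. a)" by (rule lin_id) (auto simp: HC_C)
abbreviation "jE \<equiv> tmap C C (%a. a) (%b. b)"
lemmas j_lin = tensor_map_lin[OF Em Em Cm Cm incl incl] and j_tens = tensor_map_tens[OF Em Em Cm Cm incl incl]
 and j_inj = tensor_sub_inj[OF Cm HC_sub Cm HC_sub]
lemma j2_inj: "u\<in>|TS C E| ==> v\<in>|TS C E| ==> jE u = jE v ==> u = v"
 using tensor_sub_inj[OF Cm sub_full[OF Cm] Cm HC_sub, of u v] by simp

text \<open>Injectivity of E \<otimes> E \<rightarrow> C \<otimes> C makes any preimage of \<Delta>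
  x the chosen one.\<close>

lemma H_comult_eq: "u\<in>|TS E E| ==> jE u = \<Delta> x ==> comult H x = u"
 by (simp add: gr_kG_def hopf_restrict_def Let_def) (rule the_equality, use j_inj in auto)
lemma H_comult_ex:
 assumes "x\<in>HC"
 shows "comult H x\<in>|TS E E| & jE (comult H x) = \<Delta> x"
proof -
 note J = sub_image[OF j_lin tensor_module[OF Em Em] CT sub_full[OF tensor_module[OF Em Em]]]
 have "HC\<subseteq>{x\<in>carrier C. \<Delta> x\<in>jE ` |TS E E|}"
 proof (rule span_least[OF sub_preimage[OF comult_C_lin Cm CT J]], intro subsetI)
  fix g assume g: "g\<in>G"
  have "\<Delta> g = jE (ts E E g g)" using G_HC[OF g] by (simp add: j_tens Cc.GL_D(2)[OF G_GL[OF g]])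
  thus "g\<in>{x\<in>carrier C. \<Delta> x\<in>jE ` |TS E E|}"
   using G_C[OF g] tens_closed[OF Em Em, of g g] G_HC[OF g] by auto
 qed
 then obtain u where u: "u\<in>|TS E E|" "\<Delta> x = jE u" using assms by blast
 thus ?thesis using H_comult_eq[of u x] by simp
qed

lemma H_comult_lin: "lin H (TS H H) (comult H)"
 unfolding HE
proof (rule k_linearI)
 note T = tensor_module[OF Em Em]
 fix x assume "x\<in>|H|"
 hence x: "x\<in>HC" by (simp add: H_simps)
 show "comult H x\<in>|TS E E|" using H_comult_ex[OF x] by blast
 fix y assume "y\<in>|H|"
 hence y: "y\<in>HC" by (simp add: H_simps)
 show "comult H (x +\<^sub>H y) = comult H x +\<^sub>(TS E E) comult H y"
  by (rule H_comult_eq) (use H_comult_ex[OF x] H_comult_ex[OF y] in "auto simp: T H_simps lin_add[OF j_lin] lin_add[OF comult_C_lin] HC_C[OF x] HC_C[OF y]")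
next
 note T = tensor_module[OF Em Em]
 fix k x assume k: "k\<in>|K|" and "x\<in>|H|"
 hence x: "x\<in>HC" by (simp add: H_simps)
 show "comult H (k \<odot>\<^sub>H x) = k \<odot>\<^sub>(TS E E) comult H x"
  by (rule H_comult_eq) (use H_comult_ex[OF x] k in "auto simp: T H_simps lin_smult[OF j_lin] lin_smult[OF comult_C_lin] HC_C[OF x]")
qed

lemma R_simps: "mult R = mult C" "one R = one C" "zero R = zero C" "add R = add C" "smult R = smult C" "bracket R = bracket C"
 by (simp_all add: gr_R_def poisson.truncate_def Let_def)

text \<open>The definition of R compares tensors in C \<otimes> kG, that of \<open>Cg\<close> in C
  \<otimes> C; the inclusion of the former in the latter is injective.\<close>

lemma R_carrier: "|R| = Cg 1\<^sub>C"
proof -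
 have \<pi>E: "lin C E \<pi>" by (rule lin_corestrict[OF \<pi>_lin \<pi>_HC])
 have o: "1\<^sub>C\<in>|E|" using G_HC[OF G_one] by simp
 note jl = tensor_map_lin[OF Cm Em Cm Cm lin_ident incl] and jt = tensor_map_tens[OF Cm Em Cm Cm lin_ident incl]
 note ml = tensor_map_lin[OF Cm Cm Cm Em lin_ident \<pi>E] and mt = tensor_map_tens[OF Cm Cm Cm Em lin_ident \<pi>E]
 have m: "tmap C H (%a. a) \<pi> = tmap C E (%a. a) \<pi>" by (simp add: tensor_map_def HE)
 have j: "jE (tmap C E (%a. a) \<pi> u) = mp u" if "u\<in>|CC|" for u
  by (rule lin_eq_tensor[OF Cm Cm lin_comp[OF ml jl] mp_lin _ that]) (simp add: mt jt mp_tens \<pi>_HC)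
 have "tmap C H (%a. a) \<pi> (\<Delta> x) = ts C H x 1\<^sub>H \<longleftrightarrow> \<rho> x = tC x 1\<^sub>C" if x: "x\<in>|C|" for x
 proof -
  have "tmap C E (%a. a) \<pi> (\<Delta> x) = ts C E x 1\<^sub>C \<longleftrightarrow> jE (tmap C E (%a. a) \<pi> (\<Delta> x)) = jE (ts C E x 1\<^sub>C)"
   using j2_inj[OF lin_closed[OF ml \<Delta>_closed[OF x]] tens_closed[OF Cm Em x o]] by metis
  thus ?thesis unfolding m HE H_simps \<rho>_def j[OF \<Delta>_closed[OF x]] jt[OF x o] .
 qed
 thus ?thesis unfolding Cg_def by (auto simp: gr_R_def poisson.truncate_def Let_def)
qed

lemma one_l: "g\<in>G ==> 1\<^sub>C *\<^sub>C g = g" "g\<in>G ==> g *\<^sub>C 1\<^sub>C = g" "g\<in>G ==> inv\<^bsub>C\<^esub> g *\<^sub>C g = 1\<^sub>C"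
 using G_C G_inv[of g] C_comm[of "inv\<^bsub>C\<^esub> g" g] by (auto simp: C_algebra)

lemma ad_R: "g\<in>G ==> y\<in>Cg 1\<^sub>C ==> inv\<^bsub>C\<^esub> g *\<^sub>C {g, y}\<^sub>C\<in>Cg 1\<^sub>C"
 using Cg_mult[OF Cg_G[OF G_inv(1)] Cg_bracket[OF Cg_G _ _ G_one], of g g y] G_inv(1) by (simp add: one_l)

text \<open>Each g is a unit of degree g, so multiplication by g^-1 carries the component of degree
  g into degree 1, which is R; the remaining conditions collect the facts above.\<close>

lemma gr_graded_pa: "graded_pa K C R H G (m_inv C) pr"
proof (rule graded_pa.intro[OF base_axioms], rule graded_pa_axioms.intro)
 have o: "1\<^sub>C\<in>|C|" using C_algebra by simp
 show "sub (carrier R) C"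
  using sub_eq[OF \<rho>_lin tens_lin_l[OF Cm Cm o] Cm CT] unfolding R_carrier Cg_def .
 show "x *\<^sub>C y\<in>|R|" "{x, y}\<^sub>C\<in>|R|" if "x\<in>|R|" "y\<in>|R|" for x y
  using Cg_mult[OF _ _ G_one G_one, of x y] Cg_bracket[OF _ _ G_one G_one, of x y] that one_l(1)[OF G_one] by (simp_all add: R_carrier)
 show "inv\<^bsub>C\<^esub> g *\<^sub>C pr g c\<in>|R|" if "g\<in>G" "c\<in>|C|" for g c
  using Cg_mult[OF Cg_G[OF G_inv(1)] pr_closed, of g g c] that G_inv(1) by (simp add: one_l R_carrier)
 show "pr t (y *\<^sub>C g) = (if t = g then y *\<^sub>C g else 0\<^sub>C)" if "g\<in>G" "t\<in>G" "y\<in>|R|" for g t y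
  using pr_Cg[OF that(1,2), of "y *\<^sub>C g"] Cg_mult[OF _ Cg_G[OF that(1)] G_one that(1), of y] that one_l(1) by (simp add: R_carrier)
 show "lin H (TS H H) (comult H)" by (rule H_comult_lin)
 show "lin H (base_algebra K) (counit H)" using lin_restrict[OF counit_C_lin sub_subset[OF Cm HC_sub]] by (simp add: k_linear_def H_simps)
 show "comult H g = ts H H g g" if "g\<in>G" for g
  unfolding HE using tens_closed[OF Em Em, of g g] G_HC[OF that] by (intro H_comult_eq) (simp_all add: j_tens Cc.GL_D(2)[OF G_GL[OF that]])
 show "counit H g = \<one>" if "g\<in>G" for g by (simp add: H_simps Cc.GL_D(3)[OF G_GL[OF that]])
qed (use G_sub Cg_G[OF G_one] in "simp_all add: C_poisson R_simps H_simps R_carrier G_one G_mult G_inv G_bracket pr_lin pr_decomp(1) pr_decomp(2)[symmetric] ad_R")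

sublocale gp: graded_pa K C R H G "m_inv C" pr by (rule gr_graded_pa)

text \<open>The two conditions differ only in the second-order term, identified by
  \<open>dd_dd\<close>.\<close>

lemma good_act_iff: "gr_env_action K B act \<longleftrightarrow> gp.good_act act"
proof -
 have "{g, {y, inv\<^bsub>C\<^esub> g}\<^sub>C}\<^sub>C = gp.dd g (gp.dd g y)" if "g\<in>G" "y\<in>|R|" for g y
  by (rule gp.dd_dd[OF that(1) gp.RC[OF that(2)]])
 thus ?thesis unfolding gr_env_action_def gp.good_act_def Let_def gp.dd_def by simp
qed

end

theorem theorem7p10:
  fixes K :: "('k, 'r) ring_scheme" and B :: "('k, 'b, 'z) poisson_hopf_scheme"
  assumes "field K"
    and "poisson_hopf_algebra K B"
    and "pointed K B (comult B)"
    and "\<And>g t. \<lbrakk>g \<in> grouplikes K B (comult B) (counit B); t \<in> grouplikes K B (comult B) (counit B)\<rbrakk>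
          \<Longrightarrow> \<lbrace>g, t\<rbrace>\<^bsub>B\<^esub> = \<zero>\<^bsub>B\<^esub>"
  shows "graded_poisson_hopf_algebra K (gr K B) (gr_part K B) \<and>
    (\<exists>act. gr_env_action K B act) \<and>
    (\<forall>act. gr_env_action K B act \<longrightarrow>
      (let C = gr K B; kG = gr_kG K B; R = gr_R K B;
           \<Psi> = env_map K C (\<lambda>y. y) :: (((nat \<Rightarrow> 'b set) + (nat \<Rightarrow> 'b set)) list \<Rightarrow> 'k) set \<Rightarrow> _;
           \<iota>e = env_map K C (\<lambda>x. x) :: (((nat \<Rightarrow> 'b set) + (nat \<Rightarrow> 'b set)) list \<Rightarrow> 'k) set \<Rightarrow> _
       in \<exists>\<Phi>. k_algebra_iso K (smash K (env K R) (env K kG) (env_comult K kG) act) (env K C) \<Phi> \<and>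
              (\<forall>a\<in>carrier (env K R). \<forall>b\<in>carrier (env K kG).
                \<Phi> (tens K (env K R) (env K kG) a b) = \<Psi> a \<otimes>\<^bsub>env K C\<^esub> \<iota>e b)))"
proof -
 interpret pointed_pha K B using assms by (simp add: pointed_pha_def pointed_pha_axioms_def base_def)
 have "\<exists>\<Phi>. k_algebra_iso K (smash K (env K R) (env K H) (env_comult K H) act) (env K C) \<Phi> &
   (\<forall>a\<in>|env K R|. \<forall>b\<in>|env K H|. \<Phi> (ts (env K R) (env K H) a b) = env_map K C (%y. y) a *\<^sub>(env K C) env_map K C (%x. x) b)"
  if "gr_env_action K B act" for act
  using gp.smash_iso[OF that[unfolded good_act_iff]] by blast
 thus ?thesis using gr_graded gp.act_exists unfolding good_act_iff Let_def by blast
qed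

end
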